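(* Let $\mathcal H$ be a Hopf algebra with bijective antipode and $A$ a left $\mathcal H$-comodule algebra. Then the diagonal $\Delta(A\natural\mathcal H)$ of the cylindrical module $A\natural\mathcal H$ is a cyclic module, and it is isomorphic as a cyclic module to $\mathsf C_\bullet(A\rtimes\mathcal H)$, the cyclic module of the crossed product algebra $A\rtimes\mathcal H$.
   Context: Conventions: $\mathcal H$ Hopf algebra over commutative ring $k$, bijective antipode $S$, Sweedler $\Delta^n h=h^{(0)}\otimes\cdots\otimes h^{(n)}$; $A$ left $\mathcal H$-comodule algebra with coaction $\rho(a)=a^{(\bar1)}\otimes a^{(\bar0)}$ an algebra map, iterated coaction $(\Delta^{n-1}\otimes\mathrm{id})\rho(a)=a^{(\bar n)}\otimes\cdots\otimes a^{(\bar1)}\otimes a^{(\bar0)}$; conjugation $h\cdot g=h^{(0)}gS(h^{(1)})$, $h\cdot(g_0,\dots,g_p)=(h^{(0)}\cdot g_0,\dots,h^{(p)}\cdot g_p)$. The crossed product $A\rtimes\mathcal H$ is $A\otimes\mathcal H$ with product $(a\otimes g)(b\otimes h)=ab^{(\bar0)}\otimes S^{-1}(b^{(\bar1)})gb^{(\bar2)}h$. The cylindrical module $A\natural\mathcal H$ has $(A\natural\mathcal H)_{p,q}=\mathcal H^{\otimes(p+1)}\otimes A^{\otimes(q+1)}$ with vertical operators $\tau(g\mid a)=(a_q^{(\bar1)}\cdot(g_0,\dots,g_p)\mid a_q^{(\bar0)},a_0,\dots,a_{q-1})$, $\partial_i(g\mid a)=(g\mid a_0,\dots,a_ia_{i+1},\dots,a_q)$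 for $0\le i<q$, $\partial_q(g\mid a)=(a_q^{(\bar1)}\cdot(g_0,\dots,g_p)\mid a_q^{(\bar0)}a_0,\dots,a_{q-1})$, $\sigma_i$ inserting $1$ after $a_i$ ($0\le i\le q$), and horizontal operators $\bar\tau(g\mid a)=(S^{-1}(a_0^{(\bar1)}\cdots a_q^{(\bar1)})\cdot g_p,g_0,\dots,g_{p-1}\mid a_0^{(\bar0)},\dots,a_q^{(\bar0)})$, $\bar\partial_i(g\mid a)=(g_0,\dots,g_ig_{i+1},\dots,g_p\mid a)$ for $0\le i<p$, $\bar\partial_p(g\mid a)=((S^{-1}(a_0^{(\bar1)}\cdots a_q^{(\bar1)})\cdot g_p)g_0,\dots,g_{p-1}\mid a_0^{(\bar0)},\dots,a_q^{(\bar0)})$, $\bar\sigma_i$ inserting $1$ after $g_i$ ($0\le i\le p$). The diagonal $\Delta(X)$ of a cylindrical module $X$ has $\Delta(X)_n=X_{n,n}$ with face maps $\partial_i\bar\partial_i$, degeneracies $\sigma_i\bar\sigma_i$ and cyclic operator $\tau\bar\tau$. For an algebra $B$, $\mathsf C_n(B)=B^{\otimes(n+1)}$ with $d_i(b_0,\dots,b_n)=(b_0,\dots,b_ib_{i+1},\dots,b_n)$ ($0\le i<n$), $d_n(b_0,\dots,b_n)=(b_nb_0,b_1,\dots,b_{n-1})$, $s_i$ inserting $1$ after $b_i$, $t(b_0,\dots,b_n)=(b_n,b_0,\dots,b_{n-1})$. *)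

theory Defs
  imports Main
begin

text \<open>A k-module / k-algebra is given by a carrier set inside an ambient type 'm together
with its operations.  The ground ring k is the type 'k of class comm_ring_1.
The fields amul, aone are ignored when only a module structure is meant.\<close>

record ('k, 'm) alg =
  acar :: "'m set"
  aadd :: "'m \<Rightarrow> 'm \<Rightarrow> 'm"
  azero :: 'm
  asmul :: "'k \<Rightarrow> 'm \<Rightarrow> 'm"
  amul :: "'m \<Rightarrow> 'm \<Rightarrow> 'm"
  aone :: 'm

definition is_kmod :: "('k::comm_ring_1, 'm) alg \<Rightarrow> bool" where
  "is_kmod M \<longleftrightarrow>
     azero M \<in> acar M \<and>
     (\<forall>x\<in>acar M. \<forall>y\<in>acar M. aadd M x y \<in> acar M) \<and>
     (\<forall>x\<in>acar M. \<forall>y\<in>acar M. \<forall>z\<in>acar M. aadd M (aadd M x y) z = aadd M x (aadd M y z)) \<and>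
     (\<forall>x\<in>acar M. \<forall>y\<in>acar M. aadd M x y = aadd M y x) \<and>
     (\<forall>x\<in>acar M. aadd M (azero M) x = x) \<and>
     (\<forall>x\<in>acar M. \<exists>y\<in>acar M. aadd M x y = azero M) \<and>
     (\<forall>c. \<forall>x\<in>acar M. asmul M c x \<in> acar M) \<and>
     (\<forall>c. \<forall>x\<in>acar M. \<forall>y\<in>acar M. asmul M c (aadd M x y) = aadd M (asmul M c x) (asmul M c y)) \<and>
     (\<forall>c d. \<forall>x\<in>acar M. asmul M (c + d) x = aadd M (asmul M c x) (asmul M d x)) \<and>
     (\<forall>c d. \<forall>x\<in>acar M. asmul M (c * d) x = asmul M c (asmul M d x)) \<and>
     (\<forall>x\<in>acar M. asmul M 1 x = x)"

definition is_kalg :: "('k::comm_ring_1, 'm) alg \<Rightarrow> bool" where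
  "is_kalg M \<longleftrightarrow> is_kmod M \<and> aone M \<in> acar M \<and>
     (\<forall>x\<in>acar M. \<forall>y\<in>acar M. amul M x y \<in> acar M) \<and>
     (\<forall>x\<in>acar M. \<forall>y\<in>acar M. \<forall>z\<in>acar M. amul M (amul M x y) z = amul M x (amul M y z)) \<and>
     (\<forall>x\<in>acar M. amul M (aone M) x = x \<and> amul M x (aone M) = x) \<and>
     (\<forall>x\<in>acar M. \<forall>y\<in>acar M. \<forall>z\<in>acar M.
        amul M x (aadd M y z) = aadd M (amul M x y) (amul M x z) \<and>
        amul M (aadd M y z) x = aadd M (amul M y x) (amul M z x)) \<and>
     (\<forall>c. \<forall>x\<in>acar M. \<forall>y\<in>acar M.
        amul M (asmul M c x) y = asmul M c (amul M x y) \<and>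
        amul M x (asmul M c y) = asmul M c (amul M x y))"

definition lin_map :: "('k::comm_ring_1, 'm) alg \<Rightarrow> ('k, 'n) alg \<Rightarrow> ('m \<Rightarrow> 'n) \<Rightarrow> bool" where
  "lin_map M N f \<longleftrightarrow>
     (\<forall>x\<in>acar M. f x \<in> acar N) \<and>
     (\<forall>x\<in>acar M. \<forall>y\<in>acar M. f (aadd M x y) = aadd N (f x) (f y)) \<and>
     (\<forall>c. \<forall>x\<in>acar M. f (asmul M c x) = asmul N c (f x))"

text \<open>The tensor product of a list of k-modules (all living in the same ambient type)
is the free k-module on the tuples of the product of the carriers, modulo the
submodule generated by the multilinearity relations.\<close>

definition lprod :: "('k, 'm) alg list \<Rightarrow> 'm list set" where
  "lprod Ms = {xs. length xs = length Ms \<and> (\<forall>i<length Ms. xs ! i \<in> acar (Ms ! i))}"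

definition tfree :: "('k::comm_ring_1, 'm) alg list \<Rightarrow> ('m list \<Rightarrow> 'k) set" where
  "tfree Ms = {f. finite {xs. f xs \<noteq> 0} \<and> {xs. f xs \<noteq> 0} \<subseteq> lprod Ms}"

definition tdelta :: "'m list \<Rightarrow> 'm list \<Rightarrow> 'k::comm_ring_1" where
  "tdelta xs = (\<lambda>ys. if ys = xs then 1 else 0)"

inductive_set trel :: "('k::comm_ring_1, 'm) alg list \<Rightarrow> ('m list \<Rightarrow> 'k) set"
  for Ms :: "('k, 'm) alg list" where
  trel_zero: "(\<lambda>_. 0) \<in> trel Ms"
| trel_add: "r \<in> trel Ms \<Longrightarrow> s \<in> trel Ms \<Longrightarrow> (\<lambda>z. r z + s z) \<in> trel Ms"
| trel_smul: "r \<in> trel Ms \<Longrightarrow> (\<lambda>z. c * r z) \<in> trel Ms"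
| trel_add_gen: "xs @ [x] @ ys \<in> lprod Ms \<Longrightarrow> xs @ [y] @ ys \<in> lprod Ms \<Longrightarrow>
    (\<lambda>z. tdelta (xs @ [aadd (Ms ! length xs) x y] @ ys) z - tdelta (xs @ [x] @ ys) z
          - tdelta (xs @ [y] @ ys) z) \<in> trel Ms"
| trel_smul_gen: "xs @ [x] @ ys \<in> lprod Ms \<Longrightarrow>
    (\<lambda>z. tdelta (xs @ [asmul (Ms ! length xs) c x] @ ys) z - c * tdelta (xs @ [x] @ ys) z) \<in> trel Ms"

definition tcls :: "('k::comm_ring_1, 'm) alg list \<Rightarrow> ('m list \<Rightarrow> 'k) \<Rightarrow> ('m list \<Rightarrow> 'k) set" where
  "tcls Ms f = {g \<in> tfree Ms. (\<lambda>z. g z - f z) \<in> trel Ms}"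

definition trep :: "('m list \<Rightarrow> 'k) set \<Rightarrow> 'm list \<Rightarrow> 'k" where
  "trep u = (SOME f. f \<in> u)"

definition tmod :: "('k::comm_ring_1, 'm) alg list \<Rightarrow> ('k, ('m list \<Rightarrow> 'k) set) alg" where
  "tmod Ms = \<lparr> acar = tcls Ms ` tfree Ms,
               aadd = (\<lambda>u v. tcls Ms (\<lambda>z. trep u z + trep v z)),
               azero = tcls Ms (\<lambda>_. 0),
               asmul = (\<lambda>c u. tcls Ms (\<lambda>z. c * trep u z)),
               amul = (\<lambda>u v. undefined),
               aone = undefined \<rparr>"

definition ptens :: "('k::comm_ring_1, 'm) alg list \<Rightarrow> 'm list \<Rightarrow> ('m list \<Rightarrow> 'k) set" where
  "ptens Ms xs = tcls Ms (tdelta xs)"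

definition tlift :: "('k::comm_ring_1, 'm) alg list \<Rightarrow> ('k, 'n) alg \<Rightarrow> ('m list \<Rightarrow> 'n)
                      \<Rightarrow> ('m list \<Rightarrow> 'k) set \<Rightarrow> 'n" where
  "tlift Ms N f = (THE L. lin_map (tmod Ms) N L \<and> (\<forall>xs\<in>lprod Ms. L (ptens Ms xs) = f xs) \<and>
                          (\<forall>u. u \<notin> acar (tmod Ms) \<longrightarrow> L u = undefined))"

definition tensor :: "('k::comm_ring_1, 'm) alg list \<Rightarrow> ('k, ('m list \<Rightarrow> 'k) set) alg" where
  "tensor Ms = (tmod Ms)\<lparr>
     amul := (\<lambda>u v. tlift Ms (tmod Ms)
                (\<lambda>xs. tlift Ms (tmod Ms)
                   (\<lambda>ys. ptens Ms (map (\<lambda>i. amul (Ms ! i) (xs ! i) (ys ! i)) [0..<length Ms])) v) u),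
     aone := ptens Ms (map aone Ms) \<rparr>"

definition tcat :: "('k::comm_ring_1, 'm) alg list \<Rightarrow> ('k, 'm) alg list \<Rightarrow>
                    ('m list \<Rightarrow> 'k) set \<Rightarrow> ('m list \<Rightarrow> 'k) set \<Rightarrow> ('m list \<Rightarrow> 'k) set" where
  "tcat Ms Ns u v = tlift Ms (tmod (Ms @ Ns))
      (\<lambda>xs. tlift Ns (tmod (Ms @ Ns)) (\<lambda>ys. ptens (Ms @ Ns) (xs @ ys)) v) u"

definition is_hopf :: "('k::comm_ring_1, 'm) alg \<Rightarrow> ('m \<Rightarrow> ('m list \<Rightarrow> 'k) set) \<Rightarrow>
                       ('m \<Rightarrow> 'k) \<Rightarrow> ('m \<Rightarrow> 'm) \<Rightarrow> bool" where
  "is_hopf H D e S \<longleftrightarrow> is_kalg H \<and>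
     lin_map H (tensor [H, H]) D \<and>
     (\<forall>x\<in>acar H. \<forall>y\<in>acar H. D (amul H x y) = amul (tensor [H, H]) (D x) (D y)) \<and>
     D (aone H) = aone (tensor [H, H]) \<and>
     (\<forall>x\<in>acar H. \<forall>y\<in>acar H. e (aadd H x y) = e x + e y) \<and>
     (\<forall>c. \<forall>x\<in>acar H. e (asmul H c x) = c * e x) \<and>
     (\<forall>x\<in>acar H. \<forall>y\<in>acar H. e (amul H x y) = e x * e y) \<and>
     e (aone H) = 1 \<and>
     (\<forall>x\<in>acar H.
        tlift [H, H] (tmod [H, H, H]) (\<lambda>zs. tcat [H, H] [H] (D (zs ! 0)) (ptens [H] [zs ! 1])) (D x)
      = tlift [H, H] (tmod [H, H, H]) (\<lambda>zs. tcat [H] [H, H] (ptens [H] [zs ! 0]) (D (zs ! 1))) (D x)) \<and>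
     (\<forall>x\<in>acar H. tlift [H, H] H (\<lambda>zs. asmul H (e (zs ! 0)) (zs ! 1)) (D x) = x) \<and>
     (\<forall>x\<in>acar H. tlift [H, H] H (\<lambda>zs. asmul H (e (zs ! 1)) (zs ! 0)) (D x) = x) \<and>
     lin_map H H S \<and>
     (\<forall>x\<in>acar H. tlift [H, H] H (\<lambda>zs. amul H (S (zs ! 0)) (zs ! 1)) (D x) = asmul H (e x) (aone H)) \<and>
     (\<forall>x\<in>acar H. tlift [H, H] H (\<lambda>zs. amul H (zs ! 0) (S (zs ! 1))) (D x) = asmul H (e x) (aone H))"

definition bij_antipode :: "('k, 'm) alg \<Rightarrow> ('m \<Rightarrow> 'm) \<Rightarrow> bool" where
  "bij_antipode H S \<longleftrightarrow> bij_betw S (acar H) (acar H)"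

definition is_comod_alg :: "('k::comm_ring_1, 'm) alg \<Rightarrow> ('m \<Rightarrow> ('m list \<Rightarrow> 'k) set) \<Rightarrow>
     ('m \<Rightarrow> 'k) \<Rightarrow> ('k, 'm) alg \<Rightarrow> ('m \<Rightarrow> ('m list \<Rightarrow> 'k) set) \<Rightarrow> bool" where
  "is_comod_alg H D e A r \<longleftrightarrow> is_kalg A \<and>
     lin_map A (tensor [H, A]) r \<and>
     (\<forall>a\<in>acar A. \<forall>b\<in>acar A. r (amul A a b) = amul (tensor [H, A]) (r a) (r b)) \<and>
     r (aone A) = aone (tensor [H, A]) \<and>
     (\<forall>a\<in>acar A.
        tlift [H, A] (tmod [H, H, A]) (\<lambda>zs. tcat [H, H] [A] (D (zs ! 0)) (ptens [A] [zs ! 1])) (r a)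
      = tlift [H, A] (tmod [H, H, A]) (\<lambda>zs. tcat [H] [H, A] (ptens [H] [zs ! 0]) (r (zs ! 1))) (r a)) \<and>
     (\<forall>a\<in>acar A. tlift [H, A] A (\<lambda>zs. asmul A (e (zs ! 0)) (zs ! 1)) (r a) = a)"

fun icop :: "('k::comm_ring_1, 'm) alg \<Rightarrow> ('m \<Rightarrow> ('m list \<Rightarrow> 'k) set) \<Rightarrow> nat \<Rightarrow> 'm \<Rightarrow> ('m list \<Rightarrow> 'k) set" where
  "icop H D 0 h = ptens [H] [h]"
| "icop H D (Suc n) h = tlift (replicate (Suc n) H) (tmod (replicate (Suc (Suc n)) H))
     (\<lambda>zs. tcat [H, H] (replicate n H) (D (hd zs)) (ptens (replicate n H) (tl zs))) (icop H D n h)"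

definition conj :: "('k::comm_ring_1, 'm) alg \<Rightarrow> ('m \<Rightarrow> ('m list \<Rightarrow> 'k) set) \<Rightarrow> ('m \<Rightarrow> 'm) \<Rightarrow> 'm \<Rightarrow> 'm \<Rightarrow> 'm" where
  "conj H D S h g = tlift [H, H] H (\<lambda>zs. amul H (amul H (zs ! 0) g) (S (zs ! 1))) (D h)"

definition conj_tuple :: "('k::comm_ring_1, 'm) alg \<Rightarrow> ('m \<Rightarrow> ('m list \<Rightarrow> 'k) set) \<Rightarrow> ('m \<Rightarrow> 'm) \<Rightarrow>
                          'm \<Rightarrow> 'm list \<Rightarrow> ('m list \<Rightarrow> 'k) set" where
  "conj_tuple H D S h gs = tlift (replicate (length gs) H) (tmod (replicate (length gs) H))
      (\<lambda>hs. ptens (replicate (length gs) H) (map2 (\<lambda>x g. conj H D S x g) hs gs))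
      (icop H D (length gs - 1) h)"

definition Sinv :: "('k, 'm) alg \<Rightarrow> ('m \<Rightarrow> 'm) \<Rightarrow> 'm \<Rightarrow> 'm" where
  "Sinv H S = the_inv_into (acar H) S"

definition hprod :: "('k, 'm) alg \<Rightarrow> 'm list \<Rightarrow> 'm" where
  "hprod H hs = foldr (amul H) hs (aone H)"

fun rho_all :: "('k::comm_ring_1, 'm) alg \<Rightarrow> ('k, 'm) alg \<Rightarrow> ('m \<Rightarrow> ('m list \<Rightarrow> 'k) set) \<Rightarrow>
                'm list \<Rightarrow> ('m list \<Rightarrow> 'k) set" where
  "rho_all H A r [] = ptens [] []"
| "rho_all H A r (a # as') = tcat [H, A] (concat (replicate (length as') [H, A])) (r a) (rho_all H A r as')"

definition even_part :: "'m list \<Rightarrow> 'm list" where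
  "even_part ws = map (\<lambda>j. ws ! (2 * j)) [0..<length ws div 2]"

definition odd_part :: "'m list \<Rightarrow> 'm list" where
  "odd_part ws = map (\<lambda>j. ws ! (2 * j + 1)) [0..<length ws div 2]"

definition CL :: "('k, 'm) alg \<Rightarrow> ('k, 'm) alg \<Rightarrow> nat \<Rightarrow> nat \<Rightarrow> ('k, 'm) alg list" where
  "CL H A p q = replicate (Suc p) H @ replicate (Suc q) A"

definition Cyl :: "('k::comm_ring_1, 'm) alg \<Rightarrow> ('k, 'm) alg \<Rightarrow> nat \<Rightarrow> nat \<Rightarrow> ('k, ('m list \<Rightarrow> 'k) set) alg" where
  "Cyl H A p q = tmod (CL H A p q)"

definition vtau where
  "vtau H A D S r p q = tlift (CL H A p q) (Cyl H A p q)
     (\<lambda>zs. tlift [H, A] (Cyl H A p q)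
        (\<lambda>ys. tcat (replicate (Suc p) H) (replicate (Suc q) A)
               (conj_tuple H D S (ys ! 0) (take (Suc p) zs))
               (ptens (replicate (Suc q) A) (ys ! 1 # butlast (drop (Suc p) zs))))
        (r (last zs)))"

definition vface where
  "vface H A D S r p q i =
     (if i < q then
        tlift (CL H A p q) (Cyl H A p (q - 1))
          (\<lambda>zs. ptens (CL H A p (q - 1))
             (take (Suc p) zs @ take i (drop (Suc p) zs)
              @ [amul A (drop (Suc p) zs ! i) (drop (Suc p) zs ! Suc i)]
              @ drop (Suc (Suc i)) (drop (Suc p) zs)))
      else
        tlift (CL H A p q) (Cyl H A p (q - 1))
          (\<lambda>zs. tlift [H, A] (Cyl H A p (q - 1))
             (\<lambda>ys. tcat (replicate (Suc p) H) (replicate q A)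
                    (conj_tuple H D S (ys ! 0) (take (Suc p) zs))
                    (ptens (replicate q A)
                       (amul A (ys ! 1) (drop (Suc p) zs ! 0) # butlast (tl (drop (Suc p) zs)))))
             (r (last zs))))"

definition vdegen where
  "vdegen H A p q i = tlift (CL H A p q) (Cyl H A p (Suc q))
     (\<lambda>zs. ptens (CL H A p (Suc q))
        (take (Suc p) zs @ take (Suc i) (drop (Suc p) zs) @ [aone A] @ drop (Suc i) (drop (Suc p) zs)))"

definition htau where
  "htau H A D S r p q = tlift (CL H A p q) (Cyl H A p q)
     (\<lambda>zs. tlift (concat (replicate (Suc q) [H, A])) (Cyl H A p q)
        (\<lambda>ws. ptens (CL H A p q)
           (conj H D S (Sinv H S (hprod H (even_part ws))) (last (take (Suc p) zs))
            # butlast (take (Suc p) zs) @ odd_part ws))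
        (rho_all H A r (drop (Suc p) zs)))"

definition hface where
  "hface H A D S r p q i =
     (if i < p then
        tlift (CL H A p q) (Cyl H A (p - 1) q)
          (\<lambda>zs. ptens (CL H A (p - 1) q)
             (take i zs @ [amul H (zs ! i) (zs ! Suc i)] @ drop (Suc (Suc i)) (take (Suc p) zs)
              @ drop (Suc p) zs))
      else
        tlift (CL H A p q) (Cyl H A (p - 1) q)
          (\<lambda>zs. tlift (concat (replicate (Suc q) [H, A])) (Cyl H A (p - 1) q)
             (\<lambda>ws. ptens (CL H A (p - 1) q)
                (amul H (conj H D S (Sinv H S (hprod H (even_part ws))) (last (take (Suc p) zs))) (zs ! 0)
                 # butlast (tl (take (Suc p) zs)) @ odd_part ws))
             (rho_all H A r (drop (Suc p) zs))))"

definition hdegen where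
  "hdegen H A p q i = tlift (CL H A p q) (Cyl H A (Suc p) q)
     (\<lambda>zs. ptens (CL H A (Suc p) q)
        (take (Suc i) zs @ [aone H] @ drop (Suc i) (take (Suc p) zs) @ drop (Suc p) zs))"

definition diag_mod where "diag_mod H A n = Cyl H A n n"
definition diag_face where
  "diag_face H A D S r n i x = vface H A D S r (n - 1) n i (hface H A D S r n n i x)"
definition diag_degen where
  "diag_degen H A n i x = vdegen H A (Suc n) n i (hdegen H A n n i x)"
definition diag_tau where
  "diag_tau H A D S r n x = vtau H A D S r n n (htau H A D S r n n x)"

definition coact2 where
  "coact2 H D A r b = tlift [H, A] (tmod [H, H, A])
     (\<lambda>zs. tcat [H, H] [A] (D (zs ! 0)) (ptens [A] [zs ! 1])) (r b)"

definition crossed where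
  "crossed H A D S r = (tmod [A, H])\<lparr>
     amul := (\<lambda>u v. tlift [A, H] (tmod [A, H])
        (\<lambda>xs. tlift [A, H] (tmod [A, H])
           (\<lambda>ys. tlift [H, H, A] (tmod [A, H])
              (\<lambda>ws. ptens [A, H] [amul A (xs ! 0) (ws ! 2),
                       amul H (amul H (amul H (Sinv H S (ws ! 1)) (xs ! 1)) (ws ! 0)) (ys ! 1)])
              (coact2 H D A r (ys ! 0))) v) u),
     aone := ptens [A, H] [aone A, aone H] \<rparr>"

definition Cmod where "Cmod B n = tmod (replicate (Suc n) B)"
definition Cface where
  "Cface B n i = tlift (replicate (Suc n) B) (Cmod B (n - 1))
     (\<lambda>bs. ptens (replicate n B)
        (if i < n then take i bs @ [amul B (bs ! i) (bs ! Suc i)] @ drop (Suc (Suc i)) bs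
         else amul B (last bs) (hd bs) # butlast (tl bs)))"
definition Cdegen where
  "Cdegen B n i = tlift (replicate (Suc n) B) (Cmod B (Suc n))
     (\<lambda>bs. ptens (replicate (Suc (Suc n)) B) (take (Suc i) bs @ [aone B] @ drop (Suc i) bs))"
definition Ctau where
  "Ctau B n = tlift (replicate (Suc n) B) (Cmod B n)
     (\<lambda>bs. ptens (replicate (Suc n) B) (last bs # butlast bs))"

definition cyclic_module :: "(nat \<Rightarrow> ('k::comm_ring_1, 'x) alg) \<Rightarrow> (nat \<Rightarrow> nat \<Rightarrow> 'x \<Rightarrow> 'x) \<Rightarrow>
                             (nat \<Rightarrow> nat \<Rightarrow> 'x \<Rightarrow> 'x) \<Rightarrow> (nat \<Rightarrow> 'x \<Rightarrow> 'x) \<Rightarrow> bool" where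
  "cyclic_module X d s t \<longleftrightarrow>
     (\<forall>n. is_kmod (X n)) \<and>
     (\<forall>n i. 1 \<le> n \<and> i \<le> n \<longrightarrow> lin_map (X n) (X (n - 1)) (d n i)) \<and>
     (\<forall>n i. i \<le> n \<longrightarrow> lin_map (X n) (X (Suc n)) (s n i)) \<and>
     (\<forall>n. lin_map (X n) (X n) (t n)) \<and>
     (\<forall>n i j. \<forall>x\<in>acar (X n). 2 \<le> n \<and> i < j \<and> j \<le> n \<longrightarrow>
        d (n - 1) i (d n j x) = d (n - 1) (j - 1) (d n i x)) \<and>
     (\<forall>n i j. \<forall>x\<in>acar (X n). i \<le> j \<and> j \<le> n \<longrightarrow>
        s (Suc n) i (s n j x) = s (Suc n) (Suc j) (s n i x)) \<and>
     (\<forall>n i j. \<forall>x\<in>acar (X n). i < j \<and> j \<le> n \<longrightarrow>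
        d (Suc n) i (s n j x) = s (n - 1) (j - 1) (d n i x)) \<and>
     (\<forall>n j. \<forall>x\<in>acar (X n). j \<le> n \<longrightarrow>
        d (Suc n) j (s n j x) = x \<and> d (Suc n) (Suc j) (s n j x) = x) \<and>
     (\<forall>n i j. \<forall>x\<in>acar (X n). Suc j < i \<and> i \<le> Suc n \<longrightarrow>
        d (Suc n) i (s n j x) = s (n - 1) j (d n (i - 1) x)) \<and>
     (\<forall>n i. \<forall>x\<in>acar (X n). 1 \<le> i \<and> i \<le> n \<longrightarrow>
        d n i (t n x) = t (n - 1) (d n (i - 1) x)) \<and>
     (\<forall>n. \<forall>x\<in>acar (X n). 1 \<le> n \<longrightarrow> d n 0 (t n x) = d n n x) \<and>
     (\<forall>n i. \<forall>x\<in>acar (X n). 1 \<le> i \<and> i \<le> n \<longrightarrow>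
        s n i (t n x) = t (Suc n) (s n (i - 1) x)) \<and>
     (\<forall>n. \<forall>x\<in>acar (X n). s n 0 (t n x) = t (Suc n) (t (Suc n) (s n n x))) \<and>
     (\<forall>n. \<forall>x\<in>acar (X n). (t n ^^ Suc n) x = x)"

definition cyclic_iso :: "(nat \<Rightarrow> ('k::comm_ring_1, 'x) alg) \<Rightarrow> (nat \<Rightarrow> nat \<Rightarrow> 'x \<Rightarrow> 'x) \<Rightarrow>
     (nat \<Rightarrow> nat \<Rightarrow> 'x \<Rightarrow> 'x) \<Rightarrow> (nat \<Rightarrow> 'x \<Rightarrow> 'x) \<Rightarrow>
     (nat \<Rightarrow> ('k, 'y) alg) \<Rightarrow> (nat \<Rightarrow> nat \<Rightarrow> 'y \<Rightarrow> 'y) \<Rightarrow>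
     (nat \<Rightarrow> nat \<Rightarrow> 'y \<Rightarrow> 'y) \<Rightarrow> (nat \<Rightarrow> 'y \<Rightarrow> 'y) \<Rightarrow> (nat \<Rightarrow> 'x \<Rightarrow> 'y) \<Rightarrow> bool" where
  "cyclic_iso X d s t Y d' s' t' \<phi> \<longleftrightarrow>
     (\<forall>n. lin_map (X n) (Y n) (\<phi> n) \<and> bij_betw (\<phi> n) (acar (X n)) (acar (Y n))) \<and>
     (\<forall>n i. \<forall>x\<in>acar (X n). 1 \<le> n \<and> i \<le> n \<longrightarrow> \<phi> (n - 1) (d n i x) = d' n i (\<phi> n x)) \<and>
     (\<forall>n i. \<forall>x\<in>acar (X n). i \<le> n \<longrightarrow> \<phi> (Suc n) (s n i x) = s' n i (\<phi> n x)) \<and>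
     (\<forall>n. \<forall>x\<in>acar (X n). \<phi> n (t n x) = t' n (\<phi> n x))"

end

theory Submission
  imports Defs "HOL-Algebra.Ring"
begin

text \<open>
  Writing \<open>h \<cdot> g\<close> for conjugation, the crossed product satisfies \<open>b g = \<Sum> (b\<^sub>1 \<cdot> g) b\<^sub>0\<close> and
  \<open>g b = \<Sum> b\<^sub>0 (S\<^sup>-\<^sup>1 b\<^sub>1 \<cdot> g)\<close>: it is a twisted tensor product whose braiding between \<open>A\<close> and \<open>H\<close> is
  invertible and compatible with the products and units of both factors. The operators \<open>\<tau>\<close> and \<open>\<tau>\<close>-bar of
  the cylindrical module rotate the last letter of type \<open>A\<close>, respectively \<open>H\<close>, of a word
  \<open>g\<^sub>0 \<dots> g\<^sub>p a\<^sub>0 \<dots> a\<^sub>q\<close> and bring it to its place by the braiding or its inverse. The isomorphism from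
  \<open>C\<^sub>n(A \<rtimes> H)\<close> to the diagonal reorders \<open>a\<^sub>0 g\<^sub>0 \<dots> a\<^sub>n g\<^sub>n\<close> to \<open>g\<^sub>0' \<dots> g\<^sub>n' a\<^sub>0' \<dots> a\<^sub>n'\<close> by the braiding.
  It respects inner faces and degeneracies because the braiding respects products and units, and it respects
  the cyclic operators because the braiding is invertible. The last face needs no separate argument, since
  \<open>d\<^sub>n = d\<^sub>0 t\<close> holds on both sides. Finally the cyclic identities of the diagonal are transported from
  the cyclic module of the associative algebra \<open>A \<rtimes> H\<close>.
\<close>

section \<open>Modules and linear maps\<close>

text \<open>Formal sums are lists that depend on choices, so two of them are rarely equal. What is
  proved is that they agree after evaluation against every map of the right multilinearity into a
  module \<open>N\<close>. Statements therefore carry a test map \<open>f\<close> or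
  \<open>k\<close>, inductions over words enlarge it, and most side conditions are multilinearity of
  such test maps. On long words, explicit formulas with iterated coproducts become unmanageable. The
  definitions of the cyclic operators are rewritten once as one letter crossing one letter at a
  time; after that only the local laws of the braiding are used. In each direction separately the
  cyclic operator of a cylindrical module need not have finite order, so the power identity on the
  diagonal cannot be read off from the two factors. Over the crossed product the cyclic operator is
  an honest rotation of words, which explains the transport. Compatibility is checked for the map
  out of the crossed product side, since its recursion runs along the words that are merged,
  extended and rotated there; the inverse map then inherits it.\<close>

lemmas kmod_unfold = is_kmod_def[THEN iffD1]

lemma km_zero: "is_kmod M \<Longrightarrow> azero M \<in> acar M"
  by (rule kmod_unfold[THEN conjunct1])

lemma km_add: "is_kmod M \<Longrightarrow> x \<in> acar M \<Longrightarrow> y \<in> acar M \<Longrightarrow> aadd M x y \<in> acar M"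
  by (rule kmod_unfold[THEN conjunct2, THEN conjunct1, THEN bspec, THEN bspec])

lemma km_assoc: "is_kmod M \<Longrightarrow> x \<in> acar M \<Longrightarrow> y \<in> acar M \<Longrightarrow> z \<in> acar M \<Longrightarrow> aadd M (aadd M x y) z = aadd M x (aadd M y z)"
  by (rule kmod_unfold[THEN conjunct2, THEN conjunct2, THEN conjunct1, THEN bspec, THEN bspec, THEN bspec])

lemma km_comm: "is_kmod M \<Longrightarrow> x \<in> acar M \<Longrightarrow> y \<in> acar M \<Longrightarrow> aadd M x y = aadd M y x"
  by (rule kmod_unfold[THEN conjunct2, THEN conjunct2, THEN conjunct2, THEN conjunct1, THEN bspec, THEN bspec])

lemma km_0l: "is_kmod M \<Longrightarrow> x \<in> acar M \<Longrightarrow> aadd M (azero M) x = x"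
  by (rule kmod_unfold[THEN conjunct2, THEN conjunct2, THEN conjunct2, THEN conjunct2, THEN conjunct1, THEN bspec])

lemma km_neg: "is_kmod M \<Longrightarrow> x \<in> acar M \<Longrightarrow> \<exists>y\<in>acar M. aadd M x y = azero M"
  by (rule kmod_unfold[THEN conjunct2, THEN conjunct2, THEN conjunct2, THEN conjunct2, THEN conjunct2, THEN conjunct1, THEN bspec])

lemma km_smul: "is_kmod M \<Longrightarrow> x \<in> acar M \<Longrightarrow> asmul M c x \<in> acar M"
  by (rule kmod_unfold[THEN conjunct2, THEN conjunct2, THEN conjunct2, THEN conjunct2, THEN conjunct2, THEN conjunct2, THEN conjunct1, THEN spec, THEN bspec])

lemma km_smul_add: "is_kmod M \<Longrightarrow> x \<in> acar M \<Longrightarrow> y \<in> acar M \<Longrightarrow> asmul M c (aadd M x y) = aadd M (asmul M c x) (asmul M c y)"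
  by (rule kmod_unfold[THEN conjunct2, THEN conjunct2, THEN conjunct2, THEN conjunct2, THEN conjunct2, THEN conjunct2, THEN conjunct2, THEN conjunct1, THEN spec, THEN bspec, THEN bspec])

lemma km_add_smul: "is_kmod M \<Longrightarrow> x \<in> acar M \<Longrightarrow> asmul M (c + d) x = aadd M (asmul M c x) (asmul M d x)"
  by (rule kmod_unfold[THEN conjunct2, THEN conjunct2, THEN conjunct2, THEN conjunct2, THEN conjunct2, THEN conjunct2, THEN conjunct2, THEN conjunct2, THEN conjunct1, THEN spec, THEN spec, THEN bspec])

lemma km_mul_smul: "is_kmod M \<Longrightarrow> x \<in> acar M \<Longrightarrow> asmul M (c * d) x = asmul M c (asmul M d x)"
  by (rule kmod_unfold[THEN conjunct2, THEN conjunct2, THEN conjunct2, THEN conjunct2, THEN conjunct2, THEN conjunct2, THEN conjunct2, THEN conjunct2, THEN conjunct2, THEN conjunct1, THEN spec, THEN spec, THEN bspec])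

lemma km_1: "is_kmod M \<Longrightarrow> x \<in> acar M \<Longrightarrow> asmul M 1 x = x"
  by (rule kmod_unfold[THEN conjunct2, THEN conjunct2, THEN conjunct2, THEN conjunct2, THEN conjunct2, THEN conjunct2, THEN conjunct2, THEN conjunct2, THEN conjunct2, THEN conjunct2, THEN bspec])

lemma km_0r: "is_kmod M \<Longrightarrow> x \<in> acar M \<Longrightarrow> aadd M x (azero M) = x"
  by (metis km_0l km_comm km_zero)

text \<open>The record has no negation. Adding an additive inverse \<open>w\<close> of
  \<open>x\<close> on the left removes \<open>x\<close>, and this cancellation later does the work
  of subtraction in a general module.\<close>

lemma km_cancel:
  assumes M: "is_kmod M" and x: "x \<in> acar M" and y: "y \<in> acar M" and z: "z \<in> acar M"
    and eq: "aadd M x y = aadd M x z"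
  shows "y = z"
proof -
  obtain w where w: "w \<in> acar M" "aadd M x w = azero M" using km_neg[OF M x] by blast
  have "aadd M (aadd M w x) y = aadd M (aadd M w x) z" using assms w by (simp add: km_assoc)
  then show ?thesis using w assms by (metis km_0l km_comm)
qed

lemma km_0_smul: "is_kmod M \<Longrightarrow> x \<in> acar M \<Longrightarrow> asmul M 0 x = azero M"
  using km_cancel[of M "asmul M 0 x" "asmul M 0 x" "azero M"] km_add_smul[of M x 0 0]
  by (simp add: km_smul km_zero km_0r)

lemma km_smul_0: "is_kmod M \<Longrightarrow> asmul M c (azero M) = azero M"
  using km_0_smul[of M "azero M"] km_mul_smul[of M "azero M" c 0] by (simp add: km_zero)

lemma km_left_comm: "is_kmod M \<Longrightarrow> x \<in> acar M \<Longrightarrow> y \<in> acar M \<Longrightarrow> z \<in> acar M \<Longrightarrow>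
    aadd M x (aadd M y z) = aadd M y (aadd M x z)"
  by (metis km_assoc km_comm)

lemmas km_closed = km_zero km_add km_smul
lemmas km_ac = km_assoc km_comm km_left_comm

lemma lin_mapI:
  assumes "\<And>x. x \<in> acar M \<Longrightarrow> f x \<in> acar N"
    and "\<And>x y. x \<in> acar M \<Longrightarrow> y \<in> acar M \<Longrightarrow> f (aadd M x y) = aadd N (f x) (f y)"
    and "\<And>c x. x \<in> acar M \<Longrightarrow> f (asmul M c x) = asmul N c (f x)"
  shows "lin_map M N f"
  using assms by (simp add: lin_map_def)

lemma lin_in: "lin_map M N f \<Longrightarrow> x \<in> acar M \<Longrightarrow> f x \<in> acar N"
  and lin_add: "lin_map M N f \<Longrightarrow> x \<in> acar M \<Longrightarrow> y \<in> acar M \<Longrightarrow> f (aadd M x y) = aadd N (f x) (f y)"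
  and lin_smul: "lin_map M N f \<Longrightarrow> x \<in> acar M \<Longrightarrow> f (asmul M c x) = asmul N c (f x)"
  by (simp_all add: lin_map_def)

lemma lin_zero: "lin_map M N f \<Longrightarrow> is_kmod M \<Longrightarrow> is_kmod N \<Longrightarrow> f (azero M) = azero N"
  using lin_smul[of M N f "azero M" 0] lin_in[of M N f "azero M"] by (simp add: km_0_smul km_zero)

lemma lin_cong:
  assumes M: "is_kmod M" and eq: "\<And>x. x \<in> acar M \<Longrightarrow> f x = g x"
  shows "lin_map M N f \<longleftrightarrow> lin_map M N g"
  using eq by (simp add: lin_map_def km_closed[OF M])

text \<open>Functions given by a lift or by a chosen representation are controlled only on the
  carrier. Closure of the carrier of \<open>M\<close> under its operations allows the replacement
  inside the linearity equations.\<close>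

lemma lin_eqI: "is_kmod M \<Longrightarrow> lin_map M N g \<Longrightarrow> (\<And>x. x \<in> acar M \<Longrightarrow> f x = g x) \<Longrightarrow> lin_map M N f"
  by (simp add: lin_map_def km_closed)

lemma lin_id: "lin_map M M (\<lambda>x. x)"
  by (simp add: lin_map_def)

lemma lin_comp: "lin_map M N g \<Longrightarrow> lin_map L M f \<Longrightarrow> lin_map L N (\<lambda>x. g (f x))"
  by (simp add: lin_map_def)

lemma lin_sum2:
  assumes "is_kmod N" "lin_map M N f" "lin_map M N g"
  shows "lin_map M N (\<lambda>x. aadd N (f x) (g x))"
proof (rule lin_mapI)
  fix x y assume "x \<in> acar M" "y \<in> acar M"
  then show "aadd N (f (aadd M x y)) (g (aadd M x y)) = aadd N (aadd N (f x) (g x)) (aadd N (f y) (g y))"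
    using assms by (simp add: lin_add lin_in km_closed km_ac)
qed (use assms in \<open>simp_all add: lin_in lin_smul km_closed km_smul_add\<close>)

lemma lin_scale:
  assumes "is_kmod N" "lin_map M N f"
  shows "lin_map M N (\<lambda>x. asmul N c (f x))"
proof (rule lin_mapI)
  fix d x assume "x \<in> acar M"
  then show "asmul N c (f (asmul M d x)) = asmul N d (asmul N c (f x))"
    using assms km_mul_smul[OF assms(1), of "f x" c d] km_mul_smul[OF assms(1), of "f x" d c]
    by (simp add: lin_smul lin_in mult.commute)
qed (use assms in \<open>simp_all add: lin_in lin_add km_closed km_smul_add\<close>)

lemma lin_const_zero: "is_kmod N \<Longrightarrow> lin_map M N (\<lambda>x. azero N)"
  by (simp add: lin_map_def km_closed km_0l km_smul_0)

section \<open>Sums over lists\<close>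

text \<open>A list sum keeps repeated summands and accepts index types without structure, as formal
  sums of pure tensors require. Addition is associative and commutative only on the carrier, hence
  the membership premises below.\<close>

definition lsum :: "('k, 'n) alg \<Rightarrow> 'a list \<Rightarrow> ('a \<Rightarrow> 'n) \<Rightarrow> 'n" where
  "lsum N L f = foldr (\<lambda>x. aadd N (f x)) L (azero N)"

lemma lsum_Nil [simp]: "lsum N [] f = azero N"
  and lsum_Cons [simp]: "lsum N (x # L) f = aadd N (f x) (lsum N L f)"
  by (simp_all add: lsum_def)

lemma lsum_in: "is_kmod N \<Longrightarrow> (\<And>x. x \<in> set L \<Longrightarrow> f x \<in> acar N) \<Longrightarrow> lsum N L f \<in> acar N"
  by (induction L) (simp_all add: km_closed)

lemma lsum_cong: "(\<And>x. x \<in> set L \<Longrightarrow> f x = g x) \<Longrightarrow> lsum N L f = lsum N L g"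
  by (induction L) simp_all

lemma lsum_append:
  "is_kmod N \<Longrightarrow> (\<And>x. x \<in> set L \<union> set L' \<Longrightarrow> f x \<in> acar N) \<Longrightarrow>
    lsum N (L @ L') f = aadd N (lsum N L f) (lsum N L' f)"
  by (induction L) (simp_all add: km_closed km_0l km_assoc lsum_in)

lemma lsum_map: "lsum N (map h L) f = lsum N L (\<lambda>x. f (h x))"
  by (induction L) simp_all

lemma lsum_bind:
  assumes N: "is_kmod N" and f: "\<And>x y. x \<in> set L \<Longrightarrow> y \<in> set (k x) \<Longrightarrow> f y \<in> acar N"
  shows "lsum N (concat (map k L)) f = lsum N L (\<lambda>x. lsum N (k x) f)"
  using f
proof (induction L)
  case (Cons x L)
  have "lsum N (k x @ concat (map k L)) f = aadd N (lsum N (k x) f) (lsum N (concat (map k L)) f)"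
    by (rule lsum_append[OF N]) (use Cons.prems in auto)
  also have "lsum N (concat (map k L)) f = lsum N L (\<lambda>x. lsum N (k x) f)"
    by (rule Cons.IH) (use Cons.prems in auto)
  finally show ?case by simp
qed simp

lemma lsum_zero: "is_kmod N \<Longrightarrow> lsum N L (\<lambda>x. azero N) = azero N"
  by (induction L) (simp_all add: km_0l km_zero)

lemma lsum_plus:
  "is_kmod N \<Longrightarrow> (\<And>x. x \<in> set L \<Longrightarrow> f x \<in> acar N) \<Longrightarrow> (\<And>x. x \<in> set L \<Longrightarrow> g x \<in> acar N) \<Longrightarrow>
    lsum N L (\<lambda>x. aadd N (f x) (g x)) = aadd N (lsum N L f) (lsum N L g)"
  by (induction L) (simp_all add: km_closed km_0l km_ac lsum_in)

lemma lsum_swap: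
  assumes N: "is_kmod N" and f: "\<And>x y. x \<in> set L \<Longrightarrow> y \<in> set K \<Longrightarrow> f x y \<in> acar N"
  shows "lsum N L (\<lambda>x. lsum N K (f x)) = lsum N K (\<lambda>y. lsum N L (\<lambda>x. f x y))"
  using f
proof (induction L)
  case Nil
  show ?case by (simp add: lsum_zero N)
next
  case (Cons x L)
  then show ?case by (simp add: lsum_plus N lsum_in)
qed

lemma lin_push: "is_kmod M \<Longrightarrow> is_kmod N \<Longrightarrow> lin_map M N g \<Longrightarrow> (\<And>x. x \<in> set L \<Longrightarrow> f x \<in> acar M) \<Longrightarrow>
    g (lsum M L f) = lsum N L (\<lambda>x. g (f x))"
  by (induction L) (simp_all add: lin_zero lin_add lsum_in)

lemma lin_lsum: "is_kmod N \<Longrightarrow> (\<And>z. z \<in> set L \<Longrightarrow> lin_map M N (\<lambda>x. f x z)) \<Longrightarrow>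
    lin_map M N (\<lambda>x. lsum N L (f x))"
  by (induction L) (simp_all add: lin_const_zero lin_sum2)

section \<open>Formal sums of pairs, the raw form of Sweedler notation\<close>

definition psum :: "('k, 'n) alg \<Rightarrow> ('a \<times> 'b) list \<Rightarrow> ('a \<Rightarrow> 'b \<Rightarrow> 'n) \<Rightarrow> 'n" where
  "psum N L f = lsum N L (\<lambda>p. f (fst p) (snd p))"

text \<open>Substitution into a formal sum: each pair is replaced by a formal sum of its own.
  Iterated coproducts and the motion of letters through words are composed in this way.\<close>

definition pbind :: "('a \<times> 'b) list \<Rightarrow> ('a \<Rightarrow> 'b \<Rightarrow> 'c list) \<Rightarrow> 'c list" where
  "pbind L k = concat (map (\<lambda>p. k (fst p) (snd p)) L)"

lemma psum_in:
  "is_kmod N \<Longrightarrow> set L \<subseteq> X \<times> Y \<Longrightarrow> (\<And>x y. x \<in> X \<Longrightarrow> y \<in> Y \<Longrightarrow> f x y \<in> acar N) \<Longrightarrow> psum N L f \<in> acar N"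
  unfolding psum_def by (rule lsum_in) force+

lemma psum_cong:
  "set L \<subseteq> X \<times> Y \<Longrightarrow> (\<And>x y. x \<in> X \<Longrightarrow> y \<in> Y \<Longrightarrow> f x y = g x y) \<Longrightarrow> psum N L f = psum N L g"
  unfolding psum_def by (rule lsum_cong) force

lemma psum_single: "is_kmod N \<Longrightarrow> f x y \<in> acar N \<Longrightarrow> psum N [(x, y)] f = f x y"
  by (simp add: psum_def km_0r)

text \<open>The sets \<open>U\<close> and \<open>V\<close> bound the pairs that the substitution
  produces. Splitting the concatenated sum needs all terms in the carrier, where addition is
  associative.\<close>

lemma psum_bind:
  assumes N: "is_kmod N" and L: "set L \<subseteq> X \<times> Y"
    and k: "\<And>x y. x \<in> X \<Longrightarrow> y \<in> Y \<Longrightarrow> set (k x y) \<subseteq> U \<times> V"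
    and f: "\<And>u v. u \<in> U \<Longrightarrow> v \<in> V \<Longrightarrow> f u v \<in> acar N"
  shows "psum N (pbind L k) f = psum N L (\<lambda>x y. psum N (k x y) f)"
  unfolding psum_def pbind_def
proof (rule lsum_bind[OF N])
  fix p q assume p: "p \<in> set L" and q: "q \<in> set (k (fst p) (snd p))"
  have "fst p \<in> X" "snd p \<in> Y" using p L by auto
  then have "fst q \<in> U" "snd q \<in> V" using k q by force+
  then show "f (fst q) (snd q) \<in> acar N" by (rule f)
qed

lemma pbind_in:
  assumes "set L \<subseteq> X \<times> Y" "\<And>x y. x \<in> X \<Longrightarrow> y \<in> Y \<Longrightarrow> set (k x y) \<subseteq> Z"
  shows "set (pbind L k) \<subseteq> Z"
proof -
  have "set (k (fst p) (snd p)) \<subseteq> Z" if "p \<in> set L" for p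
    using that assms(1) by (intro assms(2)) auto
  then show ?thesis by (auto simp: pbind_def)
qed

lemma psum_swap:
  assumes N: "is_kmod N" and L: "set L \<subseteq> X \<times> Y" and K: "set K \<subseteq> U \<times> V"
    and f: "\<And>x y u v. x \<in> X \<Longrightarrow> y \<in> Y \<Longrightarrow> u \<in> U \<Longrightarrow> v \<in> V \<Longrightarrow> f x y u v \<in> acar N"
  shows "psum N L (\<lambda>x y. psum N K (f x y)) = psum N K (\<lambda>u v. psum N L (\<lambda>x y. f x y u v))"
  unfolding psum_def
proof (rule lsum_swap[OF N])
  fix p q assume "p \<in> set L" "q \<in> set K"
  then have "fst p \<in> X" "snd p \<in> Y" "fst q \<in> U" "snd q \<in> V" using L K by auto
  then show "f (fst p) (snd p) (fst q) (snd q) \<in> acar N" by (rule f)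
qed

lemma lin_push2:
  assumes "is_kmod M" "is_kmod N" "lin_map M N g" "set L \<subseteq> X \<times> Y"
    "\<And>x y. x \<in> X \<Longrightarrow> y \<in> Y \<Longrightarrow> f x y \<in> acar M"
  shows "g (psum M L f) = psum N L (\<lambda>x y. g (f x y))"
  unfolding psum_def by (rule lin_push) (use assms in force)+

lemma lin_psum:
  assumes "is_kmod N" "set L \<subseteq> X \<times> Y" "\<And>u v. u \<in> X \<Longrightarrow> v \<in> Y \<Longrightarrow> lin_map M N (\<lambda>x. f x u v)"
  shows "lin_map M N (\<lambda>x. psum N L (f x))"
  unfolding psum_def by (rule lin_lsum) (use assms in force)+

section \<open>Multilinear maps\<close>

lemma lprod_Nil [simp]: "lprod [] = {[]}"
  by (auto simp: lprod_def)

lemma lprod_Cons [simp]: "x # xs \<in> lprod (M # Ms) \<longleftrightarrow> x \<in> acar M \<and> xs \<in> lprod Ms"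
  by (auto simp: lprod_def All_less_Suc2)

lemma lprod_length: "xs \<in> lprod Ms \<Longrightarrow> length xs = length Ms"
  by (simp add: lprod_def)

lemma lprod_ConsE:
  assumes "zs \<in> lprod (M # Ms)"
  obtains x xs where "zs = x # xs" "x \<in> acar M" "xs \<in> lprod Ms"
  using assms by (cases zs) (auto dest: lprod_length)

lemma lprod_append:
  "length xs = length Ms \<Longrightarrow> xs @ ys \<in> lprod (Ms @ Ns) \<longleftrightarrow> xs \<in> lprod Ms \<and> ys \<in> lprod Ns"
  by (induction xs Ms rule: list_induct2) auto

lemma lprod_appendI: "xs \<in> lprod Ms \<Longrightarrow> ys \<in> lprod Ns \<Longrightarrow> xs @ ys \<in> lprod (Ms @ Ns)"
  by (simp add: lprod_append lprod_length)

lemma lprod_appendE: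
  assumes "zs \<in> lprod (Ms @ Ns)"
  obtains xs ys where "zs = xs @ ys" "xs \<in> lprod Ms" "ys \<in> lprod Ns"
proof -
  let ?k = "length Ms"
  have "take ?k zs @ drop ?k zs \<in> lprod (Ms @ Ns)" using assms by simp
  moreover have "length (take ?k zs) = ?k" using lprod_length[OF assms] by simp
  ultimately have "take ?k zs \<in> lprod Ms" "drop ?k zs \<in> lprod Ns" by (simp_all only: lprod_append)
  then show ?thesis using that[of "take ?k zs" "drop ?k zs"] by simp
qed

lemma lprod_replicate: "xs \<in> lprod (replicate n M) \<longleftrightarrow> length xs = n \<and> set xs \<subseteq> acar M"
  unfolding lprod_def by (auto simp: in_set_conv_nth subset_iff)

text \<open>Recursion over the list of factors makes induction on words possible. The base case
  records membership in \<open>N\<close>, which no linearity clause would provide for the empty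
  word.\<close>

fun mlin :: "('k::comm_ring_1, 'm) alg list \<Rightarrow> ('k, 'n) alg \<Rightarrow> ('m list \<Rightarrow> 'n) \<Rightarrow> bool" where
  "mlin [] N f \<longleftrightarrow> f [] \<in> acar N"
| "mlin (M # Ms) N f \<longleftrightarrow> (\<forall>x\<in>acar M. mlin Ms N (\<lambda>xs. f (x # xs))) \<and>
     (\<forall>xs\<in>lprod Ms. lin_map M N (\<lambda>x. f (x # xs)))"

lemma mlin_in: "mlin Ms N f \<Longrightarrow> xs \<in> lprod Ms \<Longrightarrow> f xs \<in> acar N"
  by (induction Ms arbitrary: xs f) (auto elim!: lprod_ConsE)

text \<open>Separates the dependence on two blocks of a word; the block of \<open>H\<close> letters
  and the block of \<open>A\<close> letters are treated independently because of it.\<close>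

lemma mlin_append: "mlin (Ms @ Ns) N f \<longleftrightarrow>
    (\<forall>xs\<in>lprod Ms. mlin Ns N (\<lambda>ys. f (xs @ ys))) \<and> (\<forall>ys\<in>lprod Ns. mlin Ms N (\<lambda>xs. f (xs @ ys)))"
proof (induction Ms arbitrary: f)
  case Nil
  show ?case by (auto intro: mlin_in)
next
  case (Cons M Ms)
  show ?case (is "?L \<longleftrightarrow> ?R")
  proof
    assume L: ?L
    show ?R
    proof (intro conjI ballI)
      fix zs assume "zs \<in> lprod (M # Ms)"
      then obtain x xs where "zs = x # xs" "x \<in> acar M" "xs \<in> lprod Ms" by (rule lprod_ConsE)
      then show "mlin Ns N (\<lambda>ys. f (zs @ ys))" using L by (simp add: Cons.IH)
    next
      fix ys assume "ys \<in> lprod Ns"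
      then show "mlin (M # Ms) N (\<lambda>xs. f (xs @ ys))" using L by (simp add: Cons.IH lprod_appendI)
    qed
  next
    assume R: ?R
    have "mlin (Ms @ Ns) N (\<lambda>xs. f (x # xs))" if x: "x \<in> acar M" for x
      unfolding Cons.IH
    proof (intro conjI ballI)
      fix xs assume "xs \<in> lprod Ms"
      then show "mlin Ns N (\<lambda>ys. f (x # xs @ ys))" using bspec[OF conjunct1[OF R], of "x # xs"] x by simp
    next
      fix ys assume "ys \<in> lprod Ns"
      then show "mlin Ms N (\<lambda>xs. f (x # xs @ ys))" using R x by simp
    qed
    moreover have "lin_map M N (\<lambda>x. f (x # zs))" if "zs \<in> lprod (Ms @ Ns)" for zs
    proof -
      obtain xs ys where "zs = xs @ ys" "xs \<in> lprod Ms" "ys \<in> lprod Ns"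
        using lprod_appendE[OF \<open>zs \<in> lprod (Ms @ Ns)\<close>] by metis
      then show ?thesis using R by simp
    qed
    ultimately show ?L by simp
  qed
qed

lemma mlin_comp: "lin_map N N' g \<Longrightarrow> mlin Ms N f \<Longrightarrow> mlin Ms N' (\<lambda>xs. g (f xs))"
  by (induction Ms arbitrary: f) (auto intro: lin_in lin_comp)

definition kmods :: "('k::comm_ring_1, 'm) alg list \<Rightarrow> bool" where
  "kmods Ms \<longleftrightarrow> (\<forall>M\<in>set Ms. is_kmod M)"

lemma kmods_simps [simp]: "kmods []" "kmods (M # Ms) \<longleftrightarrow> is_kmod M \<and> kmods Ms"
  "kmods (Ms @ Ns) \<longleftrightarrow> kmods Ms \<and> kmods Ns"
  by (auto simp: kmods_def)

lemma kmods_replicate: "is_kmod M \<Longrightarrow> kmods (replicate n M)"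
  by (simp add: kmods_def)

lemma mlin_cong:
  "kmods Ms \<Longrightarrow> (\<And>xs. xs \<in> lprod Ms \<Longrightarrow> f xs = g xs) \<Longrightarrow> mlin Ms N f \<longleftrightarrow> mlin Ms N g"
proof (induction Ms arbitrary: f g)
  case (Cons M Ms)
  have "mlin Ms N (\<lambda>xs. f (x # xs)) = mlin Ms N (\<lambda>xs. g (x # xs))" if "x \<in> acar M" for x
    by (rule Cons.IH) (use Cons.prems that in auto)
  moreover have "lin_map M N (\<lambda>x. f (x # xs)) = lin_map M N (\<lambda>x. g (x # xs))" if "xs \<in> lprod Ms" for xs
    by (rule lin_cong) (use Cons.prems that in auto)
  ultimately show ?case by simp
qed simp

lemma mlin_lsum:
  assumes N: "is_kmod N"
  shows "(\<And>z. z \<in> set L \<Longrightarrow> mlin Ms N (\<lambda>xs. f xs z)) \<Longrightarrow> mlin Ms N (\<lambda>xs. lsum N L (f xs))"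
proof (induction Ms arbitrary: f)
  case Nil
  then show ?case by (auto intro: lsum_in N)
next
  case (Cons M Ms)
  then show ?case by (auto intro!: lin_lsum N)
qed

lemma mlin_psum:
  assumes "is_kmod N" "set L \<subseteq> X \<times> Y" "\<And>u v. u \<in> X \<Longrightarrow> v \<in> Y \<Longrightarrow> mlin Ms N (\<lambda>xs. f xs u v)"
  shows "mlin Ms N (\<lambda>xs. psum N L (f xs))"
  unfolding psum_def by (rule mlin_lsum) (use assms in force)+

text \<open>Linearity in one slot with all others fixed is the form in which the generators of
  \<open>trel\<close> express multilinearity; \<open>mlin_slot\<close> is the converse
  passage.\<close>

lemma mlinI:
  assumes N: "\<And>xs. xs \<in> lprod Ms \<Longrightarrow> f xs \<in> acar N"
    and "\<And>Ms1 M Ms2 xs ys. Ms = Ms1 @ M # Ms2 \<Longrightarrow> xs \<in> lprod Ms1 \<Longrightarrow> ys \<in> lprod Ms2 \<Longrightarrow>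
            lin_map M N (\<lambda>x. f (xs @ x # ys))"
  shows "mlin Ms N f"
  using assms
proof (induction Ms arbitrary: f)
  case (Cons M Ms)
  have "mlin Ms N (\<lambda>xs. f (x # xs))" if x: "x \<in> acar M" for x
  proof (rule Cons.IH)
    fix Ms1 M' Ms2 xs ys
    assume "Ms = Ms1 @ M' # Ms2" "xs \<in> lprod Ms1" "ys \<in> lprod Ms2"
    then show "lin_map M' N (\<lambda>z. f (x # xs @ z # ys))"
      using Cons.prems(2)[of "M # Ms1" M' Ms2 "x # xs" ys] x by simp
  qed (use Cons.prems x in auto)
  moreover have "lin_map M N (\<lambda>x. f (x # xs))" if "xs \<in> lprod Ms" for xs
    using Cons.prems(2)[of "[]" M Ms "[]" xs] that by simp
  ultimately show ?case by simp
qed simp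

lemma mlin_slot: "mlin (Ms1 @ M # Ms2) N f \<Longrightarrow> xs \<in> lprod Ms1 \<Longrightarrow> ys \<in> lprod Ms2 \<Longrightarrow>
    lin_map M N (\<lambda>x. f (xs @ x # ys))"
  by (auto simp: mlin_append)

section \<open>Tensor products\<close>

lemma tdelta_tfree: "xs \<in> lprod Ms \<Longrightarrow> tdelta xs \<in> tfree Ms"
  by (auto simp: tfree_def tdelta_def)

lemma tfree_zero: "(\<lambda>_. 0) \<in> tfree Ms"
  by (simp add: tfree_def)

lemma tfree_add:
  assumes "f \<in> tfree Ms" "g \<in> tfree Ms" shows "(\<lambda>z. f z + g z) \<in> tfree Ms"
proof -
  have sub: "{z. f z + g z \<noteq> 0} \<subseteq> {z. f z \<noteq> 0} \<union> {z. g z \<noteq> 0}" by auto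
  moreover have "finite ({z. f z \<noteq> 0} \<union> {z. g z \<noteq> 0})" using assms by (simp add: tfree_def)
  ultimately have "finite {z. f z + g z \<noteq> 0}" by (rule finite_subset)
  then show ?thesis using assms sub unfolding tfree_def by blast
qed

lemma tfree_smul:
  assumes "f \<in> tfree Ms" shows "(\<lambda>z. c * f z) \<in> tfree Ms"
proof -
  have sub: "{z. c * f z \<noteq> 0} \<subseteq> {z. f z \<noteq> 0}" by auto
  moreover have "finite {z. f z \<noteq> 0}" using assms by (simp add: tfree_def)
  ultimately have "finite {z. c * f z \<noteq> 0}" by (rule finite_subset)
  then show ?thesis using assms sub unfolding tfree_def by blast
qed

lemma tfree_diff: "f \<in> tfree Ms \<Longrightarrow> g \<in> tfree Ms \<Longrightarrow> (\<lambda>z. f z - g z) \<in> tfree Ms"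
  using tfree_add[of f Ms "\<lambda>z. (- 1) * g z"] tfree_smul[of g Ms "- 1"] by simp

lemma tfree_induct [consumes 1, case_names zero add]:
  assumes u: "u \<in> tfree Ms"
    and zero: "P (\<lambda>_. 0)"
    and add: "\<And>u c xs. u \<in> tfree Ms \<Longrightarrow> xs \<in> lprod Ms \<Longrightarrow> P u \<Longrightarrow> P (\<lambda>z. u z + c * tdelta xs z)"
  shows "P u"
proof -
  have "finite X \<Longrightarrow> u \<in> tfree Ms \<Longrightarrow> {z. u z \<noteq> 0} = X \<Longrightarrow> P u" for X u
  proof (induction X arbitrary: u rule: finite_induct)
    case empty
    then have "u = (\<lambda>_. 0)" by auto
    then show ?case using zero by simp
  next
    case (insert x X)
    \<comment> \<open>\<open>v\<close> deletes the point \<open>x\<close> from the support, and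
      \<open>u x\<close> becomes the coefficient with which it is added back.\<close>
    define v where "v = (\<lambda>z. if z = x then 0 else u z)"
    have vX: "{z. v z \<noteq> 0} = X" using insert by (auto simp: v_def)
    have vf: "v \<in> tfree Ms" using insert vX by (auto simp: tfree_def)
    have "u = (\<lambda>z. v z + u x * tdelta x z)" by (auto simp: v_def tdelta_def)
    moreover have "x \<in> lprod Ms" using insert by (auto simp: tfree_def)
    ultimately show ?case using add[OF vf, of x "u x"] insert.IH[OF vf vX] by simp
  qed
  then show ?thesis using u by (auto simp: tfree_def)
qed

text \<open>A generator mentions a tuple with a sum or a multiple in one slot. Closure of that
  factor puts the tuple into \<open>lprod Ms\<close> again, so relations never leave the free
  module.\<close>

lemma trel_tfree:
  assumes Ms: "kmods Ms" and "f \<in> trel Ms"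
  shows "f \<in> tfree Ms"
  using assms(2)
proof induction
  case (trel_add_gen xs x ys y)
  have "length xs < length Ms" using lprod_length[OF trel_add_gen(1)] by simp
  then obtain Ms1 M Ms2 where Ms_eq: "Ms = Ms1 @ M # Ms2" and l: "length Ms1 = length xs"
    by (metis id_take_nth_drop length_take less_imp_le min.absorb2)
  have "xs @ [aadd (Ms ! length xs) x y] @ ys \<in> lprod Ms"
    using trel_add_gen Ms by (simp add: Ms_eq lprod_append l km_add flip: l)
  then show ?case using trel_add_gen by (intro tfree_diff tdelta_tfree)
next
  case (trel_smul_gen xs x ys c)
  have "length xs < length Ms" using lprod_length[OF trel_smul_gen] by simp
  then obtain Ms1 M Ms2 where Ms_eq: "Ms = Ms1 @ M # Ms2" and l: "length Ms1 = length xs"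
    by (metis id_take_nth_drop length_take less_imp_le min.absorb2)
  have "xs @ [asmul (Ms ! length xs) c x] @ ys \<in> lprod Ms"
    using trel_smul_gen Ms by (simp add: Ms_eq lprod_append l km_smul flip: l)
  then show ?case using trel_smul_gen by (intro tfree_diff tfree_smul tdelta_tfree)
qed (auto intro: tfree_zero tfree_add tfree_smul)

lemma trel_diff: "f \<in> trel Ms \<Longrightarrow> g \<in> trel Ms \<Longrightarrow> (\<lambda>z. f z - g z) \<in> trel Ms"
  using trel_add[of f Ms "\<lambda>z. (- 1) * g z"] trel_smul[of g Ms "- 1"] by simp

lemma tcls_eq_iff:
  assumes "f \<in> tfree Ms" "g \<in> tfree Ms"
  shows "tcls Ms f = tcls Ms g \<longleftrightarrow> (\<lambda>z. f z - g z) \<in> trel Ms"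
proof
  assume "tcls Ms f = tcls Ms g"
  moreover have "f \<in> tcls Ms f" using assms trel_zero by (auto simp: tcls_def)
  ultimately show "(\<lambda>z. f z - g z) \<in> trel Ms" by (auto simp: tcls_def)
next
  assume fg: "(\<lambda>z. f z - g z) \<in> trel Ms"
  have "(\<lambda>z. h z - f z) \<in> trel Ms \<longleftrightarrow> (\<lambda>z. h z - g z) \<in> trel Ms" for h
    using trel_add[OF _ fg, of "\<lambda>z. h z - f z"] trel_diff[OF _ fg, of "\<lambda>z. h z - g z"] by auto
  then show "tcls Ms f = tcls Ms g" by (simp add: tcls_def)
qed

text \<open>\<open>trep\<close> picks an arbitrary element of a class. Any element is finitely
  supported on the right tuples and represents the same class, which is all that the operations of
  \<open>tmod\<close> rely on.\<close>

lemma trep_tcls: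
  assumes "f \<in> tfree Ms"
  shows "trep (tcls Ms f) \<in> tfree Ms" "tcls Ms (trep (tcls Ms f)) = tcls Ms f"
proof -
  have "f \<in> tcls Ms f" using assms trel_zero by (auto simp: tcls_def)
  then have "trep (tcls Ms f) \<in> tcls Ms f" unfolding trep_def by (rule someI[of "\<lambda>g. g \<in> tcls Ms f"])
  then have "trep (tcls Ms f) \<in> tfree Ms" "(\<lambda>z. trep (tcls Ms f) z - f z) \<in> trel Ms"
    by (simp_all only: tcls_def mem_Collect_eq)
  then show "trep (tcls Ms f) \<in> tfree Ms" "tcls Ms (trep (tcls Ms f)) = tcls Ms f"
    using assms by (simp_all add: tcls_eq_iff)
qed

lemma tmod_add:
  assumes "f \<in> tfree Ms" "g \<in> tfree Ms"
  shows "aadd (tmod Ms) (tcls Ms f) (tcls Ms g) = tcls Ms (\<lambda>z. f z + g z)"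
proof -
  let ?f = "trep (tcls Ms f)" and ?g = "trep (tcls Ms g)"
  have "(\<lambda>z. ?f z - f z) \<in> trel Ms" "(\<lambda>z. ?g z - g z) \<in> trel Ms"
    by (simp_all add: trep_tcls assms flip: tcls_eq_iff)
  then have "(\<lambda>z. (?f z + ?g z) - (f z + g z)) \<in> trel Ms"
    using trel_add[of "\<lambda>z. ?f z - f z" Ms "\<lambda>z. ?g z - g z"] by (simp add: algebra_simps)
  then have "tcls Ms (\<lambda>z. ?f z + ?g z) = tcls Ms (\<lambda>z. f z + g z)"
    using trep_tcls assms by (subst tcls_eq_iff) (auto intro: tfree_add)
  then show ?thesis by (simp add: tmod_def)
qed

lemma tmod_smul:
  assumes "f \<in> tfree Ms"
  shows "asmul (tmod Ms) c (tcls Ms f) = tcls Ms (\<lambda>z. c * f z)"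
proof -
  let ?f = "trep (tcls Ms f)"
  have "(\<lambda>z. ?f z - f z) \<in> trel Ms"
    by (simp_all add: trep_tcls assms flip: tcls_eq_iff)
  then have "(\<lambda>z. c * ?f z - c * f z) \<in> trel Ms"
    using trel_smul[of "\<lambda>z. ?f z - f z" Ms c] by (simp add: algebra_simps)
  then have "tcls Ms (\<lambda>z. c * ?f z) = tcls Ms (\<lambda>z. c * f z)"
    using trep_tcls assms by (subst tcls_eq_iff) (auto intro: tfree_smul)
  then show ?thesis by (simp add: tmod_def)
qed

lemma acar_tmod: "acar (tmod Ms) = tcls Ms ` tfree Ms"
  and azero_tmod: "azero (tmod Ms) = tcls Ms (\<lambda>_. 0)"
  by (simp_all add: tmod_def)

lemma kmod_tmod: "is_kmod (tmod Ms)"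
proof -
  have neg: "\<exists>g\<in>tfree Ms. tcls Ms (\<lambda>z. f z + g z) = tcls Ms (\<lambda>_. 0)" if "f \<in> tfree Ms" for f
    using tfree_smul[OF that, of "- 1"] by (intro bexI[of _ "\<lambda>z. (- 1) * f z"]) simp_all
  show ?thesis
    unfolding is_kmod_def acar_tmod azero_tmod
    by (auto simp: tmod_add tmod_smul tfree_add tfree_smul tfree_zero algebra_simps intro!: imageI neg)
qed

lemma ptens_in: "xs \<in> lprod Ms \<Longrightarrow> ptens Ms xs \<in> acar (tmod Ms)"
  by (auto simp: ptens_def acar_tmod tdelta_tfree)

text \<open>The generators of \<open>trel\<close> are precisely additivity and homogeneity in one
  slot, read off at the position \<open>length xs\<close>.\<close>

lemma mlin_ptens:
  assumes Ms: "kmods Ms"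
  shows "mlin Ms (tmod Ms) (ptens Ms)"
proof (rule mlinI)
  fix Ms1 M Ms2 xs ys
  assume Ms_eq: "Ms = Ms1 @ M # Ms2" and xs: "xs \<in> lprod Ms1" and ys: "ys \<in> lprod Ms2"
  have M: "is_kmod M" using Ms by (simp add: Ms_eq)
  have l: "xs @ x # ys \<in> lprod Ms" if "x \<in> acar M" for x
    using xs ys that by (simp add: Ms_eq lprod_appendI)
  have nth: "Ms ! length xs = M" using lprod_length[OF xs] by (simp add: Ms_eq)
  show "lin_map M (tmod Ms) (\<lambda>x. ptens Ms (xs @ x # ys))"
  proof (rule lin_mapI)
    fix x y assume xy: "x \<in> acar M" "y \<in> acar M"
    have "(\<lambda>z. tdelta (xs @ aadd M x y # ys) z - (tdelta (xs @ x # ys) z + tdelta (xs @ y # ys) z)) \<in> trel Ms"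
      using trel_add_gen[of xs x ys Ms y] l xy by (simp add: nth algebra_simps)
    then show "ptens Ms (xs @ aadd M x y # ys) = aadd (tmod Ms) (ptens Ms (xs @ x # ys)) (ptens Ms (xs @ y # ys))"
      using l xy M unfolding ptens_def
      by (subst tmod_add) (auto simp: tcls_eq_iff tdelta_tfree tfree_add km_add)
  next
    fix c x assume x: "x \<in> acar M"
    have "(\<lambda>z. tdelta (xs @ asmul M c x # ys) z - c * tdelta (xs @ x # ys) z) \<in> trel Ms"
      using trel_smul_gen[of xs x ys Ms c] l x by (simp add: nth)
    then show "ptens Ms (xs @ asmul M c x # ys) = asmul (tmod Ms) c (ptens Ms (xs @ x # ys))"
      using l x M unfolding ptens_def
      by (subst tmod_smul) (auto simp: tcls_eq_iff tdelta_tfree tfree_smul km_smul)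
  qed (use l in \<open>auto intro: ptens_in\<close>)
qed (rule ptens_in)

lemma tmod_induct [consumes 1, case_names zero add]:
  assumes u: "u \<in> acar (tmod Ms)" and zero: "P (azero (tmod Ms))"
    and add: "\<And>u c xs. u \<in> acar (tmod Ms) \<Longrightarrow> xs \<in> lprod Ms \<Longrightarrow> P u \<Longrightarrow>
          P (aadd (tmod Ms) (asmul (tmod Ms) c (ptens Ms xs)) u)"
  shows "P u"
proof -
  obtain f where f: "f \<in> tfree Ms" and uf: "u = tcls Ms f" using u by (auto simp: acar_tmod)
  from f have "P (tcls Ms f)"
  proof (induction rule: tfree_induct)
    case zero
    show ?case using \<open>P (azero (tmod Ms))\<close> by (simp add: azero_tmod)
  next
    case (add u c xs)
    have "tcls Ms (\<lambda>z. u z + c * tdelta xs z) =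
        aadd (tmod Ms) (asmul (tmod Ms) c (ptens Ms xs)) (tcls Ms u)"
      using add by (simp add: ptens_def tmod_smul tdelta_tfree tmod_add tfree_smul add.commute)
    then show ?case using assms(3)[of "tcls Ms u" xs c] add by (simp add: acar_tmod)
  qed
  then show ?thesis by (simp add: uf)
qed

text \<open>Pure tensors generate the quotient. Identities between linear maps out of a tensor
  product are reduced to words by this fact.\<close>

lemma tmod_ext:
  assumes N: "is_kmod N" and f: "lin_map (tmod Ms) N f" and g: "lin_map (tmod Ms) N g"
    and eq: "\<And>xs. xs \<in> lprod Ms \<Longrightarrow> f (ptens Ms xs) = g (ptens Ms xs)"
    and u: "u \<in> acar (tmod Ms)"
  shows "f u = g u"
  using u
proof (induction rule: tmod_induct)
  case zero
  show ?case using lin_zero[OF f kmod_tmod N] lin_zero[OF g kmod_tmod N] by simp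
next
  case (add u c xs)
  then show ?case
    by (simp add: lin_add[OF f] lin_add[OF g] lin_smul[OF f] lin_smul[OF g] eq ptens_in km_smul kmod_tmod)
qed

text \<open>The scalar of a generator is absorbed into its first factor, which is why the list of
  factors has to be nonempty. Tensors thereby become sums of pure tensors without
  coefficients.\<close>

lemma tmod_list:
  assumes "Ms \<noteq> []" and Ms: "kmods Ms" and u: "u \<in> acar (tmod Ms)"
  shows "\<exists>L. set L \<subseteq> lprod Ms \<and> u = lsum (tmod Ms) L (ptens Ms)"
  using u
proof (induction rule: tmod_induct)
  case zero
  show ?case by (intro exI[of _ "[]"]) simp
next
  case (add u c xs)
  then obtain L where L: "set L \<subseteq> lprod Ms" "u = lsum (tmod Ms) L (ptens Ms)" by auto
  obtain M Ms' where Ms_eq: "Ms = M # Ms'" using assms(1) by (cases Ms) auto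
  obtain x xs' where xs: "xs = x # xs'" "x \<in> acar M" "xs' \<in> lprod Ms'"
    using add Ms_eq by (auto elim: lprod_ConsE)
  have lin: "lin_map M (tmod Ms) (\<lambda>x. ptens Ms (x # xs'))"
    using mlin_ptens[OF Ms] xs(3) by (simp add: Ms_eq)
  have "asmul (tmod Ms) c (ptens Ms xs) = ptens Ms (asmul M c x # xs')"
    using lin_smul[OF lin xs(2)] xs by simp
  moreover have "asmul M c x # xs' \<in> lprod Ms" using xs Ms by (simp add: Ms_eq km_smul)
  ultimately show ?case using L by (intro exI[of _ "(asmul M c x # xs') # L"]) simp
qed

section \<open>The universal property of the tensor product\<close>

definition agrp :: "('k, 'n) alg \<Rightarrow> 'n ring" where
  "agrp N = \<lparr>carrier = acar N, mult = (\<lambda>x y. x), one = azero N, zero = azero N, add = aadd N\<rparr>"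

text \<open>Sums over a finite support are taken with \<open>finsum\<close>, which HOL-Algebra
  states for ring records; the additive group of \<open>N\<close> is dressed up as such a record,
  with placeholders for multiplication and unit.\<close>

lemma agrp_monoid:
  assumes "is_kmod N" shows "abelian_monoid (agrp N)"
  by (rule abelian_monoidI)
    (use assms in \<open>simp_all add: agrp_def km_closed km_0l, simp_all add: km_ac km_closed\<close>)

text \<open>The linear extension of \<open>f\<close> from tuples to the free module;
  \<open>tlift\<close> is what it induces on the quotient.\<close>

definition teval :: "('k::comm_ring_1, 'n) alg \<Rightarrow> ('m list \<Rightarrow> 'n) \<Rightarrow> ('m list \<Rightarrow> 'k) \<Rightarrow> 'n" where
  "teval N f u = finsum (agrp N) (\<lambda>xs. asmul N (u xs) (f xs)) {xs. u xs \<noteq> 0}"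

context
  fixes Ms :: "('k::comm_ring_1, 'm) alg list" and N :: "('k, 'n) alg" and f :: "'m list \<Rightarrow> 'n"
  assumes N: "is_kmod N" and f: "mlin Ms N f" and Ms: "kmods Ms"
begin

interpretation G: abelian_monoid "agrp N" by (rule agrp_monoid[OF N])

text \<open>Two elements of the free module have different supports, so additivity is proved over
  their union; the extra summands carry the coefficient 0.\<close>

lemma teval_superset:
  assumes X: "finite X" "X \<subseteq> lprod Ms" and u: "{xs. u xs \<noteq> 0} \<subseteq> X"
  shows "teval N f u = finsum (agrp N) (\<lambda>xs. asmul N (u xs) (f xs)) X"
  unfolding teval_def
proof (rule G.add.finprod_mono_neutral_cong_left[OF X(1) u])
  fix xs assume "xs \<in> X - {xs. u xs \<noteq> 0}"
  then show "asmul N (u xs) (f xs) = \<zero>\<^bsub>agrp N\<^esub>"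
    using X mlin_in[OF f, of xs] N by (auto simp: agrp_def km_0_smul)
qed (use X mlin_in[OF f] N in \<open>auto simp: agrp_def km_smul\<close>)

lemma teval_add:
  assumes "u \<in> tfree Ms" "v \<in> tfree Ms"
  shows "teval N f (\<lambda>z. u z + v z) = aadd N (teval N f u) (teval N f v)"
proof -
  let ?X = "{z. u z \<noteq> 0} \<union> {z. v z \<noteq> 0}"
  have X: "finite ?X" "?X \<subseteq> lprod Ms" using assms by (auto simp: tfree_def)
  have fin: "(\<lambda>z. asmul N (w z) (f z)) \<in> ?X \<rightarrow> carrier (agrp N)" for w
    using X mlin_in[OF f] N by (auto simp: agrp_def km_smul)
  have "teval N f (\<lambda>z. u z + v z) = finsum (agrp N) (\<lambda>z. asmul N (u z + v z) (f z)) ?X"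
    by (rule teval_superset[OF X]) auto
  also have "\<dots> = finsum (agrp N) (\<lambda>z. asmul N (u z) (f z) \<oplus>\<^bsub>agrp N\<^esub> asmul N (v z) (f z)) ?X"
  proof (rule G.finsum_cong')
    fix z assume "z \<in> ?X"
    then show "asmul N (u z + v z) (f z) = asmul N (u z) (f z) \<oplus>\<^bsub>agrp N\<^esub> asmul N (v z) (f z)"
      using X mlin_in[OF f, of z] N by (auto simp: agrp_def km_add_smul)
  qed (use fin[of u] fin[of v] in auto)
  also have "\<dots> = finsum (agrp N) (\<lambda>z. asmul N (u z) (f z)) ?X \<oplus>\<^bsub>agrp N\<^esub> finsum (agrp N) (\<lambda>z. asmul N (v z) (f z)) ?X"
    by (rule G.finsum_addf[OF fin fin])
  also have "finsum (agrp N) (\<lambda>z. asmul N (u z) (f z)) ?X = teval N f u"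
    by (rule teval_superset[OF X, symmetric]) auto
  also have "finsum (agrp N) (\<lambda>z. asmul N (v z) (f z)) ?X = teval N f v"
    by (rule teval_superset[OF X, symmetric]) auto
  finally show ?thesis by (simp add: agrp_def)
qed

lemma teval_single: "xs \<in> lprod Ms \<Longrightarrow> teval N f (\<lambda>z. c * tdelta xs z) = asmul N c (f xs)"
  by (subst teval_superset[of "{xs}"])
    (use mlin_in[OF f] N in \<open>auto simp: tdelta_def agrp_def km_smul km_closed km_0r G.finsum_insert[unfolded agrp_def]
       G.finsum_empty[unfolded agrp_def]\<close>)

lemma teval_zero: "teval N f (\<lambda>_. 0) = azero N"
  using G.finsum_empty by (simp add: teval_def) (simp add: agrp_def)

lemma teval_in: "u \<in> tfree Ms \<Longrightarrow> teval N f u \<in> acar N"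
proof (induction rule: tfree_induct)
  case zero
  show ?case by (simp add: teval_zero km_zero N)
next
  case (add u c xs)
  then show ?case
    using mlin_in[OF f] by (simp add: teval_add tfree_smul tdelta_tfree teval_single km_closed N)
qed

lemma teval_smul: "u \<in> tfree Ms \<Longrightarrow> teval N f (\<lambda>z. c * u z) = asmul N c (teval N f u)"
proof (induction rule: tfree_induct)
  case zero
  show ?case by (simp add: teval_zero km_smul_0 N)
next
  case (add u d xs)
  have "(\<lambda>z. c * (u z + d * tdelta xs z)) = (\<lambda>z. c * u z + (c * d) * tdelta xs z)"
    by (simp add: algebra_simps)
  then show ?case
    using mlin_in[OF f] add
    by (simp add: teval_add tfree_smul tdelta_tfree teval_single km_closed N teval_in km_smul_add km_mul_smul)
qed

text \<open>With no subtraction in the target, vanishing on a difference is turned into equality of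
  two values by cancellation.\<close>

lemma teval_diff:
  assumes "u \<in> tfree Ms" "v \<in> tfree Ms"
  shows "teval N f (\<lambda>z. u z - v z) = azero N \<longleftrightarrow> teval N f u = teval N f v"
proof -
  let ?w = "\<lambda>z. u z - v z"
  have "teval N f (\<lambda>z. v z + ?w z) = aadd N (teval N f v) (teval N f ?w)"
    using assms by (intro teval_add) (auto intro: tfree_diff)
  then have eq: "teval N f u = aadd N (teval N f v) (teval N f ?w)" by simp
  show ?thesis
    using km_cancel[OF N, of "teval N f v" "teval N f ?w" "azero N"] assms eq
    by (auto simp: teval_in tfree_diff N km_0r km_zero)
qed

text \<open>Linearity of \<open>f\<close> in the slot \<open>length xs\<close> gives equal values on
  the two sides of a generating relation, and \<open>teval_diff\<close> converts this into the value
  0 on the generator.\<close>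

lemma teval_trel: "u \<in> trel Ms \<Longrightarrow> teval N f u = azero N"
proof (induction rule: trel.induct)
  case trel_zero
  show ?case by (rule teval_zero)
next
  case (trel_add r s)
  then show ?case by (simp add: teval_add trel_tfree Ms km_0l km_zero N)
next
  case (trel_smul r c)
  then show ?case by (simp add: teval_smul trel_tfree Ms km_smul_0 N)
next
  case (trel_add_gen xs x ys y)
  have "length xs < length Ms" using lprod_length[OF trel_add_gen(1)] by simp
  then obtain Ms1 M Ms2 where Ms_eq: "Ms = Ms1 @ M # Ms2" and l: "length xs = length Ms1"
    by (metis id_take_nth_drop length_take less_imp_le min.absorb2)
  have M: "is_kmod M" and nth: "Ms ! length xs = M" using Ms by (simp_all add: Ms_eq l)
  have in1: "xs \<in> lprod Ms1" "ys \<in> lprod Ms2" "x \<in> acar M" "y \<in> acar M"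
    using trel_add_gen by (simp_all add: Ms_eq lprod_append l)
  then have pin: "xs @ z # ys \<in> lprod Ms" if "z \<in> acar M" for z
    using that by (simp add: Ms_eq lprod_appendI)
  have lin: "lin_map M N (\<lambda>x. f (xs @ x # ys))" using f in1(1,2) unfolding Ms_eq by (rule mlin_slot)
  have s: "teval N f (tdelta (xs @ z # ys)) = f (xs @ z # ys)" if "z \<in> acar M" for z
    using teval_single[OF pin[OF that], of 1] mlin_in[OF f pin[OF that]] N by (simp add: km_1)
  have "teval N f (\<lambda>z. tdelta (xs @ aadd M x y # ys) z - (tdelta (xs @ x # ys) z + tdelta (xs @ y # ys) z)) = azero N"
    by (subst teval_diff)
      (use in1 M in \<open>simp_all add: s teval_add tfree_add tdelta_tfree pin km_add lin_add[OF lin]\<close>)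
  then show ?case by (simp add: nth algebra_simps)
next
  case (trel_smul_gen xs x ys c)
  have "length xs < length Ms" using lprod_length[OF trel_smul_gen] by simp
  then obtain Ms1 M Ms2 where Ms_eq: "Ms = Ms1 @ M # Ms2" and l: "length xs = length Ms1"
    by (metis id_take_nth_drop length_take less_imp_le min.absorb2)
  have M: "is_kmod M" and nth: "Ms ! length xs = M" using Ms by (simp_all add: Ms_eq l)
  have in1: "xs \<in> lprod Ms1" "ys \<in> lprod Ms2" "x \<in> acar M"
    using trel_smul_gen by (simp_all add: Ms_eq lprod_append l)
  then have pin: "xs @ z # ys \<in> lprod Ms" if "z \<in> acar M" for z
    using that by (simp add: Ms_eq lprod_appendI)
  have lin: "lin_map M N (\<lambda>x. f (xs @ x # ys))" using f in1(1,2) unfolding Ms_eq by (rule mlin_slot)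
  have s: "teval N f (tdelta (xs @ z # ys)) = f (xs @ z # ys)" if "z \<in> acar M" for z
    using teval_single[OF pin[OF that], of 1] mlin_in[OF f pin[OF that]] N by (simp add: km_1)
  have "teval N f (\<lambda>z. tdelta (xs @ asmul M c x # ys) z - c * tdelta (xs @ x # ys) z) = azero N"
    by (subst teval_diff)
      (use in1 M in \<open>simp_all add: s teval_single tfree_smul tdelta_tfree pin km_smul lin_smul[OF lin]\<close>)
  then show ?case by (simp add: nth)
qed

lemma teval_trep: "u \<in> tfree Ms \<Longrightarrow> teval N f (trep (tcls Ms u)) = teval N f u"
  using trep_tcls[of u Ms] by (simp add: tcls_eq_iff teval_trel flip: teval_diff)

text \<open>\<open>tlift\<close> is a definite description, so existence and uniqueness are needed
  together. Existence evaluates \<open>f\<close> on a representative; uniqueness follows from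
  generation by pure tensors on the carrier and from the prescribed value \<open>undefined\<close>
  off it.\<close>

lemma tlift_aux:
  "lin_map (tmod Ms) N (tlift Ms N f) \<and> (\<forall>xs\<in>lprod Ms. tlift Ms N f (ptens Ms xs) = f xs) \<and>
     (\<forall>u. u \<notin> acar (tmod Ms) \<longrightarrow> tlift Ms N f u = undefined)"
  unfolding tlift_def
proof (rule theI'[of "\<lambda>L. lin_map (tmod Ms) N L \<and> (\<forall>xs\<in>lprod Ms. L (ptens Ms xs) = f xs) \<and>
     (\<forall>u. u \<notin> acar (tmod Ms) \<longrightarrow> L u = undefined)"])
  let ?L = "\<lambda>u. if u \<in> acar (tmod Ms) then teval N f (trep u) else undefined"
  have L: "?L (tcls Ms u) = teval N f u" if "u \<in> tfree Ms" for u
    using that by (simp add: acar_tmod teval_trep)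
  have lin: "lin_map (tmod Ms) N ?L"
    unfolding lin_map_def acar_tmod
    by (auto simp: tmod_add tmod_smul teval_trep teval_add teval_smul teval_in tfree_add tfree_smul)
  have pt: "?L (ptens Ms xs) = f xs" if "xs \<in> lprod Ms" for xs
    using teval_single[OF that, of 1] mlin_in[OF f that] N that L[OF tdelta_tfree[OF that]]
    by (simp only: ptens_def km_1 mult_1_left) 
  show "\<exists>!L. lin_map (tmod Ms) N L \<and> (\<forall>xs\<in>lprod Ms. L (ptens Ms xs) = f xs) \<and>
      (\<forall>u. u \<notin> acar (tmod Ms) \<longrightarrow> L u = undefined)"
  proof (rule ex1I[of _ ?L])
    show "lin_map (tmod Ms) N ?L \<and> (\<forall>xs\<in>lprod Ms. ?L (ptens Ms xs) = f xs) \<and>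
      (\<forall>u. u \<notin> acar (tmod Ms) \<longrightarrow> ?L u = undefined)"
      using lin pt by simp
  next
    fix L' assume L': "lin_map (tmod Ms) N L' \<and> (\<forall>xs\<in>lprod Ms. L' (ptens Ms xs) = f xs) \<and>
      (\<forall>u. u \<notin> acar (tmod Ms) \<longrightarrow> L' u = undefined)"
    have "L' u = ?L u" for u
    proof (cases "u \<in> acar (tmod Ms)")
      case True
      show ?thesis
        by (rule tmod_ext[OF N _ lin _ True]) (use L' in \<open>simp_all add: pt del: if_split\<close>)
    qed (use L' in simp)
    then show "L' = ?L" by (rule ext)
  qed
qed

lemma tlift_lin: "lin_map (tmod Ms) N (tlift Ms N f)"
  and tlift_ptens: "xs \<in> lprod Ms \<Longrightarrow> tlift Ms N f (ptens Ms xs) = f xs"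
  using tlift_aux by auto

end

lemma tlift_cong: "(\<And>xs. xs \<in> lprod Ms \<Longrightarrow> f xs = g xs) \<Longrightarrow> tlift Ms N f = tlift Ms N g"
  by (simp add: tlift_def)

text \<open>A description gives no formula from which the dependence on a parameter could be read,
  so linearity in \<open>v\<close> is proved by induction on the tensor \<open>u\<close>, starting
  from pure tensors.\<close>

lemma tlift_param_lin:
  assumes N: "is_kmod N" and Ms: "kmods Ms" and M: "is_kmod M"
    and f: "\<And>v. v \<in> acar M \<Longrightarrow> mlin Ms N (f v)"
    and lin: "\<And>xs. xs \<in> lprod Ms \<Longrightarrow> lin_map M N (\<lambda>v. f v xs)"
    and u: "u \<in> acar (tmod Ms)"
  shows "lin_map M N (\<lambda>v. tlift Ms N (f v) u)"
  using u
proof (induction rule: tmod_induct)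
  case zero
  have "tlift Ms N (f v) (azero (tmod Ms)) = azero N" if "v \<in> acar M" for v
    by (rule lin_zero[OF tlift_lin[OF N f[OF that] Ms] kmod_tmod N])
  then show ?case by (rule lin_eqI[OF M lin_const_zero[OF N]])
next
  case (add u c xs)
  have "tlift Ms N (f v) (aadd (tmod Ms) (asmul (tmod Ms) c (ptens Ms xs)) u) =
      aadd N (asmul N c (f v xs)) (tlift Ms N (f v) u)" if "v \<in> acar M" for v
    using add that
    by (simp add: lin_add[OF tlift_lin[OF N f[OF that] Ms]] lin_smul[OF tlift_lin[OF N f[OF that] Ms]]
        tlift_ptens[OF N f[OF that] Ms] ptens_in km_smul kmod_tmod)
  then show ?case
    by (rule lin_eqI[OF M lin_sum2[OF N lin_scale[OF N lin[OF add(2)], of c] add(3)]])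
qed

section \<open>Concatenation of tensors\<close>

context
  fixes Ms Ns :: "('k::comm_ring_1, 'm) alg list"
  assumes Ms: "kmods Ms" and Ns: "kmods Ns"
begin

lemma tcat_inner: "xs \<in> lprod Ms \<Longrightarrow> mlin Ns (tmod (Ms @ Ns)) (\<lambda>ys. ptens (Ms @ Ns) (xs @ ys))"
  and tcat_inner': "ys \<in> lprod Ns \<Longrightarrow> mlin Ms (tmod (Ms @ Ns)) (\<lambda>xs. ptens (Ms @ Ns) (xs @ ys))"
  using mlin_ptens[of "Ms @ Ns"] Ms Ns by (simp_all add: mlin_append)

text \<open>\<open>tcat\<close> is a lift of lifts, so the outer lift requires the inner one to be
  multilinear in the tuple \<open>xs\<close>. Slot by slot this is linearity of a lift in a
  parameter.\<close>

lemma tcat_outer: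
  assumes v: "v \<in> acar (tmod Ns)"
  shows "mlin Ms (tmod (Ms @ Ns)) (\<lambda>xs. tlift Ns (tmod (Ms @ Ns)) (\<lambda>ys. ptens (Ms @ Ns) (xs @ ys)) v)"
proof (rule mlinI)
  fix xs assume "xs \<in> lprod Ms"
  then show "tlift Ns (tmod (Ms @ Ns)) (\<lambda>ys. ptens (Ms @ Ns) (xs @ ys)) v \<in> acar (tmod (Ms @ Ns))"
    by (rule lin_in[OF tlift_lin[OF kmod_tmod tcat_inner Ns] v])
next
  fix Ms1 M Ms2 xs ys assume eq: "Ms = Ms1 @ M # Ms2" "xs \<in> lprod Ms1" "ys \<in> lprod Ms2"
  show "lin_map M (tmod (Ms @ Ns)) (\<lambda>x. tlift Ns (tmod (Ms @ Ns)) (\<lambda>zs. ptens (Ms @ Ns) ((xs @ x # ys) @ zs)) v)"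
  proof (rule tlift_param_lin[OF kmod_tmod Ns _ _ _ v])
    show "is_kmod M" using Ms eq by simp
    show "mlin Ns (tmod (Ms @ Ns)) (\<lambda>zs. ptens (Ms @ Ns) ((xs @ x # ys) @ zs))" if "x \<in> acar M" for x
      by (rule tcat_inner) (use eq that in \<open>simp add: lprod_appendI\<close>)
    show "lin_map M (tmod (Ms @ Ns)) (\<lambda>x. ptens (Ms @ Ns) ((xs @ x # ys) @ zs))" if "zs \<in> lprod Ns" for zs
      using tcat_inner'[OF that] eq(2,3) unfolding eq(1) by (rule mlin_slot)
  qed
qed

lemma tcat_lin1: "v \<in> acar (tmod Ns) \<Longrightarrow> lin_map (tmod Ms) (tmod (Ms @ Ns)) (\<lambda>u. tcat Ms Ns u v)"
  unfolding tcat_def by (rule tlift_lin[OF kmod_tmod tcat_outer Ms])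

lemma tcat_lin2: "u \<in> acar (tmod Ms) \<Longrightarrow> lin_map (tmod Ns) (tmod (Ms @ Ns)) (tcat Ms Ns u)"
  unfolding tcat_def
  by (rule tlift_param_lin[OF kmod_tmod Ms kmod_tmod tcat_outer tlift_lin[OF kmod_tmod tcat_inner Ns]])

lemma tcat_ptens:
  "xs \<in> lprod Ms \<Longrightarrow> ys \<in> lprod Ns \<Longrightarrow> tcat Ms Ns (ptens Ms xs) (ptens Ns ys) = ptens (Ms @ Ns) (xs @ ys)"
  unfolding tcat_def
  by (simp add: tlift_ptens[OF kmod_tmod tcat_outer Ms] ptens_in tlift_ptens[OF kmod_tmod tcat_inner Ns])

end

section \<open>Bilinear maps and tensors of rank two\<close>

definition bilin :: "('k::comm_ring_1, 'a) alg \<Rightarrow> ('k, 'b) alg \<Rightarrow> ('k, 'n) alg \<Rightarrow> ('a \<Rightarrow> 'b \<Rightarrow> 'n) \<Rightarrow> bool" where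
  "bilin M M' N f \<longleftrightarrow> (\<forall>x\<in>acar M. lin_map M' N (f x)) \<and> (\<forall>y\<in>acar M'. lin_map M N (\<lambda>x. f x y))"

definition trilin :: "('k::comm_ring_1, 'a) alg \<Rightarrow> ('k, 'b) alg \<Rightarrow> ('k, 'c) alg \<Rightarrow> ('k, 'n) alg \<Rightarrow>
    ('a \<Rightarrow> 'b \<Rightarrow> 'c \<Rightarrow> 'n) \<Rightarrow> bool" where
  "trilin M M' M'' N f \<longleftrightarrow> (\<forall>x\<in>acar M. bilin M' M'' N (f x)) \<and>
     (\<forall>y\<in>acar M'. \<forall>z\<in>acar M''. lin_map M N (\<lambda>x. f x y z))"

lemma bilinI: "(\<And>x. x \<in> acar M \<Longrightarrow> lin_map M' N (f x)) \<Longrightarrow> (\<And>y. y \<in> acar M' \<Longrightarrow> lin_map M N (\<lambda>x. f x y)) \<Longrightarrow>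
    bilin M M' N f"
  by (simp add: bilin_def)

lemma trilinI: "(\<And>x y. x \<in> acar M \<Longrightarrow> y \<in> acar M' \<Longrightarrow> lin_map M'' N (f x y)) \<Longrightarrow>
    (\<And>x z. x \<in> acar M \<Longrightarrow> z \<in> acar M'' \<Longrightarrow> lin_map M' N (\<lambda>y. f x y z)) \<Longrightarrow>
    (\<And>y z. y \<in> acar M' \<Longrightarrow> z \<in> acar M'' \<Longrightarrow> lin_map M N (\<lambda>x. f x y z)) \<Longrightarrow> trilin M M' M'' N f"
  by (simp add: bilin_def trilin_def)

lemma bilin1: "bilin M M' N f \<Longrightarrow> lin_map L M g \<Longrightarrow> y \<in> acar M' \<Longrightarrow> lin_map L N (\<lambda>x. f (g x) y)"
  and bilin2: "bilin M M' N f \<Longrightarrow> lin_map L M' h \<Longrightarrow> x \<in> acar M \<Longrightarrow> lin_map L N (\<lambda>y. f x (h y))"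
  unfolding bilin_def using lin_comp[of M N "\<lambda>x. f x y" L g] lin_comp[of M' N "f x" L h] by auto

lemma bilin_in: "bilin M M' N f \<Longrightarrow> x \<in> acar M \<Longrightarrow> y \<in> acar M' \<Longrightarrow> f x y \<in> acar N"
  unfolding bilin_def using lin_in by fastforce

lemma lprod_ball_Cons: "(\<forall>xs\<in>lprod (M # Ms). P xs) \<longleftrightarrow> (\<forall>x\<in>acar M. \<forall>xs\<in>lprod Ms. P (x # xs))"
  by (auto elim: lprod_ConsE)

text \<open>The Hopf data read tensor slots as list entries, while the calculation uses curried
  functions; this translates between them. The index is written \<open>Suc 0\<close> because
  \<open>One_nat_def\<close> is unfolded when the axioms are applied.\<close>

lemma mlin_bilin: "mlin [M, M'] N (\<lambda>zs. f (zs ! 0) (zs ! Suc 0)) \<longleftrightarrow> bilin M M' N f"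
  by (auto simp: bilin_def lin_in lprod_ball_Cons)

lemma mlin_trilin: "mlin [M, M', M''] N (\<lambda>zs. f (zs ! 0) (zs ! Suc 0) (zs ! Suc (Suc 0))) \<longleftrightarrow> trilin M M' M'' N f"
  by (auto simp: trilin_def bilin_def lprod_ball_Cons intro: lin_in)

text \<open>Sweedler notation becomes a sum over a chosen representation of a rank two tensor by pure tensors.
  With a choice, nested sums commute and linear maps go through them without any multilinearity condition;
  multilinearity of the summand is needed only when the representation changes.\<close>

definition dec2 :: "('k::comm_ring_1, 'm) alg \<Rightarrow> ('k, 'm) alg \<Rightarrow> ('m list \<Rightarrow> 'k) set \<Rightarrow> ('m \<times> 'm) list" where
  "dec2 M M' u = (SOME L. set L \<subseteq> acar M \<times> acar M' \<and>
      u = psum (tmod [M, M']) L (\<lambda>x y. ptens [M, M'] [x, y]))"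

lemma dec2:
  assumes M: "is_kmod M" "is_kmod M'" and u: "u \<in> acar (tmod [M, M'])"
  shows dec2_in: "set (dec2 M M' u) \<subseteq> acar M \<times> acar M'"
    and dec2_eq: "psum (tmod [M, M']) (dec2 M M' u) (\<lambda>x y. ptens [M, M'] [x, y]) = u"
proof -
  obtain L where L: "set L \<subseteq> lprod [M, M']" "u = lsum (tmod [M, M']) L (ptens [M, M'])"
    using tmod_list[of "[M, M']"] assms by auto
  have zs: "zs ! 0 \<in> acar M \<and> zs ! 1 \<in> acar M' \<and> zs = [zs ! 0, zs ! 1]" if "zs \<in> set L" for zs
  proof -
    have "zs \<in> lprod [M, M']" using that L by auto
    then show ?thesis by (auto elim!: lprod_ConsE)
  qed
  let ?L = "map (\<lambda>zs. (zs ! 0, zs ! 1)) L"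
  have "set ?L \<subseteq> acar M \<times> acar M'" using zs by auto
  moreover have "u = psum (tmod [M, M']) ?L (\<lambda>x y. ptens [M, M'] [x, y])"
    unfolding psum_def lsum_map L(2) by (rule lsum_cong) (use zs in simp)
  ultimately have "set (dec2 M M' u) \<subseteq> acar M \<times> acar M' \<and>
      u = psum (tmod [M, M']) (dec2 M M' u) (\<lambda>x y. ptens [M, M'] [x, y])"
    unfolding dec2_def
    using someI[of "\<lambda>L. set L \<subseteq> acar M \<times> acar M' \<and> u = psum (tmod [M, M']) L (\<lambda>x y. ptens [M, M'] [x, y])" ?L]
    by blast
  then show "set (dec2 M M' u) \<subseteq> acar M \<times> acar M'"
    "psum (tmod [M, M']) (dec2 M M' u) (\<lambda>x y. ptens [M, M'] [x, y]) = u" by auto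
qed

text \<open>The Hopf and comodule axioms are stated with lifts; replacing a lift by a sum over the
  chosen representation turns them into Sweedler identities.\<close>

lemma tlift_dec2:
  assumes M: "is_kmod M" "is_kmod M'" and u: "u \<in> acar (tmod [M, M'])"
    and N: "is_kmod N" and f: "bilin M M' N f"
  shows "tlift [M, M'] N (\<lambda>zs. f (zs ! 0) (zs ! Suc 0)) u = psum N (dec2 M M' u) f"
proof -
  let ?f = "\<lambda>zs. f (zs ! 0) (zs ! Suc 0)"
  have f': "mlin [M, M'] N ?f" using f by (simp only: mlin_bilin)
  have "tlift [M, M'] N ?f u = tlift [M, M'] N ?f (psum (tmod [M, M']) (dec2 M M' u) (\<lambda>x y. ptens [M, M'] [x, y]))"
    by (simp add: dec2_eq[OF M u])
  also have "\<dots> = psum N (dec2 M M' u) (\<lambda>x y. tlift [M, M'] N ?f (ptens [M, M'] [x, y]))"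
    by (rule lin_push2[OF kmod_tmod N tlift_lin[OF N f'] dec2_in[OF M u]]) (use M in \<open>auto intro: ptens_in\<close>)
  also have "\<dots> = psum N (dec2 M M' u) f"
    by (rule psum_cong[OF dec2_in[OF M u]]) (use M in \<open>simp add: tlift_ptens[OF N f']\<close>)
  finally show ?thesis .
qed

text \<open>The choice in \<open>dec2\<close> is made tensor by tensor and need not be additive. The
  sum against a bilinear \<open>f\<close> is still linear, because it equals the lift of
  \<open>f\<close>.\<close>

lemma dec2_lin:
  assumes "is_kmod M" "is_kmod M'" "is_kmod N" "bilin M M' N f"
  shows "lin_map (tmod [M, M']) N (\<lambda>u. psum N (dec2 M M' u) f)"
proof -
  have f': "mlin [M, M'] N (\<lambda>zs. f (zs ! 0) (zs ! Suc 0))" using assms by (simp only: mlin_bilin)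
  have "lin_map (tmod [M, M']) N (tlift [M, M'] N (\<lambda>zs. f (zs ! 0) (zs ! Suc 0)))"
    by (rule tlift_lin) (use assms f' in auto)
  then show ?thesis by (rule lin_eqI[OF kmod_tmod]) (use assms in \<open>simp add: tlift_dec2\<close>)
qed

lemma dec2_ptens:
  assumes "is_kmod M" "is_kmod M'" "is_kmod N" "bilin M M' N f" "x \<in> acar M" "y \<in> acar M'"
  shows "psum N (dec2 M M' (ptens [M, M'] [x, y])) f = f x y"
proof -
  have f': "mlin [M, M'] N (\<lambda>zs. f (zs ! 0) (zs ! Suc 0))" using assms by (simp only: mlin_bilin)
  show ?thesis
    using assms tlift_dec2[of M M' "ptens [M, M'] [x, y]" N f]
    by (simp add: tlift_ptens[OF _ f'] ptens_in)
qed

lemma kalg_mod: "is_kalg B \<Longrightarrow> is_kmod B"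
  and kalg_one: "is_kalg B \<Longrightarrow> aone B \<in> acar B"
  and kalg_mul: "is_kalg B \<Longrightarrow> x \<in> acar B \<Longrightarrow> y \<in> acar B \<Longrightarrow> amul B x y \<in> acar B"
  and kalg_assoc: "is_kalg B \<Longrightarrow> x \<in> acar B \<Longrightarrow> y \<in> acar B \<Longrightarrow> z \<in> acar B \<Longrightarrow>
    amul B (amul B x y) z = amul B x (amul B y z)"
  and kalg_1l: "is_kalg B \<Longrightarrow> x \<in> acar B \<Longrightarrow> amul B (aone B) x = x"
  and kalg_1r: "is_kalg B \<Longrightarrow> x \<in> acar B \<Longrightarrow> amul B x (aone B) = x"
  by (simp_all add: is_kalg_def)

lemma kalg_bilin: "is_kalg B \<Longrightarrow> bilin B B B (amul B)"
  by (simp add: is_kalg_def bilin_def lin_map_def)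

lemma lin_ptens1: "is_kmod M \<Longrightarrow> lin_map M (tmod [M]) (\<lambda>x. ptens [M] [x])"
  using mlin_ptens[of "[M]"] by simp

lemma bilin_ptens: "is_kmod M \<Longrightarrow> is_kmod M' \<Longrightarrow> bilin M M' (tmod [M, M']) (\<lambda>x y. ptens [M, M'] [x, y])"
  using mlin_ptens[of "[M, M']"] by (simp add: bilin_def)

context
  fixes M1 M2 M3 P :: "('k::comm_ring_1, 'm) alg" and N :: "('k, 'n) alg"
    and f :: "'m \<Rightarrow> 'm \<Rightarrow> 'm \<Rightarrow> 'n" and d :: "'m \<Rightarrow> ('m list \<Rightarrow> 'k) set"
  assumes M: "is_kmod M1" "is_kmod M2" "is_kmod M3" "is_kmod P" and N: "is_kmod N"
    and f: "trilin M1 M2 M3 N f"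
begin

abbreviation (input) T3 where "T3 \<equiv> tmod [M1, M2, M3]"

lemma tlift_trilin:
  "lin_map T3 N (tlift [M1, M2, M3] N (\<lambda>zs. f (zs ! 0) (zs ! Suc 0) (zs ! Suc (Suc 0))))"
  "x \<in> acar M1 \<Longrightarrow> y \<in> acar M2 \<Longrightarrow> z \<in> acar M3 \<Longrightarrow>
     tlift [M1, M2, M3] N (\<lambda>zs. f (zs ! 0) (zs ! Suc 0) (zs ! Suc (Suc 0))) (ptens [M1, M2, M3] [x, y, z]) = f x y z"
proof -
  have f': "mlin [M1, M2, M3] N (\<lambda>zs. f (zs ! 0) (zs ! Suc 0) (zs ! Suc (Suc 0)))"
    using f by (simp only: mlin_trilin)
  show "lin_map T3 N (tlift [M1, M2, M3] N (\<lambda>zs. f (zs ! 0) (zs ! Suc 0) (zs ! Suc (Suc 0))))"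
    by (rule tlift_lin[OF N f']) (simp add: M)
  show "x \<in> acar M1 \<Longrightarrow> y \<in> acar M2 \<Longrightarrow> z \<in> acar M3 \<Longrightarrow>
     tlift [M1, M2, M3] N (\<lambda>zs. f (zs ! 0) (zs ! Suc 0) (zs ! Suc (Suc 0))) (ptens [M1, M2, M3] [x, y, z]) = f x y z"
    by (subst tlift_ptens[OF N f']) (simp_all add: M)
qed

text \<open>(d \<otimes> id)(u) evaluated on a trilinear map becomes a nested Sweedler sum.
  Instances are one side of coassociativity for the coproduct and for the coaction, and the twofold
  coaction in the crossed product.\<close>

lemma tcat_split_left:
  assumes d: "lin_map P (tmod [M1, M2]) d" and u: "u \<in> acar (tmod [P, M3])"
  shows "tlift [M1, M2, M3] N (\<lambda>zs. f (zs ! 0) (zs ! Suc 0) (zs ! Suc (Suc 0)))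
      (tlift [P, M3] T3 (\<lambda>zs. tcat [M1, M2] [M3] (d (zs ! 0)) (ptens [M3] [zs ! Suc 0])) u)
    = psum N (dec2 P M3 u) (\<lambda>x y. psum N (dec2 M1 M2 (d x)) (\<lambda>u v. f u v y))"
    (is "?F (tlift _ _ ?k u) = _")
proof -
  have k1: "lin_map (tmod [M1, M2]) T3 (\<lambda>u. tcat [M1, M2] [M3] u v)" if "v \<in> acar (tmod [M3])" for v
    using tcat_lin1[of "[M1, M2]" "[M3]" v] that by (simp add: M)
  have k2: "lin_map (tmod [M3]) T3 (tcat [M1, M2] [M3] u)" if "u \<in> acar (tmod [M1, M2])" for u
    using tcat_lin2[of "[M1, M2]" "[M3]" u] that by (simp add: M)
  have kb: "bilin P M3 T3 (\<lambda>x y. tcat [M1, M2] [M3] (d x) (ptens [M3] [y]))"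
  proof (rule bilinI)
    fix x assume "x \<in> acar P"
    then show "lin_map M3 T3 (\<lambda>y. tcat [M1, M2] [M3] (d x) (ptens [M3] [y]))"
      by (intro lin_comp[OF k2 lin_ptens1]) (auto intro: M lin_in[OF d])
  next
    fix y assume "y \<in> acar M3"
    then show "lin_map P T3 (\<lambda>x. tcat [M1, M2] [M3] (d x) (ptens [M3] [y]))"
      by (intro lin_comp[OF k1 d]) (auto intro: ptens_in)
  qed
  have split: "?F (tcat [M1, M2] [M3] (d x) (ptens [M3] [y])) = psum N (dec2 M1 M2 (d x)) (\<lambda>u v. f u v y)"
    if x: "x \<in> acar P" and y: "y \<in> acar M3" for x y
  proof -
    have dx: "d x \<in> acar (tmod [M1, M2])" using d x by (rule lin_in)
    have y1: "ptens [M3] [y] \<in> acar (tmod [M3])" using y by (simp add: ptens_in)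
    have "?F (tcat [M1, M2] [M3] (d x) (ptens [M3] [y])) =
        ?F (tcat [M1, M2] [M3] (psum (tmod [M1, M2]) (dec2 M1 M2 (d x)) (\<lambda>u v. ptens [M1, M2] [u, v])) (ptens [M3] [y]))"
      by (simp add: dec2_eq[OF M(1,2) dx])
    also have "\<dots> = psum N (dec2 M1 M2 (d x)) (\<lambda>u v. ?F (tcat [M1, M2] [M3] (ptens [M1, M2] [u, v]) (ptens [M3] [y])))"
      by (rule lin_push2[OF kmod_tmod N lin_comp[OF tlift_trilin(1) k1[OF y1]] dec2_in[OF M(1,2) dx]]) (simp add: ptens_in)
    also have "\<dots> = psum N (dec2 M1 M2 (d x)) (\<lambda>u v. f u v y)"
      by (rule psum_cong[OF dec2_in[OF M(1,2) dx]]) (use y in \<open>simp add: tcat_ptens M tlift_trilin(2)\<close>)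
    finally show ?thesis .
  qed
  have "?F (tlift [P, M3] T3 ?k u) = ?F (psum T3 (dec2 P M3 u) (\<lambda>x y. tcat [M1, M2] [M3] (d x) (ptens [M3] [y])))"
    by (subst tlift_dec2[OF M(4,3) u kmod_tmod kb]) simp
  also have "\<dots> = psum N (dec2 P M3 u) (\<lambda>x y. ?F (tcat [M1, M2] [M3] (d x) (ptens [M3] [y])))"
    by (rule lin_push2[OF kmod_tmod N tlift_trilin(1) dec2_in[OF M(4,3) u]]) (rule bilin_in[OF kb])
  also have "\<dots> = psum N (dec2 P M3 u) (\<lambda>x y. psum N (dec2 M1 M2 (d x)) (\<lambda>u v. f u v y))"
    by (rule psum_cong[OF dec2_in[OF M(4,3) u] split])
  finally show ?thesis .
qed

text \<open>The counterpart for (id \<otimes> d)(u), which supplies the other side of the two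
  coassociativity laws.\<close>

lemma tcat_split_right:
  assumes d: "lin_map P (tmod [M2, M3]) d" and u: "u \<in> acar (tmod [M1, P])"
  shows "tlift [M1, M2, M3] N (\<lambda>zs. f (zs ! 0) (zs ! Suc 0) (zs ! Suc (Suc 0)))
      (tlift [M1, P] T3 (\<lambda>zs. tcat [M1] [M2, M3] (ptens [M1] [zs ! 0]) (d (zs ! Suc 0))) u)
    = psum N (dec2 M1 P u) (\<lambda>x y. psum N (dec2 M2 M3 (d y)) (\<lambda>u v. f x u v))"
    (is "?F (tlift _ _ ?k u) = _")
proof -
  have k1: "lin_map (tmod [M1]) T3 (\<lambda>u. tcat [M1] [M2, M3] u v)" if "v \<in> acar (tmod [M2, M3])" for v
    using tcat_lin1[of "[M1]" "[M2, M3]" v] that by (simp add: M)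
  have k2: "lin_map (tmod [M2, M3]) T3 (tcat [M1] [M2, M3] u)" if "u \<in> acar (tmod [M1])" for u
    using tcat_lin2[of "[M1]" "[M2, M3]" u] that by (simp add: M)
  have kb: "bilin M1 P T3 (\<lambda>x y. tcat [M1] [M2, M3] (ptens [M1] [x]) (d y))"
  proof (rule bilinI)
    fix x assume "x \<in> acar M1"
    then show "lin_map P T3 (\<lambda>y. tcat [M1] [M2, M3] (ptens [M1] [x]) (d y))"
      by (intro lin_comp[OF k2 d]) (auto intro: ptens_in)
  next
    fix y assume "y \<in> acar P"
    then show "lin_map M1 T3 (\<lambda>x. tcat [M1] [M2, M3] (ptens [M1] [x]) (d y))"
      by (intro lin_comp[OF k1 lin_ptens1]) (auto intro: M lin_in[OF d])
  qed
  have split: "?F (tcat [M1] [M2, M3] (ptens [M1] [x]) (d y)) = psum N (dec2 M2 M3 (d y)) (\<lambda>u v. f x u v)"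
    if x: "x \<in> acar M1" and y: "y \<in> acar P" for x y
  proof -
    have dy: "d y \<in> acar (tmod [M2, M3])" using d y by (rule lin_in)
    have x1: "ptens [M1] [x] \<in> acar (tmod [M1])" using x by (simp add: ptens_in)
    have "?F (tcat [M1] [M2, M3] (ptens [M1] [x]) (d y)) =
        ?F (tcat [M1] [M2, M3] (ptens [M1] [x]) (psum (tmod [M2, M3]) (dec2 M2 M3 (d y)) (\<lambda>u v. ptens [M2, M3] [u, v])))"
      by (simp add: dec2_eq[OF M(2,3) dy])
    also have "\<dots> = psum N (dec2 M2 M3 (d y)) (\<lambda>u v. ?F (tcat [M1] [M2, M3] (ptens [M1] [x]) (ptens [M2, M3] [u, v])))"
      by (rule lin_push2[OF kmod_tmod N lin_comp[OF tlift_trilin(1) k2[OF x1]] dec2_in[OF M(2,3) dy]]) (simp add: ptens_in)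
    also have "\<dots> = psum N (dec2 M2 M3 (d y)) (\<lambda>u v. f x u v)"
      by (rule psum_cong[OF dec2_in[OF M(2,3) dy]]) (use x in \<open>simp add: tcat_ptens M tlift_trilin(2)\<close>)
    finally show ?thesis .
  qed
  have "?F (tlift [M1, P] T3 ?k u) = ?F (psum T3 (dec2 M1 P u) (\<lambda>x y. tcat [M1] [M2, M3] (ptens [M1] [x]) (d y)))"
    by (subst tlift_dec2[OF M(1,4) u kmod_tmod kb]) simp
  also have "\<dots> = psum N (dec2 M1 P u) (\<lambda>x y. ?F (tcat [M1] [M2, M3] (ptens [M1] [x]) (d y)))"
    by (rule lin_push2[OF kmod_tmod N tlift_trilin(1) dec2_in[OF M(1,4) u]]) (rule bilin_in[OF kb])
  also have "\<dots> = psum N (dec2 M1 P u) (\<lambda>x y. psum N (dec2 M2 M3 (d y)) (\<lambda>u v. f x u v))"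
    by (rule psum_cong[OF dec2_in[OF M(1,4) u] split])
  finally show ?thesis .
qed

end

lemma acar_tensor [simp]: "acar (tensor Ms) = acar (tmod Ms)"
  and aadd_tensor [simp]: "aadd (tensor Ms) = aadd (tmod Ms)"
  and asmul_tensor [simp]: "asmul (tensor Ms) = asmul (tmod Ms)"
  and aone_tensor [simp]: "aone (tensor Ms) = ptens Ms (map aone Ms)"
  by (simp_all add: tensor_def)

lemma lin_map_tensor [simp]: "lin_map M (tensor Ms) f = lin_map M (tmod Ms) f"
  by (simp add: lin_map_def)

text \<open>Multiplication in a tensor product of algebras is a double lift; on representations it
  is the double sum of componentwise products. Multiplicativity of the coproduct and of the coaction
  enters in this form.\<close>

lemma dec2_tensor_mul:
  assumes M: "is_kalg M1" "is_kalg M2" and N: "is_kmod N" and f: "bilin M1 M2 N f"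
    and u: "u \<in> acar (tmod [M1, M2])" and v: "v \<in> acar (tmod [M1, M2])"
  shows "psum N (dec2 M1 M2 (amul (tensor [M1, M2]) u v)) f =
    psum N (dec2 M1 M2 u) (\<lambda>x y. psum N (dec2 M1 M2 v) (\<lambda>x' y'. f (amul M1 x x') (amul M2 y y')))"
proof -
  let ?T = "tmod [M1, M2]"
  note k = kalg_mod[OF M(1)] kalg_mod[OF M(2)]
  note pt = bilin_ptens[OF k]
  note m1 = kalg_bilin[OF M(1)] and m2 = kalg_bilin[OF M(2)]
  let ?g = "\<lambda>x y x' y'. ptens [M1, M2] [amul M1 x x', amul M2 y y']"
  have b1: "bilin M1 M2 ?T (?g x y)" if "x \<in> acar M1" "y \<in> acar M2" for x y
    using that by (intro bilinI bilin1[OF pt] bilin2[OF pt] bilin1[OF m1] bilin2[OF m1] bilin1[OF m2]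
        bilin2[OF m2] lin_id bilin_in[OF m1] bilin_in[OF m2])
  have b2: "bilin M1 M2 ?T (\<lambda>x y. ?g x y x' y')" if "x' \<in> acar M1" "y' \<in> acar M2" for x' y'
    using that by (intro bilinI bilin1[OF pt] bilin2[OF pt] bilin1[OF m1] bilin2[OF m1] bilin1[OF m2]
        bilin2[OF m2] lin_id bilin_in[OF m1] bilin_in[OF m2])
  note din = dec2_in[OF k u] dec2_in[OF k v]
  have b3: "bilin M1 M2 ?T (\<lambda>x y. psum ?T (dec2 M1 M2 v) (?g x y))"
  proof (rule bilinI)
    fix x assume "x \<in> acar M1"
    then show "lin_map M2 ?T (\<lambda>y. psum ?T (dec2 M1 M2 v) (?g x y))"
      by (intro lin_psum[OF kmod_tmod din(2)] bilin2[OF b2] lin_id)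
  next
    fix y assume "y \<in> acar M2"
    then show "lin_map M1 ?T (\<lambda>x. psum ?T (dec2 M1 M2 v) (?g x y))"
      by (intro lin_psum[OF kmod_tmod din(2)] bilin1[OF b2] lin_id)
  qed
  have "amul (tensor [M1, M2]) u v = tlift [M1, M2] ?T
      (\<lambda>xs. tlift [M1, M2] ?T (\<lambda>ys. ?g (xs ! 0) (xs ! Suc 0) (ys ! 0) (ys ! Suc 0)) v) u"
    by (simp add: tensor_def upt_rec)
  also have "\<dots> = tlift [M1, M2] ?T (\<lambda>xs. psum ?T (dec2 M1 M2 v) (?g (xs ! 0) (xs ! Suc 0))) u"
  proof (rule fun_cong[OF tlift_cong])
    fix xs assume "xs \<in> lprod [M1, M2]"
    then have "xs ! 0 \<in> acar M1" "xs ! Suc 0 \<in> acar M2" by (auto elim!: lprod_ConsE)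
    then show "tlift [M1, M2] ?T (\<lambda>ys. ?g (xs ! 0) (xs ! Suc 0) (ys ! 0) (ys ! Suc 0)) v =
        psum ?T (dec2 M1 M2 v) (?g (xs ! 0) (xs ! Suc 0))"
      by (rule tlift_dec2[OF k v kmod_tmod b1])
  qed
  also have "\<dots> = psum ?T (dec2 M1 M2 u) (\<lambda>x y. psum ?T (dec2 M1 M2 v) (?g x y))"
    by (rule tlift_dec2[OF k u kmod_tmod b3])
  finally have eq: "amul (tensor [M1, M2]) u v = psum ?T (dec2 M1 M2 u) (\<lambda>x y. psum ?T (dec2 M1 M2 v) (?g x y))" .
  note lin = dec2_lin[OF k N f]
  have "psum N (dec2 M1 M2 (amul (tensor [M1, M2]) u v)) f =
      psum N (dec2 M1 M2 u) (\<lambda>x y. psum N (dec2 M1 M2 (psum ?T (dec2 M1 M2 v) (?g x y))) f)"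
    unfolding eq by (rule lin_push2[OF kmod_tmod N lin din(1)]) (rule bilin_in[OF b3])
  also have "\<dots> = psum N (dec2 M1 M2 u) (\<lambda>x y. psum N (dec2 M1 M2 v) (\<lambda>x' y'. psum N (dec2 M1 M2 (?g x y x' y')) f))"
    by (intro psum_cong[OF din(1)] lin_push2[OF kmod_tmod N lin din(2)]) (rule bilin_in[OF b1])
  also have "\<dots> = psum N (dec2 M1 M2 u) (\<lambda>x y. psum N (dec2 M1 M2 v) (\<lambda>x' y'. f (amul M1 x x') (amul M2 y y')))"
    by (intro psum_cong[OF din(1)] psum_cong[OF din(2)] dec2_ptens[OF k N f]) (use M in \<open>auto intro: kalg_mul\<close>)
  finally show ?thesis .
qed

section \<open>Sweedler calculus\<close>

locale hopf_comodule_algebra =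
  fixes H A :: "('k::comm_ring_1, 'm) alg"
    and D :: "'m \<Rightarrow> ('m list \<Rightarrow> 'k) set" and e :: "'m \<Rightarrow> 'k" and S :: "'m \<Rightarrow> 'm"
    and r :: "'m \<Rightarrow> ('m list \<Rightarrow> 'k) set"
  assumes hopf: "is_hopf H D e S" and bij: "bij_antipode H S" and comod: "is_comod_alg H D e A r"
begin

lemma algH: "is_kalg H" using hopf by (simp add: is_hopf_def)
lemma algA: "is_kalg A" using comod by (simp add: is_comod_alg_def)
lemmas kH = kalg_mod[OF algH] and kA = kalg_mod[OF algA]
lemmas oneH = kalg_one[OF algH] and oneA = kalg_one[OF algA]
lemmas mulH = kalg_mul[OF algH] and mulA = kalg_mul[OF algA]
lemmas assocH = kalg_assoc[OF algH] and assocA = kalg_assoc[OF algA]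
lemmas unitH = kalg_1l[OF algH] kalg_1r[OF algH] and unitA = kalg_1l[OF algA] kalg_1r[OF algA]
lemmas bmulH = kalg_bilin[OF algH] and bmulA = kalg_bilin[OF algA]

lemma D_lin: "lin_map H (tmod [H, H]) D" using hopf by (simp add: is_hopf_def)
lemma r_lin: "lin_map A (tmod [H, A]) r" using comod by (simp add: is_comod_alg_def)
lemma S_lin: "lin_map H H S" using hopf by (simp add: is_hopf_def)
lemmas D_in = lin_in[OF D_lin] and r_in = lin_in[OF r_lin] and S_in = lin_in[OF S_lin]

lemma e_add: "x \<in> acar H \<Longrightarrow> y \<in> acar H \<Longrightarrow> e (aadd H x y) = e x + e y"
  and e_smul: "x \<in> acar H \<Longrightarrow> e (asmul H c x) = c * e x"
  and e_mul: "x \<in> acar H \<Longrightarrow> y \<in> acar H \<Longrightarrow> e (amul H x y) = e x * e y"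
  and e_one: "e (aone H) = 1"
  using hopf by (simp_all add: is_hopf_def)

definition dl :: "'m \<Rightarrow> ('m \<times> 'm) list" where "dl h = dec2 H H (D h)"
definition rl :: "'m \<Rightarrow> ('m \<times> 'm) list" where "rl a = dec2 H A (r a)"

lemma dl_in: "h \<in> acar H \<Longrightarrow> set (dl h) \<subseteq> acar H \<times> acar H"
  unfolding dl_def by (rule dec2_in[OF kH kH D_in])

lemma rl_in: "a \<in> acar A \<Longrightarrow> set (rl a) \<subseteq> acar H \<times> acar A"
  unfolding rl_def by (rule dec2_in[OF kH kA r_in])

lemma tlift_D: "is_kmod N \<Longrightarrow> bilin H H N f \<Longrightarrow> h \<in> acar H \<Longrightarrow>
    tlift [H, H] N (\<lambda>zs. f (zs ! 0) (zs ! Suc 0)) (D h) = psum N (dl h) f"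
  unfolding dl_def by (rule tlift_dec2[OF kH kH D_in])

lemma tlift_r: "is_kmod N \<Longrightarrow> bilin H A N f \<Longrightarrow> a \<in> acar A \<Longrightarrow>
    tlift [H, A] N (\<lambda>zs. f (zs ! 0) (zs ! Suc 0)) (r a) = psum N (rl a) f"
  unfolding rl_def by (rule tlift_dec2[OF kH kA r_in])

lemma dl_lin: "is_kmod N \<Longrightarrow> lin_map L H g \<Longrightarrow> bilin H H N f \<Longrightarrow> lin_map L N (\<lambda>x. psum N (dl (g x)) f)"
  unfolding dl_def by (rule lin_comp[OF dec2_lin[OF kH kH] lin_comp[OF D_lin]])

lemma rl_lin: "is_kmod N \<Longrightarrow> lin_map L A g \<Longrightarrow> bilin H A N f \<Longrightarrow> lin_map L N (\<lambda>x. psum N (rl (g x)) f)"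
  unfolding rl_def by (rule lin_comp[OF dec2_lin[OF kH kA] lin_comp[OF r_lin]])

lemma dl_const: "is_kmod N \<Longrightarrow> h \<in> acar H \<Longrightarrow> (\<And>u v. u \<in> acar H \<Longrightarrow> v \<in> acar H \<Longrightarrow> lin_map L N (\<lambda>x. f x u v)) \<Longrightarrow>
    lin_map L N (\<lambda>x. psum N (dl h) (f x))"
  by (rule lin_psum[OF _ dl_in])

lemma rl_const: "is_kmod N \<Longrightarrow> a \<in> acar A \<Longrightarrow> (\<And>u v. u \<in> acar H \<Longrightarrow> v \<in> acar A \<Longrightarrow> lin_map L N (\<lambda>x. f x u v)) \<Longrightarrow>
    lin_map L N (\<lambda>x. psum N (rl a) (f x))"
  by (rule lin_psum[OF _ rl_in])

lemma lin_e: "is_kmod N \<Longrightarrow> lin_map L H g \<Longrightarrow> n \<in> acar N \<Longrightarrow> lin_map L N (\<lambda>x. asmul N (e (g x)) n)"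
  by (rule lin_mapI) (simp_all add: lin_add lin_smul lin_in e_add e_smul km_smul km_add_smul km_mul_smul)

text \<open>Linearity of nested Sweedler expressions is proved by backward chaining with these
  rules. \<open>dl_const\<close> and \<open>rl_const\<close> fit when the expanded element does not
  depend on the variable; \<open>dl_lin\<close> and \<open>rl_lin\<close> fit when it does and the
  summand does not.\<close>

lemmas LI = lin_id bilin2[OF bmulH] bilin2[OF bmulA] bilin1[OF bmulH] bilin1[OF bmulA]
  lin_scale lin_e dl_const rl_const dl_lin rl_lin lin_comp[OF S_lin] bilinI trilinI
  mulH mulA oneH oneA S_in kH kA psum_in[OF _ dl_in] psum_in[OF _ rl_in] km_smul

text \<open>The two sides use unrelated chosen representations of one triple tensor, so trilinearity
  of the summand is what makes the values agree.\<close>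

lemma coassoc:
  assumes N: "is_kmod N" and f: "trilin H H H N f" and h: "h \<in> acar H"
  shows "psum N (dl h) (\<lambda>x z. psum N (dl x) (\<lambda>u v. f u v z)) = psum N (dl h) (\<lambda>x y. psum N (dl y) (\<lambda>u v. f x u v))"
proof -
  have "tlift [H, H] (tmod [H, H, H]) (\<lambda>zs. tcat [H, H] [H] (D (zs ! 0)) (ptens [H] [zs ! 1])) (D h)
      = tlift [H, H] (tmod [H, H, H]) (\<lambda>zs. tcat [H] [H, H] (ptens [H] [zs ! 0]) (D (zs ! 1))) (D h)"
    using hopf h unfolding is_hopf_def by blast
  then show ?thesis
    unfolding One_nat_def
    using tcat_split_left[OF kH kH kH kH N f D_lin D_in[OF h]] tcat_split_right[OF kH kH kH kH N f D_lin D_in[OF h]]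
    by (simp add: dl_def)
qed

lemma comod_coassoc:
  assumes N: "is_kmod N" and f: "trilin H H A N f" and a: "a \<in> acar A"
  shows "psum N (rl a) (\<lambda>x b. psum N (dl x) (\<lambda>u v. f u v b)) = psum N (rl a) (\<lambda>x b. psum N (rl b) (\<lambda>u v. f x u v))"
proof -
  have "tlift [H, A] (tmod [H, H, A]) (\<lambda>zs. tcat [H, H] [A] (D (zs ! 0)) (ptens [A] [zs ! 1])) (r a)
      = tlift [H, A] (tmod [H, H, A]) (\<lambda>zs. tcat [H] [H, A] (ptens [H] [zs ! 0]) (r (zs ! 1))) (r a)"
    using comod a unfolding is_comod_alg_def by blast
  then show ?thesis
    unfolding One_nat_def
    using tcat_split_left[OF kH kH kA kH N f D_lin r_in[OF a]] tcat_split_right[OF kH kH kA kA N f r_lin r_in[OF a]]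
    by (simp add: dl_def rl_def)
qed

lemma dl_mul:
  assumes "is_kmod N" "bilin H H N f" "h \<in> acar H" "k \<in> acar H"
  shows "psum N (dl (amul H h k)) f = psum N (dl h) (\<lambda>x y. psum N (dl k) (\<lambda>u v. f (amul H x u) (amul H y v)))"
proof -
  have "D (amul H h k) = amul (tensor [H, H]) (D h) (D k)" using hopf assms unfolding is_hopf_def by blast
  then show ?thesis using assms by (simp add: dl_def dec2_tensor_mul algH D_in)
qed

lemma rl_mul:
  assumes "is_kmod N" "bilin H A N f" "a \<in> acar A" "b \<in> acar A"
  shows "psum N (rl (amul A a b)) f = psum N (rl a) (\<lambda>x y. psum N (rl b) (\<lambda>u v. f (amul H x u) (amul A y v)))"
proof -
  have "r (amul A a b) = amul (tensor [H, A]) (r a) (r b)" using comod assms unfolding is_comod_alg_def by blast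
  then show ?thesis using assms by (simp add: rl_def dec2_tensor_mul algH algA r_in)
qed

lemma dl_one: "is_kmod N \<Longrightarrow> bilin H H N f \<Longrightarrow> psum N (dl (aone H)) f = f (aone H) (aone H)"
proof -
  have "D (aone H) = ptens [H, H] [aone H, aone H]" using hopf by (simp add: is_hopf_def)
  then show "is_kmod N \<Longrightarrow> bilin H H N f \<Longrightarrow> psum N (dl (aone H)) f = f (aone H) (aone H)"
    by (simp add: dl_def dec2_ptens kH oneH)
qed

lemma rl_one: "is_kmod N \<Longrightarrow> bilin H A N f \<Longrightarrow> psum N (rl (aone A)) f = f (aone H) (aone A)"
proof -
  have "r (aone A) = ptens [H, A] [aone H, aone A]" using comod by (simp add: is_comod_alg_def)
  then show "is_kmod N \<Longrightarrow> bilin H A N f \<Longrightarrow> psum N (rl (aone A)) f = f (aone H) (aone A)"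
    by (simp add: rl_def dec2_ptens kH kA oneH oneA)
qed

text \<open>The axiom lives in \<open>H\<close>; pushing it through a linear \<open>f\<close> makes
  it usable inside a longer expression with values in any \<open>N\<close>. The other counit laws
  and the antipode laws are given the same form.\<close>

lemma lin_counit1:
  assumes N: "is_kmod N" and f: "lin_map H N f" and h: "h \<in> acar H"
  shows "psum N (dl h) (\<lambda>x y. asmul N (e x) (f y)) = f h"
proof -
  have b: "bilin H H H (\<lambda>x y. asmul H (e x) y)" by (rule LI | assumption)+
  have "tlift [H, H] H (\<lambda>zs. asmul H (e (zs ! 0)) (zs ! 1)) (D h) = h"
    using hopf h unfolding is_hopf_def by blast
  then have "psum H (dl h) (\<lambda>x y. asmul H (e x) y) = h"
    unfolding One_nat_def using tlift_D[OF kH b h] by simp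
  then have "f h = f (psum H (dl h) (\<lambda>x y. asmul H (e x) y))" by simp
  also have "\<dots> = psum N (dl h) (\<lambda>x y. f (asmul H (e x) y))"
    by (rule lin_push2[OF kH N f dl_in[OF h]]) (rule bilin_in[OF b])
  also have "\<dots> = psum N (dl h) (\<lambda>x y. asmul N (e x) (f y))"
    by (rule psum_cong[OF dl_in[OF h]]) (simp add: lin_smul[OF f])
  finally show ?thesis by simp
qed

lemma lin_counit2:
  assumes N: "is_kmod N" and f: "lin_map H N f" and h: "h \<in> acar H"
  shows "psum N (dl h) (\<lambda>x y. asmul N (e y) (f x)) = f h"
proof -
  have b: "bilin H H H (\<lambda>x y. asmul H (e y) x)" by (rule LI | assumption)+
  have "tlift [H, H] H (\<lambda>zs. asmul H (e (zs ! 1)) (zs ! 0)) (D h) = h"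
    using hopf h unfolding is_hopf_def by blast
  then have "psum H (dl h) (\<lambda>x y. asmul H (e y) x) = h"
    unfolding One_nat_def using tlift_D[OF kH b h] by simp
  then have "f h = f (psum H (dl h) (\<lambda>x y. asmul H (e y) x))" by simp
  also have "\<dots> = psum N (dl h) (\<lambda>x y. f (asmul H (e y) x))"
    by (rule lin_push2[OF kH N f dl_in[OF h]]) (rule bilin_in[OF b])
  also have "\<dots> = psum N (dl h) (\<lambda>x y. asmul N (e y) (f x))"
    by (rule psum_cong[OF dl_in[OF h]]) (simp add: lin_smul[OF f])
  finally show ?thesis by simp
qed

lemma lin_counitA:
  assumes N: "is_kmod N" and f: "lin_map A N f" and a: "a \<in> acar A"
  shows "psum N (rl a) (\<lambda>x b. asmul N (e x) (f b)) = f a"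
proof -
  have b: "bilin H A A (\<lambda>x y. asmul A (e x) y)" by (rule LI | assumption)+
  have "tlift [H, A] A (\<lambda>zs. asmul A (e (zs ! 0)) (zs ! 1)) (r a) = a"
    using comod a unfolding is_comod_alg_def by blast
  then have "psum A (rl a) (\<lambda>x y. asmul A (e x) y) = a"
    unfolding One_nat_def using tlift_r[OF kA b a] by simp
  then have "f a = f (psum A (rl a) (\<lambda>x y. asmul A (e x) y))" by simp
  also have "\<dots> = psum N (rl a) (\<lambda>x y. f (asmul A (e x) y))"
    by (rule lin_push2[OF kA N f rl_in[OF a]]) (rule bilin_in[OF b])
  also have "\<dots> = psum N (rl a) (\<lambda>x y. asmul N (e x) (f y))"
    by (rule psum_cong[OF rl_in[OF a]]) (simp add: lin_smul[OF f])
  finally show ?thesis by simp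
qed

lemma antipode1:
  assumes N: "is_kmod N" and f: "lin_map H N f" and h: "h \<in> acar H"
  shows "psum N (dl h) (\<lambda>x y. f (amul H (S x) y)) = asmul N (e h) (f (aone H))"
proof -
  have b: "bilin H H H (\<lambda>x y. amul H (S x) y)" by (rule LI | assumption)+
  have "tlift [H, H] H (\<lambda>zs. amul H (S (zs ! 0)) (zs ! 1)) (D h) = asmul H (e h) (aone H)"
    using hopf h unfolding is_hopf_def by blast
  then have "psum H (dl h) (\<lambda>x y. amul H (S x) y) = asmul H (e h) (aone H)"
    unfolding One_nat_def using tlift_D[OF kH b h] by simp
  moreover have "f (psum H (dl h) (\<lambda>x y. amul H (S x) y)) = psum N (dl h) (\<lambda>x y. f (amul H (S x) y))"
    by (rule lin_push2[OF kH N f dl_in[OF h]]) (rule bilin_in[OF b])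
  ultimately show ?thesis by (simp add: lin_smul[OF f] oneH)
qed

lemma antipode2:
  assumes N: "is_kmod N" and f: "lin_map H N f" and h: "h \<in> acar H"
  shows "psum N (dl h) (\<lambda>x y. f (amul H x (S y))) = asmul N (e h) (f (aone H))"
proof -
  have b: "bilin H H H (\<lambda>x y. amul H x (S y))" by (rule LI | assumption)+
  have "tlift [H, H] H (\<lambda>zs. amul H (zs ! 0) (S (zs ! 1))) (D h) = asmul H (e h) (aone H)"
    using hopf h unfolding is_hopf_def by blast
  then have "psum H (dl h) (\<lambda>x y. amul H x (S y)) = asmul H (e h) (aone H)"
    unfolding One_nat_def using tlift_D[OF kH b h] by simp
  moreover have "f (psum H (dl h) (\<lambda>x y. amul H x (S y))) = psum N (dl h) (\<lambda>x y. f (amul H x (S y)))"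
    by (rule lin_push2[OF kH N f dl_in[OF h]]) (rule bilin_in[OF b])
  ultimately show ?thesis by (simp add: lin_smul[OF f] oneH)
qed

section \<open>The antipode and the adjoint action\<close>

lemma S_one: "S (aone H) = aone H"
proof -
  have b: "bilin H H H (\<lambda>x y. amul H (S x) y)" by (rule LI | assumption)+
  have "psum H (dl (aone H)) (\<lambda>x y. amul H (S x) y) = asmul H (e (aone H)) (aone H)"
    by (rule antipode1[OF kH lin_id oneH])
  then show ?thesis by (simp add: dl_one[OF kH b] e_one km_1[OF kH] oneH unitH S_in)
qed

text \<open>Both \<open>S(xy)\<close> and \<open>S(y) S(x)\<close> are convolution inverses of the
  multiplication of \<open>H\<close>, hence equal. The uniqueness of inverses is written out: one
  expression with six coproduct legs is contracted from either end.\<close>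

lemma S_mul:
  assumes x: "x \<in> acar H" and y: "y \<in> acar H"
  shows "S (amul H x y) = amul H (S y) (S x)"
proof -
  \<comment> \<open>The product \<open>S(y0) S(x0)\<close>, then \<open>x1 y1\<close>, then
    \<open>S(x2 y2)\<close>: one candidate inverse, the multiplication, the other candidate
    inverse.\<close>
  define K where "K x0 x1 x2 y0 y1 y2 = amul H (S y0) (amul H (S x0) (amul H x1 (amul H y1 (S (amul H x2 y2)))))"
    for x0 x1 x2 y0 y1 y2
  have "psum H (dl x) (\<lambda>x0 x'. psum H (dl x') (\<lambda>x1 x2. psum H (dl y) (\<lambda>y0 y'. psum H (dl y') (\<lambda>y1 y2. K x0 x1 x2 y0 y1 y2))))
    = psum H (dl x) (\<lambda>x0 x'. psum H (dl y) (\<lambda>y0 y'. psum H (dl x') (\<lambda>x1 x2. psum H (dl y') (\<lambda>y1 y2. K x0 x1 x2 y0 y1 y2))))"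
    unfolding K_def by (rule psum_cong[OF dl_in] psum_swap[OF kH dl_in dl_in] LI x y | assumption)+
  also have "\<dots> = psum H (dl x) (\<lambda>x0 x'. psum H (dl y) (\<lambda>y0 y'. asmul H (e y') (asmul H (e x') (amul H (S y0) (S x0)))))"
  proof (intro psum_cong[OF dl_in] x y)
    fix x0 x' y0 y'
    assume i: "x0 \<in> acar H" "x' \<in> acar H" "y0 \<in> acar H" "y' \<in> acar H"
    have b: "bilin H H H (\<lambda>u v. amul H (S y0) (amul H (S x0) (amul H u (S v))))"
      by (rule LI i | assumption)+
    have l: "lin_map H H (\<lambda>z. amul H (S y0) (amul H (S x0) z))" by (rule LI i | assumption)+
    have "psum H (dl x') (\<lambda>x1 x2. psum H (dl y') (\<lambda>y1 y2. K x0 x1 x2 y0 y1 y2)) =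
        psum H (dl x') (\<lambda>x1 x2. psum H (dl y') (\<lambda>y1 y2. amul H (S y0) (amul H (S x0) (amul H (amul H x1 y1) (S (amul H x2 y2))))))"
      by (intro psum_cong[OF dl_in] i) (simp add: K_def assocH mulH S_in)
    \<comment> \<open>The pairs \<open>x1 y1\<close> and \<open>x2 y2\<close> are the legs of the
      coproduct of \<open>x' y'\<close>, so the antipode axiom applies to them at once.\<close>
    also have "\<dots> = psum H (dl (amul H x' y')) (\<lambda>u v. amul H (S y0) (amul H (S x0) (amul H u (S v))))"
      by (rule dl_mul[OF kH b i(2,4), symmetric])
    also have "\<dots> = asmul H (e (amul H x' y')) (amul H (S y0) (amul H (S x0) (aone H)))"
      by (rule antipode2[OF kH l]) (rule LI i)+
    also have "\<dots> = asmul H (e y') (asmul H (e x') (amul H (S y0) (S x0)))"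
      using i by (simp add: e_mul unitH S_in mulH mult.commute km_mul_smul[OF kH, symmetric])
    finally show "psum H (dl x') (\<lambda>x1 x2. psum H (dl y') (\<lambda>y1 y2. K x0 x1 x2 y0 y1 y2)) =
        asmul H (e y') (asmul H (e x') (amul H (S y0) (S x0)))" .
  qed
  also have "\<dots> = psum H (dl x) (\<lambda>x0 x'. asmul H (e x') (amul H (S y) (S x0)))"
    by (intro psum_cong[OF dl_in] lin_counit2[OF kH] x y) (rule LI | assumption)+
  also have "\<dots> = amul H (S y) (S x)"
    by (intro lin_counit2[OF kH] x y) (rule LI y | assumption)+
  finally have 1: "psum H (dl x) (\<lambda>x0 x'. psum H (dl x') (\<lambda>x1 x2. psum H (dl y) (\<lambda>y0 y'. psum H (dl y') (\<lambda>y1 y2. K x0 x1 x2 y0 y1 y2))))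
     = amul H (S y) (S x)" .
  have t1: "trilin H H H H (\<lambda>x0 x1 x2. psum H (dl y) (\<lambda>y0 y'. psum H (dl y') (\<lambda>y1 y2. K x0 x1 x2 y0 y1 y2)))"
    unfolding K_def by (rule LI y | assumption)+
  have t2: "trilin H H H H (\<lambda>y0 y1 y2. K x0 x1 x2 y0 y1 y2)"
    if "x0 \<in> acar H" "x1 \<in> acar H" "x2 \<in> acar H" for x0 x1 x2
    unfolding K_def by (rule LI that | assumption)+
  \<comment> \<open>Regrouping makes \<open>x0\<close>, \<open>x1\<close> the legs of one coproduct
    and \<open>y0\<close>, \<open>y1\<close> those of another, which prepares the contraction from
    the left.\<close>
  have "psum H (dl x) (\<lambda>x0 x'. psum H (dl x') (\<lambda>x1 x2. psum H (dl y) (\<lambda>y0 y'. psum H (dl y') (\<lambda>y1 y2. K x0 x1 x2 y0 y1 y2))))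
    = psum H (dl x) (\<lambda>w x2. psum H (dl w) (\<lambda>x0 x1. psum H (dl y) (\<lambda>y0 y'. psum H (dl y') (\<lambda>y1 y2. K x0 x1 x2 y0 y1 y2))))"
    by (rule coassoc[OF kH t1 x, symmetric])
  also have "\<dots> = psum H (dl x) (\<lambda>w x2. psum H (dl w) (\<lambda>x0 x1. psum H (dl y) (\<lambda>w' y2. psum H (dl w') (\<lambda>y0 y1. K x0 x1 x2 y0 y1 y2))))"
    by (intro psum_cong[OF dl_in] coassoc[OF kH t2 y, symmetric] x)
  also have "\<dots> = psum H (dl x) (\<lambda>w x2. psum H (dl y) (\<lambda>w' y2. psum H (dl w) (\<lambda>x0 x1. psum H (dl w') (\<lambda>y0 y1. K x0 x1 x2 y0 y1 y2))))"
    unfolding K_def by (rule psum_cong[OF dl_in] psum_swap[OF kH dl_in dl_in] LI x y | assumption)+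
  also have "\<dots> = psum H (dl x) (\<lambda>w x2. psum H (dl y) (\<lambda>w' y2. asmul H (e w') (asmul H (e w) (S (amul H x2 y2)))))"
  proof (intro psum_cong[OF dl_in] x y)
    fix w x2 w' y2
    assume i: "w \<in> acar H" "x2 \<in> acar H" "w' \<in> acar H" "y2 \<in> acar H"
    have "psum H (dl w) (\<lambda>x0 x1. psum H (dl w') (\<lambda>y0 y1. K x0 x1 x2 y0 y1 y2)) =
        psum H (dl w') (\<lambda>y0 y1. psum H (dl w) (\<lambda>x0 x1. K x0 x1 x2 y0 y1 y2))"
      unfolding K_def by (rule psum_swap[OF kH dl_in dl_in] LI i | assumption)+
    also have "\<dots> = psum H (dl w') (\<lambda>y0 y1. psum H (dl w) (\<lambda>x0 x1. amul H (S y0) (amul H (amul H (S x0) x1) (amul H y1 (S (amul H x2 y2))))))"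
      by (intro psum_cong[OF dl_in] i) (simp add: K_def assocH mulH S_in i)
    also have "\<dots> = psum H (dl w') (\<lambda>y0 y1. asmul H (e w) (amul H (S y0) (amul H (aone H) (amul H y1 (S (amul H x2 y2))))))"
      by (intro psum_cong[OF dl_in] antipode1[OF kH] i) (rule LI i | assumption)+
    also have "\<dots> = psum H (dl w') (\<lambda>y0 y1. asmul H (e w) (amul H (amul H (S y0) y1) (S (amul H x2 y2))))"
      by (intro psum_cong[OF dl_in] i) (simp add: assocH mulH S_in i unitH)
    also have "\<dots> = asmul H (e w') (asmul H (e w) (amul H (aone H) (S (amul H x2 y2))))"
      by (intro antipode1[OF kH] i) (rule LI i | assumption)+
    also have "\<dots> = asmul H (e w') (asmul H (e w) (S (amul H x2 y2)))"
      by (simp add: unitH i mulH S_in)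
    finally show "psum H (dl w) (\<lambda>x0 x1. psum H (dl w') (\<lambda>y0 y1. K x0 x1 x2 y0 y1 y2)) =
        asmul H (e w') (asmul H (e w) (S (amul H x2 y2)))" .
  qed
  also have "\<dots> = psum H (dl x) (\<lambda>w x2. asmul H (e w) (S (amul H x2 y)))"
    by (intro psum_cong[OF dl_in] lin_counit1[OF kH] x y) (rule LI | assumption)+
  also have "\<dots> = S (amul H x y)"
    by (intro lin_counit1[OF kH] x y) (rule LI y | assumption)+
  finally show ?thesis using 1 by simp
qed

section \<open>The inverse antipode\<close>

abbreviation Si where "Si \<equiv> Sinv H S"

lemma Si_in: "x \<in> acar H \<Longrightarrow> Si x \<in> acar H"
  and S_Si: "x \<in> acar H \<Longrightarrow> S (Si x) = x"
  and Si_S: "x \<in> acar H \<Longrightarrow> Si (S x) = x"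
  using bij unfolding bij_antipode_def Sinv_def
  by (auto intro: the_inv_into_into the_inv_into_f_f simp: bij_betw_def f_the_inv_into_f)

lemma S_inj: "x \<in> acar H \<Longrightarrow> y \<in> acar H \<Longrightarrow> S x = S y \<Longrightarrow> x = y"
  by (metis Si_S)

text \<open>Properties of the inverse are checked after applying \<open>S\<close>, which is
  injective on the carrier.\<close>

lemma Si_lin: "lin_map H H Si"
  by (rule lin_mapI, simp add: Si_in; rule S_inj)
    (simp_all add: Si_in S_Si lin_add[OF S_lin] lin_smul[OF S_lin] km_closed kH)

lemma Si_mul: "x \<in> acar H \<Longrightarrow> y \<in> acar H \<Longrightarrow> Si (amul H x y) = amul H (Si y) (Si x)"
  by (rule S_inj) (simp_all add: Si_in S_Si S_mul mulH)

lemma Si_one: "Si (aone H) = aone H"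
  by (rule S_inj) (simp_all add: Si_in S_Si S_one oneH)

lemmas LI' = LI lin_comp[OF Si_lin] Si_in

text \<open>Applying \<open>Si\<close> to S(x1) x2 reverses the product and leaves S^-1(x2) x1.
  Together with \<open>Si_antipode2\<close> this says that the inverse antipode is an antipode for
  the opposite coproduct.\<close>

lemma Si_antipode1:
  assumes N: "is_kmod N" and f: "lin_map H N f" and h: "h \<in> acar H"
  shows "psum N (dl h) (\<lambda>u v. f (amul H (Si v) u)) = asmul N (e h) (f (aone H))"
proof -
  have "psum N (dl h) (\<lambda>u v. f (amul H (Si v) u)) = psum N (dl h) (\<lambda>u v. f (Si (amul H (S u) v)))"
    by (rule psum_cong[OF dl_in[OF h]]) (simp add: Si_mul S_in Si_S)
  also have "\<dots> = asmul N (e h) (f (Si (aone H)))"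
    by (rule antipode1[OF N lin_comp[OF f Si_lin] h])
  finally show ?thesis by (simp add: Si_one)
qed

lemma Si_antipode2:
  assumes N: "is_kmod N" and f: "lin_map H N f" and h: "h \<in> acar H"
  shows "psum N (dl h) (\<lambda>u v. f (amul H v (Si u))) = asmul N (e h) (f (aone H))"
proof -
  have "psum N (dl h) (\<lambda>u v. f (amul H v (Si u))) = psum N (dl h) (\<lambda>u v. f (Si (amul H u (S v))))"
    by (rule psum_cong[OF dl_in[OF h]]) (simp add: Si_mul S_in Si_S)
  also have "\<dots> = asmul N (e h) (f (Si (aone H)))"
    by (rule antipode2[OF N lin_comp[OF f Si_lin] h])
  finally show ?thesis by (simp add: Si_one)
qed

section \<open>The adjoint action and its inverse\<close>

abbreviation ad where "ad \<equiv> Defs.conj H D S"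

lemma ad_eq:
  assumes "h \<in> acar H" "g \<in> acar H"
  shows "ad h g = psum H (dl h) (\<lambda>u v. amul H (amul H u g) (S v))"
proof -
  have b: "bilin H H H (\<lambda>u v. amul H (amul H u g) (S v))" by (rule LI assms | assumption)+
  show ?thesis unfolding Defs.conj_def One_nat_def by (rule tlift_D[OF kH b assms(1)])
qed

lemma ad_bilin: "bilin H H H ad"
proof (rule bilinI)
  fix h assume h: "h \<in> acar H"
  have "lin_map H H (\<lambda>g. psum H (dl h) (\<lambda>u v. amul H (amul H u g) (S v)))" by (rule LI h | assumption)+
  then show "lin_map H H (ad h)" by (rule lin_eqI[OF kH]) (simp add: ad_eq h)
next
  fix g assume g: "g \<in> acar H"
  have "lin_map H H (\<lambda>h. psum H (dl h) (\<lambda>u v. amul H (amul H u g) (S v)))" by (rule LI g | assumption)+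
  then show "lin_map H H (\<lambda>h. ad h g)" by (rule lin_eqI[OF kH]) (simp add: ad_eq g)
qed

lemmas ad_in = bilin_in[OF ad_bilin]
lemmas AI = LI' bilin1[OF ad_bilin] bilin2[OF ad_bilin] ad_in

lemma ad_one: "g \<in> acar H \<Longrightarrow> ad (aone H) g = g"
proof -
  assume g: "g \<in> acar H"
  have b: "bilin H H H (\<lambda>u v. amul H (amul H u g) (S v))" by (rule LI g | assumption)+
  show ?thesis using g by (simp add: ad_eq oneH dl_one[OF kH b] unitH S_one)
qed

text \<open>Multiplicativity of the coproduct and antimultiplicativity of \<open>S\<close> nest the
  two conjugations; linearity then pulls the inner sum inside the outer product.\<close>

lemma ad_mul:
  assumes h: "h \<in> acar H" and k: "k \<in> acar H" and g: "g \<in> acar H"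
  shows "ad (amul H h k) g = ad h (ad k g)"
proof -
  have b: "bilin H H H (\<lambda>u v. amul H (amul H u g) (S v))" by (rule LI g | assumption)+
  have "ad (amul H h k) g = psum H (dl h) (\<lambda>u v. psum H (dl k) (\<lambda>u' v'. amul H (amul H (amul H u u') g) (S (amul H v v'))))"
    using assms by (simp add: ad_eq mulH dl_mul[OF kH b])
  also have "\<dots> = psum H (dl h) (\<lambda>u v. amul H (amul H u (psum H (dl k) (\<lambda>u' v'. amul H (amul H u' g) (S v')))) (S v))"
  proof (intro psum_cong[OF dl_in] h)
    fix u v assume i: "u \<in> acar H" "v \<in> acar H"
    have l: "lin_map H H (\<lambda>z. amul H (amul H u z) (S v))" by (rule LI i | assumption)+
    have "psum H (dl k) (\<lambda>u' v'. amul H (amul H (amul H u u') g) (S (amul H v v'))) =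
        psum H (dl k) (\<lambda>u' v'. amul H (amul H u (amul H (amul H u' g) (S v'))) (S v))"
      by (intro psum_cong[OF dl_in] k) (simp add: S_mul i g assocH mulH S_in)
    also have "\<dots> = amul H (amul H u (psum H (dl k) (\<lambda>u' v'. amul H (amul H u' g) (S v')))) (S v)"
      by (rule lin_push2[OF kH kH l dl_in[OF k], symmetric]) (rule LI i g | assumption)+
    finally show "psum H (dl k) (\<lambda>u' v'. amul H (amul H (amul H u u') g) (S (amul H v v'))) =
        amul H (amul H u (psum H (dl k) (\<lambda>u' v'. amul H (amul H u' g) (S v')))) (S v)" .
  qed
  also have "\<dots> = ad h (ad k g)" using assms by (simp add: ad_eq ad_in flip: ad_eq)
  finally show ?thesis .
qed

lemma ad_unit: "h \<in> acar H \<Longrightarrow> ad h (aone H) = asmul H (e h) (aone H)"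
proof -
  assume h: "h \<in> acar H"
  have "ad h (aone H) = psum H (dl h) (\<lambda>u v. amul H u (S v))"
    unfolding ad_eq[OF h oneH] by (rule psum_cong[OF dl_in[OF h]]) (simp add: unitH)
  then show ?thesis using antipode2[OF kH lin_id h] by simp
qed

text \<open>\<open>H\<close> is a module algebra under its adjoint action: in h1 g S(h2) h3 g' S(h4)
  the middle factor S(h2) h3 collapses to a counit.\<close>

lemma ad_prod:
  assumes h: "h \<in> acar H" and g: "g \<in> acar H" and g': "g' \<in> acar H"
  shows "ad h (amul H g g') = psum H (dl h) (\<lambda>x y. amul H (ad x g) (ad y g'))"
proof -
  define K where "K x0 x1 y0 y1 = amul H (amul H x0 (amul H g (S x1))) (amul H y0 (amul H g' (S y1)))" for x0 x1 y0 y1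
  have "psum H (dl h) (\<lambda>x y. amul H (ad x g) (ad y g')) =
     psum H (dl h) (\<lambda>x y. psum H (dl x) (\<lambda>x0 x1. psum H (dl y) (\<lambda>y0 y1. K x0 x1 y0 y1)))"
  proof (intro psum_cong[OF dl_in] h)
    fix x y assume i: "x \<in> acar H" "y \<in> acar H"
    have "amul H (ad x g) (ad y g') = psum H (dl x) (\<lambda>x0 x1. amul H (amul H (amul H x0 g) (S x1)) (ad y g'))"
      unfolding ad_eq[OF i(1) g]
      by (rule lin_push2[OF kH kH bilin1[OF bmulH lin_id ad_in[OF i(2) g']] dl_in[OF i(1)]]) (rule LI i g | assumption)+
    also have "\<dots> = psum H (dl x) (\<lambda>x0 x1. psum H (dl y) (\<lambda>y0 y1. amul H (amul H (amul H x0 g) (S x1)) (amul H (amul H y0 g') (S y1))))"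
      unfolding ad_eq[OF i(2) g']
      by (intro psum_cong[OF dl_in] i lin_push2[OF kH kH bilin2[OF bmulH lin_id] dl_in[OF i(2)]]) (rule LI i g g' | assumption)+
    also have "\<dots> = psum H (dl x) (\<lambda>x0 x1. psum H (dl y) (\<lambda>y0 y1. K x0 x1 y0 y1))"
      by (intro psum_cong[OF dl_in] i) (simp add: K_def assocH mulH S_in g g')
    finally show "amul H (ad x g) (ad y g') = psum H (dl x) (\<lambda>x0 x1. psum H (dl y) (\<lambda>y0 y1. K x0 x1 y0 y1))" .
  qed
  \<comment> \<open>Two applications of coassociativity make the middle legs \<open>x1\<close> and
    \<open>y0\<close> the coproduct of a single element \<open>z\<close>.\<close>
  also have "\<dots> = psum H (dl h) (\<lambda>x0 w. psum H (dl w) (\<lambda>x1 y. psum H (dl y) (\<lambda>y0 y1. K x0 x1 y0 y1)))"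
    unfolding K_def by (rule coassoc[OF kH _ h]) (rule LI g g' | assumption)+
  also have "\<dots> = psum H (dl h) (\<lambda>x0 w. psum H (dl w) (\<lambda>z y1. psum H (dl z) (\<lambda>x1 y0. K x0 x1 y0 y1)))"
  proof (rule psum_cong[OF dl_in[OF h]])
    fix x0 w assume i: "x0 \<in> acar H" "w \<in> acar H"
    have t: "trilin H H H H (\<lambda>x1 y0 y1. K x0 x1 y0 y1)" unfolding K_def by (rule LI g g' i | assumption)+
    show "psum H (dl w) (\<lambda>x1 y. psum H (dl y) (\<lambda>y0 y1. K x0 x1 y0 y1)) = psum H (dl w) (\<lambda>z y1. psum H (dl z) (\<lambda>x1 y0. K x0 x1 y0 y1))"
      by (rule coassoc[OF kH t i(2), symmetric])
  qed
  also have "\<dots> = psum H (dl h) (\<lambda>x0 w. psum H (dl w) (\<lambda>z y1. asmul H (e z) (amul H (amul H x0 (amul H g g')) (S y1))))"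
  proof (intro psum_cong[OF dl_in] h)
    fix x0 w z y1 assume i: "x0 \<in> acar H" "w \<in> acar H" "z \<in> acar H" "y1 \<in> acar H"
    have l: "lin_map H H (\<lambda>s. amul H x0 (amul H g (amul H s (amul H g' (S y1)))))" by (rule LI g g' i | assumption)+
    have "psum H (dl z) (\<lambda>x1 y0. K x0 x1 y0 y1) = psum H (dl z) (\<lambda>x1 y0. amul H x0 (amul H g (amul H (amul H (S x1) y0) (amul H g' (S y1)))))"
      by (intro psum_cong[OF dl_in] i) (simp add: K_def assocH mulH S_in g g' i)
    also have "\<dots> = asmul H (e z) (amul H x0 (amul H g (amul H (aone H) (amul H g' (S y1)))))"
      by (rule antipode1[OF kH l i(3)])
    also have "\<dots> = asmul H (e z) (amul H (amul H x0 (amul H g g')) (S y1))"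
      by (simp add: assocH mulH S_in g g' i unitH)
    finally show "psum H (dl z) (\<lambda>x1 y0. K x0 x1 y0 y1) = asmul H (e z) (amul H (amul H x0 (amul H g g')) (S y1))" .
  qed
  also have "\<dots> = psum H (dl h) (\<lambda>x0 w. amul H (amul H x0 (amul H g g')) (S w))"
    by (intro psum_cong[OF dl_in] h lin_counit1[OF kH]) (rule LI g g' | assumption)+
  also have "\<dots> = ad h (amul H g g')" using assms by (simp add: ad_eq mulH)
  finally show ?thesis by simp
qed

text \<open>The form in which the inverse of the action enters the product of the crossed product.\<close>

definition qd :: "'m \<Rightarrow> 'm \<Rightarrow> 'm" where
  "qd x g = psum H (dl x) (\<lambda>u v. amul H (amul H (Si v) g) u)"

lemma qd_bilin: "bilin H H H qd"
  unfolding qd_def by (rule LI' | assumption)+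

lemmas qd_in = bilin_in[OF qd_bilin]

text \<open>In S^-1(x4) x1 g S(x2) x3 the pair S(x2) x3 is contracted first; this leaves S^-1(x2) x1
  g, and the second contraction leaves the counit.\<close>

lemma qd_ad:
  assumes x: "x \<in> acar H" and g: "g \<in> acar H"
  shows "psum H (dl x) (\<lambda>u v. qd v (ad u g)) = asmul H (e x) g"
proof -
  define K where "K u0 u1 v0 v1 = amul H (amul H (Si v1) (amul H (amul H u0 g) (S u1))) v0" for u0 u1 v0 v1
  have "psum H (dl x) (\<lambda>u v. qd v (ad u g)) =
     psum H (dl x) (\<lambda>u v. psum H (dl u) (\<lambda>u0 u1. psum H (dl v) (\<lambda>v0 v1. K u0 u1 v0 v1)))"
  proof (intro psum_cong[OF dl_in] x)
    fix u v assume i: "u \<in> acar H" "v \<in> acar H"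
    have "qd v (ad u g) = psum H (dl u) (\<lambda>u0 u1. qd v (amul H (amul H u0 g) (S u1)))"
      unfolding ad_eq[OF i(1) g]
      by (rule lin_push2[OF kH kH bilin2[OF qd_bilin lin_id i(2)] dl_in[OF i(1)]]) (rule LI g | assumption)+
    also have "\<dots> = psum H (dl u) (\<lambda>u0 u1. psum H (dl v) (\<lambda>v0 v1. K u0 u1 v0 v1))"
      by (simp add: qd_def K_def)
    finally show "qd v (ad u g) = psum H (dl u) (\<lambda>u0 u1. psum H (dl v) (\<lambda>v0 v1. K u0 u1 v0 v1))" .
  qed
  also have "\<dots> = psum H (dl x) (\<lambda>u0 w. psum H (dl w) (\<lambda>u1 v. psum H (dl v) (\<lambda>v0 v1. K u0 u1 v0 v1)))"
    unfolding K_def by (rule coassoc[OF kH _ x]) (rule LI' g | assumption)+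
  also have "\<dots> = psum H (dl x) (\<lambda>u0 w. psum H (dl w) (\<lambda>z v1. psum H (dl z) (\<lambda>u1 v0. K u0 u1 v0 v1)))"
  proof (rule psum_cong[OF dl_in[OF x]])
    fix u0 w assume i: "u0 \<in> acar H" "w \<in> acar H"
    have t: "trilin H H H H (\<lambda>u1 v0 v1. K u0 u1 v0 v1)" unfolding K_def by (rule LI' g i | assumption)+
    show "psum H (dl w) (\<lambda>u1 v. psum H (dl v) (\<lambda>v0 v1. K u0 u1 v0 v1)) = psum H (dl w) (\<lambda>z v1. psum H (dl z) (\<lambda>u1 v0. K u0 u1 v0 v1))"
      by (rule coassoc[OF kH t i(2), symmetric])
  qed
  also have "\<dots> = psum H (dl x) (\<lambda>u0 w. psum H (dl w) (\<lambda>z v1. asmul H (e z) (amul H (amul H (Si v1) u0) g)))"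
  proof (intro psum_cong[OF dl_in] x)
    fix u0 w z v1 assume i: "u0 \<in> acar H" "w \<in> acar H" "z \<in> acar H" "v1 \<in> acar H"
    have l: "lin_map H H (\<lambda>s. amul H (Si v1) (amul H u0 (amul H g s)))" by (rule LI' g i | assumption)+
    have "psum H (dl z) (\<lambda>u1 v0. K u0 u1 v0 v1) = psum H (dl z) (\<lambda>u1 v0. amul H (Si v1) (amul H u0 (amul H g (amul H (S u1) v0))))"
      by (intro psum_cong[OF dl_in] i) (simp add: K_def assocH mulH S_in g i Si_in)
    also have "\<dots> = asmul H (e z) (amul H (Si v1) (amul H u0 (amul H g (aone H))))"
      by (rule antipode1[OF kH l i(3)])
    also have "\<dots> = asmul H (e z) (amul H (amul H (Si v1) u0) g)"
      by (simp add: assocH mulH Si_in g i unitH)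
    finally show "psum H (dl z) (\<lambda>u1 v0. K u0 u1 v0 v1) = asmul H (e z) (amul H (amul H (Si v1) u0) g)" .
  qed
  also have "\<dots> = psum H (dl x) (\<lambda>u0 w. amul H (amul H (Si w) u0) g)"
    by (intro psum_cong[OF dl_in] x lin_counit1[OF kH]) (rule LI' g | assumption)+
  also have "\<dots> = asmul H (e x) (amul H (aone H) g)"
    by (intro Si_antipode1[OF kH] x) (rule LI' g | assumption)+
  finally show ?thesis by (simp add: unitH g)
qed

lemma ad_Si_cancel:
  assumes x: "x \<in> acar H" and g: "g \<in> acar H"
  shows "psum H (dl x) (\<lambda>u v. ad v (ad (Si u) g)) = asmul H (e x) g"
proof -
  have "psum H (dl x) (\<lambda>u v. ad v (ad (Si u) g)) = psum H (dl x) (\<lambda>u v. ad (amul H v (Si u)) g)"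
    by (intro psum_cong[OF dl_in] x) (simp add: ad_mul Si_in g)
  also have "\<dots> = asmul H (e x) (ad (aone H) g)"
    by (intro Si_antipode2[OF kH] x) (rule AI g | assumption)+
  finally show ?thesis by (simp add: ad_one g)
qed

text \<open>Both are the inverse of the action, \<^term>\<open>qd\<close> on one side and \<^term>\<open>\<lambda>x. ad (Si x)\<close> on the other.
  This replaces the anti-comultiplicativity of the antipode.\<close>

lemma qd_eq:
  assumes x: "x \<in> acar H" and g: "g \<in> acar H"
  shows "qd x g = ad (Si x) g"
proof -
  note QI = AI bilin1[OF qd_bilin] bilin2[OF qd_bilin] qd_in
  \<comment> \<open>The triple composite contracts in two ways: the legs \<open>x0\<close>,
    \<open>x1\<close> cancel and leave \<open>qd x\<close>, or the legs \<open>x1\<close>,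
    \<open>x2\<close> cancel and leave the action of S^-1(x).\<close>
  have t: "trilin H H H H (\<lambda>x0 x1 x2. qd x2 (ad x1 (ad (Si x0) g)))" by (rule QI g | assumption)+
  have "psum H (dl x) (\<lambda>w x2. psum H (dl w) (\<lambda>x0 x1. qd x2 (ad x1 (ad (Si x0) g)))) = psum H (dl x) (\<lambda>w x2. asmul H (e w) (qd x2 g))"
  proof (intro psum_cong[OF dl_in] x)
    fix w x2 assume i: "w \<in> acar H" "x2 \<in> acar H"
    have "psum H (dl w) (\<lambda>x0 x1. qd x2 (ad x1 (ad (Si x0) g))) = qd x2 (psum H (dl w) (\<lambda>x0 x1. ad x1 (ad (Si x0) g)))"
      by (rule lin_push2[OF kH kH bilin2[OF qd_bilin lin_id i(2)] dl_in[OF i(1)], symmetric]) (rule AI g | assumption)+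
    also have "\<dots> = asmul H (e w) (qd x2 g)"
      by (simp add: ad_Si_cancel i g lin_smul[OF bilin2[OF qd_bilin lin_id i(2)]])
    finally show "psum H (dl w) (\<lambda>x0 x1. qd x2 (ad x1 (ad (Si x0) g))) = asmul H (e w) (qd x2 g)" .
  qed
  also have "\<dots> = qd x g" by (rule lin_counit1[OF kH bilin1[OF qd_bilin lin_id g] x])
  finally have 1: "psum H (dl x) (\<lambda>w x2. psum H (dl w) (\<lambda>x0 x1. qd x2 (ad x1 (ad (Si x0) g)))) = qd x g" .
  have "psum H (dl x) (\<lambda>x0 w. psum H (dl w) (\<lambda>x1 x2. qd x2 (ad x1 (ad (Si x0) g)))) = psum H (dl x) (\<lambda>x0 w. asmul H (e w) (ad (Si x0) g))"
    by (intro psum_cong[OF dl_in] x qd_ad) (rule AI g | assumption)+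
  also have "\<dots> = ad (Si x) g"
    by (intro lin_counit2[OF kH] x) (rule AI g | assumption)+
  finally show ?thesis using 1 coassoc[OF kH t x] by simp
qed

lemma Si_ad_cancel:
  assumes x: "x \<in> acar H" and g: "g \<in> acar H"
  shows "psum H (dl x) (\<lambda>u v. ad (Si v) (ad u g)) = asmul H (e x) g"
proof -
  have "psum H (dl x) (\<lambda>u v. ad (Si v) (ad u g)) = psum H (dl x) (\<lambda>u v. ad (amul H (Si v) u) g)"
    by (intro psum_cong[OF dl_in] x) (simp add: ad_mul Si_in g)
  also have "\<dots> = asmul H (e x) (ad (aone H) g)"
    by (intro Si_antipode1[OF kH] x) (rule AI g | assumption)+
  finally show ?thesis by (simp add: ad_one g)
qed

text \<open>The legs occur in reverse order: in S^-1(x4) g x3 S^-1(x2) g' x1 the middle factor x3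
  S^-1(x2) collapses. The inverse action thus makes \<open>H\<close> a module algebra for the
  opposite coproduct.\<close>

lemma qd_prod:
  assumes x: "x \<in> acar H" and g: "g \<in> acar H" and g': "g' \<in> acar H"
  shows "qd x (amul H g g') = psum H (dl x) (\<lambda>u v. amul H (qd v g) (qd u g'))"
proof -
  define K where "K u0 u1 v0 v1 = amul H (amul H (Si v1) (amul H g v0)) (amul H (Si u1) (amul H g' u0))" for u0 u1 v0 v1
  have "psum H (dl x) (\<lambda>u v. amul H (qd v g) (qd u g')) =
     psum H (dl x) (\<lambda>u v. psum H (dl u) (\<lambda>u0 u1. psum H (dl v) (\<lambda>v0 v1. K u0 u1 v0 v1)))"
  proof (intro psum_cong[OF dl_in] x)
    fix u v assume i: "u \<in> acar H" "v \<in> acar H"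
    have "amul H (qd v g) (qd u g') = psum H (dl u) (\<lambda>u0 u1. amul H (qd v g) (amul H (amul H (Si u1) g') u0))"
      unfolding qd_def[of u]
      by (rule lin_push2[OF kH kH bilin2[OF bmulH lin_id qd_in[OF i(2) g]] dl_in[OF i(1)]]) (rule LI' i g' | assumption)+
    also have "\<dots> = psum H (dl u) (\<lambda>u0 u1. psum H (dl v) (\<lambda>v0 v1. amul H (amul H (amul H (Si v1) g) v0) (amul H (amul H (Si u1) g') u0)))"
      unfolding qd_def
      by (intro psum_cong[OF dl_in] i lin_push2[OF kH kH bilin1[OF bmulH lin_id] dl_in[OF i(2)]]) (rule LI' i g g' | assumption)+
    also have "\<dots> = psum H (dl u) (\<lambda>u0 u1. psum H (dl v) (\<lambda>v0 v1. K u0 u1 v0 v1))"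
      by (intro psum_cong[OF dl_in] i) (simp add: K_def assocH mulH Si_in g g')
    finally show "amul H (qd v g) (qd u g') = psum H (dl u) (\<lambda>u0 u1. psum H (dl v) (\<lambda>v0 v1. K u0 u1 v0 v1))" .
  qed
  also have "\<dots> = psum H (dl x) (\<lambda>u0 w. psum H (dl w) (\<lambda>u1 v. psum H (dl v) (\<lambda>v0 v1. K u0 u1 v0 v1)))"
    unfolding K_def by (rule coassoc[OF kH _ x]) (rule LI' g g' | assumption)+
  also have "\<dots> = psum H (dl x) (\<lambda>u0 w. psum H (dl w) (\<lambda>z v1. psum H (dl z) (\<lambda>u1 v0. K u0 u1 v0 v1)))"
  proof (rule psum_cong[OF dl_in[OF x]])
    fix u0 w assume i: "u0 \<in> acar H" "w \<in> acar H"
    have t: "trilin H H H H (\<lambda>u1 v0 v1. K u0 u1 v0 v1)" unfolding K_def by (rule LI' g g' i | assumption)+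
    show "psum H (dl w) (\<lambda>u1 v. psum H (dl v) (\<lambda>v0 v1. K u0 u1 v0 v1)) = psum H (dl w) (\<lambda>z v1. psum H (dl z) (\<lambda>u1 v0. K u0 u1 v0 v1))"
      by (rule coassoc[OF kH t i(2), symmetric])
  qed
  also have "\<dots> = psum H (dl x) (\<lambda>u0 w. psum H (dl w) (\<lambda>z v1. asmul H (e z) (amul H (amul H (Si v1) (amul H g g')) u0)))"
  proof (intro psum_cong[OF dl_in] x)
    fix u0 w z v1 assume i: "u0 \<in> acar H" "w \<in> acar H" "z \<in> acar H" "v1 \<in> acar H"
    have l: "lin_map H H (\<lambda>s. amul H (Si v1) (amul H g (amul H s (amul H g' u0))))" by (rule LI' g g' i | assumption)+
    have "psum H (dl z) (\<lambda>u1 v0. K u0 u1 v0 v1) = psum H (dl z) (\<lambda>u1 v0. amul H (Si v1) (amul H g (amul H (amul H v0 (Si u1)) (amul H g' u0))))"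
      by (intro psum_cong[OF dl_in] i) (simp add: K_def assocH mulH g g' i Si_in)
    also have "\<dots> = asmul H (e z) (amul H (Si v1) (amul H g (amul H (aone H) (amul H g' u0))))"
      by (rule Si_antipode2[OF kH l i(3)])
    also have "\<dots> = asmul H (e z) (amul H (amul H (Si v1) (amul H g g')) u0)"
      by (simp add: assocH mulH Si_in g g' i unitH)
    finally show "psum H (dl z) (\<lambda>u1 v0. K u0 u1 v0 v1) = asmul H (e z) (amul H (amul H (Si v1) (amul H g g')) u0)" .
  qed
  also have "\<dots> = psum H (dl x) (\<lambda>u0 w. amul H (amul H (Si w) (amul H g g')) u0)"
    by (intro psum_cong[OF dl_in] x lin_counit1[OF kH]) (rule LI' g g' | assumption)+
  finally show ?thesis by (simp add: qd_def)
qed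

text \<open>The law is carried over from \<open>qd\<close>; a direct computation with
  \<open>ad (Si x)\<close> would require the coproduct of S^-1(x).\<close>

lemma Si_ad_prod:
  assumes x: "x \<in> acar H" and g: "g \<in> acar H" and g': "g' \<in> acar H"
  shows "ad (Si x) (amul H g g') = psum H (dl x) (\<lambda>u v. amul H (ad (Si v) g) (ad (Si u) g'))"
proof -
  have "psum H (dl x) (\<lambda>u v. amul H (qd v g) (qd u g')) = psum H (dl x) (\<lambda>u v. amul H (ad (Si v) g) (ad (Si u) g'))"
    by (intro psum_cong[OF dl_in] x) (simp add: qd_eq g g')
  then show ?thesis using qd_prod[OF assms] by (simp add: qd_eq x g g' mulH)
qed

lemma Si_ad_unit: "x \<in> acar H \<Longrightarrow> ad (Si x) (aone H) = asmul H (e x) (aone H)"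
proof -
  assume x: "x \<in> acar H"
  have "ad (Si x) (aone H) = psum H (dl x) (\<lambda>u v. amul H (Si v) u)"
    unfolding qd_eq[OF x oneH, symmetric] qd_def
    by (rule psum_cong[OF dl_in[OF x]]) (simp add: unitH Si_in)
  then show ?thesis using Si_antipode1[OF kH lin_id x] by simp
qed

end

section \<open>Moving an element through a list\<close>

text \<open>A map \<^term>\<open>m\<close> sends a pair \<open>(c, x)\<close> to a formal sum of pairs \<open>(x', c')\<close>; \<open>mv\<close> moves \<open>c\<close> to the
  right through a list, \<open>rmv\<close> to the left. The target module \<^term>\<open>N\<close> is a parameter because a hypothesis
  cannot quantify over types.\<close>

definition mover :: "('k::comm_ring_1, 'n) alg \<Rightarrow> ('k, 'c) alg \<Rightarrow> ('k, 'x) alg \<Rightarrow> ('c \<Rightarrow> 'x \<Rightarrow> ('x \<times> 'c) list) \<Rightarrow> bool" where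
  "mover N C X m \<longleftrightarrow> is_kmod N \<and> (\<forall>c\<in>acar C. \<forall>x\<in>acar X. set (m c x) \<subseteq> acar X \<times> acar C) \<and>
     (\<forall>f. bilin X C N f \<longrightarrow> bilin C X N (\<lambda>c x. psum N (m c x) f))"

primrec mv :: "('c \<Rightarrow> 'x \<Rightarrow> ('x \<times> 'c) list) \<Rightarrow> 'c \<Rightarrow> 'x list \<Rightarrow> ('x list \<times> 'c) list" where
  "mv m c [] = [([], c)]"
| "mv m c (x # xs) = pbind (m c x) (\<lambda>x' c'. pbind (mv m c' xs) (\<lambda>xs' c''. [(x' # xs', c'')]))"

primrec rmv :: "('x \<Rightarrow> 'c \<Rightarrow> ('c \<times> 'x) list) \<Rightarrow> 'x list \<Rightarrow> 'c \<Rightarrow> ('c \<times> 'x list) list" where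
  "rmv m [] c = [(c, [])]"
| "rmv m (x # xs) c = pbind (rmv m xs c) (\<lambda>c' xs'. pbind (m x c') (\<lambda>c'' x'. [(c'', x' # xs')]))"

abbreviation pw :: "nat \<Rightarrow> ('k, 'x) alg \<Rightarrow> 'x list set" where
  "pw n X \<equiv> lprod (replicate n X)"

lemma pw_Suc: "xs \<in> lprod (X # Xs) \<longleftrightarrow> (\<exists>y ys. xs = y # ys \<and> y \<in> acar X \<and> ys \<in> lprod Xs)"
  by (cases xs) (auto dest: lprod_length)

lemma pw_snoc: "xs \<in> pw n X \<Longrightarrow> x \<in> acar X \<Longrightarrow> xs @ [x] \<in> lprod (X # replicate n X)"
  using lprod_replicate[of "xs @ [x]" "Suc n" X] by (simp add: lprod_replicate)

text \<open>Multilinear in the \<open>n\<close> letters of a word and linear in the letter that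
  travels through it, a condition that is stable under motion in both directions.\<close>

definition mlc :: "nat \<Rightarrow> ('k::comm_ring_1, 'x) alg \<Rightarrow> ('k, 'c) alg \<Rightarrow> ('k, 'n) alg \<Rightarrow> ('x list \<Rightarrow> 'c \<Rightarrow> 'n) \<Rightarrow> bool" where
  "mlc n X C N f \<longleftrightarrow> (\<forall>c\<in>acar C. mlin (replicate n X) N (\<lambda>xs. f xs c)) \<and> (\<forall>xs\<in>pw n X. lin_map C N (f xs))"

lemma mlcI: "(\<And>c. c \<in> acar C \<Longrightarrow> mlin (replicate n X) N (\<lambda>xs. f xs c)) \<Longrightarrow> (\<And>xs. xs \<in> pw n X \<Longrightarrow> lin_map C N (f xs)) \<Longrightarrow>
    mlc n X C N f"
  by (simp add: mlc_def)

lemma mlc_in: "mlc n X C N f \<Longrightarrow> xs \<in> pw n X \<Longrightarrow> c \<in> acar C \<Longrightarrow> f xs c \<in> acar N"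
  by (auto simp: mlc_def intro: lin_in)

lemma mlc_Suc: "mlc (Suc n) X C N f \<longleftrightarrow>
    (\<forall>x\<in>acar X. mlc n X C N (\<lambda>xs. f (x # xs))) \<and> (\<forall>xs\<in>pw n X. bilin X C N (\<lambda>x. f (x # xs)))"
  unfolding mlc_def bilin_def by (auto simp: pw_Suc)

lemma mlc_0: "mlc 0 X C N f \<longleftrightarrow> lin_map C N (f [])"
  unfolding mlc_def by (auto intro: lin_in)

lemma mover_in: "mover N C X m \<Longrightarrow> c \<in> acar C \<Longrightarrow> x \<in> acar X \<Longrightarrow> set (m c x) \<subseteq> acar X \<times> acar C"
  by (simp add: mover_def)

lemma mover_kmod: "mover N C X m \<Longrightarrow> is_kmod N"
  by (simp add: mover_def)

lemma mover_lin: "mover N C X m \<Longrightarrow> bilin X C N f \<Longrightarrow> bilin C X N (\<lambda>c x. psum N (m c x) f)"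
  by (simp add: mover_def)

lemma mv_in: "mover N C X m \<Longrightarrow> c \<in> acar C \<Longrightarrow> xs \<in> pw n X \<Longrightarrow> set (mv m c xs) \<subseteq> pw n X \<times> acar C"
proof (induction xs arbitrary: n c)
  case (Cons x xs)
  then obtain n' where n: "n = Suc n'" by (cases n) (auto dest: lprod_length)
  have "x \<in> acar X" "xs \<in> pw n' X" using Cons.prems n by auto
  then show ?case
    unfolding mv.simps n using Cons.prems(1,2)
    by (intro pbind_in[OF mover_in] pbind_in[OF Cons.IH]) auto
qed (auto dest: lprod_length)

lemma rmv_in: "mover N X C m \<Longrightarrow> c \<in> acar C \<Longrightarrow> xs \<in> pw n X \<Longrightarrow> set (rmv m xs c) \<subseteq> acar C \<times> pw n X"
proof (induction xs arbitrary: n)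
  case (Cons x xs)
  then obtain n' where n: "n = Suc n'" by (cases n) (auto dest: lprod_length)
  have "x \<in> acar X" "xs \<in> pw n' X" using Cons.prems n by auto
  then show ?case
    unfolding rmv.simps n using Cons.prems(1,2)
    by (intro pbind_in[OF Cons.IH] pbind_in[OF mover_in]) auto
qed (auto dest: lprod_length)

text \<open>The recursion of \<open>mv\<close> after evaluation, with the singleton sums removed.
  Computations with longer words use this form in place of the defining equation.\<close>

lemma psum_mv_Cons:
  assumes m: "mover N C X m" and c: "c \<in> acar C" and x: "x \<in> acar X" and xs: "xs \<in> pw n X"
    and f: "\<And>xs c. xs \<in> pw (Suc n) X \<Longrightarrow> c \<in> acar C \<Longrightarrow> f xs c \<in> acar N"
  shows "psum N (mv m c (x # xs)) f = psum N (m c x) (\<lambda>x' c'. psum N (mv m c' xs) (\<lambda>xs' c''. f (x' # xs') c''))"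
proof -
  note N = mover_kmod[OF m]
  have "psum N (mv m c (x # xs)) f = psum N (m c x) (\<lambda>x' c'. psum N (pbind (mv m c' xs) (\<lambda>xs' c''. [(x' # xs', c'')])) f)"
    unfolding mv.simps
    by (rule psum_bind[OF N mover_in[OF m c x], where U = "pw (Suc n) X" and V = "acar C"], rule pbind_in[OF mv_in[OF m _ xs]])
      (auto intro: f)
  also have "\<dots> = psum N (m c x) (\<lambda>x' c'. psum N (mv m c' xs) (\<lambda>xs' c''. psum N [(x' # xs', c'')] f))"
    by (intro psum_cong[OF mover_in[OF m c x]] psum_bind[OF N mv_in[OF m _ xs], where U = "pw (Suc n) X" and V = "acar C"])
      (auto intro: f)
  also have "\<dots> = psum N (m c x) (\<lambda>x' c'. psum N (mv m c' xs) (\<lambda>xs' c''. f (x' # xs') c''))"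
    by (intro psum_cong[OF mover_in[OF m c x]] psum_cong[OF mv_in[OF m _ xs]] psum_single[OF N]) (auto intro: f)
  finally show ?thesis .
qed

lemma psum_rmv_Cons:
  assumes m: "mover N X C m" and c: "c \<in> acar C" and x: "x \<in> acar X" and xs: "xs \<in> pw n X"
    and f: "\<And>xs c. xs \<in> pw (Suc n) X \<Longrightarrow> c \<in> acar C \<Longrightarrow> f c xs \<in> acar N"
  shows "psum N (rmv m (x # xs) c) f = psum N (rmv m xs c) (\<lambda>c' xs'. psum N (m x c') (\<lambda>c'' x'. f c'' (x' # xs')))"
proof -
  note N = mover_kmod[OF m]
  have "psum N (rmv m (x # xs) c) f = psum N (rmv m xs c) (\<lambda>c' xs'. psum N (pbind (m x c') (\<lambda>c'' x'. [(c'', x' # xs')])) f)"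
    unfolding rmv.simps
    by (rule psum_bind[OF N rmv_in[OF m c xs], where V = "pw (Suc n) X" and U = "acar C"], rule pbind_in[OF mover_in[OF m x]])
      (auto intro: f)
  also have "\<dots> = psum N (rmv m xs c) (\<lambda>c' xs'. psum N (m x c') (\<lambda>c'' x'. psum N [(c'', x' # xs')] f))"
    by (intro psum_cong[OF rmv_in[OF m c xs]] psum_bind[OF N mover_in[OF m x], where V = "pw (Suc n) X" and U = "acar C"])
      (auto intro: f)
  also have "\<dots> = psum N (rmv m xs c) (\<lambda>c' xs'. psum N (m x c') (\<lambda>c'' x'. f c'' (x' # xs')))"
    by (intro psum_cong[OF rmv_in[OF m c xs]] psum_cong[OF mover_in[OF m x]] psum_single[OF N]) (auto intro: f)
  finally show ?thesis .
qed

lemma mlc_Suc1: "mlc (Suc n) X C N f \<Longrightarrow> x \<in> acar X \<Longrightarrow> mlc n X C N (\<lambda>xs. f (x # xs))"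
  and mlc_Suc2: "mlc (Suc n) X C N f \<Longrightarrow> xs \<in> pw n X \<Longrightarrow> bilin X C N (\<lambda>x. f (x # xs))"
  by (simp_all add: mlc_Suc)

lemma mlc_cong:
  assumes "is_kmod X" "is_kmod C" and eq: "\<And>xs c. xs \<in> pw n X \<Longrightarrow> c \<in> acar C \<Longrightarrow> f xs c = g xs c" and g: "mlc n X C N g"
  shows "mlc n X C N f"
proof (rule mlcI)
  fix c assume c: "c \<in> acar C"
  have "mlin (replicate n X) N (\<lambda>xs. f xs c) \<longleftrightarrow> mlin (replicate n X) N (\<lambda>xs. g xs c)"
    by (rule mlin_cong) (use assms c in \<open>auto simp: kmods_replicate\<close>)
  then show "mlin (replicate n X) N (\<lambda>xs. f xs c)" using g c by (simp add: mlc_def)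
next
  fix xs assume xs: "xs \<in> pw n X"
  have "lin_map C N (g xs)" using g xs by (simp add: mlc_def)
  then show "lin_map C N (f xs)" by (rule lin_eqI[OF assms(2)]) (rule eq[OF xs])
qed

text \<open>A mover sends bilinear test maps to bilinear test maps, and the induction hypothesis
  makes the rest of the journey such a test map.\<close>

lemma mv_mlc:
  assumes m: "mover N C X m" and k: "is_kmod C" "is_kmod X"
  shows "mlc n X C N f \<Longrightarrow> mlc n X C N (\<lambda>xs c. psum N (mv m c xs) f)"
proof (induction n arbitrary: f)
  case 0
  have "lin_map C N (f [])" using 0 by (simp add: mlc_0)
  then show ?case unfolding mlc_0
    by (rule lin_eqI[OF k(1)]) (use lin_in[OF \<open>lin_map C N (f [])\<close>] in \<open>simp add: psum_single mover_kmod[OF m]\<close>)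
next
  case (Suc n)
  note N = mover_kmod[OF m]
  \<comment> \<open>\<open>?g\<close> is what remains after the first crossing; \<open>?h\<close>
    states the recursion with \<open>hd\<close> and \<open>tl\<close>, so that it is a function of
    the whole word.\<close>
  let ?g = "\<lambda>x' xs c'. psum N (mv m c' xs) (\<lambda>xs' c''. f (x' # xs') c'')"
  let ?h = "\<lambda>xs c. psum N (m c (hd xs)) (\<lambda>x' c'. ?g x' (tl xs) c')"
  have g1: "mlc n X C N (?g x')" if "x' \<in> acar X" for x'
    by (rule Suc.IH[OF mlc_Suc1[OF Suc.prems that]])
  have g2: "bilin X C N (\<lambda>x' c'. ?g x' xs c')" if xs: "xs \<in> pw n X" for xs
  proof (rule bilinI)
    fix x assume "x \<in> acar X" then show "lin_map C N (?g x xs)" using g1[of x] xs by (simp add: mlc_def)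
  next
    fix c assume c: "c \<in> acar C"
    show "lin_map X N (\<lambda>x. ?g x xs c)"
      by (rule lin_psum[OF N mv_in[OF m c xs]]) (rule bilin1[OF mlc_Suc2[OF Suc.prems] lin_id])
  qed
  have "mlc (Suc n) X C N ?h"
    unfolding mlc_Suc list.sel
  proof (intro conjI ballI)
    fix x assume x: "x \<in> acar X"
    show "mlc n X C N (\<lambda>xs c. psum N (m c x) (\<lambda>x' c'. ?g x' xs c'))"
    proof (rule mlcI)
      fix c assume c: "c \<in> acar C"
      show "mlin (replicate n X) N (\<lambda>xs. psum N (m c x) (\<lambda>x' c'. ?g x' xs c'))"
        by (rule mlin_psum[OF N mover_in[OF m c x]]) (use g1 in \<open>auto simp: mlc_def\<close>)
    next
      fix xs assume xs: "xs \<in> pw n X"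
      show "lin_map C N (\<lambda>c. psum N (m c x) (\<lambda>x' c'. ?g x' xs c'))"
        by (rule bilin1[OF mover_lin[OF m g2[OF xs]] lin_id x])
    qed
  next
    fix xs assume xs: "xs \<in> pw n X"
    have "bilin C X N (\<lambda>c x. psum N (m c x) (\<lambda>x' c'. ?g x' xs c'))"
      by (rule mover_lin[OF m g2[OF xs]])
    then show "bilin X C N (\<lambda>x c. psum N (m c x) (\<lambda>x' c'. ?g x' xs c'))"
      by (simp add: bilin_def)
  qed
  then show ?case
  proof (rule mlc_cong[OF k(2,1), rotated])
    fix xs c assume "xs \<in> pw (Suc n) X" and c: "c \<in> acar C"
    then obtain y ys where xs: "xs = y # ys" "y \<in> acar X" "ys \<in> pw n X" by (auto simp: pw_Suc)
    show "psum N (mv m c xs) f = ?h xs c"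
      unfolding xs(1) list.sel by (rule psum_mv_Cons[OF m c xs(2,3)]) (rule mlc_in[OF Suc.prems])
  qed
qed

lemma rmv_mlc:
  assumes m: "mover N X C m" and k: "is_kmod C" "is_kmod X"
  shows "mlc n X C N (\<lambda>xs c. f c xs) \<Longrightarrow> mlc n X C N (\<lambda>xs c. psum N (rmv m xs c) f)"
proof (induction n arbitrary: f)
  case 0
  have l: "lin_map C N (\<lambda>c. f c [])" using 0 by (simp add: mlc_0)
  then show ?case unfolding mlc_0
    by (rule lin_eqI[OF k(1)]) (use lin_in[OF l] in \<open>simp add: psum_single mover_kmod[OF m]\<close>)
next
  case (Suc n)
  note N = mover_kmod[OF m]
  let ?g = "\<lambda>x c' xs'. psum N (m x c') (\<lambda>c'' x'. f c'' (x' # xs'))"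
  let ?h = "\<lambda>xs c. psum N (rmv m (tl xs) c) (?g (hd xs))"
  have fb: "bilin C X N (\<lambda>c x. f c (x # xs))" if "xs \<in> pw n X" for xs
    using mlc_Suc2[OF Suc.prems that] by (simp add: bilin_def)
  have g1: "mlc n X C N (\<lambda>xs c. ?g x c xs)" if x: "x \<in> acar X" for x
  proof (rule mlcI)
    fix c assume c: "c \<in> acar C"
    show "mlin (replicate n X) N (\<lambda>xs. ?g x c xs)"
      by (rule mlin_psum[OF N mover_in[OF m x c]]) (use mlc_Suc1[OF Suc.prems] in \<open>auto simp: mlc_def\<close>)
  next
    fix xs assume xs: "xs \<in> pw n X"
    show "lin_map C N (\<lambda>c. ?g x c xs)" by (rule bilin2[OF mover_lin[OF m fb[OF xs]] lin_id x])
  qed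
  have "mlc (Suc n) X C N ?h"
    unfolding mlc_Suc list.sel
  proof (intro conjI ballI)
    fix x assume x: "x \<in> acar X"
    show "mlc n X C N (\<lambda>xs c. psum N (rmv m xs c) (?g x))" by (rule Suc.IH[OF g1[OF x]])
  next
    fix xs assume xs: "xs \<in> pw n X"
    show "bilin X C N (\<lambda>x c. psum N (rmv m xs c) (?g x))"
    proof (rule bilinI)
      fix x assume "x \<in> acar X"
      then show "lin_map C N (\<lambda>c. psum N (rmv m xs c) (?g x))"
        using Suc.IH[OF g1] xs by (simp add: mlc_def)
    next
      fix c assume c: "c \<in> acar C"
      show "lin_map X N (\<lambda>x. psum N (rmv m xs c) (?g x))"
        by (rule lin_psum[OF N rmv_in[OF m c xs]]) (rule bilin1[OF mover_lin[OF m fb] lin_id])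
    qed
  qed
  then show ?case
  proof (rule mlc_cong[OF k(2,1), rotated])
    fix xs c assume "xs \<in> pw (Suc n) X" and c: "c \<in> acar C"
    then obtain y ys where xs: "xs = y # ys" "y \<in> acar X" "ys \<in> pw n X" by (auto simp: pw_Suc)
    show "psum N (rmv m xs c) f = ?h xs c"
      unfolding xs(1) list.sel by (rule psum_rmv_Cons[OF m c xs(2,3)]) (rule mlc_in[OF Suc.prems])
  qed
qed

text \<open>The definition peels off the first letter. When a word is extended at its right end, the
  letter that is met last has to be split off instead.\<close>

lemma mv_snoc:
  assumes m: "mover N C X m" and x: "x \<in> acar X"
  shows "c \<in> acar C \<Longrightarrow> xs \<in> pw n X \<Longrightarrow> (\<And>xs c. xs \<in> pw (Suc n) X \<Longrightarrow> c \<in> acar C \<Longrightarrow> f xs c \<in> acar N) \<Longrightarrow>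
    psum N (mv m c (xs @ [x])) f = psum N (mv m c xs) (\<lambda>xs' c'. psum N (m c' x) (\<lambda>x' c''. f (xs' @ [x']) c''))"
proof (induction xs arbitrary: n c f)
  case Nil
  note N = mover_kmod[OF m]
  have n: "n = 0" using Nil by (auto dest: lprod_length)
  have fi: "f [x'] c' \<in> acar N" if "x' \<in> acar X" "c' \<in> acar C" for x' c'
    using Nil.prems(3)[of "[x']" c'] that by (simp add: n)
  have "psum N (mv m c [x]) f = psum N (m c x) (\<lambda>x' c'. psum N (mv m c' []) (\<lambda>xs' c''. f (x' # xs') c''))"
    by (rule psum_mv_Cons[OF m Nil(1) x Nil(2) Nil(3)])
  also have "\<dots> = psum N (m c x) (\<lambda>x' c'. f [x'] c')"
    by (rule psum_cong[OF mover_in[OF m Nil(1) x]]) (simp add: psum_single[OF N] fi)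
  also have "\<dots> = psum N (mv m c []) (\<lambda>xs' c'. psum N (m c' x) (\<lambda>x' c''. f (xs' @ [x']) c''))"
    by (simp add: psum_single[OF N] psum_in[OF N mover_in[OF m Nil(1) x]] fi)
  finally show ?case by simp
next
  case (Cons y ys)
  note N = mover_kmod[OF m]
  obtain n' where n: "n = Suc n'" using Cons.prems by (cases n) (auto dest: lprod_length)
  have y: "y \<in> acar X" and ys: "ys \<in> pw n' X" using Cons.prems n by auto
  have ysx: "ys @ [x] \<in> pw (Suc n') X" using pw_snoc[OF ys x] by simp
  have "psum N (mv m c ((y # ys) @ [x])) f = psum N (m c y) (\<lambda>y' c'. psum N (mv m c' (ys @ [x])) (\<lambda>xs' c''. f (y' # xs') c''))"
    unfolding append_Cons by (rule psum_mv_Cons[OF m Cons.prems(1) y ysx]) (rule Cons.prems(3)[unfolded n])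
  also have "\<dots> = psum N (m c y) (\<lambda>y' c'. psum N (mv m c' ys) (\<lambda>xs' c'. psum N (m c' x) (\<lambda>x' c''. f (y' # xs' @ [x']) c'')))"
    by (intro psum_cong[OF mover_in[OF m Cons.prems(1) y]] Cons.IH[OF _ ys] Cons.prems(3)[unfolded n]) auto
  also have "\<dots> = psum N (mv m c (y # ys)) (\<lambda>xs' c'. psum N (m c' x) (\<lambda>x' c''. f (xs' @ [x']) c''))"
    unfolding append_Cons[symmetric]
  proof (rule psum_mv_Cons[OF m Cons.prems(1) y ys, symmetric])
    fix zs d assume "zs \<in> pw (Suc n') X" "d \<in> acar C"
    then show "psum N (m d x) (\<lambda>x' c''. f (zs @ [x']) c'') \<in> acar N"
      by (intro psum_in[OF N mover_in[OF m _ x]] Cons.prems(3)) (use pw_snoc[of zs "Suc n'" X] in \<open>auto simp: n\<close>)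
  qed
  finally show ?case .
qed

text \<open>The way back meets the letters in the opposite order, so the two crossings of the first
  letter enclose the round trip through the rest. The induction hypothesis removes the round trip,
  the local law the crossings.\<close>

lemma mv_rmv_cancel:
  assumes m: "mover N C X m" and m': "mover N X C m'"
    and cancel: "\<And>f c x. bilin C X N f \<Longrightarrow> c \<in> acar C \<Longrightarrow> x \<in> acar X \<Longrightarrow> psum N (m c x) (\<lambda>x' c'. psum N (m' x' c') f) = f c x"
  shows "mlc n X C N (\<lambda>xs c. f c xs) \<Longrightarrow> c \<in> acar C \<Longrightarrow> xs \<in> pw n X \<Longrightarrow>
    psum N (mv m c xs) (\<lambda>xs' c'. psum N (rmv m' xs' c') f) = f c xs"
proof (induction xs arbitrary: n c f)
  case Nil
  then show ?case using mlc_in[OF Nil(1), of "[]" c] by (auto simp: psum_single mover_kmod[OF m] dest: lprod_length)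
next
  case (Cons x xs)
  note N = mover_kmod[OF m]
  obtain n' where n: "n = Suc n'" using Cons.prems by (cases n) (auto dest: lprod_length)
  have x: "x \<in> acar X" and xs: "xs \<in> pw n' X" using Cons.prems n by auto
  have fc: "f c xs \<in> acar N" if "c \<in> acar C" "xs \<in> pw (Suc n') X" for c xs
    using mlc_in[OF Cons.prems(1)] that by (auto simp: n)
  have fb: "bilin C X N (\<lambda>c x. f c (x # xs))" if "xs \<in> pw n' X" for xs
    using mlc_Suc2[OF Cons.prems(1)[unfolded n] that] by (simp add: bilin_def)
  let ?g = "\<lambda>x c' xs'. psum N (m' x c') (\<lambda>c'' x'. f c'' (x' # xs'))"
  have g1: "mlc n' X C N (\<lambda>xs c. ?g x c xs)" if x: "x \<in> acar X" for x
  proof (rule mlcI)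
    fix c assume c: "c \<in> acar C"
    show "mlin (replicate n' X) N (\<lambda>xs. ?g x c xs)"
      by (rule mlin_psum[OF N mover_in[OF m' x c]]) (use mlc_Suc1[OF Cons.prems(1)[unfolded n]] in \<open>auto simp: mlc_def\<close>)
  next
    fix xs assume xs: "xs \<in> pw n' X"
    show "lin_map C N (\<lambda>c. ?g x c xs)" by (rule bilin2[OF mover_lin[OF m' fb[OF xs]] lin_id x])
  qed
  have "psum N (mv m c (x # xs)) (\<lambda>xs' c'. psum N (rmv m' xs' c') f) =
      psum N (m c x) (\<lambda>x' c'. psum N (mv m c' xs) (\<lambda>xs' c''. psum N (rmv m' (x' # xs') c'') f))"
    by (rule psum_mv_Cons[OF m Cons.prems(2) x xs], rule psum_in[OF N rmv_in[OF m']]) (auto intro: fc)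
  also have "\<dots> = psum N (m c x) (\<lambda>x' c'. psum N (mv m c' xs) (\<lambda>xs' c''. psum N (rmv m' xs' c'') (?g x')))"
    by (intro psum_cong[OF mover_in[OF m Cons.prems(2) x]] psum_cong[OF mv_in[OF m _ xs]] psum_rmv_Cons[OF m'] fc)
  also have "\<dots> = psum N (m c x) (\<lambda>x' c'. ?g x' c' xs)"
    by (intro psum_cong[OF mover_in[OF m Cons.prems(2) x]] Cons.IH[OF g1 _ xs])
  also have "\<dots> = f c (x # xs)" by (rule cancel[OF fb[OF xs] Cons.prems(2) x])
  finally show ?case .
qed

text \<open>Here the two crossings of the first letter are adjacent, so the local law comes first
  and the induction hypothesis applies to what remains.\<close>

lemma rmv_mv_cancel:
  assumes m: "mover N C X m" and m': "mover N X C m'" and k: "is_kmod C" "is_kmod X"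
    and cancel: "\<And>f c x. bilin X C N f \<Longrightarrow> c \<in> acar C \<Longrightarrow> x \<in> acar X \<Longrightarrow> psum N (m' x c) (\<lambda>c' x'. psum N (m c' x') f) = f x c"
  shows "mlc n X C N f \<Longrightarrow> c \<in> acar C \<Longrightarrow> xs \<in> pw n X \<Longrightarrow>
    psum N (rmv m' xs c) (\<lambda>c' xs'. psum N (mv m c' xs') f) = f xs c"
proof (induction xs arbitrary: n f)
  case Nil
  then show ?case using mlc_in[OF Nil(1), of "[]" c] by (auto simp: psum_single mover_kmod[OF m] dest: lprod_length)
next
  case (Cons x xs)
  note N = mover_kmod[OF m]
  obtain n' where n: "n = Suc n'" using Cons.prems by (cases n) (auto dest: lprod_length)
  have x: "x \<in> acar X" and xs: "xs \<in> pw n' X" using Cons.prems n by auto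
  have f: "mlc (Suc n') X C N f" using Cons.prems n by simp
  let ?g = "\<lambda>x' xs c'. psum N (mv m c' xs) (\<lambda>xs' c''. f (x' # xs') c'')"
  have g2: "bilin X C N (\<lambda>x' c'. ?g x' xs c')" if xs: "xs \<in> pw n' X" for xs
  proof (rule bilinI)
    fix x assume "x \<in> acar X" then show "lin_map C N (?g x xs)"
      using mv_mlc[OF m k mlc_Suc1[OF f, of x]] xs by (simp add: mlc_def)
  next
    fix c assume c: "c \<in> acar C"
    show "lin_map X N (\<lambda>x. ?g x xs c)"
      by (rule lin_psum[OF N mv_in[OF m c xs]]) (rule bilin1[OF mlc_Suc2[OF f] lin_id])
  qed
  have "psum N (rmv m' (x # xs) c) (\<lambda>c' xs'. psum N (mv m c' xs') f) =
      psum N (rmv m' xs c) (\<lambda>c1 xs1. psum N (m' x c1) (\<lambda>c2 x2. psum N (mv m c2 (x2 # xs1)) f))"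
    by (rule psum_rmv_Cons[OF m' Cons.prems(2) x xs], rule psum_in[OF N mv_in[OF m]]) (auto intro: mlc_in[OF f])
  also have "\<dots> = psum N (rmv m' xs c) (\<lambda>c1 xs1. psum N (m' x c1) (\<lambda>c2 x2. psum N (m c2 x2) (\<lambda>x3 c3. ?g x3 xs1 c3)))"
    by (intro psum_cong[OF rmv_in[OF m' Cons.prems(2) xs]] psum_cong[OF mover_in[OF m' x]] psum_mv_Cons[OF m] mlc_in[OF f])
  also have "\<dots> = psum N (rmv m' xs c) (\<lambda>c1 xs1. ?g x xs1 c1)"
    by (intro psum_cong[OF rmv_in[OF m' Cons.prems(2) xs]] cancel[OF g2 _ x])
  also have "\<dots> = f (x # xs) c" by (rule Cons.IH[OF mlc_Suc1[OF f x] Cons.prems(2) xs])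
  finally show ?case .
qed

context hopf_comodule_algebra
begin

section \<open>The braiding\<close>

text \<open>In the crossed product \<open>b g = \<Sum> (b\<^sub>1 \<cdot> g) b\<^sub>0\<close> and \<open>g b = \<Sum> b\<^sub>0 (S\<^sup>-\<^sup>1 b\<^sub>1 \<cdot> g)\<close>.\<close>

definition brl :: "'m \<Rightarrow> 'm \<Rightarrow> ('m \<times> 'm) list" where
  "brl a g = map (\<lambda>p. (ad (fst p) g, snd p)) (rl a)"

definition ibl :: "'m \<Rightarrow> 'm \<Rightarrow> ('m \<times> 'm) list" where
  "ibl g a = map (\<lambda>p. (snd p, ad (Si (fst p)) g)) (rl a)"

lemma psum_brl: "psum N (brl a g) f = psum N (rl a) (\<lambda>x b. f (ad x g) b)"
  and psum_ibl: "psum N (ibl g a) f' = psum N (rl a) (\<lambda>x b. f' b (ad (Si x) g))"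
  by (simp_all add: psum_def brl_def ibl_def lsum_map)

lemma brl_in: "a \<in> acar A \<Longrightarrow> g \<in> acar H \<Longrightarrow> set (brl a g) \<subseteq> acar H \<times> acar A"
  using rl_in[of a] by (fastforce simp: brl_def intro: ad_in)

lemma ibl_in: "g \<in> acar H \<Longrightarrow> a \<in> acar A \<Longrightarrow> set (ibl g a) \<subseteq> acar A \<times> acar H"
  using rl_in[of a] by (fastforce simp: ibl_def intro: ad_in Si_in)

lemma brl_mover: "is_kmod N \<Longrightarrow> mover N A H brl"
  unfolding mover_def psum_brl
proof (intro conjI ballI allI impI brl_in)
  fix f assume N: "is_kmod N" and f: "bilin H A N f"
  show "bilin A H N (\<lambda>a g. psum N (rl a) (\<lambda>x b. f (ad x g) b))"
    by (rule AI N bilin1[OF f] bilin2[OF f] | assumption)+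
qed

lemma ibl_mover: "is_kmod N \<Longrightarrow> mover N H A ibl"
  unfolding mover_def psum_ibl
proof (intro conjI ballI allI impI ibl_in)
  fix f assume N: "is_kmod N" and f: "bilin A H N f"
  show "bilin H A N (\<lambda>g a. psum N (rl a) (\<lambda>x b. f b (ad (Si x) g)))"
    by (rule AI N bilin1[OF f] bilin2[OF f] | assumption)+
qed

text \<open>The module algebra law gives each of \<open>g\<close> and \<open>g'\<close> its own
  coproduct leg, and coassociativity of the coaction turns the two legs into two successive
  coactions, that is two crossings.\<close>

lemma br_mulH:
  assumes N: "is_kmod N" and f: "bilin H A N f" and a: "a \<in> acar A" and g: "g \<in> acar H" and g': "g' \<in> acar H"
  shows "psum N (brl a (amul H g g')) f = psum N (brl a g) (\<lambda>g1 a1. psum N (brl a1 g') (\<lambda>g2 a2. f (amul H g1 g2) a2))"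
proof -
  note FI = AI N g g' bilin1[OF f] bilin2[OF f] bilin_in[OF f]
  have "psum N (brl a (amul H g g')) f = psum N (rl a) (\<lambda>x b. psum N (dl x) (\<lambda>u v. f (amul H (ad u g) (ad v g')) b))"
    unfolding psum_brl
  proof (rule psum_cong[OF rl_in[OF a]])
    fix x b assume i: "x \<in> acar H" "b \<in> acar A"
    show "f (ad x (amul H g g')) b = psum N (dl x) (\<lambda>u v. f (amul H (ad u g) (ad v g')) b)"
      unfolding ad_prod[OF i(1) g g']
      by (rule lin_push2[OF kH N bilin1[OF f lin_id i(2)] dl_in[OF i(1)]]) (rule FI | assumption)+
  qed
  also have "\<dots> = psum N (rl a) (\<lambda>x b. psum N (rl b) (\<lambda>u v. f (amul H (ad x g) (ad u g')) v))"
    by (rule comod_coassoc[OF N _ a]) (rule FI | assumption)+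
  finally show ?thesis by (simp add: psum_brl)
qed

text \<open>The adjoint action on the unit is the counit, which the counit law of the coaction
  absorbs.\<close>

lemma br_oneH:
  assumes N: "is_kmod N" and f: "bilin H A N f" and a: "a \<in> acar A"
  shows "psum N (brl a (aone H)) f = f (aone H) a"
proof -
  have "psum N (brl a (aone H)) f = psum N (rl a) (\<lambda>x b. asmul N (e x) (f (aone H) b))"
    unfolding psum_brl
    by (rule psum_cong[OF rl_in[OF a]]) (simp add: ad_unit lin_smul[OF bilin1[OF f lin_id]] oneH)
  also have "\<dots> = f (aone H) a" by (rule lin_counitA[OF N bilin2[OF f lin_id oneH] a])
  finally show ?thesis .
qed

text \<open>The coaction is multiplicative and the adjoint action is an action, so \<open>b\<close>,
  the letter next to \<open>g\<close>, crosses first. The independent expansions of \<open>a\<close>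
  and \<open>b\<close> are exchanged to obtain this order.\<close>

lemma br_mulA:
  assumes N: "is_kmod N" and f: "bilin H A N f" and a: "a \<in> acar A" and b: "b \<in> acar A" and g: "g \<in> acar H"
  shows "psum N (brl (amul A a b) g) f = psum N (brl b g) (\<lambda>g1 b1. psum N (brl a g1) (\<lambda>g2 a1. f g2 (amul A a1 b1)))"
proof -
  note FI = AI N g bilin1[OF f] bilin2[OF f] bilin_in[OF f]
  have 1: "bilin H A N (\<lambda>x c. f (ad x g) c)" by (rule FI | assumption)+
  have "psum N (brl (amul A a b) g) f = psum N (rl a) (\<lambda>x a0. psum N (rl b) (\<lambda>y b0. f (ad (amul H x y) g) (amul A a0 b0)))"
    unfolding psum_brl by (rule rl_mul[OF N 1 a b])
  also have "\<dots> = psum N (rl a) (\<lambda>x a0. psum N (rl b) (\<lambda>y b0. f (ad x (ad y g)) (amul A a0 b0)))"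
    by (intro psum_cong[OF rl_in] a b) (simp add: ad_mul g)
  also have "\<dots> = psum N (rl b) (\<lambda>y b0. psum N (rl a) (\<lambda>x a0. f (ad x (ad y g)) (amul A a0 b0)))"
    by (rule psum_swap[OF N rl_in[OF a] rl_in[OF b]]) (rule FI | assumption)+
  finally show ?thesis by (simp add: psum_brl)
qed

lemma br_oneA:
  assumes N: "is_kmod N" and f: "bilin H A N f" and g: "g \<in> acar H"
  shows "psum N (brl (aone A) g) f = f g (aone A)"
proof -
  have 1: "bilin H A N (\<lambda>x c. f (ad x g) c)" by (rule AI N g bilin1[OF f] bilin2[OF f] | assumption)+
  show ?thesis unfolding psum_brl by (simp add: rl_one[OF N 1] ad_one g)
qed

text \<open>After coassociativity both actions come from the legs of one element \<open>x\<close>,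
  where \<open>ad_Si_cancel\<close> reduces them to its counit.\<close>

lemma ib_br:
  assumes N: "is_kmod N" and f: "bilin H A N f" and g: "g \<in> acar H" and a: "a \<in> acar A"
  shows "psum N (ibl g a) (\<lambda>a' g'. psum N (brl a' g') f) = f g a"
proof -
  note FI = AI N g bilin1[OF f] bilin2[OF f] bilin_in[OF f]
  have "psum N (ibl g a) (\<lambda>a' g'. psum N (brl a' g') f) = psum N (rl a) (\<lambda>x b. psum N (rl b) (\<lambda>y c. f (ad y (ad (Si x) g)) c))"
    by (simp add: psum_brl psum_ibl)
  also have "\<dots> = psum N (rl a) (\<lambda>x c. psum N (dl x) (\<lambda>u v. f (ad v (ad (Si u) g)) c))"
    by (rule comod_coassoc[OF N _ a, symmetric]) (rule FI | assumption)+
  also have "\<dots> = psum N (rl a) (\<lambda>x c. asmul N (e x) (f g c))"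
  proof (rule psum_cong[OF rl_in[OF a]])
    fix x c assume i: "x \<in> acar H" "c \<in> acar A"
    have "psum N (dl x) (\<lambda>u v. f (ad v (ad (Si u) g)) c) = f (psum H (dl x) (\<lambda>u v. ad v (ad (Si u) g))) c"
      by (rule lin_push2[OF kH N bilin1[OF f lin_id i(2)] dl_in[OF i(1)], symmetric]) (rule FI | assumption)+
    then show "psum N (dl x) (\<lambda>u v. f (ad v (ad (Si u) g)) c) = asmul N (e x) (f g c)"
      by (simp add: ad_Si_cancel i g lin_smul[OF bilin1[OF f lin_id]])
  qed
  also have "\<dots> = f g a" by (rule lin_counitA[OF N bilin2[OF f lin_id g] a])
  finally show ?thesis .
qed

lemma br_ib:
  assumes N: "is_kmod N" and f: "bilin A H N f" and a: "a \<in> acar A" and g: "g \<in> acar H"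
  shows "psum N (brl a g) (\<lambda>g' a'. psum N (ibl g' a') f) = f a g"
proof -
  note FI = AI N g bilin1[OF f] bilin2[OF f] bilin_in[OF f]
  have "psum N (brl a g) (\<lambda>g' a'. psum N (ibl g' a') f) = psum N (rl a) (\<lambda>x b. psum N (rl b) (\<lambda>y c. f c (ad (Si y) (ad x g))))"
    by (simp add: psum_brl psum_ibl)
  also have "\<dots> = psum N (rl a) (\<lambda>x c. psum N (dl x) (\<lambda>u v. f c (ad (Si v) (ad u g))))"
    by (rule comod_coassoc[OF N _ a, symmetric]) (rule FI | assumption)+
  also have "\<dots> = psum N (rl a) (\<lambda>x c. asmul N (e x) (f c g))"
  proof (rule psum_cong[OF rl_in[OF a]])
    fix x c assume i: "x \<in> acar H" "c \<in> acar A"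
    have "psum N (dl x) (\<lambda>u v. f c (ad (Si v) (ad u g))) = f c (psum H (dl x) (\<lambda>u v. ad (Si v) (ad u g)))"
      by (rule lin_push2[OF kH N bilin2[OF f lin_id i(2)] dl_in[OF i(1)], symmetric]) (rule FI | assumption)+
    then show "psum N (dl x) (\<lambda>u v. f c (ad (Si v) (ad u g))) = asmul N (e x) (f c g)"
      by (simp add: Si_ad_cancel i g lin_smul[OF bilin2[OF f lin_id]])
  qed
  also have "\<dots> = f a g" by (rule lin_counitA[OF N bilin1[OF f lin_id g] a])
  finally show ?thesis .
qed

text \<open>The reversed legs of \<open>Si_ad_prod\<close> match the position of the letters:
  \<open>g'\<close> stands next to \<open>a\<close> and is crossed first.\<close>

lemma ib_mulH:
  assumes N: "is_kmod N" and f: "bilin A H N f" and a: "a \<in> acar A" and g: "g \<in> acar H" and g': "g' \<in> acar H"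
  shows "psum N (ibl (amul H g g') a) f = psum N (ibl g' a) (\<lambda>a1 g1. psum N (ibl g a1) (\<lambda>a2 g2. f a2 (amul H g2 g1)))"
proof -
  note FI = AI N g g' bilin1[OF f] bilin2[OF f] bilin_in[OF f]
  have "psum N (ibl (amul H g g') a) f = psum N (rl a) (\<lambda>x b. psum N (dl x) (\<lambda>u v. f b (amul H (ad (Si v) g) (ad (Si u) g'))))"
    unfolding psum_ibl
  proof (rule psum_cong[OF rl_in[OF a]])
    fix x b assume i: "x \<in> acar H" "b \<in> acar A"
    show "f b (ad (Si x) (amul H g g')) = psum N (dl x) (\<lambda>u v. f b (amul H (ad (Si v) g) (ad (Si u) g')))"
      unfolding Si_ad_prod[OF i(1) g g']
      by (rule lin_push2[OF kH N bilin2[OF f lin_id i(2)] dl_in[OF i(1)]]) (rule FI | assumption)+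
  qed
  also have "\<dots> = psum N (rl a) (\<lambda>x b. psum N (rl b) (\<lambda>u v. f v (amul H (ad (Si u) g) (ad (Si x) g'))))"
    by (rule comod_coassoc[OF N _ a]) (rule FI | assumption)+
  finally show ?thesis by (simp add: psum_ibl)
qed

lemma ib_oneH:
  assumes N: "is_kmod N" and f: "bilin A H N f" and a: "a \<in> acar A"
  shows "psum N (ibl (aone H) a) f = f a (aone H)"
proof -
  have "psum N (ibl (aone H) a) f = psum N (rl a) (\<lambda>x b. asmul N (e x) (f b (aone H)))"
    unfolding psum_ibl
    by (rule psum_cong[OF rl_in[OF a]]) (simp add: Si_ad_unit lin_smul[OF bilin2[OF f lin_id]] oneH)
  also have "\<dots> = f a (aone H)" by (rule lin_counitA[OF N bilin1[OF f lin_id oneH] a])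
  finally show ?thesis .
qed

text \<open>\<open>Si\<close> reverses products, so S^-1(x y) acts as S^-1(x) followed by S^-1(y),
  the order in which \<open>g\<close> meets \<open>a\<close> and \<open>b\<close>.\<close>

lemma ib_mulA:
  assumes N: "is_kmod N" and f: "bilin A H N f" and a: "a \<in> acar A" and b: "b \<in> acar A" and g: "g \<in> acar H"
  shows "psum N (ibl g (amul A a b)) f = psum N (ibl g a) (\<lambda>a1 g1. psum N (ibl g1 b) (\<lambda>b1 g2. f (amul A a1 b1) g2))"
proof -
  note FI = AI N g bilin1[OF f] bilin2[OF f] bilin_in[OF f]
  have 1: "bilin H A N (\<lambda>x c. f c (ad (Si x) g))" by (rule FI | assumption)+
  have "psum N (ibl g (amul A a b)) f = psum N (rl a) (\<lambda>x a0. psum N (rl b) (\<lambda>y b0. f (amul A a0 b0) (ad (Si (amul H x y)) g)))"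
    unfolding psum_ibl by (rule rl_mul[OF N 1 a b])
  also have "\<dots> = psum N (rl a) (\<lambda>x a0. psum N (rl b) (\<lambda>y b0. f (amul A a0 b0) (ad (Si y) (ad (Si x) g))))"
    by (intro psum_cong[OF rl_in] a b) (simp add: ad_mul Si_mul Si_in g)
  finally show ?thesis by (simp add: psum_ibl)
qed

lemma ib_oneA:
  assumes N: "is_kmod N" and f: "bilin A H N f" and g: "g \<in> acar H"
  shows "psum N (ibl g (aone A)) f = f (aone A) g"
proof -
  have 1: "bilin H A N (\<lambda>x c. f c (ad (Si x) g))" by (rule AI N g bilin1[OF f] bilin2[OF f] | assumption)+
  show ?thesis unfolding psum_ibl by (simp add: rl_one[OF N 1] ad_one g Si_one)
qed

end

section \<open>The cyclic module of an algebra\<close>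

text \<open>Recursion on the position suits inductions over words; \<open>mrg_eq\<close> recovers
  the description by \<open>take\<close> and \<open>drop\<close> that the face operators
  use.\<close>

primrec mrg :: "('k, 'b) alg \<Rightarrow> nat \<Rightarrow> 'b list \<Rightarrow> 'b list" where
  "mrg B 0 xs = amul B (hd xs) (hd (tl xs)) # tl (tl xs)"
| "mrg B (Suc i) xs = hd xs # mrg B i (tl xs)"

definition ins :: "('k, 'b) alg \<Rightarrow> nat \<Rightarrow> 'b list \<Rightarrow> 'b list" where
  "ins B i xs = take i xs @ aone B # drop i xs"

definition rot :: "'b list \<Rightarrow> 'b list" where
  "rot xs = last xs # butlast xs"

lemma mrg_eq: "Suc i < length xs \<Longrightarrow> mrg B i xs = take i xs @ [amul B (xs ! i) (xs ! Suc i)] @ drop (Suc (Suc i)) xs"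
proof (induction i arbitrary: xs)
  case 0
  then show ?case by (cases xs; cases "tl xs") auto
next
  case (Suc i)
  then show ?case by (cases xs) auto
qed

lemma length_mrg [simp]: "Suc i < length xs \<Longrightarrow> length (mrg B i xs) = length xs - 1"
  by (simp add: mrg_eq)

lemma length_ins [simp]: "length (ins B i xs) = Suc (length xs)"
  by (simp add: ins_def)

lemma length_rot [simp]: "xs \<noteq> [] \<Longrightarrow> length (rot xs) = length xs"
  by (simp add: rot_def)

lemma nth_mrg: "Suc i < length xs \<Longrightarrow> k < length xs - 1 \<Longrightarrow>
    mrg B i xs ! k = (if k < i then xs ! k else if k = i then amul B (xs ! i) (xs ! Suc i) else xs ! Suc k)"
  by (auto simp: mrg_eq nth_append nth_Cons' nth_drop)

lemma nth_ins: "i \<le> length xs \<Longrightarrow> k \<le> length xs \<Longrightarrow>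
    ins B i xs ! k = (if k < i then xs ! k else if k = i then aone B else xs ! (k - 1))"
  by (auto simp: ins_def nth_append nth_Cons')

lemma nth_rot: "k < length xs \<Longrightarrow> rot xs ! k = (if k = 0 then xs ! (length xs - 1) else xs ! (k - 1))"
  by (auto simp: rot_def nth_Cons nth_butlast last_conv_nth split: nat.split)

lemma mrg_in:
  assumes "is_kalg B" "xs \<in> pw (Suc n) B" "i < n" shows "mrg B i xs \<in> pw n B"
proof -
  have l: "length xs = Suc n" and s: "set xs \<subseteq> acar B" using assms(2) lprod_replicate[of xs "Suc n" B] by auto
  have "xs ! i \<in> acar B" "xs ! Suc i \<in> acar B" using l s assms(3) by (simp_all add: nth_mem subsetD)
  then show ?thesis
    using l s assms set_take_subset[of i xs] set_drop_subset[of "Suc (Suc i)" xs]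
    by (auto simp: lprod_replicate mrg_eq kalg_mul)
qed

lemma ins_in: "is_kalg B \<Longrightarrow> xs \<in> pw n B \<Longrightarrow> ins B i xs \<in> pw (Suc n) B"
  using lprod_replicate[of "ins B i xs" "Suc n" B] set_take_subset[of i xs] set_drop_subset[of i xs]
  by (auto simp: lprod_replicate ins_def kalg_one)

lemma rot_in: "xs \<in> pw (Suc n) B \<Longrightarrow> rot xs \<in> pw (Suc n) B"
  using lprod_replicate[of "rot xs" "Suc n" B] lprod_replicate[of xs "Suc n" B]
  by (cases "xs = []") (auto simp: rot_def dest: in_set_butlastD)

text \<open>Splitting the list of factors before its last entry isolates the slot that
  \<open>rot\<close> brings to the front.\<close>

lemma mlin_rot:
  assumes f: "mlin (M # Ms) N f" shows "mlin (Ms @ [M]) N (\<lambda>zs. f (rot zs))"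
  unfolding mlin_append
proof (intro conjI ballI)
  fix xs assume "xs \<in> lprod Ms"
  then show "mlin [M] N (\<lambda>ys. f (rot (xs @ ys)))" using f mlin_in[OF f] by (simp add: rot_def butlast_append)
next
  fix ys assume "ys \<in> lprod [M]"
  then obtain y where "ys = [y]" "y \<in> acar M" by (auto simp: pw_Suc)
  then show "mlin Ms N (\<lambda>xs. f (rot (xs @ ys)))" using f by (simp add: rot_def butlast_append)
qed

lemma mlin_rot_pw: "mlin (replicate (Suc n) B) N f \<Longrightarrow> mlin (replicate (Suc n) B) N (\<lambda>zs. f (rot zs))"
  using mlin_rot[of B "replicate n B" N f] by (simp add: replicate_append_same)

lemma mlin_mrg:
  assumes B: "is_kalg B"
  shows "mlin (replicate n B) N f \<Longrightarrow> i < n \<Longrightarrow> mlin (replicate (Suc n) B) N (\<lambda>xs. f (mrg B i xs))"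
proof (induction i arbitrary: n f)
  case 0
  then obtain m where n: "n = Suc m" by (cases n) auto
  note f = 0(1)[unfolded n, simplified]
  show ?case
    unfolding n replicate_Suc mlin.simps mrg.simps list.sel
  proof (intro conjI ballI)
    fix x y assume "x \<in> acar B" "y \<in> acar B"
    then show "mlin (replicate m B) N (\<lambda>xs. f (amul B x y # xs))" using f kalg_mul[OF B] by simp
  next
    fix x xs assume x: "x \<in> acar B" and "xs \<in> pw m B"
    then have l: "lin_map B N (\<lambda>z. f (z # xs))" using f by simp
    show "lin_map B N (\<lambda>y. f (amul B x y # xs))" by (rule lin_comp[OF l bilin2[OF kalg_bilin[OF B] lin_id x]])
  next
    fix zs assume "zs \<in> lprod (B # replicate m B)"
    then obtain y xs where zs: "zs = y # xs" "y \<in> acar B" "xs \<in> pw m B" by (auto simp: pw_Suc)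
    then have l: "lin_map B N (\<lambda>z. f (z # xs))" using f by simp
    show "lin_map B N (\<lambda>x. f (amul B x (hd zs) # tl zs))"
      unfolding zs(1) list.sel by (rule lin_comp[OF l bilin1[OF kalg_bilin[OF B] lin_id zs(2)]])
  qed
next
  case (Suc i)
  then obtain m where n: "n = Suc m" and i: "i < m" by (cases n) auto
  note f = Suc.prems(1)[unfolded n, simplified]
  have "mlin (replicate (Suc m) B) N (\<lambda>xs. f (x # mrg B i xs))" if "x \<in> acar B" for x
    by (rule Suc.IH) (use f that i in auto)
  moreover have "lin_map B N (\<lambda>x. f (x # mrg B i xs))" if "xs \<in> pw (Suc m) B" for xs
    using f mrg_in[OF B that i] by blast
  ultimately show ?case by (simp add: n)
qed

lemma mlin_ins:
  assumes B: "is_kalg B"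
  shows "mlin (replicate (Suc n) B) N f \<Longrightarrow> i \<le> n \<Longrightarrow> mlin (replicate n B) N (\<lambda>xs. f (ins B i xs))"
proof (induction i arbitrary: n f)
  case 0
  then show ?case using kalg_one[OF B] by (simp add: ins_def)
next
  case (Suc i)
  then obtain m where n: "n = Suc m" and i: "i \<le> m" by (cases n) auto
  note f = Suc.prems(1)[unfolded n, simplified]
  have "mlin (replicate m B) N (\<lambda>xs. f (x # ins B i xs))" if "x \<in> acar B" for x
    by (rule Suc.IH) (use f that i in auto)
  moreover have "lin_map B N (\<lambda>x. f (x # ins B i xs))" if "xs \<in> pw m B" for xs
    using Suc.prems(1) ins_in[OF B that, of i] by (auto simp: n)
  ultimately show ?case by (simp add: n) (simp add: ins_def)
qed

section \<open>Faces, degeneracies and rotation on words\<close>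

definition fc :: "('k, 'b) alg \<Rightarrow> nat \<Rightarrow> nat \<Rightarrow> 'b list \<Rightarrow> 'b list" where
  "fc B n i xs = (if i < n then mrg B i xs else mrg B 0 (rot xs))"

lemma length_fc [simp]: "length xs = Suc n \<Longrightarrow> 1 \<le> n \<Longrightarrow> length (fc B n i xs) = n"
  by (cases "xs = []") (auto simp: fc_def)

text \<open>An entrywise description of all faces at once, wrapping face included, so that the
  simplicial identities become case distinctions on an index.\<close>

lemma nth_fc: "length xs = Suc n \<Longrightarrow> 1 \<le> n \<Longrightarrow> k < n \<Longrightarrow>
    fc B n i xs ! k = (if i < n then if k < i then xs ! k else if k = i then amul B (xs ! i) (xs ! Suc i) else xs ! Suc k
      else if k = 0 then amul B (xs ! n) (xs ! 0) else xs ! k)"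
  by (cases "xs = []") (auto simp: fc_def nth_mrg nth_rot simp del: mrg.simps)

context
  fixes B :: "('k::comm_ring_1, 'b) alg" assumes B: "is_kalg B"
begin

lemma fc_in: "xs \<in> pw (Suc n) B \<Longrightarrow> 1 \<le> n \<Longrightarrow> fc B n i xs \<in> pw n B"
  by (simp add: fc_def mrg_in[OF B] rot_in del: replicate_Suc mrg.simps)

lemma nth_pw: "xs \<in> pw n B \<Longrightarrow> i < n \<Longrightarrow> xs ! i \<in> acar B"
  by (auto simp: lprod_replicate)

lemma fc_fc:
  assumes xs: "xs \<in> pw (Suc n) B" and ij: "2 \<le> n" "i < j" "j \<le> n"
  shows "fc B (n - 1) i (fc B n j xs) = fc B (n - 1) (j - 1) (fc B n i xs)"
proof -
  have l: "length xs = Suc n" using lprod_length[OF xs] by simp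
  have c: "xs ! k \<in> acar B" if "k \<le> n" for k using nth_pw[OF xs] that by simp
  obtain m where n: "n = Suc (Suc m)" using ij(1) by (metis Suc_le_D numeral_2_eq_2 Suc_le_mono)
  obtain j' where j: "j = Suc j'" using ij(2) by (cases j) auto
  show ?thesis
  proof (cases "j = n")
    case True
    \<comment> \<open>For \<open>j = n\<close> the outer face may wrap around as well, namely for
      \<open>i = n - 1\<close>; that case is associativity of the last two letters with the first
      one.\<close>
    consider "i < Suc m" | "i = Suc m" using ij n by linarith
    then show ?thesis
      by cases (intro nth_equalityI; use True l ij c in \<open>auto simp: nth_fc n kalg_assoc[OF B]\<close>)+
  next
    case False
    then have "j' < Suc m" using ij n j by simp
    then show ?thesis
      by (intro nth_equalityI) (use l ij c in \<open>auto simp: nth_fc n j kalg_assoc[OF B]\<close>)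
  qed
qed

lemma ins_ins: "i \<le> j \<Longrightarrow> j \<le> length xs \<Longrightarrow> ins B i (ins B j xs) = ins B (Suc j) (ins B i xs)"
  by (rule nth_equalityI) (auto simp: nth_ins)

text \<open>The index of \<open>ins\<close> is a position in the word: the degeneracy of index
  \<open>j\<close> inserts after the letter \<open>j\<close>, that is at position
  \<open>Suc j\<close>.\<close>

lemma fc_ins_low:
  assumes xs: "length xs = Suc n" and ij: "i < j" "j \<le> n"
  shows "fc B (Suc n) i (ins B (Suc j) xs) = ins B j (fc B n i xs)"
  by (rule nth_equalityI) (use xs ij in \<open>auto simp: nth_fc nth_ins\<close>)

lemma fc_ins_high:
  assumes xs: "length xs = Suc n" and ij: "Suc j < i" "i \<le> Suc n"
  shows "fc B (Suc n) i (ins B (Suc j) xs) = ins B (Suc j) (fc B n (i - 1) xs)"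
proof -
  obtain i' where i: "i = Suc i'" using ij(1) by (cases i) auto
  show ?thesis by (rule nth_equalityI) (use xs ij in \<open>auto simp: nth_fc nth_ins i\<close>)
qed

lemma fc_ins_same:
  assumes xs: "xs \<in> pw (Suc n) B" and j: "j \<le> n"
  shows "fc B (Suc n) j (ins B (Suc j) xs) = xs" "fc B (Suc n) (Suc j) (ins B (Suc j) xs) = xs"
proof -
  have l: "length xs = Suc n" using lprod_length[OF xs] by simp
  have c: "xs ! k \<in> acar B" if "k \<le> n" for k using nth_pw[OF xs] that by simp
  show "fc B (Suc n) j (ins B (Suc j) xs) = xs"
    by (rule nth_equalityI) (use l j c in \<open>auto simp: nth_fc nth_ins kalg_1r[OF B]\<close>)
  show "fc B (Suc n) (Suc j) (ins B (Suc j) xs) = xs"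
    by (rule nth_equalityI) (use l j c in \<open>auto simp: nth_fc nth_ins kalg_1l[OF B]\<close>)
qed

lemma fc_rot:
  assumes xs: "length xs = Suc n" and i: "1 \<le> i" "i \<le> n"
  shows "fc B n i (rot xs) = rot (fc B n (i - 1) xs)"
proof -
  have "xs \<noteq> []" "fc B n (i - 1) xs \<noteq> []" using xs i length_fc[OF xs, of B "i - 1"] by (auto simp del: length_fc)
  moreover obtain i' where "i = Suc i'" using i by (cases i) auto
  ultimately show ?thesis
    by (intro nth_equalityI) (use xs i in \<open>auto simp: nth_fc nth_rot\<close>)
qed

lemma fc_rot_0: "1 \<le> n \<Longrightarrow> fc B n 0 (rot xs) = fc B n n xs"
  by (simp add: fc_def)

lemma ins_rot:
  assumes xs: "length xs = Suc n" and i: "1 \<le> i" "i \<le> n"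
  shows "ins B (Suc i) (rot xs) = rot (ins B i xs)"
proof -
  have "xs \<noteq> []" "ins B i xs \<noteq> []" using xs by (auto simp: ins_def)
  then show ?thesis
    by (intro nth_equalityI) (use xs i in \<open>auto simp: nth_ins nth_rot\<close>)
qed

lemma ins_rot_0: "xs \<noteq> [] \<Longrightarrow> ins B (Suc 0) (rot xs) = rot (rot (ins B (length xs) xs))"
  by (simp add: ins_def rot_def)

end

text \<open>\<open>rotate1\<close> undoes \<open>rot\<close> on nonempty words, so the claim follows
  from the fact that rotating by the length is the identity.\<close>

lemma rot_funpow_length: "(rot ^^ length xs) xs = xs"
proof (cases "xs = []")
  case False
  have ne: "(rot ^^ m) xs \<noteq> [] \<and> length ((rot ^^ m) xs) = length xs" for m
    using False by (induction m) (auto simp: rot_def)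
  have "rotate1 (rot ys) = ys" if "ys \<noteq> []" for ys :: "'a list" using that by (simp add: rot_def)
  then have "(rotate1 ^^ m) ((rot ^^ m) xs) = xs" for m
  proof (induction m)
    case (Suc m)
    have "(rotate1 ^^ Suc m) ((rot ^^ Suc m) xs) = (rotate1 ^^ m) (rotate1 (rot ((rot ^^ m) xs)))"
      by (subst funpow_Suc_right) simp
    then show ?case using Suc ne by simp
  qed simp
  from this[of "length xs"] show ?thesis using ne[of "length xs"] by (metis rotate_def rotate_id mod_self)
qed simp

lemma kmod_Cmod: "is_kmod (Cmod B n)" by (simp add: Cmod_def kmod_tmod)

section \<open>The cyclic operators of an algebra on pure tensors\<close>

context
  fixes B :: "('k::comm_ring_1, 'b) alg" assumes B: "is_kalg B"
begin

lemma kmods_pw: "kmods (replicate n B)" by (rule kmods_replicate[OF kalg_mod[OF B]])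

lemma Cface_mlin: "1 \<le> n \<Longrightarrow> mlin (replicate (Suc n) B) (Cmod B (n - 1)) (\<lambda>xs. ptens (replicate n B) (fc B n i xs))"
proof -
  assume n: "1 \<le> n"
  have p: "mlin (replicate n B) (Cmod B (n - 1)) (ptens (replicate n B))"
    using mlin_ptens[OF kmods_pw, of n] n by (simp add: Cmod_def del: replicate_Suc)
  show ?thesis
  proof (cases "i < n")
    case True
    then show ?thesis using mlin_mrg[OF B p, of i] by (simp add: fc_def del: replicate_Suc)
  next
    case False
    then show ?thesis using mlin_rot_pw[OF mlin_mrg[OF B p, of 0]] n by (simp add: fc_def del: replicate_Suc)
  qed
qed

lemma Cface_eq: "1 \<le> n \<Longrightarrow> Cface B n i = tlift (replicate (Suc n) B) (Cmod B (n - 1)) (\<lambda>xs. ptens (replicate n B) (fc B n i xs))"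
  unfolding Cface_def
proof (rule tlift_cong)
  fix xs :: "'b list" assume n: "1 \<le> n" and "xs \<in> pw (Suc n) B"
  then have l: "length xs = Suc n" using lprod_length[of xs "replicate (Suc n) B"] by simp
  then obtain y ys z where "xs = y # ys @ [z]" using n
    by (metis Suc_le_D append_butlast_last_id length_0_conv length_Suc_conv list.size(3) nat.simps(3) One_nat_def)
  then show "ptens (replicate n B) (if i < n then take i xs @ [amul B (xs ! i) (xs ! Suc i)] @ drop (Suc (Suc i)) xs
         else amul B (last xs) (hd xs) # butlast (tl xs)) = ptens (replicate n B) (fc B n i xs)"
    using l by (cases "i < n") (simp_all only: fc_def if_True if_False mrg_eq, simp_all add: rot_def)
qed

lemma Cface_lin: "1 \<le> n \<Longrightarrow> lin_map (Cmod B n) (Cmod B (n - 1)) (Cface B n i)"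
  unfolding Cface_eq using tlift_lin[OF kmod_Cmod Cface_mlin kmods_pw] by (simp add: Cmod_def)

lemma Cface_pt: "1 \<le> n \<Longrightarrow> xs \<in> pw (Suc n) B \<Longrightarrow> Cface B n i (ptens (replicate (Suc n) B) xs) = ptens (replicate n B) (fc B n i xs)"
  unfolding Cface_eq by (rule tlift_ptens[OF kmod_Cmod Cface_mlin kmods_pw])

lemma Cdegen_mlin: "i \<le> n \<Longrightarrow> mlin (replicate (Suc n) B) (Cmod B (Suc n)) (\<lambda>xs. ptens (replicate (Suc (Suc n)) B) (ins B (Suc i) xs))"
  using mlin_ins[OF B mlin_ptens[OF kmods_pw[of "Suc (Suc n)"]], of "Suc i"] by (simp add: Cmod_def del: replicate_Suc)

lemma Cdegen_eq: "Cdegen B n i = tlift (replicate (Suc n) B) (Cmod B (Suc n)) (\<lambda>xs. ptens (replicate (Suc (Suc n)) B) (ins B (Suc i) xs))"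
  by (simp add: Cdegen_def ins_def)

lemma Cdegen_lin: "i \<le> n \<Longrightarrow> lin_map (Cmod B n) (Cmod B (Suc n)) (Cdegen B n i)"
  unfolding Cdegen_eq using tlift_lin[OF kmod_Cmod Cdegen_mlin kmods_pw] by (simp add: Cmod_def)

lemma Cdegen_pt: "i \<le> n \<Longrightarrow> xs \<in> pw (Suc n) B \<Longrightarrow>
    Cdegen B n i (ptens (replicate (Suc n) B) xs) = ptens (replicate (Suc (Suc n)) B) (ins B (Suc i) xs)"
  unfolding Cdegen_eq by (rule tlift_ptens[OF kmod_Cmod Cdegen_mlin kmods_pw])

lemma Ctau_mlin: "mlin (replicate (Suc n) B) (Cmod B n) (\<lambda>xs. ptens (replicate (Suc n) B) (rot xs))"
  using mlin_rot_pw[OF mlin_ptens[OF kmods_pw], of n] by (simp add: Cmod_def del: replicate_Suc)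

lemma Ctau_eq: "Ctau B n = tlift (replicate (Suc n) B) (Cmod B n) (\<lambda>xs. ptens (replicate (Suc n) B) (rot xs))"
  by (simp add: Ctau_def rot_def)

lemma Ctau_lin: "lin_map (Cmod B n) (Cmod B n) (Ctau B n)"
  unfolding Ctau_eq using tlift_lin[OF kmod_Cmod Ctau_mlin kmods_pw] by (simp add: Cmod_def)

lemma Ctau_pt: "xs \<in> pw (Suc n) B \<Longrightarrow> Ctau B n (ptens (replicate (Suc n) B) xs) = ptens (replicate (Suc n) B) (rot xs)"
  unfolding Ctau_eq by (rule tlift_ptens[OF kmod_Cmod Ctau_mlin kmods_pw])

lemma Cmod_ext:
  assumes "is_kmod N" "lin_map (Cmod B n) N f" "lin_map (Cmod B n) N g"
    and "\<And>xs. xs \<in> pw (Suc n) B \<Longrightarrow> f (ptens (replicate (Suc n) B) xs) = g (ptens (replicate (Suc n) B) xs)"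
    and "x \<in> acar (Cmod B n)"
  shows "f x = g x"
  using assms unfolding Cmod_def by (rule tmod_ext)

lemma Ctau_pow_lin: "lin_map (Cmod B n) (Cmod B n) (Ctau B n ^^ m)"
  by (induction m) (auto simp: id_def o_def intro: lin_id lin_comp[OF Ctau_lin])

text \<open>Membership of the rotated word is carried through the induction, since every further
  application of \<open>Ctau\<close> asks for it.\<close>

lemma Ctau_pow_pt: "xs \<in> pw (Suc n) B \<Longrightarrow>
    (Ctau B n ^^ m) (ptens (replicate (Suc n) B) xs) = ptens (replicate (Suc n) B) ((rot ^^ m) xs) \<and> (rot ^^ m) xs \<in> pw (Suc n) B"
  by (induction m) (simp_all add: Ctau_pt rot_in del: replicate_Suc)

text \<open>Both sides of each identity are linear, so it is enough to compare them on pure tensors,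
  where it becomes an identity between words.\<close>

theorem cyclic_Cmod: "cyclic_module (Cmod B) (Cface B) (Cdegen B) (Ctau B)"
  unfolding cyclic_module_def
proof (intro conjI allI impI ballI; (elim conjE)?)
  have len: "length xs = Suc n" if "xs \<in> pw (Suc n) B" for xs n using lprod_length[OF that] by simp
  fix n
  show "is_kmod (Cmod B n)" by (rule kmod_Cmod)
  show "lin_map (Cmod B n) (Cmod B n) (Ctau B n)" by (rule Ctau_lin)
  fix i
  show "1 \<le> n \<Longrightarrow> lin_map (Cmod B n) (Cmod B (n - 1)) (Cface B n i)" by (rule Cface_lin)
  show "i \<le> n \<Longrightarrow> lin_map (Cmod B n) (Cmod B (Suc n)) (Cdegen B n i)" by (rule Cdegen_lin)
  { fix j x assume x: "x \<in> acar (Cmod B n)" and ij: "2 \<le> n" "i < j" "j \<le> n"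
    then obtain m where n: "n = Suc (Suc m)" by (metis Suc_le_D numeral_2_eq_2 Suc_le_mono)
    show "Cface B (n - 1) i (Cface B n j x) = Cface B (n - 1) (j - 1) (Cface B n i x)"
    proof (rule Cmod_ext[OF kmod_Cmod _ _ _ x])
      show "lin_map (Cmod B n) (Cmod B (n - 1 - 1)) (\<lambda>x. Cface B (n - 1) i (Cface B n j x))"
        by (rule lin_comp[OF Cface_lin Cface_lin]) (use n in auto)
      show "lin_map (Cmod B n) (Cmod B (n - 1 - 1)) (\<lambda>x. Cface B (n - 1) (j - 1) (Cface B n i x))"
        by (rule lin_comp[OF Cface_lin Cface_lin]) (use n in auto)
      fix xs assume xs: "xs \<in> pw (Suc n) B"
      have fin: "fc B n k xs \<in> pw (Suc (n - 1)) B" for k using fc_in[OF B xs, of k] n by simp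
      have c: "Cface B n k (ptens (replicate (Suc n) B) xs) = ptens (replicate (Suc (n - 1)) B) (fc B n k xs)" for k
        using Cface_pt[OF _ xs, of k] n by (simp del: replicate_Suc)
      show "Cface B (n - 1) i (Cface B n j (ptens (replicate (Suc n) B) xs)) = Cface B (n - 1) (j - 1) (Cface B n i (ptens (replicate (Suc n) B) xs))"
        unfolding c using Cface_pt[OF _ fin] fc_fc[OF B xs ij] n by (simp del: replicate_Suc)
    qed }
  { fix j x assume x: "x \<in> acar (Cmod B n)" and ij: "i \<le> j" "j \<le> n"
    show "Cdegen B (Suc n) i (Cdegen B n j x) = Cdegen B (Suc n) (Suc j) (Cdegen B n i x)"
    proof (rule Cmod_ext[OF kmod_Cmod _ _ _ x])
      show "lin_map (Cmod B n) (Cmod B (Suc (Suc n))) (\<lambda>x. Cdegen B (Suc n) i (Cdegen B n j x))"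
        by (rule lin_comp[OF Cdegen_lin Cdegen_lin]) (use ij in auto)
      show "lin_map (Cmod B n) (Cmod B (Suc (Suc n))) (\<lambda>x. Cdegen B (Suc n) (Suc j) (Cdegen B n i x))"
        by (rule lin_comp[OF Cdegen_lin Cdegen_lin]) (use ij in auto)
      fix xs assume xs: "xs \<in> pw (Suc n) B"
      show "Cdegen B (Suc n) i (Cdegen B n j (ptens (replicate (Suc n) B) xs)) =
          Cdegen B (Suc n) (Suc j) (Cdegen B n i (ptens (replicate (Suc n) B) xs))"
        using ij xs len[OF xs] ins_ins[OF B, of "Suc i" "Suc j" xs]
        by (simp add: Cdegen_pt ins_in[OF B] del: replicate_Suc)
    qed }
  { fix j x assume x: "x \<in> acar (Cmod B n)" and ij: "i < j" "j \<le> n"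
    obtain m where n: "n = Suc m" using ij by (cases n) auto
    show "Cface B (Suc n) i (Cdegen B n j x) = Cdegen B (n - 1) (j - 1) (Cface B n i x)"
    proof (rule Cmod_ext[OF kmod_Cmod _ _ _ x])
      show "lin_map (Cmod B n) (Cmod B n) (\<lambda>x. Cface B (Suc n) i (Cdegen B n j x))"
        using lin_comp[OF Cface_lin[of "Suc n" i] Cdegen_lin] ij by simp
      show "lin_map (Cmod B n) (Cmod B n) (\<lambda>x. Cdegen B (n - 1) (j - 1) (Cface B n i x))"
        using lin_comp[OF Cdegen_lin[of "j - 1" "n - 1"] Cface_lin[of n i]] ij n by simp
      fix xs assume xs: "xs \<in> pw (Suc n) B"
      have fin: "fc B n k xs \<in> pw (Suc m) B" for k using fc_in[OF B xs, of k] n by simp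
      show "Cface B (Suc n) i (Cdegen B n j (ptens (replicate (Suc n) B) xs)) =
          Cdegen B (n - 1) (j - 1) (Cface B n i (ptens (replicate (Suc n) B) xs))"
        using ij xs len[OF xs] fc_ins_low[OF B, of xs n i j] fin[of i] n
        by (simp add: Cdegen_pt Cface_pt ins_in[OF B] del: replicate_Suc)
    qed }
  { fix x assume x: "x \<in> acar (Cmod B n)" and i: "i \<le> n"
    show "Cface B (Suc n) i (Cdegen B n i x) = x"
    proof (rule Cmod_ext[OF kmod_Cmod _ lin_id _ x])
      show "lin_map (Cmod B n) (Cmod B n) (\<lambda>x. Cface B (Suc n) i (Cdegen B n i x))"
        using lin_comp[OF Cface_lin[of "Suc n" i] Cdegen_lin] i by simp
      fix xs assume xs: "xs \<in> pw (Suc n) B"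
      show "Cface B (Suc n) i (Cdegen B n i (ptens (replicate (Suc n) B) xs)) = ptens (replicate (Suc n) B) xs"
        using i xs fc_ins_same[OF B xs i] by (simp add: Cdegen_pt Cface_pt ins_in[OF B] del: replicate_Suc)
    qed
    show "Cface B (Suc n) (Suc i) (Cdegen B n i x) = x"
    proof (rule Cmod_ext[OF kmod_Cmod _ lin_id _ x])
      show "lin_map (Cmod B n) (Cmod B n) (\<lambda>x. Cface B (Suc n) (Suc i) (Cdegen B n i x))"
        using lin_comp[OF Cface_lin[of "Suc n" "Suc i"] Cdegen_lin] i by simp
      fix xs assume xs: "xs \<in> pw (Suc n) B"
      show "Cface B (Suc n) (Suc i) (Cdegen B n i (ptens (replicate (Suc n) B) xs)) = ptens (replicate (Suc n) B) xs"
        using i xs fc_ins_same[OF B xs i] by (simp add: Cdegen_pt Cface_pt ins_in[OF B] del: replicate_Suc)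
    qed }
  { fix j x assume x: "x \<in> acar (Cmod B n)" and ij: "Suc j < i" "i \<le> Suc n"
    obtain m where n: "n = Suc m" using ij by (cases n) auto
    show "Cface B (Suc n) i (Cdegen B n j x) = Cdegen B (n - 1) j (Cface B n (i - 1) x)"
    proof (rule Cmod_ext[OF kmod_Cmod _ _ _ x])
      show "lin_map (Cmod B n) (Cmod B n) (\<lambda>x. Cface B (Suc n) i (Cdegen B n j x))"
        using lin_comp[OF Cface_lin[of "Suc n" i] Cdegen_lin] ij by simp
      show "lin_map (Cmod B n) (Cmod B n) (\<lambda>x. Cdegen B (n - 1) j (Cface B n (i - 1) x))"
        using lin_comp[OF Cdegen_lin[of "j" "n - 1"] Cface_lin[of n "i - 1"]] ij n by simp
      fix xs assume xs: "xs \<in> pw (Suc n) B"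
      have fin: "fc B n k xs \<in> pw (Suc m) B" for k using fc_in[OF B xs, of k] n by simp
      show "Cface B (Suc n) i (Cdegen B n j (ptens (replicate (Suc n) B) xs)) =
          Cdegen B (n - 1) j (Cface B n (i - 1) (ptens (replicate (Suc n) B) xs))"
        using ij xs len[OF xs] fc_ins_high[OF B, of xs n j i] fin[of "i - 1"] n
        by (simp add: Cdegen_pt Cface_pt ins_in[OF B] del: replicate_Suc)
    qed }
  { fix x assume x: "x \<in> acar (Cmod B n)" and i: "1 \<le> i" "i \<le> n"
    obtain m where n: "n = Suc m" using i by (cases n) auto
    show "Cface B n i (Ctau B n x) = Ctau B (n - 1) (Cface B n (i - 1) x)"
    proof (rule Cmod_ext[OF kmod_Cmod _ _ _ x])
      show "lin_map (Cmod B n) (Cmod B (n - 1)) (\<lambda>x. Cface B n i (Ctau B n x))"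
        using i by (intro lin_comp[OF Cface_lin Ctau_lin]) auto
      show "lin_map (Cmod B n) (Cmod B (n - 1)) (\<lambda>x. Ctau B (n - 1) (Cface B n (i - 1) x))"
        using i by (intro lin_comp[OF Ctau_lin Cface_lin]) auto
      fix xs assume xs: "xs \<in> pw (Suc n) B"
      have fin: "fc B n k xs \<in> pw (Suc m) B" for k using fc_in[OF B xs, of k] n by simp
      show "Cface B n i (Ctau B n (ptens (replicate (Suc n) B) xs)) = Ctau B (n - 1) (Cface B n (i - 1) (ptens (replicate (Suc n) B) xs))"
        using i xs fc_rot[OF B len[OF xs] i] fin[of "i - 1"] n
        by (simp add: Ctau_pt Cface_pt rot_in del: replicate_Suc)
    qed }
  { fix x assume x: "x \<in> acar (Cmod B n)" and n1: "1 \<le> n"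
    show "Cface B n 0 (Ctau B n x) = Cface B n n x"
    proof (rule Cmod_ext[OF kmod_Cmod _ _ _ x])
      show "lin_map (Cmod B n) (Cmod B (n - 1)) (\<lambda>x. Cface B n 0 (Ctau B n x))"
        using n1 by (intro lin_comp[OF Cface_lin Ctau_lin]) auto
      show "lin_map (Cmod B n) (Cmod B (n - 1)) (Cface B n n)" using n1 by (intro Cface_lin)
      fix xs assume xs: "xs \<in> pw (Suc n) B"
      show "Cface B n 0 (Ctau B n (ptens (replicate (Suc n) B) xs)) = Cface B n n (ptens (replicate (Suc n) B) xs)"
        using n1 xs fc_rot_0[OF B n1, of xs] by (simp add: Ctau_pt Cface_pt rot_in del: replicate_Suc)
    qed }
  { fix x assume x: "x \<in> acar (Cmod B n)" and i: "1 \<le> i" "i \<le> n"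
    obtain i' where i': "i = Suc i'" using i by (cases i) auto
    show "Cdegen B n i (Ctau B n x) = Ctau B (Suc n) (Cdegen B n (i - 1) x)"
    proof (rule Cmod_ext[OF kmod_Cmod _ _ _ x])
      show "lin_map (Cmod B n) (Cmod B (Suc n)) (\<lambda>x. Cdegen B n i (Ctau B n x))"
        using i by (intro lin_comp[OF Cdegen_lin Ctau_lin]) auto
      show "lin_map (Cmod B n) (Cmod B (Suc n)) (\<lambda>x. Ctau B (Suc n) (Cdegen B n (i - 1) x))"
        using i by (intro lin_comp[OF Ctau_lin Cdegen_lin]) auto
      fix xs assume xs: "xs \<in> pw (Suc n) B"
      show "Cdegen B n i (Ctau B n (ptens (replicate (Suc n) B) xs)) = Ctau B (Suc n) (Cdegen B n (i - 1) (ptens (replicate (Suc n) B) xs))"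
        using i xs ins_rot[OF B len[OF xs] i] i'
        by (simp add: Ctau_pt Cdegen_pt rot_in ins_in[OF B] del: replicate_Suc)
    qed }
  { fix x assume x: "x \<in> acar (Cmod B n)"
    show "Cdegen B n 0 (Ctau B n x) = Ctau B (Suc n) (Ctau B (Suc n) (Cdegen B n n x))"
    proof (rule Cmod_ext[OF kmod_Cmod _ _ _ x])
      show "lin_map (Cmod B n) (Cmod B (Suc n)) (\<lambda>x. Cdegen B n 0 (Ctau B n x))"
        by (intro lin_comp[OF Cdegen_lin Ctau_lin]) auto
      show "lin_map (Cmod B n) (Cmod B (Suc n)) (\<lambda>x. Ctau B (Suc n) (Ctau B (Suc n) (Cdegen B n n x)))"
        by (intro lin_comp[OF Ctau_lin lin_comp[OF Ctau_lin Cdegen_lin]]) auto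
      fix xs assume xs: "xs \<in> pw (Suc n) B"
      have "xs \<noteq> []" using len[OF xs] by auto
      then show "Cdegen B n 0 (Ctau B n (ptens (replicate (Suc n) B) xs)) = Ctau B (Suc n) (Ctau B (Suc n) (Cdegen B n n (ptens (replicate (Suc n) B) xs)))"
        using xs ins_rot_0[OF B, of xs] len[OF xs]
        by (simp add: Ctau_pt Cdegen_pt rot_in ins_in[OF B] del: replicate_Suc)
    qed }
  { fix x assume x: "x \<in> acar (Cmod B n)"
    show "(Ctau B n ^^ Suc n) x = x"
    proof (rule Cmod_ext[OF kmod_Cmod Ctau_pow_lin lin_id _ x])
      fix xs assume xs: "xs \<in> pw (Suc n) B"
      show "(Ctau B n ^^ Suc n) (ptens (replicate (Suc n) B) xs) = ptens (replicate (Suc n) B) xs"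
        using Ctau_pow_pt[OF xs, of "Suc n"] rot_funpow_length[of xs] len[OF xs] by (simp del: replicate_Suc funpow.simps)
    qed }
qed

end

section \<open>The crossed product\<close>

context hopf_comodule_algebra
begin

abbreviation B where "B \<equiv> crossed H A D S r"

lemma crossed_simps [simp]: "acar B = acar (tmod [A, H])" "aadd B = aadd (tmod [A, H])"
  "azero B = azero (tmod [A, H])" "asmul B = asmul (tmod [A, H])"
  by (simp_all add: crossed_def)

lemma kmod_B: "is_kmod B"
  using kmod_tmod[of "[A, H]"] unfolding is_kmod_def crossed_simps .

lemma lin_map_B: "lin_map B N f \<longleftrightarrow> lin_map (tmod [A, H]) N f" "lin_map M B g \<longleftrightarrow> lin_map M (tmod [A, H]) g"
  by (simp_all add: lin_map_def)

lemma psum_B: "psum B L f = psum (tmod [A, H]) L f"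
  by (simp add: psum_def lsum_def)

abbreviation pt :: "'m \<Rightarrow> 'm \<Rightarrow> ('m list \<Rightarrow> 'k) set" where
  "pt a g \<equiv> ptens [A, H] [a, g]"

lemma pt_bilin: "bilin A H B pt"
  using bilin_ptens[OF kA kH] by (simp add: bilin_def lin_map_B)

lemmas pt_in = bilin_in[OF pt_bilin]

definition bl :: "('m list \<Rightarrow> 'k) set \<Rightarrow> ('m \<times> 'm) list" where
  "bl b = dec2 A H b"

lemma bl_in: "b \<in> acar B \<Longrightarrow> set (bl b) \<subseteq> acar A \<times> acar H"
  unfolding bl_def by (rule dec2_in[OF kA kH]) simp

lemma bl_lin: "is_kmod N \<Longrightarrow> bilin A H N f \<Longrightarrow> lin_map B N (\<lambda>b. psum N (bl b) f)"
  unfolding lin_map_B bl_def by (rule dec2_lin[OF kA kH])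

lemma bl_pt: "is_kmod N \<Longrightarrow> bilin A H N f \<Longrightarrow> a \<in> acar A \<Longrightarrow> g \<in> acar H \<Longrightarrow> psum N (bl (pt a g)) f = f a g"
  unfolding bl_def by (rule dec2_ptens[OF kA kH])

lemma bl_eq: "b \<in> acar B \<Longrightarrow> psum B (bl b) pt = b"
  unfolding psum_B bl_def by (rule dec2_eq[OF kA kH]) simp

lemma bl_apply: "is_kmod N \<Longrightarrow> lin_map B N f \<Longrightarrow> b \<in> acar B \<Longrightarrow> psum N (bl b) (\<lambda>a g. f (pt a g)) = f b"
  using lin_push2[OF kmod_B _ _ bl_in, of N f b pt] bl_eq[of b] pt_in by simp

lemma ibl_bilin: "is_kmod N \<Longrightarrow> bilin A H N f \<Longrightarrow> bilin H A N (\<lambda>g a. psum N (ibl g a) f)"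
  by (rule mover_lin[OF ibl_mover])

text \<open>The product of \<open>a \<otimes> g\<close> and \<open>b \<otimes> h\<close>, evaluated
  on a test map: \<open>g b\<close> is rewritten as b' g' by the inverse braiding. Having
  \<open>f\<close> as an argument lets products be nested without leaving sums over pure
  tensors.\<close>

definition cm :: "('k, 'n) alg \<Rightarrow> 'm \<Rightarrow> 'm \<Rightarrow> 'm \<Rightarrow> 'm \<Rightarrow> ('m \<Rightarrow> 'm \<Rightarrow> 'n) \<Rightarrow> 'n" where
  "cm N a g b h f = psum N (ibl g b) (\<lambda>b' g'. f (amul A a b') (amul H g' h))"

context
  fixes N :: "('k, 'n) alg" and f
  assumes N: "is_kmod N" and f: "bilin A H N f"
begin

lemma cm_inner: "a \<in> acar A \<Longrightarrow> h \<in> acar H \<Longrightarrow> bilin A H N (\<lambda>b' g'. f (amul A a b') (amul H g' h))"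
  by (rule AI N bilin1[OF f] bilin2[OF f] | assumption)+

lemma cm_bilin1: "b \<in> acar A \<Longrightarrow> h \<in> acar H \<Longrightarrow> bilin A H N (\<lambda>a g. cm N a g b h f)"
  unfolding cm_def
proof (rule bilinI)
  fix a assume "b \<in> acar A" "h \<in> acar H" "a \<in> acar A"
  then show "lin_map H N (\<lambda>g. psum N (ibl g b) (\<lambda>b' g'. f (amul A a b') (amul H g' h)))"
    by (intro bilin1[OF ibl_bilin[OF N cm_inner] lin_id])
next
  fix g assume "b \<in> acar A" "h \<in> acar H" "g \<in> acar H"
  then show "lin_map A N (\<lambda>a. psum N (ibl g b) (\<lambda>b' g'. f (amul A a b') (amul H g' h)))"
    by (intro lin_psum[OF N ibl_in]) (assumption | rule AI bilin1[OF f])+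
qed

lemma cm_bilin2: "a \<in> acar A \<Longrightarrow> g \<in> acar H \<Longrightarrow> bilin A H N (\<lambda>b h. cm N a g b h f)"
  unfolding cm_def
proof (rule bilinI)
  fix b assume "a \<in> acar A" "g \<in> acar H" "b \<in> acar A"
  then show "lin_map H N (\<lambda>h. psum N (ibl g b) (\<lambda>b' g'. f (amul A a b') (amul H g' h)))"
    by (intro lin_psum[OF N ibl_in]) (assumption | rule AI bilin2[OF f])+
next
  fix h assume "a \<in> acar A" "g \<in> acar H" "h \<in> acar H"
  then show "lin_map A N (\<lambda>b. psum N (ibl g b) (\<lambda>b' g'. f (amul A a b') (amul H g' h)))"
    by (intro bilin2[OF ibl_bilin[OF N cm_inner] lin_id])
qed

lemma cm_in: "a \<in> acar A \<Longrightarrow> g \<in> acar H \<Longrightarrow> b \<in> acar A \<Longrightarrow> h \<in> acar H \<Longrightarrow> cm N a g b h f \<in> acar N"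
  using bilin_in[OF cm_bilin2] .

lemma cm_bilin1_sum: "v \<in> acar B \<Longrightarrow> bilin A H N (\<lambda>a g. psum N (bl v) (\<lambda>b h. cm N a g b h f))"
  by (rule bilinI; rule lin_psum[OF N bl_in]) (assumption | rule bilin1[OF cm_bilin1 lin_id] bilin2[OF cm_bilin1 lin_id])+

lemma cm_bilin2_sum: "u \<in> acar B \<Longrightarrow> bilin A H N (\<lambda>b h. psum N (bl u) (\<lambda>a g. cm N a g b h f))"
  by (rule bilinI; rule lin_psum[OF N bl_in]) (assumption | rule bilin1[OF cm_bilin2 lin_id] bilin2[OF cm_bilin2 lin_id])+

end

text \<open>Summed over the coproduct of a coaction leg of \<open>b\<close>, the factor S^-1(b1) g
  b2 of the definition is \<open>qd\<close>. By \<open>qd_eq\<close> it is the inverse adjoint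
  action, so the product is governed by the inverse braiding.\<close>

lemma mul_B:
  assumes u: "u \<in> acar B" and v: "v \<in> acar B"
  shows "amul B u v = psum B (bl u) (\<lambda>a g. psum B (bl v) (\<lambda>b h. cm B a g b h pt))"
proof -
  let ?T = "tmod [A, H]"
  note k = kmod_tmod[of "[A, H]"]
  have ptT: "bilin A H ?T pt" by (rule bilin_ptens[OF kA kH])
  note PI = AI k bilin1[OF ptT] bilin2[OF ptT] bilin_in[OF ptT]
  have in1: "tlift [H, H, A] ?T (\<lambda>ws. pt (amul A a (ws ! Suc (Suc 0))) (amul H (amul H (amul H (Si (ws ! Suc 0)) g) (ws ! 0)) h))
      (coact2 H D A r b) = cm ?T a g b h pt"
    if i: "a \<in> acar A" "g \<in> acar H" "b \<in> acar A" "h \<in> acar H" for a g b h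
  proof -
    have t: "trilin H H A ?T (\<lambda>u v c. pt (amul A a c) (amul H (amul H (amul H (Si v) g) u) h))"
      by (rule PI i | assumption)+
    have "tlift [H, H, A] ?T (\<lambda>ws. pt (amul A a (ws ! Suc (Suc 0))) (amul H (amul H (amul H (Si (ws ! Suc 0)) g) (ws ! 0)) h))
      (coact2 H D A r b) = psum ?T (rl b) (\<lambda>x c. psum ?T (dl x) (\<lambda>u v. pt (amul A a c) (amul H (amul H (amul H (Si v) g) u) h)))"
      unfolding coact2_def One_nat_def using tcat_split_left[OF kH kH kA kH k t D_lin r_in[OF i(3)]]
      by (simp add: rl_def dl_def)
    also have "\<dots> = psum ?T (rl b) (\<lambda>x c. pt (amul A a c) (amul H (ad (Si x) g) h))"
    proof (rule psum_cong[OF rl_in[OF i(3)]])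
      fix x c assume j: "x \<in> acar H" "c \<in> acar A"
      have l: "lin_map H ?T (\<lambda>z. pt (amul A a c) (amul H z h))" by (rule PI i j | assumption)+
      have "psum ?T (dl x) (\<lambda>u v. pt (amul A a c) (amul H (amul H (amul H (Si v) g) u) h)) = pt (amul A a c) (amul H (qd x g) h)"
        unfolding qd_def by (rule lin_push2[OF kH k l dl_in[OF j(1)], symmetric]) (rule PI i j | assumption)+
      then show "psum ?T (dl x) (\<lambda>u v. pt (amul A a c) (amul H (amul H (amul H (Si v) g) u) h)) = pt (amul A a c) (amul H (ad (Si x) g) h)"
        by (simp add: qd_eq j i)
    qed
    finally show ?thesis by (simp add: cm_def psum_ibl)
  qed
  have u': "u \<in> acar ?T" and v': "v \<in> acar ?T" using u v by simp_all
  have elt: "xs ! 0 \<in> acar A \<and> xs ! Suc 0 \<in> acar H" if "xs \<in> lprod [A, H]" for xs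
    using that by (auto simp: pw_Suc)
  have "amul B u v = tlift [A, H] ?T (\<lambda>xs. tlift [A, H] ?T (\<lambda>ys. tlift [H, H, A] ?T
      (\<lambda>ws. pt (amul A (xs ! 0) (ws ! Suc (Suc 0))) (amul H (amul H (amul H (Si (ws ! Suc 0)) (xs ! Suc 0)) (ws ! 0)) (ys ! Suc 0)))
      (coact2 H D A r (ys ! 0))) v) u"
    by (simp add: crossed_def numeral_2_eq_2)
  also have "\<dots> = tlift [A, H] ?T (\<lambda>xs. tlift [A, H] ?T (\<lambda>ys. cm ?T (xs ! 0) (xs ! Suc 0) (ys ! 0) (ys ! Suc 0) pt) v) u"
    by (intro fun_cong[OF tlift_cong] in1) (simp_all add: elt)
  also have "\<dots> = tlift [A, H] ?T (\<lambda>xs. psum ?T (bl v) (\<lambda>b h. cm ?T (xs ! 0) (xs ! Suc 0) b h pt)) u"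
    unfolding bl_def
    by (intro fun_cong[OF tlift_cong] tlift_dec2[OF kA kH v' k] cm_bilin2[OF k ptT]) (simp_all add: elt)
  also have "\<dots> = psum ?T (bl u) (\<lambda>a g. psum ?T (bl v) (\<lambda>b h. cm ?T a g b h pt))"
    unfolding bl_def[of u] by (rule tlift_dec2[OF kA kH u' k cm_bilin1_sum[OF k ptT v]])
  finally show ?thesis by (simp add: psum_B cm_def)
qed

lemma bl_mul:
  assumes N: "is_kmod N" and f: "bilin A H N f" and u: "u \<in> acar B" and v: "v \<in> acar B"
  shows "psum N (bl (amul B u v)) f = psum N (bl u) (\<lambda>a g. psum N (bl v) (\<lambda>b h. cm N a g b h f))"
proof -
  note lin = bl_lin[OF N f]
  note cmi = cm_in[OF kmod_B pt_bilin]
  have "psum N (bl (amul B u v)) f = psum N (bl u) (\<lambda>a g. psum N (bl (psum B (bl v) (\<lambda>b h. cm B a g b h pt))) f)"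
    unfolding mul_B[OF u v]
    by (rule lin_push2[OF kmod_B N lin bl_in[OF u]], rule psum_in[OF kmod_B bl_in[OF v]]) (rule cmi)
  also have "\<dots> = psum N (bl u) (\<lambda>a g. psum N (bl v) (\<lambda>b h. psum N (bl (cm B a g b h pt)) f))"
    by (intro psum_cong[OF bl_in[OF u]] lin_push2[OF kmod_B N lin bl_in[OF v]] cmi)
  also have "\<dots> = psum N (bl u) (\<lambda>a g. psum N (bl v) (\<lambda>b h. cm N a g b h f))"
  proof (intro psum_cong[OF bl_in] u v)
    fix a g b h assume i: "a \<in> acar A" "g \<in> acar H" "b \<in> acar A" "h \<in> acar H"
    have "psum N (bl (cm B a g b h pt)) f = psum N (ibl g b) (\<lambda>b' g'. psum N (bl (pt (amul A a b') (amul H g' h))) f)"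
      unfolding cm_def by (rule lin_push2[OF kmod_B N lin ibl_in[OF i(2,3)]]) (rule pt_in AI i | assumption)+
    also have "\<dots> = cm N a g b h f"
      unfolding cm_def by (intro psum_cong[OF ibl_in] i bl_pt[OF N f]) (rule AI i | assumption)+
    finally show "psum N (bl (cm B a g b h pt)) f = cm N a g b h f" .
  qed
  finally show ?thesis .
qed

lemma mul_B_bilin: "bilin B B B (amul B)"
proof (rule bilinI)
  fix u assume u: "u \<in> acar B"
  have "lin_map B B (\<lambda>v. psum B (bl v) (\<lambda>b h. psum B (bl u) (\<lambda>a g. cm B a g b h pt)))"
    by (rule bl_lin[OF kmod_B cm_bilin2_sum[OF kmod_B pt_bilin u]])
  then show "lin_map B B (amul B u)"
  proof (rule lin_eqI[OF kmod_B])
    fix v assume v: "v \<in> acar B"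
    show "amul B u v = psum B (bl v) (\<lambda>b h. psum B (bl u) (\<lambda>a g. cm B a g b h pt))"
      unfolding mul_B[OF u v] by (rule psum_swap[OF kmod_B bl_in[OF u] bl_in[OF v]]) (rule cm_in[OF kmod_B pt_bilin])
  qed
next
  fix v assume v: "v \<in> acar B"
  have "lin_map B B (\<lambda>u. psum B (bl u) (\<lambda>a g. psum B (bl v) (\<lambda>b h. cm B a g b h pt)))"
    by (rule bl_lin[OF kmod_B cm_bilin1_sum[OF kmod_B pt_bilin v]])
  then show "lin_map B B (\<lambda>u. amul B u v)"
    by (rule lin_eqI[OF kmod_B]) (rule mul_B[OF _ v])
qed

lemma one_B: "aone B = pt (aone A) (aone H)"
  by (simp add: crossed_def)

lemma B_ext: "u \<in> acar B \<Longrightarrow> v \<in> acar B \<Longrightarrow> psum B (bl u) pt = psum B (bl v) pt \<Longrightarrow> u = v"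
  by (simp only: bl_eq)

lemma mul_B_1l: assumes v: "v \<in> acar B" shows "amul B (aone B) v = v"
proof (rule B_ext)
  have o: "aone B \<in> acar B" unfolding one_B by (intro pt_in oneA oneH)
  show "amul B (aone B) v \<in> acar B" by (rule bilin_in[OF mul_B_bilin o v])
  have "psum B (bl (amul B (aone B) v)) pt = psum B (bl v) (\<lambda>b h. cm B (aone A) (aone H) b h pt)"
    unfolding bl_mul[OF kmod_B pt_bilin o v] unfolding one_B
    by (rule bl_pt[OF kmod_B cm_bilin1_sum[OF kmod_B pt_bilin v] oneA oneH])
  also have "\<dots> = psum B (bl v) pt"
  proof (rule psum_cong[OF bl_in[OF v]])
    fix b h assume "b \<in> acar A" "h \<in> acar H"
    then show "cm B (aone A) (aone H) b h pt = pt b h"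
      unfolding cm_def by (subst ib_oneH[OF kmod_B cm_inner[OF kmod_B pt_bilin]]) (simp_all add: oneA unitA unitH)
  qed
  finally show "psum B (bl (amul B (aone B) v)) pt = psum B (bl v) pt" .
qed (rule v)

lemma mul_B_1r: assumes u: "u \<in> acar B" shows "amul B u (aone B) = u"
proof (rule B_ext)
  have o: "aone B \<in> acar B" unfolding one_B by (intro pt_in oneA oneH)
  show "amul B u (aone B) \<in> acar B" by (rule bilin_in[OF mul_B_bilin u o])
  have "psum B (bl (amul B u (aone B))) pt = psum B (bl u) (\<lambda>a g. cm B a g (aone A) (aone H) pt)"
    unfolding bl_mul[OF kmod_B pt_bilin u o] unfolding one_B
    by (intro psum_cong[OF bl_in[OF u]] bl_pt[OF kmod_B cm_bilin2[OF kmod_B pt_bilin]] oneA oneH)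
  also have "\<dots> = psum B (bl u) pt"
  proof (rule psum_cong[OF bl_in[OF u]])
    fix a g assume "a \<in> acar A" "g \<in> acar H"
    then show "cm B a g (aone A) (aone H) pt = pt a g"
      unfolding cm_def by (subst ib_oneA[OF kmod_B cm_inner[OF kmod_B pt_bilin]]) (simp_all add: oneH unitA unitH)
  qed
  finally show "psum B (bl (amul B u (aone B))) pt = psum B (bl u) pt" .
qed (rule u)

text \<open>As for any twisted tensor product: a letter of \<open>A\<close> crosses a product in
  \<open>H\<close> factor by factor (\<open>ib_mulH\<close>), a letter of \<open>H\<close> crosses a
  product in \<open>A\<close> factor by factor (\<open>ib_mulA\<close>), and both bracketings reach
  the same normal form.\<close>

lemma mul_B_assoc:
  assumes u: "u \<in> acar B" and v: "v \<in> acar B" and w: "w \<in> acar B"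
  shows "amul B (amul B u v) w = amul B u (amul B v w)"
proof (rule B_ext)
  have uv: "amul B u v \<in> acar B" and vw: "amul B v w \<in> acar B" using bilin_in[OF mul_B_bilin] u v w by blast+
  show "amul B (amul B u v) w \<in> acar B" "amul B u (amul B v w) \<in> acar B" using bilin_in[OF mul_B_bilin] u v w uv vw by blast+
  note cb = cm_bilin1_sum[OF kmod_B pt_bilin w]
  note PI = AI pt_in ibl_in psum_in[OF kmod_B ibl_in] psum_in[OF kmod_B bl_in]
  \<comment> \<open>The normal form of (a g)(b h)(c k): \<open>c\<close> has changed places with
    \<open>h\<close>, and then \<open>g\<close> has passed first \<open>b\<close> and next the
    resulting \<open>c1\<close>.\<close>
  let ?X = "\<lambda>a g b h c k. psum B (ibl h c) (\<lambda>c1 h1. psum B (ibl g b) (\<lambda>b1 g1. psum B (ibl g1 c1) (\<lambda>c2 g2.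
      pt (amul A a (amul A b1 c2)) (amul H g2 (amul H h1 k)))))"
  have "psum B (bl (amul B (amul B u v) w)) pt = psum B (bl u) (\<lambda>a g. psum B (bl v) (\<lambda>b h. psum B (ibl g b) (\<lambda>b' g'.
      psum B (bl w) (\<lambda>c k. cm B (amul A a b') (amul H g' h) c k pt))))"
    unfolding bl_mul[OF kmod_B pt_bilin uv w] bl_mul[OF kmod_B cb u v] unfolding cm_def[of _ _ _ _ _ "\<lambda>a g. psum B (bl w) (\<lambda>b h. cm B a g b h pt)"] ..
  also have "\<dots> = psum B (bl u) (\<lambda>a g. psum B (bl v) (\<lambda>b h. psum B (bl w) (\<lambda>c k. ?X a g b h c k)))"
  proof (intro psum_cong[OF bl_in] u v)
    fix a g b h assume i: "a \<in> acar A" "g \<in> acar H" "b \<in> acar A" "h \<in> acar H"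
    have "psum B (ibl g b) (\<lambda>b' g'. psum B (bl w) (\<lambda>c k. cm B (amul A a b') (amul H g' h) c k pt)) =
        psum B (bl w) (\<lambda>c k. psum B (ibl g b) (\<lambda>b' g'. cm B (amul A a b') (amul H g' h) c k pt))"
      by (rule psum_swap[OF kmod_B ibl_in[OF i(2,3)] bl_in[OF w]]) (rule cm_in[OF kmod_B pt_bilin] AI i | assumption)+
    also have "\<dots> = psum B (bl w) (\<lambda>c k. ?X a g b h c k)"
    proof (rule psum_cong[OF bl_in[OF w]])
      fix c k assume j: "c \<in> acar A" "k \<in> acar H"
      have "psum B (ibl g b) (\<lambda>b' g'. cm B (amul A a b') (amul H g' h) c k pt) =
          psum B (ibl g b) (\<lambda>b' g'. psum B (ibl h c) (\<lambda>c1 h1. psum B (ibl g' c1) (\<lambda>c2 g2. pt (amul A (amul A a b') c2) (amul H (amul H g2 h1) k))))"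
        unfolding cm_def
        by (intro psum_cong[OF ibl_in[OF i(2,3)]] ib_mulH[OF kmod_B cm_inner[OF kmod_B pt_bilin]]) (rule AI i j | assumption)+
      also have "\<dots> = psum B (ibl h c) (\<lambda>c1 h1. psum B (ibl g b) (\<lambda>b' g'. psum B (ibl g' c1) (\<lambda>c2 g2. pt (amul A (amul A a b') c2) (amul H (amul H g2 h1) k))))"
        by (rule psum_swap[OF kmod_B ibl_in[OF i(2,3)] ibl_in[OF i(4) j(1)]]) (rule PI i j | assumption)+
      also have "\<dots> = ?X a g b h c k"
      proof (intro psum_cong[OF ibl_in] i j)
        fix c1 h1 b1 g1 c2 g2
        assume x: "c1 \<in> acar A" "h1 \<in> acar H" "b1 \<in> acar A" "g1 \<in> acar H" "c2 \<in> acar A" "g2 \<in> acar H"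
        show "pt (amul A (amul A a b1) c2) (amul H (amul H g2 h1) k) = pt (amul A a (amul A b1 c2)) (amul H g2 (amul H h1 k))"
          using x i j by (simp only: assocA assocH)
      qed
      finally show "psum B (ibl g b) (\<lambda>b' g'. cm B (amul A a b') (amul H g' h) c k pt) = ?X a g b h c k" .
    qed
    finally show "psum B (ibl g b) (\<lambda>b' g'. psum B (bl w) (\<lambda>c k. cm B (amul A a b') (amul H g' h) c k pt)) = psum B (bl w) (\<lambda>c k. ?X a g b h c k)" .
  qed
  also have "\<dots> = psum B (bl u) (\<lambda>a g. psum B (bl v) (\<lambda>b h. psum B (bl w) (\<lambda>c k. cm B b h c k (\<lambda>b h. cm B a g b h pt))))"
  proof (intro psum_cong[OF bl_in] u v w)
    fix a g b h c k assume i: "a \<in> acar A" "g \<in> acar H" "b \<in> acar A" "h \<in> acar H" "c \<in> acar A" "k \<in> acar H"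
    show "?X a g b h c k = cm B b h c k (\<lambda>b h. cm B a g b h pt)"
      unfolding cm_def
      by (intro psum_cong[OF ibl_in[OF i(4,5)]] ib_mulA[OF kmod_B cm_inner[OF kmod_B pt_bilin], symmetric]) (rule AI i | assumption)+
  qed
  also have "\<dots> = psum B (bl u) (\<lambda>a g. psum B (bl (amul B v w)) (\<lambda>b h. cm B a g b h pt))"
    by (intro psum_cong[OF bl_in[OF u]] bl_mul[OF kmod_B cm_bilin2[OF kmod_B pt_bilin] v w, symmetric])
  also have "\<dots> = psum B (bl (amul B u (amul B v w))) pt"
    by (rule bl_mul[OF kmod_B pt_bilin u vw, symmetric])
  finally show "psum B (bl (amul B (amul B u v) w)) pt = psum B (bl (amul B u (amul B v w))) pt" .
qed

lemma algB: "is_kalg B"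
proof -
  have o: "aone B \<in> acar B" unfolding one_B by (intro pt_in oneA oneH)
  note l = bilin1[OF mul_B_bilin lin_id] bilin2[OF mul_B_bilin lin_id]
  show ?thesis
    unfolding is_kalg_def
    by (intro conjI allI ballI)
      (assumption | rule kmod_B o bilin_in[OF mul_B_bilin] mul_B_assoc mul_B_1l mul_B_1r
        lin_add[OF l(1)] lin_add[OF l(2)] lin_smul[OF l(1)] lin_smul[OF l(2)])+
qed

end

section \<open>The cylindrical module on pure tensors\<close>

text \<open>Keeps an \<open>H\<close> word and an \<open>A\<close> word as separate arguments; by
  \<open>mlin_append\<close> this amounts to multilinearity on the concatenated word.\<close>

definition ml2 :: "nat \<Rightarrow> ('k::comm_ring_1, 'x) alg \<Rightarrow> nat \<Rightarrow> ('k, 'c) alg \<Rightarrow> ('k, 'n) alg \<Rightarrow> ('x list \<Rightarrow> 'c list \<Rightarrow> 'n) \<Rightarrow> bool" where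
  "ml2 p X q C N k \<longleftrightarrow> (\<forall>xs\<in>pw p X. mlin (replicate q C) N (k xs)) \<and> (\<forall>cs\<in>pw q C. mlin (replicate p X) N (\<lambda>xs. k xs cs))"

lemma ml2I: "(\<And>xs. xs \<in> pw p X \<Longrightarrow> mlin (replicate q C) N (k xs)) \<Longrightarrow>
    (\<And>cs. cs \<in> pw q C \<Longrightarrow> mlin (replicate p X) N (\<lambda>xs. k xs cs)) \<Longrightarrow> ml2 p X q C N k"
  and ml2D1: "ml2 p X q C N k \<Longrightarrow> xs \<in> pw p X \<Longrightarrow> mlin (replicate q C) N (k xs)"
  and ml2D2: "ml2 p X q C N k \<Longrightarrow> cs \<in> pw q C \<Longrightarrow> mlin (replicate p X) N (\<lambda>xs. k xs cs)"
  by (simp_all add: ml2_def)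

lemma ml2_sym: "ml2 p X q C N k \<Longrightarrow> ml2 q C p X N (\<lambda>cs xs. k xs cs)"
  by (simp add: ml2_def)

lemma ml2_in: "ml2 p X q C N k \<Longrightarrow> xs \<in> pw p X \<Longrightarrow> cs \<in> pw q C \<Longrightarrow> k xs cs \<in> acar N"
  using mlin_in[OF ml2D1] .

lemma ml2_mrg:
  assumes X: "is_kalg X" and k: "ml2 p X q C N k" and i: "i < p"
  shows "ml2 (Suc p) X q C N (\<lambda>xs cs. k (mrg X i xs) cs)"
  by (rule ml2I, rule ml2D1[OF k mrg_in[OF X _ i]], assumption, rule mlin_mrg[OF X ml2D2[OF k] i])

lemma ml2_ins:
  assumes X: "is_kalg X" and k: "ml2 (Suc p) X q C N k" and i: "i \<le> p"
  shows "ml2 p X q C N (\<lambda>xs cs. k (ins X i xs) cs)"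
  by (rule ml2I, rule ml2D1[OF k ins_in[OF X]], assumption, rule mlin_ins[OF X ml2D2[OF k] i])

lemma ml2_mlc: "ml2 p X (Suc q) C N k \<Longrightarrow> cs \<in> pw q C \<Longrightarrow> mlc p X C N (\<lambda>xs c. k xs (c # cs))"
  unfolding ml2_def mlc_def by auto

lemma ml2_mlc': "ml2 (Suc p) X q C N k \<Longrightarrow> xs \<in> pw p X \<Longrightarrow> mlc q C X N (\<lambda>cs x. k (x # xs) cs)"
  unfolding ml2_def mlc_def by auto

lemma mv_ml2:
  assumes m: "mover N C X m" and kk: "is_kmod C" "is_kmod X" and k: "ml2 p X (Suc q) C N k"
  shows "ml2 p X (Suc q) C N (\<lambda>xs cs. psum N (mv m (hd cs) xs) (\<lambda>xs' c'. k xs' (c' # tl cs)))"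
proof (rule ml2I)
  note N = mover_kmod[OF m]
  have mlcs: "mlc p X C N (\<lambda>xs c. psum N (mv m c xs) (\<lambda>xs' c'. k xs' (c' # cs)))" if "cs \<in> pw q C" for cs
    by (rule mv_mlc[OF m kk ml2_mlc[OF k that]])
  fix xs assume xs: "xs \<in> pw p X"
  show "mlin (replicate (Suc q) C) N (\<lambda>cs. psum N (mv m (hd cs) xs) (\<lambda>xs' c'. k xs' (c' # tl cs)))"
    unfolding replicate_Suc mlin.simps list.sel
  proof (intro conjI ballI)
    fix c assume c: "c \<in> acar C"
    show "mlin (replicate q C) N (\<lambda>cs. psum N (mv m c xs) (\<lambda>xs' c'. k xs' (c' # cs)))"
      by (rule mlin_psum[OF N mv_in[OF m c xs]]) (use ml2D1[OF k] in auto)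
  next
    fix cs assume "cs \<in> pw q C"
    then show "lin_map C N (\<lambda>c. psum N (mv m c xs) (\<lambda>xs' c'. k xs' (c' # cs)))" using mlcs xs by (simp add: mlc_def)
  qed
next
  fix cs assume "cs \<in> pw (Suc q) C"
  then obtain d ds where "cs = d # ds" "d \<in> acar C" "ds \<in> pw q C" by (auto simp: pw_Suc)
  then show "mlin (replicate p X) N (\<lambda>xs. psum N (mv m (hd cs) xs) (\<lambda>xs' c'. k xs' (c' # tl cs)))"
    using mv_mlc[OF m kk ml2_mlc[OF k, of ds]] by (simp add: mlc_def)
qed

lemma ml2_rot:
  assumes k: "ml2 p X (Suc q) C N k" shows "ml2 p X (Suc q) C N (\<lambda>xs cs. k xs (rot cs))"
  by (rule ml2I, rule mlin_rot_pw[OF ml2D1[OF k]], assumption, rule ml2D2[OF k rot_in])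

text \<open>The pattern common to both cyclic operators: the last letter of one word travels through
  the other word and is then put in front of what remains of its own.\<close>

lemma mv_rot_ml2:
  assumes m: "mover N C X m" and kk: "is_kmod C" "is_kmod X" and k: "ml2 p X (Suc q) C N k"
  shows "ml2 p X (Suc q) C N (\<lambda>xs cs. psum N (mv m (last cs) xs) (\<lambda>xs' c'. k xs' (c' # butlast cs)))"
  using ml2_rot[OF mv_ml2[OF assms]] by (simp add: rot_def)

lemma map2_in: "hs \<in> lprod (replicate n X) \<Longrightarrow> gs \<in> lprod (replicate n X) \<Longrightarrow>
    (\<And>h g. h \<in> acar X \<Longrightarrow> g \<in> acar X \<Longrightarrow> f h g \<in> acar X) \<Longrightarrow> map2 f hs gs \<in> lprod (replicate n X)"
proof (induction n arbitrary: hs gs)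
  case (Suc n)
  then show ?case by (auto simp: pw_Suc)
qed simp

lemma mlin_map2:
  assumes b: "bilin X X X f"
  shows "mlin (replicate n X) N k \<Longrightarrow> gs \<in> pw n X \<Longrightarrow> mlin (replicate n X) N (\<lambda>hs. k (map2 f hs gs))"
proof (induction n arbitrary: k gs)
  case (Suc n)
  obtain g gs' where gs: "gs = g # gs'" "g \<in> acar X" "gs' \<in> pw n X" using Suc.prems by (auto simp: pw_Suc)
  note k = Suc.prems(1)[simplified]
  show ?case
    unfolding gs(1) replicate_Suc mlin.simps zip_Cons_Cons list.map case_prod_conv
  proof (intro conjI ballI)
    fix h assume "h \<in> acar X"
    then show "mlin (replicate n X) N (\<lambda>hs. k (f h g # map2 f hs gs'))"
      using k bilin_in[OF b _ gs(2)] by (intro Suc.IH[OF _ gs(3)]) auto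
  next
    fix hs assume "hs \<in> pw n X"
    then have "map2 f hs gs' \<in> pw n X" using gs(3) bilin_in[OF b] by (rule map2_in)
    then have l: "lin_map X N (\<lambda>z. k (z # map2 f hs gs'))" using k by simp
    show "lin_map X N (\<lambda>h. k (f h g # map2 f hs gs'))" by (rule lin_comp[OF l bilin1[OF b lin_id gs(2)]])
  qed
qed simp

lemma tlift_tcat_pt:
  assumes k: "kmods Ms" "kmods Ns" and N: "is_kmod N" and f: "mlin (Ms @ Ns) N f" and xs: "xs \<in> lprod Ms"
    and v: "v \<in> acar (tmod Ns)"
  shows "tlift (Ms @ Ns) N f (tcat Ms Ns (ptens Ms xs) v) = tlift Ns N (\<lambda>ys. f (xs @ ys)) v"
proof (rule tmod_ext[OF N _ _ _ v])
  have kk: "kmods (Ms @ Ns)" using k by simp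
  have f1: "mlin Ns N (\<lambda>ys. f (xs @ ys))" using f xs by (simp add: mlin_append)
  show "lin_map (tmod Ns) N (\<lambda>v. tlift (Ms @ Ns) N f (tcat Ms Ns (ptens Ms xs) v))"
    by (rule lin_comp[OF tlift_lin[OF N f kk] tcat_lin2[OF k ptens_in[OF xs]]])
  show "lin_map (tmod Ns) N (tlift Ns N (\<lambda>ys. f (xs @ ys)))" by (rule tlift_lin[OF N f1 k(2)])
  fix ys assume ys: "ys \<in> lprod Ns"
  show "tlift (Ms @ Ns) N f (tcat Ms Ns (ptens Ms xs) (ptens Ns ys)) = tlift Ns N (\<lambda>ys. f (xs @ ys)) (ptens Ns ys)"
    by (simp add: tcat_ptens[OF k xs ys] tlift_ptens[OF N f kk] tlift_ptens[OF N f1 k(2)] lprod_appendI xs ys)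
qed

lemma even_part_Nil: "even_part [] = []" and odd_part_Nil: "odd_part [] = []"
  by (simp_all add: even_part_def odd_part_def)

lemma even_part_Cons: "even_part (x # b # ws) = x # even_part ws"
  and odd_part_Cons: "odd_part (x # b # ws) = b # odd_part ws"
proof -
  have "[0..<length (x # b # ws) div 2] = 0 # map Suc [0..<length ws div 2]"
    by (simp add: upt_conv_Cons map_Suc_upt del: upt_Suc)
  then show "even_part (x # b # ws) = x # even_part ws" "odd_part (x # b # ws) = b # odd_part ws"
    by (simp_all add: even_part_def odd_part_def)
qed

section \<open>Iterated coproducts: the vertical operators as braidings\<close>

context hopf_comodule_algebra
begin

text \<open>The iterated coproduct expanded at its last leg, so that the recursion follows a word
  from the left. \<open>icop\<close> expands at the first leg instead, and
  \<open>icl_split_head\<close> reconciles the two. The head is kept apart because there is always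
  at least one leg.\<close>

primrec icl :: "nat \<Rightarrow> 'm \<Rightarrow> ('m \<times> 'm list) list" where
  "icl 0 h = [(h, [])]"
| "icl (Suc n) h = pbind (dl h) (\<lambda>x y. pbind (icl n y) (\<lambda>z zs. [(x, z # zs)]))"

lemma icl_in: "h \<in> acar H \<Longrightarrow> set (icl n h) \<subseteq> acar H \<times> pw n H"
proof (induction n arbitrary: h)
  case (Suc n)
  then show ?case unfolding icl.simps by (intro pbind_in[OF dl_in] pbind_in[OF Suc.IH]) auto
qed simp

lemma psum_icl_Suc:
  assumes N: "is_kmod N" and h: "h \<in> acar H" and f: "\<And>x zs. x \<in> acar H \<Longrightarrow> zs \<in> pw (Suc n) H \<Longrightarrow> f x zs \<in> acar N"
  shows "psum N (icl (Suc n) h) f = psum N (dl h) (\<lambda>x y. psum N (icl n y) (\<lambda>z zs. f x (z # zs)))"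
proof -
  have "psum N (icl (Suc n) h) f = psum N (dl h) (\<lambda>x y. psum N (pbind (icl n y) (\<lambda>z zs. [(x, z # zs)])) f)"
    unfolding icl.simps
    by (rule psum_bind[OF N dl_in[OF h], where U = "acar H" and V = "pw (Suc n) H"], rule pbind_in[OF icl_in]) (auto intro: f)
  also have "\<dots> = psum N (dl h) (\<lambda>x y. psum N (icl n y) (\<lambda>z zs. psum N [(x, z # zs)] f))"
    by (intro psum_cong[OF dl_in[OF h]] psum_bind[OF N icl_in, where U = "acar H" and V = "pw (Suc n) H"]) (auto intro: f)
  also have "\<dots> = psum N (dl h) (\<lambda>x y. psum N (icl n y) (\<lambda>z zs. f x (z # zs)))"
    by (intro psum_cong[OF dl_in[OF h]] psum_cong[OF icl_in] psum_single[OF N]) (auto intro: f)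
  finally show ?thesis .
qed

lemma icl_lin: "is_kmod N \<Longrightarrow> mlin (replicate (Suc n) H) N (\<lambda>zs. f (hd zs) (tl zs)) \<Longrightarrow> lin_map H N (\<lambda>h. psum N (icl n h) f)"
proof (induction n arbitrary: f)
  case 0
  then have l: "lin_map H N (\<lambda>x. f x [])" by simp
  then show ?case by (rule lin_eqI[OF kH]) (simp add: psum_single lin_in[OF l] 0)
next
  case (Suc n)
  note f = Suc.prems(2)[unfolded replicate_Suc[of "Suc n"] mlin.simps(2)[of H "replicate (Suc n) H"] list.sel]
  have fi: "f x zs \<in> acar N" if "x \<in> acar H" "zs \<in> pw (Suc n) H" for x zs
    using mlin_in[OF Suc.prems(2), of "x # zs"] that by simp
  have "bilin H H N (\<lambda>x y. psum N (icl n y) (\<lambda>z zs. f x (z # zs)))"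
  proof (rule bilinI)
    fix x assume x: "x \<in> acar H"
    have "mlin (replicate (Suc n) H) N (\<lambda>zs. f x (hd zs # tl zs))"
      by (subst mlin_cong[where g = "f x"]) (use f x kH in \<open>auto simp: kmods_replicate pw_Suc\<close>)
    then show "lin_map H N (\<lambda>y. psum N (icl n y) (\<lambda>z zs. f x (z # zs)))"
      by (rule Suc.IH[OF Suc.prems(1)])
  next
    fix y assume y: "y \<in> acar H"
    show "lin_map H N (\<lambda>x. psum N (icl n y) (\<lambda>z zs. f x (z # zs)))"
      by (rule lin_psum[OF Suc.prems(1) icl_in[OF y]]) (use f in auto)
  qed
  then have "lin_map H N (\<lambda>h. psum N (dl h) (\<lambda>x y. psum N (icl n y) (\<lambda>z zs. f x (z # zs))))"
    by (rule dl_lin[OF Suc.prems(1) lin_id])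
  then show ?case by (rule lin_eqI[OF kH]) (rule psum_icl_Suc[OF Suc.prems(1) _ fi])
qed

text \<open>On nonempty words the rewriting changes nothing; it produces the shape with separated
  head and tail that \<open>icl_lin\<close> expects.\<close>

lemma mlin_uncons: "is_kmod M \<Longrightarrow> mlin (replicate (Suc n) M) N f \<Longrightarrow> mlin (replicate (Suc n) M) N (\<lambda>zs. f (hd zs # tl zs))"
  by (subst mlin_cong[where g = f]) (auto simp: kmods_replicate pw_Suc)

text \<open>Generalised coassociativity. Only the first two legs are regrouped: after independent
  sums are exchanged, a single use of coassociativity suffices.\<close>

lemma icl_split_head:
  assumes N: "is_kmod N" and f: "mlin (replicate (Suc (Suc n)) H) N f" and h: "h \<in> acar H"
  shows "psum N (icl n h) (\<lambda>z zs. psum N (dl z) (\<lambda>u v. f (u # v # zs))) = psum N (icl (Suc n) h) (\<lambda>z zs. f (z # zs))"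
proof (cases n)
  case 0
  have fi: "f [x, y] \<in> acar N" if "x \<in> acar H" "y \<in> acar H" for x y
    using mlin_in[OF f, of "[x, y]"] that 0 by simp
  have "psum N (icl (Suc 0) h) (\<lambda>z zs. f (z # zs)) = psum N (dl h) (\<lambda>x y. psum N (icl 0 y) (\<lambda>z zs. f (x # z # zs)))"
    by (rule psum_icl_Suc[OF N h]) (use mlin_in[OF f] 0 in auto)
  also have "\<dots> = psum N (dl h) (\<lambda>u v. f [u, v])"
    by (rule psum_cong[OF dl_in[OF h]]) (simp add: psum_single[OF N] fi)
  finally show ?thesis by (simp only: 0 icl.simps(1)) (subst psum_single[OF N], auto intro: psum_in[OF N dl_in[OF h]] fi)
next
  case (Suc m)
  have fi: "f zs \<in> acar N" if "zs \<in> pw (Suc (Suc (Suc m))) H" for zs using mlin_in[OF f] that Suc by simp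
  have "psum N (icl n h) (\<lambda>z zs. psum N (dl z) (\<lambda>u v. f (u # v # zs))) =
      psum N (dl h) (\<lambda>x y. psum N (icl m y) (\<lambda>z zs. psum N (dl x) (\<lambda>u v. f (u # v # z # zs))))"
    unfolding Suc by (rule psum_icl_Suc[OF N h], rule psum_in[OF N dl_in]) (auto intro!: fi)
  also have "\<dots> = psum N (dl h) (\<lambda>x y. psum N (dl x) (\<lambda>u v. psum N (icl m y) (\<lambda>z zs. f (u # v # z # zs))))"
    by (intro psum_cong[OF dl_in[OF h]] psum_swap[OF N icl_in dl_in]) (auto intro!: fi)
  also have "\<dots> = psum N (dl h) (\<lambda>x w. psum N (dl w) (\<lambda>v y. psum N (icl m y) (\<lambda>z zs. f (x # v # z # zs))))"
  proof (rule coassoc[OF N _ h], rule trilinI)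
    fix u v assume uv: "u \<in> acar H" "v \<in> acar H"
    have "mlin (replicate (Suc m) H) N (\<lambda>zs. f (u # v # zs))" using f uv Suc by simp
    then show "lin_map H N (\<lambda>y. psum N (icl m y) (\<lambda>z zs. f (u # v # z # zs)))"
      by (intro icl_lin[OF N] mlin_uncons[OF kH])
  next
    fix u y assume uy: "u \<in> acar H" "y \<in> acar H"
    show "lin_map H N (\<lambda>v. psum N (icl m y) (\<lambda>z zs. f (u # v # z # zs)))"
      by (rule lin_psum[OF N icl_in[OF uy(2)]]) (use f uy Suc in auto)
  next
    fix v y assume vy: "v \<in> acar H" "y \<in> acar H"
    show "lin_map H N (\<lambda>u. psum N (icl m y) (\<lambda>z zs. f (u # v # z # zs)))"
      by (rule lin_psum[OF N icl_in[OF vy(2)]]) (use f vy Suc in auto)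
  qed
  also have "\<dots> = psum N (dl h) (\<lambda>x w. psum N (icl (Suc m) w) (\<lambda>z zs. f (x # z # zs)))"
    by (intro psum_cong[OF dl_in[OF h]] psum_icl_Suc[OF N, symmetric]) (auto intro!: fi)
  also have "\<dots> = psum N (icl (Suc (Suc m)) h) (\<lambda>z zs. f (z # zs))"
    by (rule psum_icl_Suc[OF N h, symmetric]) (auto intro!: fi)
  finally show ?thesis by (simp only: Suc)
qed

lemma icop_split_mlin:
  "mlin (replicate (Suc n) H) (tmod (replicate (Suc (Suc n)) H)) (\<lambda>zs. tcat [H, H] (replicate n H) (D (hd zs)) (ptens (replicate n H) (tl zs)))"
proof -
  have k: "kmods [H, H]" "kmods (replicate n H)" by (simp_all add: kH kmods_replicate)
  have "mlin (replicate n H) (tmod ([H, H] @ replicate n H)) (\<lambda>zs. tcat [H, H] (replicate n H) (D z) (ptens (replicate n H) zs))"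
    if "z \<in> acar H" for z
    by (rule mlin_comp[OF tcat_lin2[OF k D_in[OF that]] mlin_ptens[OF k(2)]])
  moreover have "lin_map H (tmod ([H, H] @ replicate n H)) (\<lambda>z. tcat [H, H] (replicate n H) (D z) (ptens (replicate n H) zs))"
    if "zs \<in> pw n H" for zs
    by (rule lin_comp[OF tcat_lin1[OF k ptens_in[OF that]] D_lin])
  ultimately show ?thesis by simp
qed

lemma icop_in: "h \<in> acar H \<Longrightarrow> icop H D n h \<in> acar (tmod (replicate (Suc n) H))"
proof (induction n)
  case 0
  then show ?case by (simp add: ptens_in)
next
  case (Suc n)
  then show ?case
    unfolding icop.simps
    by (intro lin_in[OF tlift_lin[OF kmod_tmod icop_split_mlin kmods_replicate[OF kH]]])
qed

text \<open>The outer lift is pushed inside the lift that defines \<open>icop\<close>; the coproduct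
  added last is then a splitting of the head, which \<open>icl_split_head\<close> absorbs.\<close>

lemma tlift_icop: "is_kmod N \<Longrightarrow> mlin (replicate (Suc n) H) N f \<Longrightarrow> h \<in> acar H \<Longrightarrow>
    tlift (replicate (Suc n) H) N f (icop H D n h) = psum N (icl n h) (\<lambda>z zs. f (z # zs))"
proof (induction n arbitrary: f)
  case 0
  have f: "mlin [H] N f" using 0 by simp
  have "f [h] \<in> acar N" using mlin_in[OF f, of "[h]"] 0 by simp
  then show ?case using 0 by (simp add: tlift_ptens[OF 0(1) f] kH psum_single)
next
  case (Suc n)
  note N = Suc.prems(1) and f = Suc.prems(2)
  let ?T = "tmod (replicate (Suc (Suc n)) H)"
  let ?L = "\<lambda>zs. tcat [H, H] (replicate n H) (D (hd zs)) (ptens (replicate n H) (tl zs))"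
  let ?F = "tlift (replicate (Suc (Suc n)) H) N f"
  have k: "kmods [H, H]" "kmods (replicate n H)" by (simp_all add: kH kmods_replicate)
  note kk = kmods_replicate[OF kH]
  have Fl: "lin_map ?T N ?F" by (rule tlift_lin[OF N f kk])
  have FL: "mlin (replicate (Suc n) H) N (\<lambda>zs. ?F (?L zs))" by (rule mlin_comp[OF Fl icop_split_mlin])
  have "?F (icop H D (Suc n) h) = ?F (tlift (replicate (Suc n) H) ?T ?L (icop H D n h))" by simp
  also have "\<dots> = tlift (replicate (Suc n) H) N (\<lambda>zs. ?F (?L zs)) (icop H D n h)"
  proof (rule tmod_ext[OF N _ _ _ icop_in[OF Suc.prems(3)]])
    show "lin_map (tmod (replicate (Suc n) H)) N (\<lambda>u. ?F (tlift (replicate (Suc n) H) ?T ?L u))"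
      by (rule lin_comp[OF Fl tlift_lin[OF kmod_tmod icop_split_mlin kk]])
    show "lin_map (tmod (replicate (Suc n) H)) N (tlift (replicate (Suc n) H) N (\<lambda>zs. ?F (?L zs)))"
      by (rule tlift_lin[OF N FL kk])
    fix zs assume zs: "zs \<in> pw (Suc n) H"
    show "?F (tlift (replicate (Suc n) H) ?T ?L (ptens (replicate (Suc n) H) zs)) =
        tlift (replicate (Suc n) H) N (\<lambda>zs. ?F (?L zs)) (ptens (replicate (Suc n) H) zs)"
      by (simp only: tlift_ptens[OF kmod_tmod icop_split_mlin kk zs] tlift_ptens[OF N FL kk zs])
  qed
  also have "\<dots> = psum N (icl n h) (\<lambda>z zs. ?F (?L (z # zs)))"
    by (rule Suc.IH[OF N FL Suc.prems(3)])
  also have "\<dots> = psum N (icl n h) (\<lambda>z zs. psum N (dl z) (\<lambda>u v. f (u # v # zs)))"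
  proof (rule psum_cong[OF icl_in[OF Suc.prems(3)]])
    fix z zs assume z: "z \<in> acar H" and zs: "zs \<in> pw n H"
    have "?F (?L (z # zs)) = ?F (tcat [H, H] (replicate n H) (psum (tmod [H, H]) (dl z) (\<lambda>u v. ptens [H, H] [u, v])) (ptens (replicate n H) zs))"
      unfolding dl_def by (simp add: dec2_eq[OF kH kH D_in[OF z]])
    also have "\<dots> = psum N (dl z) (\<lambda>u v. ?F (tcat [H, H] (replicate n H) (ptens [H, H] [u, v]) (ptens (replicate n H) zs)))"
    proof (rule lin_push2[OF kmod_tmod N _ dl_in[OF z]])
      show "lin_map (tmod [H, H]) N (\<lambda>u. ?F (tcat [H, H] (replicate n H) u (ptens (replicate n H) zs)))"
        using lin_comp[OF Fl, of "tmod [H, H]"] tcat_lin1[OF k ptens_in[OF zs]] by simp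
    qed (simp add: ptens_in)
    also have "\<dots> = psum N (dl z) (\<lambda>u v. f (u # v # zs))"
    proof (rule psum_cong[OF dl_in[OF z]])
      fix u v assume uv: "u \<in> acar H" "v \<in> acar H"
      have "tcat [H, H] (replicate n H) (ptens [H, H] [u, v]) (ptens (replicate n H) zs) = ptens (replicate (Suc (Suc n)) H) (u # v # zs)"
        using tcat_ptens[OF k, of "[u, v]" zs] uv zs by simp
      moreover have "u # v # zs \<in> pw (Suc (Suc n)) H" using uv zs by simp
      ultimately show "?F (tcat [H, H] (replicate n H) (ptens [H, H] [u, v]) (ptens (replicate n H) zs)) = f (u # v # zs)"
        by (simp only: tlift_ptens[OF N f kk])
    qed
    finally show "?F (?L (z # zs)) = psum N (dl z) (\<lambda>u v. f (u # v # zs))" .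
  qed
  also have "\<dots> = psum N (icl (Suc n) h) (\<lambda>z zs. f (z # zs))"
    by (rule icl_split_head[OF N f Suc.prems(3)])
  finally show ?case .
qed

text \<open>Coassociativity of the coaction trades the coproduct of \<open>x\<close> for another
  coaction on \<open>b\<close>. Acting diagonally through an iterated coproduct is therefore the
  same as crossing the letters one by one.\<close>

lemma icl_mv:
  assumes N: "is_kmod N"
  shows "mlc (Suc p) H A N f \<Longrightarrow> a \<in> acar A \<Longrightarrow> gs \<in> pw (Suc p) H \<Longrightarrow>
    psum N (rl a) (\<lambda>x b. psum N (icl p x) (\<lambda>z zs. f (map2 ad (z # zs) gs) b)) = psum N (mv brl a gs) f"
proof (induction p arbitrary: f a gs)
  case 0
  then obtain g where gs: "gs = [g]" "g \<in> acar H" by (auto simp: pw_Suc)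
  have fi: "f [x] b \<in> acar N" if "x \<in> acar H" "b \<in> acar A" for x b
    using mlc_in[OF 0(1), of "[x]" b] that by simp
  have "psum N (mv brl a [g]) f = psum N (brl a g) (\<lambda>g' a'. psum N (mv brl a' []) (\<lambda>xs' c''. f (g' # xs') c''))"
    by (rule psum_mv_Cons[OF brl_mover[OF N] 0(2) gs(2), where n = 0]) (use mlc_in[OF 0(1)] in auto)
  also have "\<dots> = psum N (brl a g) (\<lambda>g' a'. f [g'] a')"
    by (rule psum_cong[OF brl_in[OF 0(2) gs(2)]]) (simp add: psum_single[OF N] fi)
  also have "\<dots> = psum N (rl a) (\<lambda>x b. psum N (icl 0 x) (\<lambda>z zs. f (map2 ad (z # zs) [g]) b))"
    unfolding psum_brl by (rule psum_cong[OF rl_in[OF 0(2)]]) (simp add: psum_single[OF N] fi ad_in gs)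
  finally show ?case by (simp add: gs)
next
  case (Suc p)
  obtain g gs' where gs: "gs = g # gs'" "g \<in> acar H" "gs' \<in> pw (Suc p) H" using Suc.prems(3) by (auto simp: pw_Suc)
  note f = Suc.prems(1) and a = Suc.prems(2)
  have m2: "map2 ad zs gs' \<in> pw (Suc p) H" if "zs \<in> pw (Suc p) H" for zs
    using map2_in[OF that gs(3)] ad_in by blast
  have fi: "f (x # map2 ad zs gs') b \<in> acar N" if "x \<in> acar H" "zs \<in> pw (Suc p) H" "b \<in> acar A" for x zs b
    using mlc_in[OF f, of "x # map2 ad zs gs'" b] m2[OF that(2)] that by simp
  have f1: "mlin (replicate (Suc p) H) N (\<lambda>zs. f (x # zs) b)" if "x \<in> acar H" "b \<in> acar A" for x b
    using f that by (simp add: mlc_def)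
  have "psum N (rl a) (\<lambda>x b. psum N (icl (Suc p) x) (\<lambda>z zs. f (map2 ad (z # zs) gs) b)) =
      psum N (rl a) (\<lambda>x b. psum N (dl x) (\<lambda>u v. psum N (icl p v) (\<lambda>z zs. f (ad u g # map2 ad (z # zs) gs') b)))"
    unfolding gs(1) zip_Cons_Cons list.map case_prod_conv
    by (intro psum_cong[OF rl_in[OF a]] psum_icl_Suc[OF N]) (use fi ad_in gs(2) in auto)
  also have "\<dots> = psum N (rl a) (\<lambda>x b. psum N (rl b) (\<lambda>y c. psum N (icl p y) (\<lambda>z zs. f (ad x g # map2 ad (z # zs) gs') c)))"
  proof (rule comod_coassoc[OF N _ a], rule trilinI)
    fix u v assume uv: "u \<in> acar H" "v \<in> acar H"
    show "lin_map A N (\<lambda>b. psum N (icl p v) (\<lambda>z zs. f (ad u g # map2 ad (z # zs) gs') b))"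
    proof (rule lin_psum[OF N icl_in[OF uv(2)]])
      fix z zs assume "z \<in> acar H" "zs \<in> pw p H"
      then have "ad u g # map2 ad (z # zs) gs' \<in> pw (Suc (Suc p)) H" using m2[of "z # zs"] ad_in uv gs by simp
      then show "lin_map A N (\<lambda>b. f (ad u g # map2 ad (z # zs) gs') b)" using f by (simp only: mlc_def)
    qed
  next
    fix u b assume ub: "u \<in> acar H" "b \<in> acar A"
    show "lin_map H N (\<lambda>v. psum N (icl p v) (\<lambda>z zs. f (ad u g # map2 ad (z # zs) gs') b))"
      by (rule icl_lin[OF N], rule mlin_uncons[OF kH, where f = "\<lambda>zs. f (ad u g # map2 ad zs gs') b"],
          rule mlin_map2[OF ad_bilin f1 gs(3)]) (use ub ad_in gs in auto)
  next
    fix v b assume vb: "v \<in> acar H" "b \<in> acar A"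
    show "lin_map H N (\<lambda>u. psum N (icl p v) (\<lambda>z zs. f (ad u g # map2 ad (z # zs) gs') b))"
    proof (rule lin_psum[OF N icl_in[OF vb(1)]])
      fix z zs assume "z \<in> acar H" "zs \<in> pw p H"
      then have i: "map2 ad (z # zs) gs' \<in> pw (Suc p) H" using m2[of "z # zs"] by simp
      show "lin_map H N (\<lambda>u. f (ad u g # map2 ad (z # zs) gs') b)"
        by (rule bilin1[OF mlc_Suc2[OF f i] bilin1[OF ad_bilin lin_id gs(2)] vb(2)])
    qed
  qed
  also have "\<dots> = psum N (rl a) (\<lambda>x b. psum N (mv brl b gs') (\<lambda>gs'' c. f (ad x g # gs'') c))"
    by (intro psum_cong[OF rl_in[OF a]] Suc.IH[OF mlc_Suc1[OF f] _ gs(3)] ad_in gs(2))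
  also have "\<dots> = psum N (brl a g) (\<lambda>g' a'. psum N (mv brl a' gs') (\<lambda>gs'' c. f (g' # gs'') c))"
    by (simp add: psum_brl)
  also have "\<dots> = psum N (mv brl a gs) f"
    unfolding gs(1) by (rule psum_mv_Cons[OF brl_mover[OF N] a gs(2,3) mlc_in[OF f], symmetric])
  finally show ?case .
qed

text \<open>The word \<open>w a\<close> is left open so that it can be the rotated word of the
  cyclic operator as well as the word with merged head of the last face.\<close>

lemma conj_tuple_mv:
  assumes gs: "gs \<in> pw (Suc p) H" and a: "a \<in> acar A"
    and w: "\<And>a. a \<in> acar A \<Longrightarrow> w a \<in> pw m A" and wl: "lin_map A (tmod (replicate m A)) (\<lambda>a. ptens (replicate m A) (w a))"
  shows "tlift [H, A] (tmod (replicate (Suc p) H @ replicate m A))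
      (\<lambda>ys. tcat (replicate (Suc p) H) (replicate m A) (conj_tuple H D S (ys ! 0) gs) (ptens (replicate m A) (w (ys ! 1)))) (r a)
    = psum (tmod (replicate (Suc p) H @ replicate m A)) (mv brl a gs)
        (\<lambda>gs' a'. ptens (replicate (Suc p) H @ replicate m A) (gs' @ w a'))"
proof -
  let ?Hs = "replicate (Suc p) H" and ?As = "replicate m A"
  let ?T = "tmod (?Hs @ ?As)"
  let ?f = "\<lambda>gs' b. ptens (?Hs @ ?As) (gs' @ w b)"
  have l: "length gs = Suc p" using lprod_length[OF gs] by simp
  have k: "kmods ?Hs" "kmods ?As" by (rule kmods_replicate[OF kH], rule kmods_replicate[OF kA])
  have kk: "kmods (?Hs @ ?As)" using k by simp
  have f: "mlc (Suc p) H A ?T ?f"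
  proof (rule mlcI)
    fix c assume "c \<in> acar A"
    then show "mlin ?Hs ?T (\<lambda>xs. ?f xs c)" using mlin_ptens[OF kk] w[of c] unfolding mlin_append by blast
  next
    fix xs assume xs: "xs \<in> pw (Suc p) H"
    have "lin_map A ?T (\<lambda>c. tcat ?Hs ?As (ptens ?Hs xs) (ptens ?As (w c)))"
      by (rule lin_comp[OF tcat_lin2[OF k ptens_in[OF xs]] wl])
    then show "lin_map A ?T (?f xs)"
      by (rule lin_eqI[OF kA]) (simp only: tcat_ptens[OF k xs w])
  qed
  have m2: "map2 ad zs gs \<in> pw (Suc p) H" if "zs \<in> pw (Suc p) H" for zs
    using map2_in[OF that gs] ad_in by blast
  let ?K = "\<lambda>x b. psum ?T (icl p x) (\<lambda>z zs. ?f (map2 ad (z # zs) gs) b)"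
  have ct: "tcat ?Hs ?As (conj_tuple H D S x gs) (ptens ?As (w b)) = ?K x b" if x: "x \<in> acar H" and b: "b \<in> acar A" for x b
  proof -
    have "conj_tuple H D S x gs = tlift ?Hs (tmod ?Hs) (\<lambda>hs. ptens ?Hs (map2 ad hs gs)) (icop H D p x)"
      by (simp add: conj_tuple_def l)
    also have "\<dots> = psum (tmod ?Hs) (icl p x) (\<lambda>z zs. ptens ?Hs (map2 ad (z # zs) gs))"
      by (rule tlift_icop[OF kmod_tmod mlin_map2[OF ad_bilin mlin_ptens[OF k(1)] gs] x])
    finally have "tcat ?Hs ?As (conj_tuple H D S x gs) (ptens ?As (w b)) =
        tcat ?Hs ?As (psum (tmod ?Hs) (icl p x) (\<lambda>z zs. ptens ?Hs (map2 ad (z # zs) gs))) (ptens ?As (w b))" by simp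
    also have "\<dots> = psum ?T (icl p x) (\<lambda>z zs. tcat ?Hs ?As (ptens ?Hs (map2 ad (z # zs) gs)) (ptens ?As (w b)))"
      by (rule lin_push2[OF kmod_tmod kmod_tmod tcat_lin1[OF k ptens_in[OF w[OF b]]] icl_in[OF x]], rule ptens_in[OF m2]) simp
    also have "\<dots> = ?K x b"
      by (rule psum_cong[OF icl_in[OF x]], rule tcat_ptens[OF k m2 w[OF b]]) simp
    finally show ?thesis .
  qed
  have K: "bilin H A ?T ?K"
  proof (rule bilinI)
    fix x assume x: "x \<in> acar H"
    show "lin_map A ?T (?K x)"
    proof (rule lin_psum[OF kmod_tmod icl_in[OF x]])
      fix z zs assume "z \<in> acar H" "zs \<in> pw p H"
      then have "map2 ad (z # zs) gs \<in> pw (Suc p) H" by (intro m2) simp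
      then show "lin_map A ?T (\<lambda>b. ?f (map2 ad (z # zs) gs) b)" using f unfolding mlc_def by blast
    qed
  next
    fix b assume b: "b \<in> acar A"
    have fb: "mlin ?Hs ?T (\<lambda>xs. ?f xs b)" using f b unfolding mlc_def by blast
    show "lin_map H ?T (\<lambda>x. ?K x b)"
      by (rule icl_lin[OF kmod_tmod], rule mlin_uncons[OF kH, where f = "\<lambda>zs. ?f (map2 ad zs gs) b"],
          rule mlin_map2[OF ad_bilin fb gs])
  qed
  have "tlift [H, A] ?T (\<lambda>ys. tcat ?Hs ?As (conj_tuple H D S (ys ! 0) gs) (ptens ?As (w (ys ! 1)))) (r a) =
      tlift [H, A] ?T (\<lambda>ys. ?K (ys ! 0) (ys ! Suc 0)) (r a)"
    unfolding One_nat_def by (intro fun_cong[OF tlift_cong] ct) (auto simp: pw_Suc)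
  also have "\<dots> = psum ?T (rl a) ?K" by (rule tlift_r[OF kmod_tmod K a])
  also have "\<dots> = psum ?T (mv brl a gs) ?f" by (rule icl_mv[OF kmod_tmod f a gs])
  finally show ?thesis .
qed

section \<open>Iterated coactions: the horizontal operators as inverse braidings\<close>

abbreviation Ws :: "nat \<Rightarrow> ('k, 'm) alg list" where
  "Ws n \<equiv> concat (replicate n [H, A])"

lemma kmods_Ws: "kmods (Ws n)" by (induction n) (simp_all add: kH kA)

lemma hprod_in: "ws \<in> lprod (Ws n) \<Longrightarrow> hprod H (even_part ws) \<in> acar H \<and> odd_part ws \<in> pw n A"
  by (induction n arbitrary: ws)
    (auto simp: pw_Suc even_part_Nil odd_part_Nil even_part_Cons odd_part_Cons hprod_def oneH mulH)

text \<open>The product inside S^-1 is opened from the left: S^-1(x h) acts as S^-1(x) followed by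
  S^-1(h). The element acted upon changes at each step, so \<open>g\<close> varies in the
  induction.\<close>

lemma Ws_mlin:
  assumes N: "is_kmod N"
  shows "mlc n A H N k \<Longrightarrow> g \<in> acar H \<Longrightarrow> mlin (Ws n) N (\<lambda>ws. k (odd_part ws) (ad (Si (hprod H (even_part ws))) g))"
proof (induction n arbitrary: k g)
  case 0
  then show ?case using mlc_in[OF 0(1), of "[]"] by (simp add: odd_part_Nil even_part_Nil hprod_def Si_one ad_one oneH)
next
  case (Suc n)
  note k = Suc.prems(1) and g = Suc.prems(2)
  have hp: "hprod H (x # xs) = amul H x (hprod H xs)" for x xs by (simp add: hprod_def)
  have "mlin (H # A # Ws n) N (\<lambda>ws. k (odd_part ws) (ad (Si (hprod H (even_part ws))) g))"
    unfolding mlin.simps even_part_Cons odd_part_Cons hp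
  proof (intro conjI ballI)
    fix x b assume x: "x \<in> acar H" and b: "b \<in> acar A"
    have "mlin (Ws n) N (\<lambda>ws. k (b # odd_part ws) (ad (Si (hprod H (even_part ws))) (ad (Si x) g)))"
      by (rule Suc.IH[OF mlc_Suc1[OF k b]]) (intro ad_in Si_in x g)
    moreover have "k (b # odd_part ws) (ad (Si (amul H x (hprod H (even_part ws)))) g) =
        k (b # odd_part ws) (ad (Si (hprod H (even_part ws))) (ad (Si x) g))" if "ws \<in> lprod (Ws n)" for ws
      using hprod_in[OF that] x g by (simp add: Si_mul ad_mul Si_in)
    ultimately show "mlin (Ws n) N (\<lambda>ws. k (b # odd_part ws) (ad (Si (amul H x (hprod H (even_part ws)))) g))"
      using mlin_cong[OF kmods_Ws, of n] by (metis (no_types, lifting))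
  next
    fix x ws assume x: "x \<in> acar H" and ws: "ws \<in> lprod (Ws n)"
    show "lin_map A N (\<lambda>b. k (b # odd_part ws) (ad (Si (amul H x (hprod H (even_part ws)))) g))"
      by (rule bilin1[OF mlc_Suc2[OF k] lin_id]) (use hprod_in[OF ws] x g in \<open>auto intro!: ad_in Si_in mulH\<close>)
  next
    fix ws' assume "ws' \<in> lprod (A # Ws n)"
    then obtain b ws where ws: "ws' = b # ws" "b \<in> acar A" "ws \<in> lprod (Ws n)" by (auto simp: pw_Suc)
    have hi: "hprod H (even_part ws) \<in> acar H" and oi: "odd_part ws \<in> pw n A" using hprod_in[OF ws(3)] by auto
    show "lin_map H N (\<lambda>x. k (odd_part (x # ws')) (ad (Si (hprod H (even_part (x # ws')))) g))"
      unfolding ws(1) even_part_Cons odd_part_Cons hp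
      by (rule bilin2[OF mlc_Suc2[OF k oi]]) (rule AI g hi ws | assumption)+
  qed
  then show ?case by simp
qed

lemma rho_all_in: "as \<in> pw n A \<Longrightarrow> rho_all H A r as \<in> acar (tmod (Ws n))"
proof (induction as arbitrary: n)
  case Nil
  then have "n = 0" by (auto dest: lprod_length)
  then show ?case by (simp add: ptens_in)
next
  case (Cons a as)
  then obtain n' where n: "n = Suc n'" by (cases n) (auto dest: lprod_length)
  have a: "a \<in> acar A" and as: "as \<in> pw n' A" using Cons.prems n by auto
  have "lin_map (tmod [H, A]) (tmod ([H, A] @ Ws n')) (\<lambda>u. tcat [H, A] (Ws n') u (rho_all H A r as))"
    by (rule tcat_lin1[OF _ kmods_Ws Cons.IH[OF as]]) (simp add: kH kA)
  from lin_in[OF this r_in[OF a]] show ?case using lprod_length[OF as] by (simp add: n)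
qed

text \<open>By antimultiplicativity of \<open>Si\<close>, the coaction leg of the first letter acts
  on \<open>g\<close> before the later ones do. This is \<open>g\<close> passing the letters of
  \<open>A\<close> from left to right by the inverse braiding.\<close>

lemma rho_all_mv:
  assumes N: "is_kmod N"
  shows "mlc n A H N k \<Longrightarrow> g \<in> acar H \<Longrightarrow> as \<in> pw n A \<Longrightarrow>
    tlift (Ws n) N (\<lambda>ws. k (odd_part ws) (ad (Si (hprod H (even_part ws))) g)) (rho_all H A r as) = psum N (mv ibl g as) k"
proof (induction as arbitrary: n k g)
  case Nil
  then have n: "n = 0" by (auto dest: lprod_length)
  have ki: "k [] g \<in> acar N" using mlc_in[OF Nil(1), of "[]" g] Nil n by simp
  have "mlin [] N (\<lambda>ws. k (odd_part ws) (ad (Si (hprod H (even_part ws))) g))"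
    using Ws_mlin[OF N Nil(1,2)] n by simp
  from tlift_ptens[OF N this, of "[]"] show ?case
    using ki Nil(2) by (simp add: n odd_part_Nil even_part_Nil hprod_def Si_one ad_one psum_single[OF N])
next
  case (Cons a as)
  then obtain n' where n: "n = Suc n'" by (cases n) (auto dest: lprod_length)
  have a: "a \<in> acar A" and as: "as \<in> pw n' A" using Cons.prems n by auto
  note k = Cons.prems(1)[unfolded n] and g = Cons.prems(2)
  let ?f = "\<lambda>ws. k (odd_part ws) (ad (Si (hprod H (even_part ws))) g)"
  have f: "mlin ([H, A] @ Ws n') N ?f" using Ws_mlin[OF N k g] by simp
  have km: "kmods [H, A]" "kmods (Ws n')" "kmods ([H, A] @ Ws n')" by (simp_all add: kH kA kmods_Ws)
  have lr: "length as = n'" using lprod_length[OF as] by simp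
  note ri = rho_all_in[OF as]
  have hp: "hprod H (x # xs) = amul H x (hprod H xs)" for x xs by (simp add: hprod_def)
  have "tlift (Ws n) N ?f (rho_all H A r (a # as)) =
      tlift ([H, A] @ Ws n') N ?f (tcat [H, A] (Ws n') (psum (tmod [H, A]) (rl a) (\<lambda>x b. ptens [H, A] [x, b])) (rho_all H A r as))"
    unfolding rl_def by (simp add: dec2_eq[OF kH kA r_in[OF a]] n lr)
  also have "\<dots> = psum N (rl a) (\<lambda>x b. tlift ([H, A] @ Ws n') N ?f (tcat [H, A] (Ws n') (ptens [H, A] [x, b]) (rho_all H A r as)))"
    by (rule lin_push2[OF kmod_tmod N lin_comp[OF tlift_lin[OF N f km(3)] tcat_lin1[OF km(1,2) ri]] rl_in[OF a]]) (simp add: ptens_in)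
  also have "\<dots> = psum N (rl a) (\<lambda>x b. psum N (mv ibl (ad (Si x) g) as) (\<lambda>as' g'. k (b # as') g'))"
  proof (rule psum_cong[OF rl_in[OF a]])
    fix x b assume x: "x \<in> acar H" and b: "b \<in> acar A"
    have "tlift ([H, A] @ Ws n') N ?f (tcat [H, A] (Ws n') (ptens [H, A] [x, b]) (rho_all H A r as)) =
        tlift (Ws n') N (\<lambda>ws. ?f ([x, b] @ ws)) (rho_all H A r as)"
      by (rule tlift_tcat_pt[OF km(1,2) N f _ ri]) (simp add: x b)
    also have "\<dots> = tlift (Ws n') N (\<lambda>ws. k (b # odd_part ws) (ad (Si (hprod H (even_part ws))) (ad (Si x) g))) (rho_all H A r as)"
    proof (rule fun_cong[OF tlift_cong])
      fix ws assume "ws \<in> lprod (Ws n')"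
      then show "?f ([x, b] @ ws) = k (b # odd_part ws) (ad (Si (hprod H (even_part ws))) (ad (Si x) g))"
        using hprod_in[of ws n'] x g by (simp add: even_part_Cons odd_part_Cons hp Si_mul ad_mul Si_in)
    qed
    also have "\<dots> = psum N (mv ibl (ad (Si x) g) as) (\<lambda>as' g'. k (b # as') g')"
      by (rule Cons.IH[OF mlc_Suc1[OF k b] _ as]) (intro ad_in Si_in x g)
    finally show "tlift ([H, A] @ Ws n') N ?f (tcat [H, A] (Ws n') (ptens [H, A] [x, b]) (rho_all H A r as)) =
        psum N (mv ibl (ad (Si x) g) as) (\<lambda>as' g'. k (b # as') g')" .
  qed
  also have "\<dots> = psum N (ibl g a) (\<lambda>a' g'. psum N (mv ibl g' as) (\<lambda>as' g'. k (a' # as') g'))"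
    by (simp add: psum_ibl)
  also have "\<dots> = psum N (mv ibl g (a # as)) k"
    by (rule psum_mv_Cons[OF ibl_mover[OF N] g a as mlc_in[OF k], symmetric])
  finally show ?case .
qed

end

section \<open>A letter crossing a whole word: products and units\<close>

lemma mv_bilin:
  assumes m: "mover N C X m" and k: "is_kmod C" "is_kmod X" and f: "mlc (Suc n) X C N f" and xs: "xs \<in> pw n X"
  shows "bilin X C N (\<lambda>x c. psum N (mv m c xs) (\<lambda>xs' c'. f (x # xs') c'))"
proof (rule bilinI)
  fix x assume "x \<in> acar X" then show "lin_map C N (\<lambda>c. psum N (mv m c xs) (\<lambda>xs' c'. f (x # xs') c'))"
    using mv_mlc[OF m k mlc_Suc1[OF f, of x]] xs by (simp add: mlc_def)
next
  fix c assume c: "c \<in> acar C"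
  show "lin_map X N (\<lambda>x. psum N (mv m c xs) (\<lambda>xs' c'. f (x # xs') c'))"
    by (rule lin_psum[OF mover_kmod[OF m] mv_in[OF m c xs]]) (rule bilin1[OF mlc_Suc2[OF f] lin_id])
qed

lemma pw_butlast: "xs \<in> pw (Suc n) X \<Longrightarrow> butlast xs \<in> pw n X \<and> last xs \<in> acar X"
  using lprod_replicate[of xs "Suc n" X] by (cases xs rule: rev_cases) (auto simp: lprod_replicate)

lemma mlc_mrg:
  assumes X: "is_kalg X" and f: "mlc n X C N f" and i: "i < n"
  shows "mlc (Suc n) X C N (\<lambda>xs c. f (mrg X i xs) c)"
proof (rule mlcI)
  fix c assume "c \<in> acar C"
  then have "mlin (replicate n X) N (\<lambda>xs. f xs c)" using f by (simp add: mlc_def)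
  then show "mlin (replicate (Suc n) X) N (\<lambda>xs. f (mrg X i xs) c)" by (rule mlin_mrg[OF X _ i])
next
  fix xs assume "xs \<in> pw (Suc n) X"
  then show "lin_map C N (\<lambda>c. f (mrg X i xs) c)" using mrg_in[OF X _ i] f unfolding mlc_def by blast
qed

context hopf_comodule_algebra
begin

text \<open>At the merged position this is \<open>br_mulH\<close>; the letters in front of it are
  crossed as before and only enlarge the test map.\<close>

lemma push_mrg:
  assumes N: "is_kmod N"
  shows "mlc n H A N f \<Longrightarrow> i < n \<Longrightarrow> gs \<in> pw (Suc n) H \<Longrightarrow> a \<in> acar A \<Longrightarrow>
    psum N (mv brl a (mrg H i gs)) f = psum N (mv brl a gs) (\<lambda>gs' a'. f (mrg H i gs') a')"
proof (induction i arbitrary: n f gs a)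
  case 0
  note m = brl_mover[OF N]
  obtain n' where n: "n = Suc n'" using 0 by (cases n) auto
  obtain g h gs' where gs: "gs = g # h # gs'" "g \<in> acar H" "h \<in> acar H" "gs' \<in> pw n' H"
    using 0(3) by (auto simp: n pw_Suc)
  note f = 0(1)[unfolded n] and a = 0(4)
  note b = mv_bilin[OF m kA kH f gs(4)]
  have hgs: "h # gs' \<in> pw (Suc n') H" using gs by simp
  have "psum N (mv brl a (mrg H 0 gs)) f = psum N (brl a (amul H g h)) (\<lambda>x a1. psum N (mv brl a1 gs') (\<lambda>xs c. f (x # xs) c))"
    unfolding gs(1) mrg.simps list.sel by (rule psum_mv_Cons[OF m a mulH[OF gs(2,3)] gs(4) mlc_in[OF f]])
  also have "\<dots> = psum N (brl a g) (\<lambda>g1 a1. psum N (brl a1 h) (\<lambda>g2 a2. psum N (mv brl a2 gs') (\<lambda>xs c. f (amul H g1 g2 # xs) c)))"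
    by (rule br_mulH[OF N b a gs(2,3)])
  also have "\<dots> = psum N (brl a g) (\<lambda>g1 a1. psum N (mv brl a1 (h # gs')) (\<lambda>xs c. f (mrg H 0 (g1 # xs)) c))"
  proof (rule psum_cong[OF brl_in[OF a gs(2)]])
    fix g1 a1 assume i: "g1 \<in> acar H" "a1 \<in> acar A"
    have "psum N (mv brl a1 (h # gs')) (\<lambda>xs c. f (mrg H 0 (g1 # xs)) c) =
        psum N (brl a1 h) (\<lambda>g2 a2. psum N (mv brl a2 gs') (\<lambda>xs c. f (mrg H 0 (g1 # g2 # xs)) c))"
      by (rule psum_mv_Cons[OF m i(2) gs(3,4)], rule mlc_in[OF mlc_mrg[OF algH f, of 0]]) (use i in auto)
    then show "psum N (brl a1 h) (\<lambda>g2 a2. psum N (mv brl a2 gs') (\<lambda>xs c. f (amul H g1 g2 # xs) c)) =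
        psum N (mv brl a1 (h # gs')) (\<lambda>xs c. f (mrg H 0 (g1 # xs)) c)" by simp
  qed
  also have "\<dots> = psum N (mv brl a gs) (\<lambda>gs' a'. f (mrg H 0 gs') a')"
    unfolding gs(1) by (rule psum_mv_Cons[OF m a gs(2) hgs mlc_in[OF mlc_mrg[OF algH f]], symmetric]) simp_all
  finally show ?case .
next
  case (Suc i)
  note m = brl_mover[OF N]
  obtain n' where n: "n = Suc n'" using Suc by (cases n) auto
  obtain g gs' where gs: "gs = g # gs'" "g \<in> acar H" "gs' \<in> pw (Suc n') H"
    using Suc.prems(3) unfolding n by (auto simp: pw_Suc)
  note f = Suc.prems(1)[unfolded n] and a = Suc.prems(4)
  have i: "i < n'" using Suc.prems(2) n by simp
  have "psum N (mv brl a (mrg H (Suc i) gs)) f = psum N (brl a g) (\<lambda>x a1. psum N (mv brl a1 (mrg H i gs')) (\<lambda>xs c. f (x # xs) c))"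
    unfolding gs(1) mrg.simps list.sel by (rule psum_mv_Cons[OF m a gs(2) mrg_in[OF algH gs(3) i] mlc_in[OF f]])
  also have "\<dots> = psum N (brl a g) (\<lambda>x a1. psum N (mv brl a1 gs') (\<lambda>xs c. f (mrg H (Suc i) (x # xs)) c))"
    unfolding mrg.simps list.sel by (intro psum_cong[OF brl_in[OF a gs(2)]] Suc.IH[OF mlc_Suc1[OF f] i gs(3)])
  also have "\<dots> = psum N (mv brl a gs) (\<lambda>gs' a'. f (mrg H (Suc i) gs') a')"
    unfolding gs(1) by (rule psum_mv_Cons[OF m a gs(2,3) mlc_in[OF mlc_mrg[OF algH f]], symmetric]) (use i in simp_all)
  finally show ?case .
qed

lemma ins_0: "ins M 0 xs = aone M # xs" and ins_Suc: "ins M (Suc i) (x # xs) = x # ins M i xs"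
  by (simp_all add: ins_def)

lemma push_ins:
  assumes N: "is_kmod N"
  shows "mlc (Suc n) H A N f \<Longrightarrow> i \<le> n \<Longrightarrow> gs \<in> pw n H \<Longrightarrow> a \<in> acar A \<Longrightarrow>
    psum N (mv brl a (ins H i gs)) f = psum N (mv brl a gs) (\<lambda>gs' a'. f (ins H i gs') a')"
proof (induction i arbitrary: n f gs a)
  case 0
  note m = brl_mover[OF N]
  have "psum N (mv brl a (ins H 0 gs)) f = psum N (brl a (aone H)) (\<lambda>x a1. psum N (mv brl a1 gs) (\<lambda>xs c. f (x # xs) c))"
    unfolding ins_0 by (rule psum_mv_Cons[OF m 0(4) oneH 0(3) mlc_in[OF 0(1)]])
  also have "\<dots> = psum N (mv brl a gs) (\<lambda>xs c. f (aone H # xs) c)"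
    by (rule br_oneH[OF N mv_bilin[OF m kA kH 0(1,3)] 0(4)])
  finally show ?case by (simp add: ins_0)
next
  case (Suc i)
  note m = brl_mover[OF N]
  obtain n' where n: "n = Suc n'" using Suc by (cases n) auto
  obtain g gs' where gs: "gs = g # gs'" "g \<in> acar H" "gs' \<in> pw n' H"
    using Suc.prems(3) unfolding n by (auto simp: pw_Suc)
  note f = Suc.prems(1)[unfolded n] and a = Suc.prems(4)
  have i: "i \<le> n'" using Suc.prems(2) n by simp
  have fi: "f (ins H (Suc i) xs) c \<in> acar N" if "xs \<in> pw (Suc n') H" "c \<in> acar A" for xs c
    by (rule mlc_in[OF f ins_in[OF algH that(1)] that(2)])
  have "psum N (mv brl a (ins H (Suc i) gs)) f = psum N (brl a g) (\<lambda>x a1. psum N (mv brl a1 (ins H i gs')) (\<lambda>xs c. f (x # xs) c))"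
    unfolding gs(1) ins_Suc by (rule psum_mv_Cons[OF m a gs(2) ins_in[OF algH gs(3)] mlc_in[OF f]])
  also have "\<dots> = psum N (brl a g) (\<lambda>x a1. psum N (mv brl a1 gs') (\<lambda>xs c. f (ins H (Suc i) (x # xs)) c))"
    unfolding ins_Suc by (intro psum_cong[OF brl_in[OF a gs(2)]] Suc.IH[OF mlc_Suc1[OF f] i gs(3)])
  also have "\<dots> = psum N (mv brl a gs) (\<lambda>gs' a'. f (ins H (Suc i) gs') a')"
    unfolding gs(1) by (rule psum_mv_Cons[OF m a gs(2,3) fi, symmetric])
  finally show ?case .
qed

lemma mlc_mulA:
  assumes f: "mlc n H A N f" and a: "a \<in> acar A"
  shows "mlc n H A N (\<lambda>gs b. f gs (amul A a b))"
  by (rule mlcI) (use f a in \<open>auto simp: mlc_def mulA intro: lin_comp[OF _ bilin2[OF bmulA lin_id]]\<close>)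

lemma mlc_mulA':
  assumes f: "mlc n H A N f" and b: "b \<in> acar A"
  shows "mlc n H A N (\<lambda>gs a. f gs (amul A a b))"
  by (rule mlcI) (use f b in \<open>auto simp: mlc_def mulA intro: lin_comp[OF _ bilin1[OF bmulA lin_id]]\<close>)

text \<open>By \<open>br_mulA\<close>, \<open>b\<close> crosses each single letter before
  \<open>a\<close> does. To let \<open>b\<close> finish the whole word before \<open>a\<close>
  starts, the first crossing of \<open>a\<close> is exchanged with the rest of the journey of
  \<open>b\<close>.\<close>

lemma push_mulA:
  assumes N: "is_kmod N"
  shows "mlc n H A N f \<Longrightarrow> gs \<in> pw n H \<Longrightarrow> a \<in> acar A \<Longrightarrow> b \<in> acar A \<Longrightarrow>
    psum N (mv brl (amul A a b) gs) f = psum N (mv brl b gs) (\<lambda>gs' b'. psum N (mv brl a gs') (\<lambda>gs'' a'. f gs'' (amul A a' b')))"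
proof (induction gs arbitrary: n f a b)
  case Nil
  have "f [] (amul A a b) \<in> acar N" by (rule mlc_in[OF Nil(1,2)]) (use Nil mulA in auto)
  then show ?case by (simp add: psum_single[OF N])
next
  case (Cons g gs)
  note m = brl_mover[OF N] and a = Cons.prems(3) and b = Cons.prems(4)
  obtain n' where n: "n = Suc n'" using Cons.prems by (cases n) (auto dest: lprod_length)
  have g: "g \<in> acar H" and gs: "gs \<in> pw n' H" using Cons.prems n by auto
  note f = Cons.prems(1)[unfolded n]
  have fi: "f xs c \<in> acar N" if "xs \<in> pw (Suc n') H" "c \<in> acar A" for xs c by (rule mlc_in[OF f that])
  have "psum N (mv brl (amul A a b) (g # gs)) f = psum N (brl (amul A a b) g) (\<lambda>g' c. psum N (mv brl c gs) (\<lambda>xs c. f (g' # xs) c))"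
    by (rule psum_mv_Cons[OF m mulA[OF a b] g gs fi])
  also have "\<dots> = psum N (brl b g) (\<lambda>g1 b1. psum N (brl a g1) (\<lambda>g2 a1. psum N (mv brl (amul A a1 b1) gs) (\<lambda>xs c. f (g2 # xs) c)))"
    by (rule br_mulA[OF N mv_bilin[OF m kA kH f gs] a b g])
  also have "\<dots> = psum N (brl b g) (\<lambda>g1 b1. psum N (brl a g1) (\<lambda>g2 a1. psum N (mv brl b1 gs) (\<lambda>gs' b'. psum N (mv brl a1 gs') (\<lambda>gs'' a'. f (g2 # gs'') (amul A a' b')))))"
    by (intro psum_cong[OF brl_in] Cons.IH[OF mlc_Suc1[OF f] gs] a b g)
  also have "\<dots> = psum N (brl b g) (\<lambda>g1 b1. psum N (mv brl b1 gs) (\<lambda>gs' b'. psum N (brl a g1) (\<lambda>g2 a1. psum N (mv brl a1 gs') (\<lambda>gs'' a'. f (g2 # gs'') (amul A a' b')))))"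
    by (rule psum_cong[OF brl_in[OF b g]], rule psum_swap[OF N brl_in mv_in[OF m _ gs]])
      (auto intro!: psum_in[OF N mv_in[OF m]] fi mulA a)
  also have "\<dots> = psum N (brl b g) (\<lambda>g1 b1. psum N (mv brl b1 gs) (\<lambda>gs' b'. psum N (mv brl a (g1 # gs')) (\<lambda>gs'' a'. f gs'' (amul A a' b'))))"
    by (rule psum_cong[OF brl_in[OF b g]], rule psum_cong[OF mv_in[OF m _ gs]], assumption, rule psum_mv_Cons[OF m a, symmetric])
      (auto intro!: fi mulA)
  also have "\<dots> = psum N (mv brl b (g # gs)) (\<lambda>gs' b'. psum N (mv brl a gs') (\<lambda>gs'' a'. f gs'' (amul A a' b')))"
    by (rule psum_mv_Cons[OF m b g gs, symmetric], rule psum_in[OF N mv_in[OF m a]]) (auto intro!: fi mulA)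
  finally show ?case .
qed

lemma push_oneA:
  assumes N: "is_kmod N"
  shows "mlc n H A N f \<Longrightarrow> gs \<in> pw n H \<Longrightarrow> psum N (mv brl (aone A) gs) f = f gs (aone A)"
proof (induction gs arbitrary: n f)
  case Nil
  have "f [] (aone A) \<in> acar N" by (rule mlc_in[OF Nil oneA])
  then show ?case by (simp add: psum_single[OF N])
next
  case (Cons g gs)
  note m = brl_mover[OF N]
  obtain n' where n: "n = Suc n'" using Cons.prems by (cases n) (auto dest: lprod_length)
  have g: "g \<in> acar H" and gs: "gs \<in> pw n' H" using Cons.prems n by auto
  note f = Cons.prems(1)[unfolded n]
  have "psum N (mv brl (aone A) (g # gs)) f = psum N (brl (aone A) g) (\<lambda>g' c. psum N (mv brl c gs) (\<lambda>xs c. f (g' # xs) c))"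
    by (rule psum_mv_Cons[OF m oneA g gs mlc_in[OF f]])
  also have "\<dots> = psum N (mv brl (aone A) gs) (\<lambda>xs c. f (g # xs) c)"
    by (rule br_oneA[OF N mv_bilin[OF m kA kH f gs] g])
  also have "\<dots> = f (g # gs) (aone A)" by (rule Cons.IH[OF mlc_Suc1[OF f g] gs])
  finally show ?case .
qed

section \<open>Faces, degeneracies and cyclic operators as operations on pairs of words\<close>

abbreviation cpt :: "nat \<Rightarrow> nat \<Rightarrow> 'm list \<Rightarrow> 'm list \<Rightarrow> ('m list \<Rightarrow> 'k) set" where
  "cpt p q gs as \<equiv> ptens (CL H A p q) (gs @ as)"

lemma kmods_CL: "kmods (CL H A p q)"
  by (simp add: CL_def kmods_replicate kH kA)

lemma kmod_Cyl: "is_kmod (Cyl H A p q)"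
  by (simp add: Cyl_def kmod_tmod)

lemma cpt_ml2: "ml2 (Suc p) H (Suc q) A (Cyl H A p q) (cpt p q)"
  using mlin_ptens[OF kmods_CL, of p q] unfolding ml2_def Cyl_def CL_def mlin_append by blast

lemmas cpt_in = ml2_in[OF cpt_ml2]

text \<open>Each operator is a lift whose integrand reads one concatenated word. Identifying the
  integrand with a function \<open>k\<close> of two words reduces its multilinearity to
  \<open>ml2\<close>.\<close>

lemma
  assumes N: "is_kmod N" and k: "ml2 (Suc p) H (Suc q) A N k"
    and eq: "\<And>gs as. gs \<in> pw (Suc p) H \<Longrightarrow> as \<in> pw (Suc q) A \<Longrightarrow> f (gs @ as) = k gs as"
  shows CL_op_lin: "lin_map (Cyl H A p q) N (tlift (CL H A p q) N f)"
    and CL_op_pt: "gs \<in> pw (Suc p) H \<Longrightarrow> as \<in> pw (Suc q) A \<Longrightarrow> tlift (CL H A p q) N f (cpt p q gs as) = k gs as"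
proof -
  have f: "mlin (CL H A p q) N f"
    unfolding CL_def mlin_append
  proof (intro conjI ballI)
    fix gs assume gs: "gs \<in> pw (Suc p) H"
    have "mlin (replicate (Suc q) A) N (\<lambda>ys. f (gs @ ys)) \<longleftrightarrow> mlin (replicate (Suc q) A) N (k gs)"
      by (rule mlin_cong[OF kmods_replicate[OF kA] eq[OF gs]])
    then show "mlin (replicate (Suc q) A) N (\<lambda>ys. f (gs @ ys))" using ml2D1[OF k gs] by blast
  next
    fix as assume as: "as \<in> pw (Suc q) A"
    have "mlin (replicate (Suc p) H) N (\<lambda>ys. f (ys @ as)) \<longleftrightarrow> mlin (replicate (Suc p) H) N (\<lambda>gs. k gs as)"
      by (rule mlin_cong[OF kmods_replicate[OF kH] eq[OF _ as]])
    then show "mlin (replicate (Suc p) H) N (\<lambda>ys. f (ys @ as))" using ml2D2[OF k as] by blast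
  qed
  show "lin_map (Cyl H A p q) N (tlift (CL H A p q) N f)"
    unfolding Cyl_def by (rule tlift_lin[OF N f kmods_CL])
  assume gs: "gs \<in> pw (Suc p) H" and as: "as \<in> pw (Suc q) A"
  then have "gs @ as \<in> lprod (CL H A p q)" unfolding CL_def by (rule lprod_appendI)
  then show "tlift (CL H A p q) N f (cpt p q gs as) = k gs as"
    by (simp add: tlift_ptens[OF N f kmods_CL] eq[OF gs as])
qed

lemma Cyl_ext:
  assumes "is_kmod N" "lin_map (Cyl H A p q) N f" "lin_map (Cyl H A p q) N g"
    and eq: "\<And>gs as. gs \<in> pw (Suc p) H \<Longrightarrow> as \<in> pw (Suc q) A \<Longrightarrow> f (cpt p q gs as) = g (cpt p q gs as)"
    and "x \<in> acar (Cyl H A p q)"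
  shows "f x = g x"
proof (rule tmod_ext[OF assms(1)])
  show "lin_map (tmod (CL H A p q)) N f" "lin_map (tmod (CL H A p q)) N g" "x \<in> acar (tmod (CL H A p q))"
    using assms by (simp_all add: Cyl_def)
  fix zs assume "zs \<in> lprod (CL H A p q)"
  then obtain gs as where "zs = gs @ as" "gs \<in> pw (Suc p) H" "as \<in> pw (Suc q) A"
    unfolding CL_def by (rule lprod_appendE)
  then show "f (ptens (CL H A p q) zs) = g (ptens (CL H A p q) zs)" using eq by simp
qed

lemma len_pw: "xs \<in> pw n M \<Longrightarrow> length xs = n"
  using lprod_length by fastforce

lemma hface_low:
  assumes "i < Suc p"
  shows "lin_map (Cyl H A (Suc p) q) (Cyl H A p q) (hface H A D S r (Suc p) q i)"
    and "gs \<in> pw (Suc (Suc p)) H \<Longrightarrow> as \<in> pw (Suc q) A \<Longrightarrow>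
      hface H A D S r (Suc p) q i (cpt (Suc p) q gs as) = cpt p q (mrg H i gs) as"
proof -
  let ?f = "\<lambda>zs. ptens (CL H A p q)
             (take i zs @ [amul H (zs ! i) (zs ! Suc i)] @ drop (Suc (Suc i)) (take (Suc (Suc p)) zs) @ drop (Suc (Suc p)) zs)"
  have k: "ml2 (Suc (Suc p)) H (Suc q) A (Cyl H A p q) (\<lambda>gs as. cpt p q (mrg H i gs) as)"
    by (rule ml2_mrg[OF algH cpt_ml2 assms])
  have eq: "?f (gs @ as) = cpt p q (mrg H i gs) as" if "gs \<in> pw (Suc (Suc p)) H" for gs as
    using len_pw[OF that] assms by (simp add: mrg_eq nth_append)
  have h: "hface H A D S r (Suc p) q i = tlift (CL H A (Suc p) q) (Cyl H A p q) ?f"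
    using assms by (simp add: hface_def)
  show "lin_map (Cyl H A (Suc p) q) (Cyl H A p q) (hface H A D S r (Suc p) q i)"
    unfolding h by (rule CL_op_lin[OF kmod_Cyl k eq])
  show "gs \<in> pw (Suc (Suc p)) H \<Longrightarrow> as \<in> pw (Suc q) A \<Longrightarrow>
      hface H A D S r (Suc p) q i (cpt (Suc p) q gs as) = cpt p q (mrg H i gs) as"
    unfolding h by (rule CL_op_pt[OF kmod_Cyl k eq])
qed

lemma vface_low:
  assumes "i < Suc q"
  shows "lin_map (Cyl H A p (Suc q)) (Cyl H A p q) (vface H A D S r p (Suc q) i)"
    and "gs \<in> pw (Suc p) H \<Longrightarrow> as \<in> pw (Suc (Suc q)) A \<Longrightarrow>
      vface H A D S r p (Suc q) i (cpt p (Suc q) gs as) = cpt p q gs (mrg A i as)"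
proof -
  let ?f = "\<lambda>zs. ptens (CL H A p q)
             (take (Suc p) zs @ take i (drop (Suc p) zs)
              @ [amul A (drop (Suc p) zs ! i) (drop (Suc p) zs ! Suc i)]
              @ drop (Suc (Suc i)) (drop (Suc p) zs))"
  have k: "ml2 (Suc p) H (Suc (Suc q)) A (Cyl H A p q) (\<lambda>gs as. cpt p q gs (mrg A i as))"
    using ml2_sym[OF ml2_mrg[OF algA ml2_sym[OF cpt_ml2] assms]] .
  have eq: "?f (gs @ as) = cpt p q gs (mrg A i as)" if "gs \<in> pw (Suc p) H" "as \<in> pw (Suc (Suc q)) A" for gs as
    using len_pw[OF that(1)] len_pw[OF that(2)] assms by (simp add: mrg_eq)
  have h: "vface H A D S r p (Suc q) i = tlift (CL H A p (Suc q)) (Cyl H A p q) ?f"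
    using assms by (simp add: vface_def)
  show "lin_map (Cyl H A p (Suc q)) (Cyl H A p q) (vface H A D S r p (Suc q) i)"
    unfolding h by (rule CL_op_lin[OF kmod_Cyl k eq])
  show "gs \<in> pw (Suc p) H \<Longrightarrow> as \<in> pw (Suc (Suc q)) A \<Longrightarrow>
      vface H A D S r p (Suc q) i (cpt p (Suc q) gs as) = cpt p q gs (mrg A i as)"
    unfolding h by (rule CL_op_pt[OF kmod_Cyl k eq])
qed

lemma hdegen_pt:
  assumes "i \<le> p"
  shows "lin_map (Cyl H A p q) (Cyl H A (Suc p) q) (hdegen H A p q i)"
    and "gs \<in> pw (Suc p) H \<Longrightarrow> as \<in> pw (Suc q) A \<Longrightarrow>
      hdegen H A p q i (cpt p q gs as) = cpt (Suc p) q (ins H (Suc i) gs) as"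
proof -
  let ?f = "\<lambda>zs. ptens (CL H A (Suc p) q) (take (Suc i) zs @ [aone H] @ drop (Suc i) (take (Suc p) zs) @ drop (Suc p) zs)"
  have k: "ml2 (Suc p) H (Suc q) A (Cyl H A (Suc p) q) (\<lambda>gs as. cpt (Suc p) q (ins H (Suc i) gs) as)"
    by (rule ml2_ins[OF algH cpt_ml2]) (use assms in simp)
  have eq: "?f (gs @ as) = cpt (Suc p) q (ins H (Suc i) gs) as" if "gs \<in> pw (Suc p) H" for gs as
    using len_pw[OF that] assms by (simp add: ins_def)
  show "lin_map (Cyl H A p q) (Cyl H A (Suc p) q) (hdegen H A p q i)"
    unfolding hdegen_def by (rule CL_op_lin[OF kmod_Cyl k eq])
  show "gs \<in> pw (Suc p) H \<Longrightarrow> as \<in> pw (Suc q) A \<Longrightarrow>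
      hdegen H A p q i (cpt p q gs as) = cpt (Suc p) q (ins H (Suc i) gs) as"
    unfolding hdegen_def by (rule CL_op_pt[OF kmod_Cyl k eq])
qed

lemma vdegen_pt:
  assumes "i \<le> q"
  shows "lin_map (Cyl H A p q) (Cyl H A p (Suc q)) (vdegen H A p q i)"
    and "gs \<in> pw (Suc p) H \<Longrightarrow> as \<in> pw (Suc q) A \<Longrightarrow>
      vdegen H A p q i (cpt p q gs as) = cpt p (Suc q) gs (ins A (Suc i) as)"
proof -
  let ?f = "\<lambda>zs. ptens (CL H A p (Suc q)) (take (Suc p) zs @ take (Suc i) (drop (Suc p) zs) @ [aone A] @ drop (Suc i) (drop (Suc p) zs))"
  have k: "ml2 (Suc p) H (Suc q) A (Cyl H A p (Suc q)) (\<lambda>gs as. cpt p (Suc q) gs (ins A (Suc i) as))"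
    by (rule ml2_sym, rule ml2_ins[OF algA ml2_sym[OF cpt_ml2]]) (use assms in simp)
  have eq: "?f (gs @ as) = cpt p (Suc q) gs (ins A (Suc i) as)" if "gs \<in> pw (Suc p) H" for gs as
    using len_pw[OF that] assms by (simp add: ins_def)
  show "lin_map (Cyl H A p q) (Cyl H A p (Suc q)) (vdegen H A p q i)"
    unfolding vdegen_def by (rule CL_op_lin[OF kmod_Cyl k eq])
  show "gs \<in> pw (Suc p) H \<Longrightarrow> as \<in> pw (Suc q) A \<Longrightarrow>
      vdegen H A p q i (cpt p q gs as) = cpt p (Suc q) gs (ins A (Suc i) as)"
    unfolding vdegen_def by (rule CL_op_pt[OF kmod_Cyl k eq])
qed

text \<open>Shared by the horizontal cyclic operator and the last horizontal face, which differ only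
  in \<open>k\<close>: the lift along all coactions is the last \<open>H\<close> letter crossing the
  \<open>A\<close> word by the inverse braiding.\<close>

lemma
  assumes N: "is_kmod N" and k: "ml2 (Suc p) H (Suc q) A N k"
    and f: "\<And>gs as ws. gs \<in> pw (Suc p) H \<Longrightarrow> as \<in> pw (Suc q) A \<Longrightarrow>
      f (gs @ as) ws = k (ad (Si (hprod H (even_part ws))) (last gs) # butlast gs) (odd_part ws)"
  shows pull_op_lin: "lin_map (Cyl H A p q) N (tlift (CL H A p q) N (\<lambda>zs. tlift (Ws (Suc q)) N (f zs) (rho_all H A r (drop (Suc p) zs))))"
    and pull_op_pt: "gs \<in> pw (Suc p) H \<Longrightarrow> as \<in> pw (Suc q) A \<Longrightarrow>
      tlift (CL H A p q) N (\<lambda>zs. tlift (Ws (Suc q)) N (f zs) (rho_all H A r (drop (Suc p) zs))) (cpt p q gs as)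
      = psum N (mv ibl (last gs) as) (\<lambda>as' g'. k (g' # butlast gs) as')"
proof -
  have k2: "ml2 (Suc p) H (Suc q) A N (\<lambda>gs as. psum N (mv ibl (last gs) as) (\<lambda>as' g'. k (g' # butlast gs) as'))"
    by (rule ml2_sym[OF mv_rot_ml2[OF ibl_mover[OF N] kH kA ml2_sym[OF k]]])
  have eq: "tlift (Ws (Suc q)) N (f (gs @ as)) (rho_all H A r (drop (Suc p) (gs @ as))) =
      psum N (mv ibl (last gs) as) (\<lambda>as' g'. k (g' # butlast gs) as')" if gs: "gs \<in> pw (Suc p) H" and as: "as \<in> pw (Suc q) A" for gs as
  proof -
    have d: "drop (Suc p) (gs @ as) = as" using len_pw[OF gs] by simp
    have bl: "butlast gs \<in> pw p H" "last gs \<in> acar H" using pw_butlast[OF gs] by auto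
    have "tlift (Ws (Suc q)) N (f (gs @ as)) (rho_all H A r as) =
        tlift (Ws (Suc q)) N (\<lambda>ws. k (ad (Si (hprod H (even_part ws))) (last gs) # butlast gs) (odd_part ws)) (rho_all H A r as)"
      by (rule fun_cong[OF tlift_cong]) (rule f[OF gs as])
    also have "\<dots> = psum N (mv ibl (last gs) as) (\<lambda>as' g'. k (g' # butlast gs) as')"
      by (rule rho_all_mv[OF N ml2_mlc'[OF k bl(1)] bl(2) as])
    finally show ?thesis by (simp only: d)
  qed
  show "lin_map (Cyl H A p q) N (tlift (CL H A p q) N (\<lambda>zs. tlift (Ws (Suc q)) N (f zs) (rho_all H A r (drop (Suc p) zs))))"
    by (rule CL_op_lin[OF N k2 eq])
  show "gs \<in> pw (Suc p) H \<Longrightarrow> as \<in> pw (Suc q) A \<Longrightarrow>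
      tlift (CL H A p q) N (\<lambda>zs. tlift (Ws (Suc q)) N (f zs) (rho_all H A r (drop (Suc p) zs))) (cpt p q gs as)
      = psum N (mv ibl (last gs) as) (\<lambda>as' g'. k (g' # butlast gs) as')"
    by (rule CL_op_pt[OF N k2 eq])
qed

lemma htau_pt:
  shows "lin_map (Cyl H A p q) (Cyl H A p q) (htau H A D S r p q)"
    and "gs \<in> pw (Suc p) H \<Longrightarrow> as \<in> pw (Suc q) A \<Longrightarrow> htau H A D S r p q (cpt p q gs as) =
      psum (Cyl H A p q) (mv ibl (last gs) as) (\<lambda>as' g'. cpt p q (g' # butlast gs) as')"
proof -
  have eq: "ptens (CL H A p q) (ad (Si (hprod H (even_part ws))) (last (take (Suc p) (gs @ as))) # butlast (take (Suc p) (gs @ as)) @ odd_part ws)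
      = cpt p q (ad (Si (hprod H (even_part ws))) (last gs) # butlast gs) (odd_part ws)" if "gs \<in> pw (Suc p) H" for gs as ws
    using len_pw[OF that] by simp
  show "lin_map (Cyl H A p q) (Cyl H A p q) (htau H A D S r p q)"
    unfolding htau_def by (rule pull_op_lin[OF kmod_Cyl cpt_ml2 eq])
  show "gs \<in> pw (Suc p) H \<Longrightarrow> as \<in> pw (Suc q) A \<Longrightarrow> htau H A D S r p q (cpt p q gs as) =
      psum (Cyl H A p q) (mv ibl (last gs) as) (\<lambda>as' g'. cpt p q (g' # butlast gs) as')"
    unfolding htau_def by (rule pull_op_pt[OF kmod_Cyl cpt_ml2 eq])
qed

lemma tl_butlast: "length xs = Suc (Suc p) \<Longrightarrow> hd (butlast xs) = xs ! 0 \<and> tl (butlast xs) = butlast (tl xs)"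
  by (cases xs; cases "tl xs") auto

text \<open>With the moved letter put in front, the last face is the merge at position 0; in this
  shape it can be compared with face 0 after the cyclic operator.\<close>

lemma hface_last:
  shows "lin_map (Cyl H A (Suc p) q) (Cyl H A p q) (hface H A D S r (Suc p) q (Suc p))"
    and "gs \<in> pw (Suc (Suc p)) H \<Longrightarrow> as \<in> pw (Suc q) A \<Longrightarrow> hface H A D S r (Suc p) q (Suc p) (cpt (Suc p) q gs as) =
      psum (Cyl H A p q) (mv ibl (last gs) as) (\<lambda>as' g'. cpt p q (mrg H 0 (g' # butlast gs)) as')"
proof -
  let ?f = "\<lambda>zs ws. ptens (CL H A p q) (amul H (ad (Si (hprod H (even_part ws))) (last (take (Suc (Suc p)) zs))) (zs ! 0)
                 # butlast (tl (take (Suc (Suc p)) zs)) @ odd_part ws)"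
  have k: "ml2 (Suc (Suc p)) H (Suc q) A (Cyl H A p q) (\<lambda>gs as. cpt p q (mrg H 0 gs) as)"
    by (rule ml2_mrg[OF algH cpt_ml2]) simp
  have eq: "?f (gs @ as) ws = cpt p q (mrg H 0 (ad (Si (hprod H (even_part ws))) (last gs) # butlast gs)) (odd_part ws)"
    if "gs \<in> pw (Suc (Suc p)) H" for gs as ws
    using len_pw[OF that] tl_butlast[OF len_pw[OF that]] by (simp add: nth_append)
  have h: "hface H A D S r (Suc p) q (Suc p) = tlift (CL H A (Suc p) q) (Cyl H A p q)
      (\<lambda>zs. tlift (Ws (Suc q)) (Cyl H A p q) (?f zs) (rho_all H A r (drop (Suc (Suc p)) zs)))"
    by (simp add: hface_def)
  show "lin_map (Cyl H A (Suc p) q) (Cyl H A p q) (hface H A D S r (Suc p) q (Suc p))"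
    unfolding h by (rule pull_op_lin[OF kmod_Cyl k eq])
  show "gs \<in> pw (Suc (Suc p)) H \<Longrightarrow> as \<in> pw (Suc q) A \<Longrightarrow> hface H A D S r (Suc p) q (Suc p) (cpt (Suc p) q gs as) =
      psum (Cyl H A p q) (mv ibl (last gs) as) (\<lambda>as' g'. cpt p q (mrg H 0 (g' # butlast gs)) as')"
    unfolding h by (rule pull_op_pt[OF kmod_Cyl k eq])
qed

lemma vtau_pt:
  shows "lin_map (Cyl H A p q) (Cyl H A p q) (vtau H A D S r p q)"
    and "gs \<in> pw (Suc p) H \<Longrightarrow> as \<in> pw (Suc q) A \<Longrightarrow> vtau H A D S r p q (cpt p q gs as) =
      psum (Cyl H A p q) (mv brl (last as) gs) (\<lambda>gs' a'. cpt p q gs' (a' # butlast as))"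
proof -
  let ?f = "\<lambda>zs. tlift [H, A] (Cyl H A p q)
        (\<lambda>ys. tcat (replicate (Suc p) H) (replicate (Suc q) A)
               (conj_tuple H D S (ys ! 0) (take (Suc p) zs))
               (ptens (replicate (Suc q) A) (ys ! 1 # butlast (drop (Suc p) zs))))
        (r (last zs))"
  note m = brl_mover[OF kmod_Cyl]
  have k: "ml2 (Suc p) H (Suc q) A (Cyl H A p q) (\<lambda>gs as. psum (Cyl H A p q) (mv brl (last as) gs) (\<lambda>gs' a'. cpt p q gs' (a' # butlast as)))"
    by (rule mv_rot_ml2[OF m kA kH cpt_ml2])
  have eq: "?f (gs @ as) = psum (Cyl H A p q) (mv brl (last as) gs) (\<lambda>gs' a'. cpt p q gs' (a' # butlast as))"
    if gs: "gs \<in> pw (Suc p) H" and as: "as \<in> pw (Suc q) A" for gs as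
  proof -
    have bl: "butlast as \<in> pw q A" "last as \<in> acar A" using pw_butlast[OF as] by auto
    have td: "take (Suc p) (gs @ as) = gs" "drop (Suc p) (gs @ as) = as" "last (gs @ as) = last as"
      using len_pw[OF gs] len_pw[OF as] by (auto simp: last_append)
    have wl: "lin_map A (tmod (replicate (Suc q) A)) (\<lambda>a. ptens (replicate (Suc q) A) (a # butlast as))"
      using mlin_ptens[OF kmods_replicate[OF kA], of "Suc q"] bl(1) by simp
    show ?thesis
      unfolding td Cyl_def CL_def by (rule conj_tuple_mv[OF gs bl(2) _ wl]) (use bl in simp)
  qed
  show "lin_map (Cyl H A p q) (Cyl H A p q) (vtau H A D S r p q)"
    unfolding vtau_def by (rule CL_op_lin[OF kmod_Cyl k eq])
  show "gs \<in> pw (Suc p) H \<Longrightarrow> as \<in> pw (Suc q) A \<Longrightarrow> vtau H A D S r p q (cpt p q gs as) =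
      psum (Cyl H A p q) (mv brl (last as) gs) (\<lambda>gs' a'. cpt p q gs' (a' # butlast as))"
    unfolding vtau_def by (rule CL_op_pt[OF kmod_Cyl k eq])
qed

lemma vface_last:
  shows "lin_map (Cyl H A p (Suc q)) (Cyl H A p q) (vface H A D S r p (Suc q) (Suc q))"
    and "gs \<in> pw (Suc p) H \<Longrightarrow> as \<in> pw (Suc (Suc q)) A \<Longrightarrow> vface H A D S r p (Suc q) (Suc q) (cpt p (Suc q) gs as) =
      psum (Cyl H A p q) (mv brl (last as) gs) (\<lambda>gs' a'. cpt p q gs' (mrg A 0 (a' # butlast as)))"
proof -
  let ?f = "\<lambda>zs. tlift [H, A] (Cyl H A p q)
             (\<lambda>ys. tcat (replicate (Suc p) H) (replicate (Suc q) A)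
                    (conj_tuple H D S (ys ! 0) (take (Suc p) zs))
                    (ptens (replicate (Suc q) A)
                       (amul A (ys ! 1) (drop (Suc p) zs ! 0) # butlast (tl (drop (Suc p) zs)))))
             (r (last zs))"
  note m = brl_mover[OF kmod_Cyl]
  have k0: "ml2 (Suc p) H (Suc (Suc q)) A (Cyl H A p q) (\<lambda>gs as. cpt p q gs (mrg A 0 as))"
    by (rule ml2_sym, rule ml2_mrg[OF algA ml2_sym[OF cpt_ml2]]) simp
  have k: "ml2 (Suc p) H (Suc (Suc q)) A (Cyl H A p q) (\<lambda>gs as. psum (Cyl H A p q) (mv brl (last as) gs) (\<lambda>gs' a'. cpt p q gs' (mrg A 0 (a' # butlast as))))"
    by (rule mv_rot_ml2[OF m kA kH k0])
  have eq: "?f (gs @ as) = psum (Cyl H A p q) (mv brl (last as) gs) (\<lambda>gs' a'. cpt p q gs' (mrg A 0 (a' # butlast as)))"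
    if gs: "gs \<in> pw (Suc p) H" and as: "as \<in> pw (Suc (Suc q)) A" for gs as
  proof -
    have bl: "butlast as \<in> pw (Suc q) A" "last as \<in> acar A" using pw_butlast[OF as] by auto
    have td: "take (Suc p) (gs @ as) = gs" "drop (Suc p) (gs @ as) = as" "last (gs @ as) = last as"
      using len_pw[OF gs] len_pw[OF as] by (auto simp: last_append)
    have mr: "amul A a (as ! 0) # butlast (tl as) = mrg A 0 (a # butlast as)" for a
      using tl_butlast[OF len_pw[OF as]] by simp
    have "mlin (replicate (Suc (Suc q)) A) (tmod (replicate (Suc q) A)) (\<lambda>xs. ptens (replicate (Suc q) A) (mrg A 0 xs))"
      by (rule mlin_mrg[OF algA mlin_ptens[OF kmods_replicate[OF kA]]]) simp
    then have wl: "lin_map A (tmod (replicate (Suc q) A)) (\<lambda>a. ptens (replicate (Suc q) A) (mrg A 0 (a # butlast as)))"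
      unfolding replicate_Suc[of "Suc q"] mlin.simps(2)[of A "replicate (Suc q) A"] using bl(1) by blast
    show ?thesis
      unfolding td mr unfolding Cyl_def CL_def
      by (rule conj_tuple_mv[OF gs bl(2) mrg_in[OF algA] wl]) (use bl in simp_all)
  qed
  have h: "vface H A D S r p (Suc q) (Suc q) = tlift (CL H A p (Suc q)) (Cyl H A p q) ?f"
    by (simp add: vface_def)
  show "lin_map (Cyl H A p (Suc q)) (Cyl H A p q) (vface H A D S r p (Suc q) (Suc q))"
    unfolding h by (rule CL_op_lin[OF kmod_Cyl k eq])
  show "gs \<in> pw (Suc p) H \<Longrightarrow> as \<in> pw (Suc (Suc q)) A \<Longrightarrow> vface H A D S r p (Suc q) (Suc q) (cpt p (Suc q) gs as) =
      psum (Cyl H A p q) (mv brl (last as) gs) (\<lambda>gs' a'. cpt p q gs' (mrg A 0 (a' # butlast as)))"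
    unfolding h by (rule CL_op_pt[OF kmod_Cyl k eq])
qed

section \<open>The operators of the diagonal\<close>

abbreviation "dface \<equiv> diag_face H A D S r"
abbreviation "dtau \<equiv> diag_tau H A D S r"

lemma dface_lin: "i \<le> Suc n \<Longrightarrow> lin_map (Cyl H A (Suc n) (Suc n)) (Cyl H A n n) (dface (Suc n) i)"
  unfolding diag_face_def
  using lin_comp[OF vface_low(1)[of i n n] hface_low(1)[of i n "Suc n"]] lin_comp[OF vface_last(1)[of n n] hface_last(1)[of n "Suc n"]]
  by (cases "i = Suc n") simp_all

lemma ddegen_lin: "i \<le> n \<Longrightarrow> lin_map (Cyl H A n n) (Cyl H A (Suc n) (Suc n)) (diag_degen H A n i)"
  unfolding diag_degen_def by (rule lin_comp[OF vdegen_pt(1) hdegen_pt(1)])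

lemma dtau_lin: "lin_map (Cyl H A n n) (Cyl H A n n) (dtau n)"
  unfolding diag_tau_def by (rule lin_comp[OF vtau_pt(1) htau_pt(1)])

lemma dface_pt: "i < Suc n \<Longrightarrow> gs \<in> pw (Suc (Suc n)) H \<Longrightarrow> as \<in> pw (Suc (Suc n)) A \<Longrightarrow>
    dface (Suc n) i (cpt (Suc n) (Suc n) gs as) = cpt n n (mrg H i gs) (mrg A i as)"
  by (simp only: diag_face_def hface_low(2) diff_Suc_1 vface_low(2) mrg_in[OF algH])

lemma ddegen_pt: "i \<le> n \<Longrightarrow> gs \<in> pw (Suc n) H \<Longrightarrow> as \<in> pw (Suc n) A \<Longrightarrow>
    diag_degen H A n i (cpt n n gs as) = cpt (Suc n) (Suc n) (ins H (Suc i) gs) (ins A (Suc i) as)"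
  by (simp only: diag_degen_def hdegen_pt(2) vdegen_pt(2) ins_in[OF algH])

lemma cons_butlast: "xs \<in> pw (Suc n) M \<Longrightarrow> x \<in> acar M \<Longrightarrow> x # butlast xs \<in> pw (Suc n) M"
  using pw_butlast[of xs n M] by simp

lemma dtau_pt:
  assumes gs: "gs \<in> pw (Suc n) H" and as: "as \<in> pw (Suc n) A"
  shows "dtau n (cpt n n gs as) = psum (Cyl H A n n) (mv ibl (last gs) as) (\<lambda>as' g'.
      psum (Cyl H A n n) (mv brl (last as') (g' # butlast gs)) (\<lambda>gs' a'. cpt n n gs' (a' # butlast as')))"
proof -
  note mi = mv_in[OF ibl_mover[OF kmod_Cyl] conjunct2[OF pw_butlast[OF gs]] as]
  have "dtau n (cpt n n gs as) = psum (Cyl H A n n) (mv ibl (last gs) as) (\<lambda>as' g'. vtau H A D S r n n (cpt n n (g' # butlast gs) as'))"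
    unfolding diag_tau_def htau_pt(2)[OF gs as]
    by (rule lin_push2[OF kmod_Cyl kmod_Cyl vtau_pt(1) mi]) (rule cpt_in[OF cons_butlast[OF gs]])
  also have "\<dots> = psum (Cyl H A n n) (mv ibl (last gs) as) (\<lambda>as' g'.
      psum (Cyl H A n n) (mv brl (last as') (g' # butlast gs)) (\<lambda>gs' a'. cpt n n gs' (a' # butlast as')))"
    by (rule psum_cong[OF mi]) (rule vtau_pt(2)[OF cons_butlast[OF gs]])
  finally show ?thesis .
qed

text \<open>The last diagonal face multiplies the moved \<open>H\<close> letter with the first one
  before the \<open>A\<close> letter crosses, whereas face 0 after the cyclic operator multiplies
  afterwards. \<open>push_mrg\<close> identifies the two.\<close>

lemma dface_last:
  assumes x: "x \<in> acar (Cyl H A (Suc n) (Suc n))"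
  shows "dface (Suc n) (Suc n) x = dface (Suc n) 0 (dtau (Suc n) x)"
proof (rule Cyl_ext[OF kmod_Cyl dface_lin lin_comp[OF dface_lin dtau_lin] _ x])
  fix gs as assume gs: "gs \<in> pw (Suc (Suc n)) H" and as: "as \<in> pw (Suc (Suc n)) A"
  let ?T = "Cyl H A n n" and ?T' = "Cyl H A (Suc n) (Suc n)"
  note bm = brl_mover[OF kmod_Cyl]
  have lg: "last gs \<in> acar H" and bg: "butlast gs \<in> pw (Suc n) H" using pw_butlast[OF gs] by auto
  note mi = mv_in[OF ibl_mover[OF kmod_Cyl] lg as]
  have m1: "mrg H 0 (g' # butlast gs) \<in> pw (Suc n) H" if "g' \<in> acar H" for g'
    by (rule mrg_in[OF algH cons_butlast[OF gs that]]) simp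
  have m2: "mrg A 0 (a' # butlast as') \<in> pw (Suc n) A" if "a' \<in> acar A" "as' \<in> pw (Suc (Suc n)) A" for a' as'
    by (rule mrg_in[OF algA cons_butlast[OF that(2,1)]]) simp
  have "dface (Suc n) (Suc n) (cpt (Suc n) (Suc n) gs as) =
      psum ?T (mv ibl (last gs) as) (\<lambda>as' g'. vface H A D S r n (Suc n) (Suc n) (cpt n (Suc n) (mrg H 0 (g' # butlast gs)) as'))"
    unfolding diag_face_def hface_last(2)[OF gs as] diff_Suc_1
    by (rule lin_push2[OF kmod_Cyl kmod_Cyl vface_last(1) mi]) (rule cpt_in[OF m1])
  also have "\<dots> = psum ?T (mv ibl (last gs) as) (\<lambda>as' g'. psum ?T (mv brl (last as') (mrg H 0 (g' # butlast gs))) (\<lambda>gs' a'. cpt n n gs' (mrg A 0 (a' # butlast as'))))"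
    by (rule psum_cong[OF mi]) (rule vface_last(2)[OF m1])
  also have "\<dots> = psum ?T (mv ibl (last gs) as) (\<lambda>as' g'. psum ?T (mv brl (last as') (g' # butlast gs)) (\<lambda>gs' a'. cpt n n (mrg H 0 gs') (mrg A 0 (a' # butlast as'))))"
  proof (rule psum_cong[OF mi])
    fix as' g' assume as': "as' \<in> pw (Suc (Suc n)) A" and g': "g' \<in> acar H"
    have "ml2 (Suc n) H (Suc (Suc n)) A ?T (\<lambda>gs as. cpt n n gs (mrg A 0 as))"
      by (rule ml2_sym, rule ml2_mrg[OF algA ml2_sym[OF cpt_ml2]]) simp
    from ml2_mlc[OF this] have "mlc (Suc n) H A ?T (\<lambda>gs' a'. cpt n n gs' (mrg A 0 (a' # butlast as')))"
      using pw_butlast[OF as'] by blast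
    then show "psum ?T (mv brl (last as') (mrg H 0 (g' # butlast gs))) (\<lambda>gs' a'. cpt n n gs' (mrg A 0 (a' # butlast as'))) =
        psum ?T (mv brl (last as') (g' # butlast gs)) (\<lambda>gs' a'. cpt n n (mrg H 0 gs') (mrg A 0 (a' # butlast as')))"
      by (rule push_mrg[OF kmod_Cyl _ _ cons_butlast[OF gs g']]) (use pw_butlast[OF as'] in auto)
  qed
  also have "\<dots> = psum ?T (mv ibl (last gs) as) (\<lambda>as' g'. psum ?T (mv brl (last as') (g' # butlast gs)) (\<lambda>gs' a'. dface (Suc n) 0 (cpt (Suc n) (Suc n) gs' (a' # butlast as'))))"
  proof (rule psum_cong[OF mi])
    fix as' g' assume as': "as' \<in> pw (Suc (Suc n)) A" and g': "g' \<in> acar H"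
    show "psum ?T (mv brl (last as') (g' # butlast gs)) (\<lambda>gs' a'. cpt n n (mrg H 0 gs') (mrg A 0 (a' # butlast as'))) =
        psum ?T (mv brl (last as') (g' # butlast gs)) (\<lambda>gs' a'. dface (Suc n) 0 (cpt (Suc n) (Suc n) gs' (a' # butlast as')))"
      by (rule psum_cong[OF mv_in[OF bm conjunct2[OF pw_butlast[OF as']] cons_butlast[OF gs g']]])
        (rule dface_pt[OF zero_less_Suc _ cons_butlast[OF as'], symmetric])
  qed
  also have "\<dots> = psum ?T (mv ibl (last gs) as) (\<lambda>as' g'. dface (Suc n) 0 (psum ?T' (mv brl (last as') (g' # butlast gs)) (\<lambda>gs' a'. cpt (Suc n) (Suc n) gs' (a' # butlast as'))))"
  proof (rule psum_cong[OF mi])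
    fix as' g' assume as': "as' \<in> pw (Suc (Suc n)) A" and g': "g' \<in> acar H"
    show "psum ?T (mv brl (last as') (g' # butlast gs)) (\<lambda>gs' a'. dface (Suc n) 0 (cpt (Suc n) (Suc n) gs' (a' # butlast as'))) =
        dface (Suc n) 0 (psum ?T' (mv brl (last as') (g' # butlast gs)) (\<lambda>gs' a'. cpt (Suc n) (Suc n) gs' (a' # butlast as')))"
      by (rule lin_push2[OF kmod_Cyl kmod_Cyl dface_lin mv_in[OF bm conjunct2[OF pw_butlast[OF as']] cons_butlast[OF gs g']], symmetric],
          simp, rule cpt_in[OF _ cons_butlast[OF as']])
  qed
  also have "\<dots> = dface (Suc n) 0 (dtau (Suc n) (cpt (Suc n) (Suc n) gs as))"
    unfolding dtau_pt[OF gs as]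
    by (rule lin_push2[OF kmod_Cyl kmod_Cyl dface_lin mi, symmetric], simp,
        rule psum_in[OF kmod_Cyl mv_in[OF bm conjunct2[OF pw_butlast] cons_butlast[OF gs]]], assumption+,
        rule cpt_in[OF _ cons_butlast])
  finally show "dface (Suc n) (Suc n) (cpt (Suc n) (Suc n) gs as) = dface (Suc n) 0 (dtau (Suc n) (cpt (Suc n) (Suc n) gs as))" .
qed simp_all

end

section \<open>The isomorphism\<close>

lemma mlin_eqI: "kmods Ms \<Longrightarrow> mlin Ms N g \<Longrightarrow> (\<And>xs. xs \<in> lprod Ms \<Longrightarrow> f xs = g xs) \<Longrightarrow> mlin Ms N f"
  using mlin_cong[of Ms f g N] by blast

context hopf_comodule_algebra
begin

text \<open>The word \<open>a\<^sub>0 g\<^sub>0 \<dots> a\<^sub>n g\<^sub>n\<close> is rewritten with all letters \<open>g\<close> in front, starting from the right;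
  \<open>Gl\<close> below undoes this from the left.\<close>

primrec Fl :: "('m list \<Rightarrow> 'k) set list \<Rightarrow> ('m list \<times> 'm list) list" where
  "Fl [] = [([], [])]"
| "Fl (b # bs) = pbind (bl b) (\<lambda>a g. pbind (Fl bs) (\<lambda>gs as. pbind (mv brl a (g # gs)) (\<lambda>gs' a'. [(gs', a' # as)])))"

lemma brl_mv_in: "a \<in> acar A \<Longrightarrow> gs \<in> pw n H \<Longrightarrow> set (mv brl a gs) \<subseteq> pw n H \<times> acar A"
  by (rule mv_in[OF brl_mover[OF kA]])

lemma Fl_in: "bs \<in> pw n B \<Longrightarrow> set (Fl bs) \<subseteq> pw n H \<times> pw n A"
proof (induction bs arbitrary: n)
  case Nil
  then have "n = 0" by (auto dest: lprod_length)
  then show ?case by simp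
next
  case (Cons b bs)
  then obtain n' where n: "n = Suc n'" by (cases n) (auto dest: lprod_length)
  have b: "b \<in> acar B" and bs: "bs \<in> pw n' B" using Cons.prems by (auto simp: n)
  show ?case
    unfolding Fl.simps n
    by (rule pbind_in[OF bl_in[OF b]], rule pbind_in[OF Cons.IH[OF bs]], rule pbind_in[OF brl_mv_in, of _ _ "Suc n'"]) auto
qed

lemma psum_Fl_Cons:
  assumes N: "is_kmod N" and b: "b \<in> acar B" and bs: "bs \<in> pw n B"
    and f: "\<And>gs as. gs \<in> pw (Suc n) H \<Longrightarrow> as \<in> pw (Suc n) A \<Longrightarrow> f gs as \<in> acar N"
  shows "psum N (Fl (b # bs)) f = psum N (bl b) (\<lambda>a g. psum N (Fl bs) (\<lambda>gs as. psum N (mv brl a (g # gs)) (\<lambda>gs' a'. f gs' (a' # as))))"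
proof -
  have "psum N (Fl (b # bs)) f = psum N (bl b) (\<lambda>a g. psum N (pbind (Fl bs) (\<lambda>gs as. pbind (mv brl a (g # gs)) (\<lambda>gs' a'. [(gs', a' # as)]))) f)"
    unfolding Fl.simps
    by (rule psum_bind[OF N bl_in[OF b], where U = "pw (Suc n) H" and V = "pw (Suc n) A"],
        rule pbind_in[OF Fl_in[OF bs]], rule pbind_in[OF brl_mv_in, of _ _ "Suc n"]) (auto intro: f)
  also have "\<dots> = psum N (bl b) (\<lambda>a g. psum N (Fl bs) (\<lambda>gs as. psum N (pbind (mv brl a (g # gs)) (\<lambda>gs' a'. [(gs', a' # as)])) f))"
    by (rule psum_cong[OF bl_in[OF b]], rule psum_bind[OF N Fl_in[OF bs], where U = "pw (Suc n) H" and V = "pw (Suc n) A"],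
        rule pbind_in[OF brl_mv_in, of _ _ "Suc n"]) (auto intro: f)
  also have "\<dots> = psum N (bl b) (\<lambda>a g. psum N (Fl bs) (\<lambda>gs as. psum N (mv brl a (g # gs)) (\<lambda>gs' a'. psum N [(gs', a' # as)] f)))"
    by (rule psum_cong[OF bl_in[OF b]], rule psum_cong[OF Fl_in[OF bs]],
        rule psum_bind[OF N brl_mv_in, of _ _ "Suc n", where U = "pw (Suc n) H" and V = "pw (Suc n) A"]) (auto intro: f)
  also have "\<dots> = psum N (bl b) (\<lambda>a g. psum N (Fl bs) (\<lambda>gs as. psum N (mv brl a (g # gs)) (\<lambda>gs' a'. f gs' (a' # as))))"
    by (rule psum_cong[OF bl_in[OF b]], rule psum_cong[OF Fl_in[OF bs]], rule psum_cong[OF brl_mv_in, of _ _ "Suc n"],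
        assumption, simp, rule psum_single[OF N]) (auto intro: f)
  finally show ?thesis .
qed

text \<open>One step of \<open>Fl\<close> seen as an operation on test maps. The first part keeps
  the new letter fixed for the induction, the second treats the dependence on that letter.\<close>

lemma step_ml2:
  assumes N: "is_kmod N" and k: "ml2 (Suc n) H (Suc n) A N k"
  shows "a \<in> acar A \<Longrightarrow> g \<in> acar H \<Longrightarrow> ml2 n H n A N (\<lambda>gs as. psum N (mv brl a (g # gs)) (\<lambda>gs' a'. k gs' (a' # as)))"
    and "gs \<in> pw n H \<Longrightarrow> as \<in> pw n A \<Longrightarrow> bilin A H N (\<lambda>a g. psum N (mv brl a (g # gs)) (\<lambda>gs' a'. k gs' (a' # as)))"
proof -
  have M: "mlc (Suc n) H A N (\<lambda>gs a. psum N (mv brl a gs) (\<lambda>gs' a'. k gs' (a' # as)))" if "as \<in> pw n A" for as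
    by (rule mv_mlc[OF brl_mover[OF N] kA kH ml2_mlc[OF k that]])
  show "gs \<in> pw n H \<Longrightarrow> as \<in> pw n A \<Longrightarrow> bilin A H N (\<lambda>a g. psum N (mv brl a (g # gs)) (\<lambda>gs' a'. k gs' (a' # as)))"
    using mlc_Suc2[OF M] by (simp add: bilin_def)
  assume a: "a \<in> acar A" and g: "g \<in> acar H"
  show "ml2 n H n A N (\<lambda>gs as. psum N (mv brl a (g # gs)) (\<lambda>gs' a'. k gs' (a' # as)))"
  proof (rule ml2I)
    fix gs assume "gs \<in> pw n H"
    then have gg: "g # gs \<in> pw (Suc n) H" using g by simp
    show "mlin (replicate n A) N (\<lambda>as. psum N (mv brl a (g # gs)) (\<lambda>gs' a'. k gs' (a' # as)))"
      by (rule mlin_psum[OF N brl_mv_in[OF a gg]]) (use ml2D1[OF k] in auto)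
  next
    fix as assume "as \<in> pw n A"
    then show "mlin (replicate n H) N (\<lambda>gs. psum N (mv brl a (g # gs)) (\<lambda>gs' a'. k gs' (a' # as)))"
      using mlc_Suc1[OF M g] a by (simp add: mlc_def)
  qed
qed

lemma Fl_bilin:
  assumes N: "is_kmod N" and k: "ml2 (Suc n) H (Suc n) A N k" and bs: "bs \<in> pw n B"
  shows "bilin A H N (\<lambda>a g. psum N (Fl bs) (\<lambda>gs as. psum N (mv brl a (g # gs)) (\<lambda>gs' a'. k gs' (a' # as))))"
  by (rule bilinI; rule lin_psum[OF N Fl_in[OF bs]])
    (rule bilin1[OF step_ml2(2)[OF N k] lin_id] bilin2[OF step_ml2(2)[OF N k] lin_id]; assumption)+

text \<open>Although \<open>Fl\<close> uses chosen representations of the letters, its evaluation is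
  multilinear in them, and so it descends to the tensor power.\<close>

lemma Fl_mlin:
  assumes N: "is_kmod N"
  shows "ml2 n H n A N k \<Longrightarrow> mlin (replicate n B) N (\<lambda>bs. psum N (Fl bs) k)"
proof (induction n arbitrary: k)
  case 0
  then have "k [] [] \<in> acar N" using ml2_in[OF 0, of "[]" "[]"] by simp
  then show ?case by (simp add: psum_single[OF N])
next
  case (Suc n)
  let ?st = "\<lambda>a g gs as. psum N (mv brl a (g # gs)) (\<lambda>gs' a'. k gs' (a' # as))"
  have "mlin (replicate (Suc n) B) N (\<lambda>bs. psum N (bl (hd bs)) (\<lambda>a g. psum N (Fl (tl bs)) (?st a g)))"
    unfolding replicate_Suc mlin.simps list.sel
  proof (intro conjI ballI)
    fix b assume b: "b \<in> acar B"
    show "mlin (replicate n B) N (\<lambda>bs. psum N (bl b) (\<lambda>a g. psum N (Fl bs) (?st a g)))"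
      by (rule mlin_psum[OF N bl_in[OF b]], rule Suc.IH, rule step_ml2(1)[OF N Suc.prems])
  next
    fix bs assume bs: "bs \<in> pw n B"
    show "lin_map B N (\<lambda>b. psum N (bl b) (\<lambda>a g. psum N (Fl bs) (?st a g)))"
      by (rule bl_lin[OF N Fl_bilin[OF N Suc.prems bs]])
  qed
  then show ?case
  proof (rule mlin_eqI[OF kmods_replicate[OF kmod_B]])
    show "psum N (Fl bs) k = psum N (bl (hd bs)) (\<lambda>a g. psum N (Fl (tl bs)) (?st a g))" if "bs \<in> pw (Suc n) B" for bs
    proof -
      obtain b bs' where "bs = b # bs'" "b \<in> acar B" "bs' \<in> pw n B" using \<open>bs \<in> pw (Suc n) B\<close> by (auto simp: pw_Suc)
      then show ?thesis using psum_Fl_Cons[OF N, of b bs' n k] ml2_in[OF Suc.prems] by simp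
    qed
  qed
qed

text \<open>At the first position the product replaces \<open>g b\<close> by b' g'. Carrying
  \<open>b'\<close> on through \<open>g'\<close> undoes this, and what is left is \<open>b\<close>
  and then \<open>a\<close> moving through the words that are not yet merged. At later positions the
  letter in front crosses a merged word.\<close>

lemma Fl_mrg:
  assumes N: "is_kmod N"
  shows "ml2 n H n A N k \<Longrightarrow> i < n \<Longrightarrow> bs \<in> pw (Suc n) B \<Longrightarrow>
    psum N (Fl (mrg B i bs)) k = psum N (Fl bs) (\<lambda>gs as. k (mrg H i gs) (mrg A i as))"
proof (induction i arbitrary: n bs k)
  case 0
  note m = brl_mover[OF N]
  obtain n' where n: "n = Suc n'" using 0 by (cases n) auto
  obtain b0 b1 bs' where bs: "bs = b0 # b1 # bs'" "b0 \<in> acar B" "b1 \<in> acar B" "bs' \<in> pw n' B"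
    using 0(3) unfolding n by (auto simp: pw_Suc)
  note k = 0(1)[unfolded n]
  have ki: "k gs as \<in> acar N" if "gs \<in> pw (Suc n') H" "as \<in> pw (Suc n') A" for gs as by (rule ml2_in[OF k that])
  have kk: "ml2 (Suc (Suc n')) H (Suc (Suc n')) A N (\<lambda>gs as. k (mrg H 0 gs) (mrg A 0 as))"
    by (rule ml2_mrg[OF algH], rule ml2_sym[OF ml2_mrg[OF algA ml2_sym[OF k]]]) simp_all
  have b1bs: "b1 # bs' \<in> pw (Suc n') B" using bs by simp
  have "psum N (Fl (mrg B 0 bs)) k = psum N (bl (amul B b0 b1)) (\<lambda>a g. psum N (Fl bs') (\<lambda>gs as. psum N (mv brl a (g # gs)) (\<lambda>gs' a'. k gs' (a' # as))))"
    unfolding bs(1) mrg.simps list.sel by (rule psum_Fl_Cons[OF N kalg_mul[OF algB bs(2,3)] bs(4) ki])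
  also have "\<dots> = psum N (bl b0) (\<lambda>a g. psum N (bl b1) (\<lambda>b h. psum N (ibl g b) (\<lambda>b' g'.
      psum N (Fl bs') (\<lambda>gs as. psum N (mv brl (amul A a b') (amul H g' h # gs)) (\<lambda>gs' a'. k gs' (a' # as))))))"
    using bl_mul[OF N Fl_bilin[OF N k bs(4)] bs(2,3)] by (simp add: cm_def)
  also have "\<dots> = psum N (bl b0) (\<lambda>a g. psum N (bl b1) (\<lambda>b h. psum N (Fl bs') (\<lambda>gs as. psum N (ibl g b) (\<lambda>b' g'.
      psum N (mv brl (amul A a b') (amul H g' h # gs)) (\<lambda>gs' a'. k gs' (a' # as))))))"
    by (rule psum_cong[OF bl_in[OF bs(2)]], rule psum_cong[OF bl_in[OF bs(3)]], rule psum_swap[OF N ibl_in Fl_in[OF bs(4)]], assumption, assumption,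
        rule psum_in[OF N brl_mv_in, of _ _ "Suc n'"]) (auto intro: ki mulA mulH)
  also have "\<dots> = psum N (bl b0) (\<lambda>a g. psum N (bl b1) (\<lambda>b h. psum N (Fl bs') (\<lambda>gs as.
      psum N (mv brl b (h # gs)) (\<lambda>gs1 b2. psum N (mv brl a (g # gs1)) (\<lambda>gs2 a2. k (mrg H 0 gs2) (amul A a2 b2 # as))))))"
  proof (rule psum_cong[OF bl_in[OF bs(2)]], rule psum_cong[OF bl_in[OF bs(3)]], rule psum_cong[OF Fl_in[OF bs(4)]])
    fix a g b h gs as
    assume i: "a \<in> acar A" "g \<in> acar H" "b \<in> acar A" "h \<in> acar H" and gs: "gs \<in> pw n' H" and as: "as \<in> pw n' A"
    let ?c = "\<lambda>gs' a'. k gs' (a' # as)"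
    \<comment> \<open>What remains once the letter from \<open>b\<close> has passed the word:
      \<open>a\<close> travels through it and is multiplied with what arrived.\<close>
    let ?c1 = "\<lambda>gs1 b1. psum N (mv brl a gs1) (\<lambda>gs2 a2. ?c gs2 (amul A a2 b1))"
    have c: "mlc (Suc n') H A N ?c" by (rule ml2_mlc[OF k as])
    have c1: "mlc (Suc n') H A N ?c1"
    proof (rule mlcI)
      fix b1 assume "b1 \<in> acar A"
      from mv_mlc[OF m kA kH mlc_mulA'[OF c this]] show "mlin (replicate (Suc n') H) N (\<lambda>gs1. ?c1 gs1 b1)" using i by (simp add: mlc_def)
    next
      fix gs1 assume gs1: "gs1 \<in> pw (Suc n') H"
      show "lin_map A N (?c1 gs1)"
      proof (rule lin_psum[OF N brl_mv_in[OF i(1) gs1]])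
        fix u v assume "u \<in> pw (Suc n') H" "v \<in> acar A"
        then show "lin_map A N (\<lambda>x. ?c u (amul A v x))" using mlc_mulA[OF c, of v] unfolding mlc_def by blast
      qed
    qed
    have c2: "mlc (Suc (Suc n')) H A N (\<lambda>gs1 b1. ?c1 (mrg H 0 gs1) b1)" by (rule mlc_mrg[OF algH c1]) simp
    have hgs: "h # gs \<in> pw (Suc n') H" using i gs by simp
    have "psum N (ibl g b) (\<lambda>b' g'. psum N (mv brl (amul A a b') (amul H g' h # gs)) ?c) =
        psum N (ibl g b) (\<lambda>b' g'. psum N (mv brl b' (mrg H 0 (g' # h # gs))) ?c1)"
    proof (rule psum_cong[OF ibl_in[OF i(2,3)]])
      fix b' g' assume "b' \<in> acar A" "g' \<in> acar H"
      then show "psum N (mv brl (amul A a b') (amul H g' h # gs)) ?c = psum N (mv brl b' (mrg H 0 (g' # h # gs))) ?c1"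
        unfolding mrg.simps list.sel by (intro push_mulA[OF N c]) (use i gs mulH in auto)
    qed
    also have "\<dots> = psum N (ibl g b) (\<lambda>b' g'. psum N (mv brl b' (g' # h # gs)) (\<lambda>gs1 b1. ?c1 (mrg H 0 gs1) b1))"
      by (rule psum_cong[OF ibl_in[OF i(2,3)]], rule push_mrg[OF N c1]) (use i gs in auto)
    also have "\<dots> = psum N (ibl g b) (\<lambda>b' g'. psum N (brl b' g') (\<lambda>g1 b1. psum N (mv brl b1 (h # gs)) (\<lambda>gs1 b2. ?c1 (mrg H 0 (g1 # gs1)) b2)))"
      by (rule psum_cong[OF ibl_in[OF i(2,3)]], rule psum_mv_Cons[OF m _ _ hgs mlc_in[OF c2]])
    \<comment> \<open>The inverse braiding from the product and the first crossing of
      \<open>b'\<close> cancel, so the original \<open>g\<close> and \<open>b\<close>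
      return.\<close>
    also have "\<dots> = psum N (mv brl b (h # gs)) (\<lambda>gs1 b2. ?c1 (mrg H 0 (g # gs1)) b2)"
      by (rule ib_br[OF N mv_bilin[OF m kA kH c2 hgs] i(2,3)])
    also have "\<dots> = psum N (mv brl b (h # gs)) (\<lambda>gs1 b2. psum N (mv brl a (g # gs1)) (\<lambda>gs2 a2. ?c (mrg H 0 gs2) (amul A a2 b2)))"
      by (rule psum_cong[OF brl_mv_in[OF i(3) hgs]], rule push_mrg[OF N mlc_mulA'[OF c]]) (use i in auto)
    finally show "psum N (ibl g b) (\<lambda>b' g'. psum N (mv brl (amul A a b') (amul H g' h # gs)) (\<lambda>gs' a'. k gs' (a' # as))) =
        psum N (mv brl b (h # gs)) (\<lambda>gs1 b2. psum N (mv brl a (g # gs1)) (\<lambda>gs2 a2. k (mrg H 0 gs2) (amul A a2 b2 # as)))" .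
  qed
  also have "\<dots> = psum N (bl b0) (\<lambda>a g. psum N (Fl (b1 # bs')) (\<lambda>gs as. psum N (mv brl a (g # gs)) (\<lambda>gs' a'. k (mrg H 0 gs') (mrg A 0 (a' # as)))))"
  proof (rule psum_cong[OF bl_in[OF bs(2)]])
    fix a g assume ag: "a \<in> acar A" "g \<in> acar H"
    have "psum N (Fl (b1 # bs')) (\<lambda>gs as. psum N (mv brl a (g # gs)) (\<lambda>gs' a'. k (mrg H 0 gs') (mrg A 0 (a' # as)))) =
        psum N (bl b1) (\<lambda>b h. psum N (Fl bs') (\<lambda>gs as. psum N (mv brl b (h # gs)) (\<lambda>gs1 b2. psum N (mv brl a (g # gs1)) (\<lambda>gs2 a2. k (mrg H 0 gs2) (mrg A 0 (a2 # b2 # as))))))"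
      by (rule psum_Fl_Cons[OF N bs(3,4) ml2_in[OF step_ml2(1)[OF N kk ag]]])
    then show "psum N (bl b1) (\<lambda>b h. psum N (Fl bs') (\<lambda>gs as. psum N (mv brl b (h # gs)) (\<lambda>gs1 b2. psum N (mv brl a (g # gs1)) (\<lambda>gs2 a2. k (mrg H 0 gs2) (amul A a2 b2 # as))))) =
        psum N (Fl (b1 # bs')) (\<lambda>gs as. psum N (mv brl a (g # gs)) (\<lambda>gs' a'. k (mrg H 0 gs') (mrg A 0 (a' # as))))" by simp
  qed
  also have "\<dots> = psum N (Fl bs) (\<lambda>gs as. k (mrg H 0 gs) (mrg A 0 as))"
    unfolding bs(1) by (rule psum_Fl_Cons[OF N bs(2) b1bs ml2_in[OF kk], symmetric])
  finally show ?case .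
next
  case (Suc i)
  obtain n' where n: "n = Suc n'" using Suc by (cases n) auto
  obtain b bs' where bs: "bs = b # bs'" "b \<in> acar B" "bs' \<in> pw (Suc n') B"
    using Suc.prems(3) unfolding n by (auto simp: pw_Suc)
  note k = Suc.prems(1)[unfolded n]
  have i: "i < n'" using Suc.prems(2) n by simp
  have kk: "ml2 (Suc (Suc n')) H (Suc (Suc n')) A N (\<lambda>gs as. k (mrg H (Suc i) gs) (mrg A (Suc i) as))"
    by (rule ml2_mrg[OF algH], rule ml2_sym[OF ml2_mrg[OF algA ml2_sym[OF k]]]) (use i in simp_all)
  have "psum N (Fl (mrg B (Suc i) bs)) k = psum N (bl b) (\<lambda>a g. psum N (Fl (mrg B i bs')) (\<lambda>gs as. psum N (mv brl a (g # gs)) (\<lambda>gs' a'. k gs' (a' # as))))"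
    unfolding bs(1) mrg.simps list.sel by (rule psum_Fl_Cons[OF N bs(2) mrg_in[OF algB bs(3) i] ml2_in[OF k]])
  also have "\<dots> = psum N (bl b) (\<lambda>a g. psum N (Fl bs') (\<lambda>gs as. psum N (mv brl a (g # mrg H i gs)) (\<lambda>gs' a'. k gs' (a' # mrg A i as))))"
    by (rule psum_cong[OF bl_in[OF bs(2)]], rule Suc.IH[OF step_ml2(1)[OF N k] i bs(3)])
  also have "\<dots> = psum N (bl b) (\<lambda>a g. psum N (Fl bs') (\<lambda>gs as. psum N (mv brl a (g # gs)) (\<lambda>gs' a'. k (mrg H (Suc i) gs') (mrg A (Suc i) (a' # as)))))"
  proof (rule psum_cong[OF bl_in[OF bs(2)]], rule psum_cong[OF Fl_in[OF bs(3)]])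
    fix a g gs as assume a: "a \<in> acar A" and g: "g \<in> acar H" and gs: "gs \<in> pw (Suc n') H" and as: "as \<in> pw (Suc n') A"
    have "psum N (mv brl a (mrg H (Suc i) (g # gs))) (\<lambda>gs' a'. k gs' (a' # mrg A i as)) =
        psum N (mv brl a (g # gs)) (\<lambda>gs' a'. k (mrg H (Suc i) gs') (a' # mrg A i as))"
      by (rule push_mrg[OF N ml2_mlc[OF k mrg_in[OF algA as i]]]) (use i a g gs in auto)
    then show "psum N (mv brl a (g # mrg H i gs)) (\<lambda>gs' a'. k gs' (a' # mrg A i as)) =
        psum N (mv brl a (g # gs)) (\<lambda>gs' a'. k (mrg H (Suc i) gs') (mrg A (Suc i) (a' # as)))" by simp
  qed
  also have "\<dots> = psum N (Fl bs) (\<lambda>gs as. k (mrg H (Suc i) gs) (mrg A (Suc i) as))"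
    unfolding bs(1) by (rule psum_Fl_Cons[OF N bs(2,3) ml2_in[OF kk], symmetric])
  finally show ?case .
qed

text \<open>The inserted letter is a pure tensor of units: its \<open>A\<close> part crosses
  everything trivially, and the letters to its left cross its \<open>H\<close> part
  trivially.\<close>

lemma Fl_ins:
  assumes N: "is_kmod N"
  shows "ml2 (Suc n) H (Suc n) A N k \<Longrightarrow> i \<le> n \<Longrightarrow> bs \<in> pw n B \<Longrightarrow>
    psum N (Fl (ins B i bs)) k = psum N (Fl bs) (\<lambda>gs as. k (ins H i gs) (ins A i as))"
proof (induction i arbitrary: n bs k)
  case 0
  have "psum N (Fl (ins B 0 bs)) k = psum N (bl (aone B)) (\<lambda>a g. psum N (Fl bs) (\<lambda>gs as. psum N (mv brl a (g # gs)) (\<lambda>gs' a'. k gs' (a' # as))))"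
    unfolding ins_0 by (rule psum_Fl_Cons[OF N kalg_one[OF algB] 0(3) ml2_in[OF 0(1)]])
  also have "\<dots> = psum N (Fl bs) (\<lambda>gs as. psum N (mv brl (aone A) (aone H # gs)) (\<lambda>gs' a'. k gs' (a' # as)))"
    unfolding one_B by (rule bl_pt[OF N Fl_bilin[OF N 0(1,3)] oneA oneH])
  also have "\<dots> = psum N (Fl bs) (\<lambda>gs as. k (ins H 0 gs) (ins A 0 as))"
    unfolding ins_0 by (rule psum_cong[OF Fl_in[OF 0(3)]], rule push_oneA[OF N ml2_mlc[OF 0(1)]]) (use oneH in auto)
  finally show ?case .
next
  case (Suc i)
  obtain n' where n: "n = Suc n'" using Suc by (cases n) auto
  obtain b bs' where bs: "bs = b # bs'" "b \<in> acar B" "bs' \<in> pw n' B"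
    using Suc.prems(3) unfolding n by (auto simp: pw_Suc)
  note k = Suc.prems(1)[unfolded n]
  have i: "i \<le> n'" using Suc.prems(2) n by simp
  have ki: "k (ins H (Suc i) gs) (ins A (Suc i) as) \<in> acar N" if "gs \<in> pw (Suc n') H" "as \<in> pw (Suc n') A" for gs as
    by (rule ml2_in[OF k ins_in[OF algH that(1)] ins_in[OF algA that(2)]])
  have "psum N (Fl (ins B (Suc i) bs)) k = psum N (bl b) (\<lambda>a g. psum N (Fl (ins B i bs')) (\<lambda>gs as. psum N (mv brl a (g # gs)) (\<lambda>gs' a'. k gs' (a' # as))))"
    unfolding bs(1) ins_Suc by (rule psum_Fl_Cons[OF N bs(2) ins_in[OF algB bs(3)] ml2_in[OF k]])
  also have "\<dots> = psum N (bl b) (\<lambda>a g. psum N (Fl bs') (\<lambda>gs as. psum N (mv brl a (g # ins H i gs)) (\<lambda>gs' a'. k gs' (a' # ins A i as))))"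
    by (rule psum_cong[OF bl_in[OF bs(2)]], rule Suc.IH[OF step_ml2(1)[OF N k] i bs(3)])
  also have "\<dots> = psum N (bl b) (\<lambda>a g. psum N (Fl bs') (\<lambda>gs as. psum N (mv brl a (g # gs)) (\<lambda>gs' a'. k (ins H (Suc i) gs') (ins A (Suc i) (a' # as)))))"
  proof (rule psum_cong[OF bl_in[OF bs(2)]], rule psum_cong[OF Fl_in[OF bs(3)]])
    fix a g gs as assume a: "a \<in> acar A" and g: "g \<in> acar H" and gs: "gs \<in> pw n' H" and as: "as \<in> pw n' A"
    have "psum N (mv brl a (ins H (Suc i) (g # gs))) (\<lambda>gs' a'. k gs' (a' # ins A i as)) =
        psum N (mv brl a (g # gs)) (\<lambda>gs' a'. k (ins H (Suc i) gs') (a' # ins A i as))"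
      by (rule push_ins[OF N ml2_mlc[OF k ins_in[OF algA as]]]) (use i a g gs in auto)
    then show "psum N (mv brl a (g # ins H i gs)) (\<lambda>gs' a'. k gs' (a' # ins A i as)) =
        psum N (mv brl a (g # gs)) (\<lambda>gs' a'. k (ins H (Suc i) gs') (ins A (Suc i) (a' # as)))" by (simp add: ins_Suc)
  qed
  also have "\<dots> = psum N (Fl bs) (\<lambda>gs as. k (ins H (Suc i) gs) (ins A (Suc i) as))"
    unfolding bs(1) by (rule psum_Fl_Cons[OF N bs(2,3) ki, symmetric])
  finally show ?case .
qed

lemma brl_rmv_in: "g \<in> acar H \<Longrightarrow> as \<in> pw n A \<Longrightarrow> set (rmv brl as g) \<subseteq> acar H \<times> pw n A"
  by (rule rmv_in[OF brl_mover[OF kA]])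

lemma snoc_pw: "xs \<in> pw n M \<Longrightarrow> x \<in> acar M \<Longrightarrow> xs @ [x] \<in> pw (Suc n) M"
  using pw_snoc by simp

text \<open>Peeling off the last letter instead of the first one moves it to the left through all letters of \<open>A\<close>,
  which is what the horizontal cyclic operator reverts.\<close>

lemma Fl_snoc:
  fixes N :: "('k, 'n) alg"
  assumes N: "is_kmod N" and b: "b \<in> acar B"
  shows "bs \<in> pw n B \<Longrightarrow> (\<And>gs as. gs \<in> pw (Suc n) H \<Longrightarrow> as \<in> pw (Suc n) A \<Longrightarrow> k gs as \<in> acar N) \<Longrightarrow>
    psum N (Fl (bs @ [b])) k = psum N (bl b) (\<lambda>a g. psum N (Fl bs) (\<lambda>gs as. psum N (rmv brl (as @ [a]) g) (\<lambda>g' as'. k (gs @ [g']) as')))"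
proof (induction bs arbitrary: n k)
  case Nil
  note m = brl_mover[OF N]
  have n: "n = 0" using Nil by (auto dest: lprod_length)
  have ki: "k [g] [a] \<in> acar N" if "g \<in> acar H" "a \<in> acar A" for g a using Nil(2)[of "[g]" "[a]"] that by (simp add: n)
  have "psum N (Fl [b]) k = psum N (bl b) (\<lambda>a g. psum N (Fl []) (\<lambda>gs as. psum N (mv brl a (g # gs)) (\<lambda>gs' a'. k gs' (a' # as))))"
    by (rule psum_Fl_Cons[OF N b Nil(1)]) (rule Nil(2))
  also have "\<dots> = psum N (bl b) (\<lambda>a g. psum N (Fl []) (\<lambda>gs as. psum N (rmv brl (as @ [a]) g) (\<lambda>g' as'. k (gs @ [g']) as')))"
  proof (rule psum_cong[OF bl_in[OF b]])
    fix a g assume ag: "a \<in> acar A" "g \<in> acar H"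
    have "psum N (mv brl a [g]) (\<lambda>gs' a'. k gs' [a']) = psum N (brl a g) (\<lambda>g' a'. psum N (mv brl a' []) (\<lambda>gs' a'. k (g' # gs') [a']))"
      by (rule psum_mv_Cons[OF m ag, of "[]" 0]) (use Nil(2) n in auto)
    also have "\<dots> = psum N (brl a g) (\<lambda>g' a'. k [g'] [a'])"
      by (rule psum_cong[OF brl_in[OF ag]]) (simp add: psum_single[OF N] ki)
    finally have 1: "psum N (mv brl a [g]) (\<lambda>gs' a'. k gs' [a']) = psum N (brl a g) (\<lambda>g' a'. k [g'] [a'])" .
    have bi: "psum N (brl a g) (\<lambda>g' a'. k [g'] [a']) \<in> acar N" by (rule psum_in[OF N brl_in[OF ag] ki])
    have "psum N (rmv brl [a] g) (\<lambda>g' as'. k [g'] as') = psum N (rmv brl [] g) (\<lambda>c xs'. psum N (brl a c) (\<lambda>c' x'. k [c'] (x' # xs')))"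
      by (rule psum_rmv_Cons[OF m ag(2,1), of "[]" 0]) (use Nil(2) n in auto)
    also have "\<dots> = psum N (brl a g) (\<lambda>g' a'. k [g'] [a'])" using bi by (simp add: psum_single[OF N])
    finally have 2: "psum N (rmv brl [a] g) (\<lambda>g' as'. k [g'] as') = psum N (brl a g) (\<lambda>g' a'. k [g'] [a'])" .
    show "psum N (Fl []) (\<lambda>gs as. psum N (mv brl a (g # gs)) (\<lambda>gs' a'. k gs' (a' # as))) =
        psum N (Fl []) (\<lambda>gs as. psum N (rmv brl (as @ [a]) g) (\<lambda>g' as'. k (gs @ [g']) as'))"
      using 1 2 bi by (simp only: Fl.simps psum_single[OF N] append_Nil)
  qed
  finally show ?case by simp
next
  case (Cons b0 bs)
  note m = brl_mover[OF N]
  obtain n' where n: "n = Suc n'" using Cons.prems by (cases n) (auto dest: lprod_length)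
  have b0: "b0 \<in> acar B" and bs: "bs \<in> pw n' B" using Cons.prems(1) by (auto simp: n)
  have ki: "k gs as \<in> acar N" if "gs \<in> pw (Suc (Suc n')) H" "as \<in> pw (Suc (Suc n')) A" for gs as
    by (rule Cons.prems(2)) (use that n in auto)
  let ?st = "\<lambda>a0 g0 gs as. psum N (mv brl a0 (g0 # gs)) (\<lambda>gs' a'. k gs' (a' # as))"
  have sti: "?st a0 g0 gs as \<in> acar N" if "a0 \<in> acar A" "g0 \<in> acar H" "gs \<in> pw (Suc n') H" "as \<in> pw (Suc n') A" for a0 g0 gs as
    by (rule psum_in[OF N brl_mv_in, of _ _ "Suc (Suc n')"]) (use that ki in auto)
  let ?E = "\<lambda>a0 g0 a g gs as. psum N (mv brl a0 (g0 # gs)) (\<lambda>gs' a'. psum N (rmv brl ((a' # as) @ [a]) g) (\<lambda>g' as'. k (gs' @ [g']) as'))"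
  \<comment> \<open>\<open>a0\<close> meets \<open>g'\<close> last. That crossing counts either as
    the end of the journey of \<open>a0\<close> or as the last step of \<open>g'\<close> to the
    left, and the other motions are independent and may be exchanged.\<close>
  have inner: "psum N (rmv brl (as @ [a]) g) (\<lambda>g' as'. ?st a0 g0 (gs @ [g']) as') = ?E a0 g0 a g gs as"
    if i: "a0 \<in> acar A" "g0 \<in> acar H" "a \<in> acar A" "g \<in> acar H" and gs: "gs \<in> pw n' H" and as: "as \<in> pw n' A" for a0 g0 a g gs as
  proof -
    have asa: "as @ [a] \<in> pw (Suc n') A" by (rule snoc_pw[OF as i(3)])
    have ggs: "g0 # gs \<in> pw (Suc n') H" using i gs by simp
    note ri = brl_rmv_in[OF i(4) asa]
    note mi = brl_mv_in[OF i(1) ggs]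
    have "psum N (rmv brl (as @ [a]) g) (\<lambda>g' as'. ?st a0 g0 (gs @ [g']) as') =
        psum N (rmv brl (as @ [a]) g) (\<lambda>g' as'. psum N (mv brl a0 (g0 # gs)) (\<lambda>gs' a'. psum N (brl a' g') (\<lambda>g'' a''. k (gs' @ [g'']) (a'' # as'))))"
    proof (rule psum_cong[OF ri])
      fix g' as' assume j: "g' \<in> acar H" "as' \<in> pw (Suc n') A"
      show "?st a0 g0 (gs @ [g']) as' = psum N (mv brl a0 (g0 # gs)) (\<lambda>gs' a'. psum N (brl a' g') (\<lambda>g'' a''. k (gs' @ [g'']) (a'' # as')))"
        unfolding append_Cons[symmetric]
        by (rule mv_snoc[OF m j(1) i(1) ggs], rule ki) (use j in auto)
    qed
    also have "\<dots> = psum N (mv brl a0 (g0 # gs)) (\<lambda>gs' a'. psum N (rmv brl (as @ [a]) g) (\<lambda>g' as'. psum N (brl a' g') (\<lambda>g'' a''. k (gs' @ [g'']) (a'' # as'))))"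
      by (rule psum_swap[OF N ri mi], rule psum_in[OF N brl_in], assumption+, rule ki[OF snoc_pw]) auto
    also have "\<dots> = ?E a0 g0 a g gs as"
      unfolding append_Cons
      by (rule psum_cong[OF mi], rule psum_rmv_Cons[OF m i(4) _ asa, symmetric], assumption, rule ki[OF snoc_pw]) auto
    finally show ?thesis .
  qed
  have Ei: "psum N (rmv brl (as @ [a]) g) (\<lambda>g' as'. k (gs @ [g']) as') \<in> acar N"
    if "a \<in> acar A" "g \<in> acar H" "gs \<in> pw (Suc n') H" "as \<in> pw (Suc n') A" for a g gs as
    by (rule psum_in[OF N brl_rmv_in[OF that(2) snoc_pw[OF that(4,1)]]]) (rule ki[OF snoc_pw[OF that(3)]])
  have E2: "?E a0 g0 a g gs as \<in> acar N"
    if "a0 \<in> acar A" "g0 \<in> acar H" "a \<in> acar A" "g \<in> acar H" "gs \<in> pw n' H" "as \<in> pw n' A" for a0 g0 a g gs as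
    by (rule psum_in[OF N brl_mv_in[of _ _ "Suc n'"] Ei]) (use that in auto)
  have "psum N (Fl ((b0 # bs) @ [b])) k = psum N (bl b0) (\<lambda>a0 g0. psum N (Fl (bs @ [b])) (?st a0 g0))"
    unfolding append_Cons by (rule psum_Fl_Cons[OF N b0 snoc_pw[OF bs b] ki])
  also have "\<dots> = psum N (bl b0) (\<lambda>a0 g0. psum N (bl b) (\<lambda>a g. psum N (Fl bs) (\<lambda>gs as. psum N (rmv brl (as @ [a]) g) (\<lambda>g' as'. ?st a0 g0 (gs @ [g']) as'))))"
    by (rule psum_cong[OF bl_in[OF b0]], rule Cons.IH[OF bs], rule sti)
  also have "\<dots> = psum N (bl b0) (\<lambda>a0 g0. psum N (bl b) (\<lambda>a g. psum N (Fl bs) (\<lambda>gs as. ?E a0 g0 a g gs as)))"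
    by (rule psum_cong[OF bl_in[OF b0]], rule psum_cong[OF bl_in[OF b]], rule psum_cong[OF Fl_in[OF bs]], rule inner)
  also have "\<dots> = psum N (bl b) (\<lambda>a g. psum N (bl b0) (\<lambda>a0 g0. psum N (Fl bs) (\<lambda>gs as. ?E a0 g0 a g gs as)))"
    by (rule psum_swap[OF N bl_in[OF b0] bl_in[OF b]], rule psum_in[OF N Fl_in[OF bs]], rule E2)
  also have "\<dots> = psum N (bl b) (\<lambda>a g. psum N (Fl (b0 # bs)) (\<lambda>gs as. psum N (rmv brl (as @ [a]) g) (\<lambda>g' as'. k (gs @ [g']) as')))"
    by (rule psum_cong[OF bl_in[OF b]], rule psum_Fl_Cons[OF N b0 bs, symmetric], rule Ei)
  finally show ?case .
qed

text \<open>The word is taken apart at its last letter. The horizontal operator undoes the leftward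
  motion of the last \<open>g\<close> that \<open>Fl_snoc\<close> produces; the vertical one then
  carries \<open>a\<close> through all \<open>H\<close> letters, which is the first step of
  \<open>Fl\<close> on the rotated word.\<close>

lemma Fl_rot:
  assumes N: "is_kmod N" and k: "ml2 (Suc n) H (Suc n) A N k" and bs: "bs \<in> pw (Suc n) B"
  shows "psum N (Fl (rot bs)) k = psum N (Fl bs) (\<lambda>gs as. psum N (mv ibl (last gs) as) (\<lambda>as' g'.
      psum N (mv brl (last as') (g' # butlast gs)) (\<lambda>gs' a'. k gs' (a' # butlast as'))))"
proof -
  note mb = brl_mover[OF N] and mi = ibl_mover[OF N]
  let ?b = "last bs" and ?bs = "butlast bs"
  have b: "?b \<in> acar B" and bs': "?bs \<in> pw n B" using pw_butlast[OF bs] by auto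
  have bs_eq: "bs = ?bs @ [?b]" using len_pw[OF bs] by (cases bs) auto
  let ?c = "\<lambda>gs as. psum N (mv brl (last as) gs) (\<lambda>gs' a'. k gs' (a' # butlast as))"
  have c: "ml2 (Suc n) H (Suc n) A N ?c" by (rule mv_rot_ml2[OF mb kA kH k])
  let ?K = "\<lambda>gs as. psum N (mv ibl (last gs) as) (\<lambda>as' g'. ?c (g' # butlast gs) as')"
  have K: "ml2 (Suc n) H (Suc n) A N ?K" by (rule ml2_sym[OF mv_rot_ml2[OF mi kH kA ml2_sym[OF c]]])
  have "psum N (Fl bs) ?K = psum N (bl ?b) (\<lambda>a g. psum N (Fl ?bs) (\<lambda>gs as. psum N (rmv brl (as @ [a]) g) (\<lambda>g' as'. ?K (gs @ [g']) as')))"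
    by (subst bs_eq, rule Fl_snoc[OF N b bs' ml2_in[OF K]])
  also have "\<dots> = psum N (bl ?b) (\<lambda>a g. psum N (Fl ?bs) (\<lambda>gs as. psum N (mv brl a (g # gs)) (\<lambda>gs' a'. k gs' (a' # as))))"
  proof (rule psum_cong[OF bl_in[OF b]], rule psum_cong[OF Fl_in[OF bs']])
    fix a g gs as assume i: "a \<in> acar A" "g \<in> acar H" "gs \<in> pw n H" "as \<in> pw n A"
    have "psum N (rmv brl (as @ [a]) g) (\<lambda>g' as'. psum N (mv ibl g' as') (\<lambda>as'' g''. ?c (g'' # gs) as'')) = ?c (g # gs) (as @ [a])"
      by (rule rmv_mv_cancel[OF mi mb kH kA br_ib[OF N] ml2_mlc'[OF c i(3)] i(2) snoc_pw[OF i(4,1)]])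
    then show "psum N (rmv brl (as @ [a]) g) (\<lambda>g' as'. ?K (gs @ [g']) as') = psum N (mv brl a (g # gs)) (\<lambda>gs' a'. k gs' (a' # as))"
      by simp
  qed
  also have "\<dots> = psum N (Fl (?b # ?bs)) k"
    by (rule psum_Fl_Cons[OF N b bs' ml2_in[OF k], symmetric])
  finally show ?thesis by (simp add: rot_def)
qed

text \<open>The letter \<open>a\<close> goes back through all remaining \<open>H\<close> letters and
  is paired with the first of them. The \<open>unit\<close> component makes the result a formal sum
  of pairs, so that \<open>psum\<close> and \<open>pbind\<close> apply.\<close>

primrec Gl :: "'m list \<Rightarrow> 'm list \<Rightarrow> (('m list \<Rightarrow> 'k) set list \<times> unit) list" where
  "Gl [] gs = [([], ())]"
| "Gl (a # as) gs = pbind (rmv ibl gs a) (\<lambda>a' gs'. pbind (Gl as (tl gs')) (\<lambda>bs u. [(pt a' (hd gs') # bs, ())]))"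

lemma ibl_rmv_in: "a \<in> acar A \<Longrightarrow> gs \<in> pw n H \<Longrightarrow> set (rmv ibl gs a) \<subseteq> acar A \<times> pw n H"
  by (rule rmv_in[OF ibl_mover[OF kH]])

lemma hd_tl_pw: "xs \<in> pw (Suc n) M \<Longrightarrow> hd xs \<in> acar M \<and> tl xs \<in> pw n M \<and> hd xs # tl xs = xs"
  by (auto simp: pw_Suc)

lemma Gl_in: "as \<in> pw n A \<Longrightarrow> gs \<in> pw n H \<Longrightarrow> set (Gl as gs) \<subseteq> pw n B \<times> UNIV"
proof (induction as arbitrary: n gs)
  case Nil
  then have "n = 0" by (auto dest: lprod_length)
  then show ?case by simp
next
  case (Cons a as)
  then obtain n' where n: "n = Suc n'" by (cases n) (auto dest: lprod_length)
  have a: "a \<in> acar A" and as: "as \<in> pw n' A" and gs: "gs \<in> pw (Suc n') H" using Cons.prems by (auto simp: n)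
  show ?case
    unfolding Gl.simps n
    by (rule pbind_in[OF ibl_rmv_in[OF a gs]], rule pbind_in[OF Cons.IH[OF as]]) (use hd_tl_pw[of _ n' H] pt_in in auto)
qed

lemma psum_Gl_Cons:
  assumes N: "is_kmod N" and a: "a \<in> acar A" and as: "as \<in> pw n A" and gs: "gs \<in> pw (Suc n) H"
    and f: "\<And>bs. bs \<in> pw (Suc n) B \<Longrightarrow> f bs \<in> acar N"
  shows "psum N (Gl (a # as) gs) (\<lambda>bs u. f bs) = psum N (rmv ibl gs a) (\<lambda>a' gs'. psum N (Gl as (tl gs')) (\<lambda>bs u. f (pt a' (hd gs') # bs)))"
proof -
  note ri = ibl_rmv_in[OF a gs]
  have pin: "pt a' (hd gs') # bs \<in> pw (Suc n) B" if "a' \<in> acar A" "gs' \<in> pw (Suc n) H" "bs \<in> pw n B" for a' gs' bs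
    using that hd_tl_pw[OF that(2)] pt_in by simp
  have "psum N (Gl (a # as) gs) (\<lambda>bs u. f bs) = psum N (rmv ibl gs a) (\<lambda>a' gs'. psum N (pbind (Gl as (tl gs')) (\<lambda>bs u. [(pt a' (hd gs') # bs, ())])) (\<lambda>bs u. f bs))"
    unfolding Gl.simps
    by (rule psum_bind[OF N ri, where U = "pw (Suc n) B" and V = UNIV], rule pbind_in[OF Gl_in[OF as]])
      (use hd_tl_pw pin f in \<open>auto simp del: replicate_Suc\<close>)
  also have "\<dots> = psum N (rmv ibl gs a) (\<lambda>a' gs'. psum N (Gl as (tl gs')) (\<lambda>bs u. psum N [(pt a' (hd gs') # bs, ())] (\<lambda>bs u. f bs)))"
    by (rule psum_cong[OF ri], rule psum_bind[OF N Gl_in[OF as], where U = "pw (Suc n) B" and V = UNIV])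
      (use hd_tl_pw pin f in \<open>auto simp del: replicate_Suc\<close>)
  also have "\<dots> = psum N (rmv ibl gs a) (\<lambda>a' gs'. psum N (Gl as (tl gs')) (\<lambda>bs u. f (pt a' (hd gs') # bs)))"
  proof (rule psum_cong[OF ri])
    fix a' gs' assume a': "a' \<in> acar A" and gs': "gs' \<in> pw (Suc n) H"
    have t: "tl gs' \<in> pw n H" using hd_tl_pw[OF gs'] by blast
    show "psum N (Gl as (tl gs')) (\<lambda>bs u. psum N [(pt a' (hd gs') # bs, ())] (\<lambda>bs u. f bs)) = psum N (Gl as (tl gs')) (\<lambda>bs u. f (pt a' (hd gs') # bs))"
      by (rule psum_cong[OF Gl_in[OF as t]], rule psum_single[OF N], rule f[OF pin[OF a' gs']])
  qed
  finally show ?thesis .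
qed

text \<open>Multilinearity of the shorter \<open>Gl\<close> is a premise, because the step is used
  inside the induction that establishes it and again afterwards.\<close>

lemma Gl_step_mlc:
  assumes N: "is_kmod N" and f: "mlin (replicate (Suc n) B) N f" and as: "as \<in> pw n A"
    and IH: "\<And>f. mlin (replicate n B) N f \<Longrightarrow> ml2 n H n A N (\<lambda>gs as. psum N (Gl as gs) (\<lambda>bs u. f bs))"
  shows "mlc (Suc n) H A N (\<lambda>gs' a'. psum N (Gl as (tl gs')) (\<lambda>bs u. f (pt a' (hd gs') # bs)))"
proof (rule mlcI)
  note f' = f[unfolded replicate_Suc mlin.simps]
  have fl: "lin_map B N (\<lambda>x. f (x # bs))" if "bs \<in> pw n B" for bs using f' that by blast
  fix a' assume a': "a' \<in> acar A"
  show "mlin (replicate (Suc n) H) N (\<lambda>gs'. psum N (Gl as (tl gs')) (\<lambda>bs u. f (pt a' (hd gs') # bs)))"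
    unfolding replicate_Suc mlin.simps list.sel
  proof (intro conjI ballI)
    fix g assume "g \<in> acar H"
    then have "mlin (replicate n B) N (\<lambda>bs. f (pt a' g # bs))" using f' pt_in[OF a'] by blast
    from ml2D2[OF IH[OF this] as] show "mlin (replicate n H) N (\<lambda>xs. psum N (Gl as xs) (\<lambda>bs u. f (pt a' g # bs)))" .
  next
    fix gs assume gs: "gs \<in> pw n H"
    show "lin_map H N (\<lambda>g. psum N (Gl as gs) (\<lambda>bs u. f (pt a' g # bs)))"
      by (rule lin_psum[OF N Gl_in[OF as gs]], rule lin_comp[OF fl bilin2[OF pt_bilin lin_id a']])
  qed
next
  note f' = f[unfolded replicate_Suc mlin.simps]
  have fl: "lin_map B N (\<lambda>x. f (x # bs))" if "bs \<in> pw n B" for bs using f' that by blast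
  fix gs assume gs: "gs \<in> pw (Suc n) H"
  then have hg: "hd gs \<in> acar H" and tg: "tl gs \<in> pw n H" using hd_tl_pw by auto
  show "lin_map A N (\<lambda>a'. psum N (Gl as (tl gs)) (\<lambda>bs u. f (pt a' (hd gs) # bs)))"
    by (rule lin_psum[OF N Gl_in[OF as tg]], rule lin_comp[OF fl bilin1[OF pt_bilin lin_id hg]])
qed

lemma Gl_ml2:
  assumes N: "is_kmod N"
  shows "mlin (replicate n B) N f \<Longrightarrow> ml2 n H n A N (\<lambda>gs as. psum N (Gl as gs) (\<lambda>bs u. f bs))"
proof (induction n arbitrary: f)
  case 0
  then show ?case by (simp add: ml2_def psum_single[OF N])
next
  case (Suc n)
  note m = ibl_mover[OF N] and f = Suc.prems
  let ?k = "\<lambda>as a' gs'. psum N (Gl as (tl gs')) (\<lambda>bs u. f (pt a' (hd gs') # bs))"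
  let ?h = "\<lambda>gs as. psum N (rmv ibl gs (hd as)) (?k (tl as))"
  have M: "mlc (Suc n) H A N (\<lambda>gs a. psum N (rmv ibl gs a) (?k as))" if "as \<in> pw n A" for as
    by (rule rmv_mlc[OF m kA kH Gl_step_mlc[OF N f that Suc.IH]])
  have eq: "psum N (Gl as gs) (\<lambda>bs u. f bs) = ?h gs as" if "gs \<in> pw (Suc n) H" "as \<in> pw (Suc n) A" for gs as
  proof -
    have "psum N (Gl (hd as # tl as) gs) (\<lambda>bs u. f bs) = ?h gs as"
      using hd_tl_pw[OF that(2)] by (intro psum_Gl_Cons[OF N _ _ that(1) mlin_in[OF f]]) auto
    then show ?thesis using hd_tl_pw[OF that(2)] by simp
  qed
  show ?case
  proof (rule ml2I)
    fix gs assume gs: "gs \<in> pw (Suc n) H"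
    have "mlin (replicate (Suc n) A) N (?h gs)"
      unfolding replicate_Suc mlin.simps list.sel
    proof (intro conjI ballI)
      fix a assume a: "a \<in> acar A"
      show "mlin (replicate n A) N (\<lambda>as. psum N (rmv ibl gs a) (?k as))"
      proof (rule mlin_psum[OF N ibl_rmv_in[OF a gs]])
        fix a' gs' assume a': "a' \<in> acar A" and gs': "gs' \<in> pw (Suc n) H"
        have "mlin (replicate n B) N (\<lambda>bs. f (pt a' (hd gs') # bs))"
          using f hd_tl_pw[OF gs'] pt_in[OF a'] by simp
        from ml2D1[OF Suc.IH[OF this]] show "mlin (replicate n A) N (\<lambda>as. ?k as a' gs')"
          using hd_tl_pw[OF gs'] by blast
      qed
    next
      fix as assume "as \<in> pw n A"
      then show "lin_map A N (\<lambda>a. psum N (rmv ibl gs a) (?k as))" using M gs unfolding mlc_def by blast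
    qed
    then show "mlin (replicate (Suc n) A) N (\<lambda>as. psum N (Gl as gs) (\<lambda>bs u. f bs))"
      by (rule mlin_eqI[OF kmods_replicate[OF kA] _ eq[OF gs]])
  next
    fix as assume as: "as \<in> pw (Suc n) A"
    have "mlin (replicate (Suc n) H) N (\<lambda>gs. ?h gs as)" using M[of "tl as"] hd_tl_pw[OF as] unfolding mlc_def by blast
    then show "mlin (replicate (Suc n) H) N (\<lambda>gs. psum N (Gl as gs) (\<lambda>bs u. f bs))"
      by (rule mlin_eqI[OF kmods_replicate[OF kH] _ eq[OF _ as]])
  qed
qed

text \<open>In the step of \<open>Fl\<close> the letter \<open>a\<close> crosses all
  \<open>H\<close> letters, and in the step of \<open>Gl\<close> it returns. \<open>br_ib\<close>,
  extended to words, cancels the two motions.\<close>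

lemma Gl_Fl:
  assumes N: "is_kmod N"
  shows "mlin (replicate n B) N f \<Longrightarrow> bs \<in> pw n B \<Longrightarrow> psum N (Fl bs) (\<lambda>gs as. psum N (Gl as gs) (\<lambda>bs u. f bs)) = f bs"
proof (induction bs arbitrary: n f)
  case Nil
  then show ?case using mlin_in[OF Nil] by (simp add: psum_single[OF N])
next
  case (Cons b bs)
  obtain n' where n: "n = Suc n'" using Cons.prems by (cases n) (auto dest: lprod_length)
  have b: "b \<in> acar B" and bs: "bs \<in> pw n' B" using Cons.prems(2) by (auto simp: n)
  note f = Cons.prems(1)[unfolded n]
  let ?k = "\<lambda>as a' gs'. psum N (Gl as (tl gs')) (\<lambda>bs u. f (pt a' (hd gs') # bs))"
  have "psum N (Fl (b # bs)) (\<lambda>gs as. psum N (Gl as gs) (\<lambda>bs u. f bs)) =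
      psum N (bl b) (\<lambda>a g. psum N (Fl bs) (\<lambda>gs as. psum N (mv brl a (g # gs)) (\<lambda>gs' a'. psum N (Gl (a' # as) gs') (\<lambda>bs u. f bs))))"
    by (rule psum_Fl_Cons[OF N b bs ml2_in[OF Gl_ml2[OF N f]]])
  also have "\<dots> = psum N (bl b) (\<lambda>a g. psum N (Fl bs) (\<lambda>gs as. psum N (Gl as gs) (\<lambda>bs u. f (pt a g # bs))))"
  proof (rule psum_cong[OF bl_in[OF b]], rule psum_cong[OF Fl_in[OF bs]])
    fix a g gs as assume i: "a \<in> acar A" "g \<in> acar H" "gs \<in> pw n' H" "as \<in> pw n' A"
    have ggs: "g # gs \<in> pw (Suc n') H" using i by simp
    have "psum N (mv brl a (g # gs)) (\<lambda>gs' a'. psum N (Gl (a' # as) gs') (\<lambda>bs u. f bs)) =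
        psum N (mv brl a (g # gs)) (\<lambda>gs' a'. psum N (rmv ibl gs' a') (?k as))"
      by (rule psum_cong[OF brl_mv_in[OF i(1) ggs]], rule psum_Gl_Cons[OF N _ i(4) _ mlin_in[OF f]])
    also have "\<dots> = ?k as a (g # gs)"
      by (rule mv_rmv_cancel[OF brl_mover[OF N] ibl_mover[OF N] br_ib[OF N] Gl_step_mlc[OF N f i(4) Gl_ml2[OF N]] i(1) ggs])
    finally show "psum N (mv brl a (g # gs)) (\<lambda>gs' a'. psum N (Gl (a' # as) gs') (\<lambda>bs u. f bs)) = psum N (Gl as gs) (\<lambda>bs u. f (pt a g # bs))"
      by simp
  qed
  also have "\<dots> = psum N (bl b) (\<lambda>a g. f (pt a g # bs))"
    by (rule psum_cong[OF bl_in[OF b]], rule Cons.IH[OF _ bs]) (use f pt_in in simp)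
  also have "\<dots> = f (b # bs)"
    by (rule bl_apply[OF N _ b]) (use f bs in simp)
  finally show ?case .
qed

text \<open>The induction hypothesis is used first, with the motion of \<open>a'\<close> as part of
  the test map; the return trip of the letter is then cancelled by \<open>ib_br\<close>, extended to
  words.\<close>

lemma Fl_Gl:
  assumes N: "is_kmod N"
  shows "ml2 n H n A N k \<Longrightarrow> gs \<in> pw n H \<Longrightarrow> as \<in> pw n A \<Longrightarrow> psum N (Gl as gs) (\<lambda>bs u. psum N (Fl bs) k) = k gs as"
proof (induction as arbitrary: n gs k)
  case Nil
  then have "gs = []" by (auto dest: lprod_length)
  then show ?case using ml2_in[OF Nil(1,2,3)] by (simp add: psum_single[OF N])
next
  case (Cons a as)
  obtain n' where n: "n = Suc n'" using Cons.prems by (cases n) (auto dest: lprod_length)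
  have a: "a \<in> acar A" and as: "as \<in> pw n' A" using Cons.prems(3) by (auto simp: n)
  note k = Cons.prems(1)[unfolded n] and gs = Cons.prems(2)[unfolded n]
  have "psum N (Gl (a # as) gs) (\<lambda>bs u. psum N (Fl bs) k) =
      psum N (rmv ibl gs a) (\<lambda>a' gs'. psum N (Gl as (tl gs')) (\<lambda>bs u. psum N (Fl (pt a' (hd gs') # bs)) k))"
    by (rule psum_Gl_Cons[OF N a as gs mlin_in[OF Fl_mlin[OF N k]]])
  also have "\<dots> = psum N (rmv ibl gs a) (\<lambda>a' gs'. psum N (mv brl a' gs') (\<lambda>gs'' a''. k gs'' (a'' # as)))"
  proof (rule psum_cong[OF ibl_rmv_in[OF a gs]])
    fix a' gs' assume a': "a' \<in> acar A" and gs': "gs' \<in> pw (Suc n') H"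
    have h: "hd gs' \<in> acar H" and t: "tl gs' \<in> pw n' H" and ht: "hd gs' # tl gs' = gs'" using hd_tl_pw[OF gs'] by auto
    have "psum N (Gl as (tl gs')) (\<lambda>bs u. psum N (Fl (pt a' (hd gs') # bs)) k) =
        psum N (Gl as (tl gs')) (\<lambda>bs u. psum N (Fl bs) (\<lambda>gs as. psum N (mv brl a' (hd gs' # gs)) (\<lambda>gs'' a''. k gs'' (a'' # as))))"
    proof (rule psum_cong[OF Gl_in[OF as t]])
      fix bs and u :: unit assume bs: "bs \<in> pw n' B"
      have "psum N (Fl (pt a' (hd gs') # bs)) k = psum N (bl (pt a' (hd gs'))) (\<lambda>a g. psum N (Fl bs) (\<lambda>gs as. psum N (mv brl a (g # gs)) (\<lambda>gs' a'. k gs' (a' # as))))"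
        by (rule psum_Fl_Cons[OF N pt_in[OF a' h] bs ml2_in[OF k]])
      also have "\<dots> = psum N (Fl bs) (\<lambda>gs as. psum N (mv brl a' (hd gs' # gs)) (\<lambda>gs'' a''. k gs'' (a'' # as)))"
        by (rule bl_pt[OF N Fl_bilin[OF N k bs] a' h])
      finally show "psum N (Fl (pt a' (hd gs') # bs)) k = psum N (Fl bs) (\<lambda>gs as. psum N (mv brl a' (hd gs' # gs)) (\<lambda>gs'' a''. k gs'' (a'' # as)))" .
    qed
    also have "\<dots> = psum N (mv brl a' (hd gs' # tl gs')) (\<lambda>gs'' a''. k gs'' (a'' # as))"
      by (rule Cons.IH[OF step_ml2(1)[OF N k a' h] t as])
    finally show "psum N (Gl as (tl gs')) (\<lambda>bs u. psum N (Fl (pt a' (hd gs') # bs)) k) = psum N (mv brl a' gs') (\<lambda>gs'' a''. k gs'' (a'' # as))"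
      by (simp only: ht)
  qed
  also have "\<dots> = k gs (a # as)"
    by (rule rmv_mv_cancel[OF brl_mover[OF N] ibl_mover[OF N] kA kH ib_br[OF N] ml2_mlc[OF k as] a gs])
  finally show ?case .
qed

end

text \<open>Both sides of each identity have the same image under the injective
  \<open>\<phi>\<close>. Linearity of the structure maps of \<open>X\<close> is a separate premise:
  it is required of a cyclic module, and it keeps all terms in the carriers where
  \<open>\<phi>\<close> is injective.\<close>

lemma cyclic_module_transport:
  fixes X :: "nat \<Rightarrow> ('k::comm_ring_1, 'x) alg" and Y :: "nat \<Rightarrow> ('k, 'y) alg"
  assumes Y: "cyclic_module Y d' s' t'" and iso: "cyclic_iso X d s t Y d' s' t' \<phi>"
    and X: "\<And>n. is_kmod (X n)"
    and d: "\<And>n i. 1 \<le> n \<Longrightarrow> i \<le> n \<Longrightarrow> lin_map (X n) (X (n - 1)) (d n i)"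
    and s: "\<And>n i. i \<le> n \<Longrightarrow> lin_map (X n) (X (Suc n)) (s n i)"
    and t: "\<And>n. lin_map (X n) (X n) (t n)"
  shows "cyclic_module X d s t"
proof -
  note Y' = Y[unfolded cyclic_module_def] and iso' = iso[unfolded cyclic_iso_def]
  have pin: "\<phi> n x \<in> acar (Y n)" if "x \<in> acar (X n)" for n x using iso' that lin_in by metis
  have inj: "x = y" if "\<phi> n x = \<phi> n y" "x \<in> acar (X n)" "y \<in> acar (X n)" for n x y
    using iso' that by (meson bij_betw_def inj_on_def)
  have pd: "\<phi> (n - 1) (d n i x) = d' n i (\<phi> n x)" if "1 \<le> n" "i \<le> n" "x \<in> acar (X n)" for n i x
    using iso' that by blast
  have ps: "\<phi> (Suc n) (s n i x) = s' n i (\<phi> n x)" if "i \<le> n" "x \<in> acar (X n)" for n i x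
    using iso' that by blast
  have pt: "\<phi> n (t n x) = t' n (\<phi> n x)" if "x \<in> acar (X n)" for n x
    using iso' that by blast
  have din: "d n i x \<in> acar (X (n - 1))" if "1 \<le> n" "i \<le> n" "x \<in> acar (X n)" for n i x
    using lin_in[OF d] that by blast
  have sin: "s n i x \<in> acar (X (Suc n))" if "i \<le> n" "x \<in> acar (X n)" for n i x
    using lin_in[OF s] that by blast
  have tin: "t n x \<in> acar (X n)" if "x \<in> acar (X n)" for n x
    using lin_in[OF t] that by blast
  have pd1: "\<phi> n (d (Suc n) i x) = d' (Suc n) i (\<phi> (Suc n) x)" if "i \<le> Suc n" "x \<in> acar (X (Suc n))" for n i x
    using pd[of "Suc n" i x] that by simp
  have din1: "d (Suc n) i x \<in> acar (X n)" if "i \<le> Suc n" "x \<in> acar (X (Suc n))" for n i x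
    using din[of "Suc n" i x] that by simp
  have pow: "\<phi> n ((t n ^^ m) x) = (t' n ^^ m) (\<phi> n x) \<and> (t n ^^ m) x \<in> acar (X n)" if "x \<in> acar (X n)" for n m x
    by (induction m) (simp_all add: that pt tin)
  show ?thesis
    unfolding cyclic_module_def
  proof (intro conjI allI ballI impI; (elim conjE)?)
    fix n
    show "is_kmod (X n)" by (rule X)
    show "lin_map (X n) (X n) (t n)" by (rule t)
    fix i
    show "1 \<le> n \<Longrightarrow> i \<le> n \<Longrightarrow> lin_map (X n) (X (n - 1)) (d n i)" by (rule d)
    show "i \<le> n \<Longrightarrow> lin_map (X n) (X (Suc n)) (s n i)" by (rule s)
    fix x assume x: "x \<in> acar (X n)"
    note Y5 = Y'[THEN conjunct2, THEN conjunct2, THEN conjunct2, THEN conjunct2, THEN conjunct1, rule_format, OF pin[OF x]]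
    note Y6 = Y'[THEN conjunct2, THEN conjunct2, THEN conjunct2, THEN conjunct2, THEN conjunct2, THEN conjunct1, rule_format, OF pin[OF x]]
    note Y7 = Y'[THEN conjunct2, THEN conjunct2, THEN conjunct2, THEN conjunct2, THEN conjunct2, THEN conjunct2, THEN conjunct1, rule_format, OF pin[OF x]]
    note Y8 = Y'[THEN conjunct2, THEN conjunct2, THEN conjunct2, THEN conjunct2, THEN conjunct2, THEN conjunct2, THEN conjunct2, THEN conjunct1, rule_format, OF pin[OF x]]
    note Y9 = Y'[THEN conjunct2, THEN conjunct2, THEN conjunct2, THEN conjunct2, THEN conjunct2, THEN conjunct2, THEN conjunct2, THEN conjunct2, THEN conjunct1, rule_format, OF pin[OF x]]
    note Y10 = Y'[THEN conjunct2, THEN conjunct2, THEN conjunct2, THEN conjunct2, THEN conjunct2, THEN conjunct2, THEN conjunct2, THEN conjunct2, THEN conjunct2, THEN conjunct1, rule_format, OF pin[OF x]]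
    note Y11 = Y'[THEN conjunct2, THEN conjunct2, THEN conjunct2, THEN conjunct2, THEN conjunct2, THEN conjunct2, THEN conjunct2, THEN conjunct2, THEN conjunct2, THEN conjunct2, THEN conjunct1, rule_format, OF pin[OF x]]
    note Y12 = Y'[THEN conjunct2, THEN conjunct2, THEN conjunct2, THEN conjunct2, THEN conjunct2, THEN conjunct2, THEN conjunct2, THEN conjunct2, THEN conjunct2, THEN conjunct2, THEN conjunct2, THEN conjunct1, rule_format, OF pin[OF x]]
    note Y13 = Y'[THEN conjunct2, THEN conjunct2, THEN conjunct2, THEN conjunct2, THEN conjunct2, THEN conjunct2, THEN conjunct2, THEN conjunct2, THEN conjunct2, THEN conjunct2, THEN conjunct2, THEN conjunct2, THEN conjunct1, rule_format, OF pin[OF x]]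
    note Y14 = Y'[THEN conjunct2, THEN conjunct2, THEN conjunct2, THEN conjunct2, THEN conjunct2, THEN conjunct2, THEN conjunct2, THEN conjunct2, THEN conjunct2, THEN conjunct2, THEN conjunct2, THEN conjunct2, THEN conjunct2, rule_format, OF pin[OF x]]
    { fix j assume ij: "2 \<le> n" "i < j" "j \<le> n"
      obtain m where n: "n = Suc (Suc m)" using ij(1) by (metis Suc_le_D numeral_2_eq_2 Suc_le_mono)
      have "d' (n - 1) i (d' n j (\<phi> n x)) = d' (n - 1) (j - 1) (d' n i (\<phi> n x))"
        using Y5 ij by simp
      then show "d (n - 1) i (d n j x) = d (n - 1) (j - 1) (d n i x)"
        using ij x by (intro inj[of m]) (auto simp: n pd1 din1) }
    { fix j assume ij: "i \<le> j" "j \<le> n"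
      have "s' (Suc n) i (s' n j (\<phi> n x)) = s' (Suc n) (Suc j) (s' n i (\<phi> n x))" using Y6 ij by simp
      then show "s (Suc n) i (s n j x) = s (Suc n) (Suc j) (s n i x)"
        using ij x by (intro inj[of "Suc (Suc n)"]) (simp_all add: ps sin) }
    { fix j assume ij: "i < j" "j \<le> n"
      obtain m where n: "n = Suc m" using ij by (cases n) auto
      have "d' (Suc n) i (s' n j (\<phi> n x)) = s' (n - 1) (j - 1) (d' n i (\<phi> n x))" using Y7 ij by simp
      then show "d (Suc n) i (s n j x) = s (n - 1) (j - 1) (d n i x)"
        using ij x by (intro inj[of n]) (auto simp: n ps sin pd1 din1) }
    { assume i: "i \<le> n"
      have "d' (Suc n) i (s' n i (\<phi> n x)) = \<phi> n x \<and> d' (Suc n) (Suc i) (s' n i (\<phi> n x)) = \<phi> n x" using Y8 i by simp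
      then show "d (Suc n) i (s n i x) = x" "d (Suc n) (Suc i) (s n i x) = x"
        using i x by (auto intro!: inj[of n] simp: ps sin pd1 din1) }
    { fix j assume ij: "Suc j < i" "i \<le> Suc n"
      obtain m where n: "n = Suc m" using ij by (cases n) auto
      have "d' (Suc n) i (s' n j (\<phi> n x)) = s' (n - 1) j (d' n (i - 1) (\<phi> n x))" using Y9 ij by simp
      then show "d (Suc n) i (s n j x) = s (n - 1) j (d n (i - 1) x)"
        using ij x by (intro inj[of n]) (auto simp: n ps sin pd1 din1) }
    { assume i: "1 \<le> i" "i \<le> n"
      obtain m where n: "n = Suc m" using i by (cases n) auto
      have "d' n i (t' n (\<phi> n x)) = t' (n - 1) (d' n (i - 1) (\<phi> n x))" using Y10 i by simp
      then show "d n i (t n x) = t (n - 1) (d n (i - 1) x)"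
        using i x by (intro inj[of m]) (auto simp: n pd1 din1 pt tin)
      have "s' n i (t' n (\<phi> n x)) = t' (Suc n) (s' n (i - 1) (\<phi> n x))" using Y12 i by simp
      then show "s n i (t n x) = t (Suc n) (s n (i - 1) x)"
        using i x by (intro inj[of "Suc n"]) (auto simp: ps sin pt tin) }
    { assume n1: "1 \<le> n"
      then obtain m where n: "n = Suc m" by (cases n) auto
      have "d' n 0 (t' n (\<phi> n x)) = d' n n (\<phi> n x)" using Y11 n1 by simp
      then show "d n 0 (t n x) = d n n x"
        using x by (intro inj[of m]) (auto simp: n pd1 din1 pt tin) }
    { have "s' n 0 (t' n (\<phi> n x)) = t' (Suc n) (t' (Suc n) (s' n n (\<phi> n x)))" using Y13 by simp
      then show "s n 0 (t n x) = t (Suc n) (t (Suc n) (s n n x))"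
        using x by (intro inj[of "Suc n"]) (auto simp: ps sin pt tin) }
    { have "(t' n ^^ Suc n) (\<phi> n x) = \<phi> n x" by (rule Y14)
      then show "(t n ^^ Suc n) x = x"
        using x pow[OF x, of "Suc n"] by (intro inj[of n]) (simp_all del: funpow.simps) }
  qed
qed

section \<open>The isomorphism of cyclic modules\<close>

context hopf_comodule_algebra
begin

definition Fmap :: "nat \<Rightarrow> (('m list \<Rightarrow> 'k) set list \<Rightarrow> 'k) set \<Rightarrow> ('m list \<Rightarrow> 'k) set" where
  "Fmap n = tlift (replicate (Suc n) B) (Cyl H A n n) (\<lambda>bs. psum (Cyl H A n n) (Fl bs) (cpt n n))"

definition Gmap :: "nat \<Rightarrow> ('m list \<Rightarrow> 'k) set \<Rightarrow> (('m list \<Rightarrow> 'k) set list \<Rightarrow> 'k) set" where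
  "Gmap n = tlift (CL H A n n) (Cmod B n)
     (\<lambda>zs. psum (Cmod B n) (Gl (drop (Suc n) zs) (take (Suc n) zs)) (\<lambda>bs u. ptens (replicate (Suc n) B) bs))"

lemma Fmap_lin: "lin_map (Cmod B n) (Cyl H A n n) (Fmap n)"
  unfolding Fmap_def Cmod_def by (rule tlift_lin[OF kmod_Cyl Fl_mlin[OF kmod_Cyl cpt_ml2] kmods_replicate[OF kmod_B]])

lemma Fmap_pt: "bs \<in> pw (Suc n) B \<Longrightarrow> Fmap n (ptens (replicate (Suc n) B) bs) = psum (Cyl H A n n) (Fl bs) (cpt n n)"
  unfolding Fmap_def by (rule tlift_ptens[OF kmod_Cyl Fl_mlin[OF kmod_Cyl cpt_ml2] kmods_replicate[OF kmod_B]])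

lemma Cpt_mlin: "mlin (replicate (Suc n) B) (Cmod B n) (ptens (replicate (Suc n) B))"
  unfolding Cmod_def by (rule mlin_ptens[OF kmods_replicate[OF kmod_B]])

lemma Gmap_lin: "lin_map (Cyl H A n n) (Cmod B n) (Gmap n)"
  and Gmap_pt: "gs \<in> pw (Suc n) H \<Longrightarrow> as \<in> pw (Suc n) A \<Longrightarrow>
    Gmap n (cpt n n gs as) = psum (Cmod B n) (Gl as gs) (\<lambda>bs u. ptens (replicate (Suc n) B) bs)"
proof -
  note k = Gl_ml2[OF kmod_Cmod Cpt_mlin[of n]]
  have eq: "psum (Cmod B n) (Gl (drop (Suc n) (gs @ as)) (take (Suc n) (gs @ as))) (\<lambda>bs u. ptens (replicate (Suc n) B) bs) =
      psum (Cmod B n) (Gl as gs) (\<lambda>bs u. ptens (replicate (Suc n) B) bs)" if "gs \<in> pw (Suc n) H" for gs as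
    using len_pw[OF that] by simp
  show "lin_map (Cyl H A n n) (Cmod B n) (Gmap n)"
    unfolding Gmap_def by (rule CL_op_lin[OF kmod_Cmod k eq])
  show "gs \<in> pw (Suc n) H \<Longrightarrow> as \<in> pw (Suc n) A \<Longrightarrow>
    Gmap n (cpt n n gs as) = psum (Cmod B n) (Gl as gs) (\<lambda>bs u. ptens (replicate (Suc n) B) bs)"
    unfolding Gmap_def by (rule CL_op_pt[OF kmod_Cmod k eq])
qed

lemma Gmap_Fmap: "y \<in> acar (Cmod B n) \<Longrightarrow> Gmap n (Fmap n y) = y"
proof (rule Cmod_ext[OF algB kmod_Cmod lin_comp[OF Gmap_lin Fmap_lin] lin_id])
  fix bs assume bs: "bs \<in> pw (Suc n) B"
  have "Gmap n (Fmap n (ptens (replicate (Suc n) B) bs)) = psum (Cmod B n) (Fl bs) (\<lambda>gs as. Gmap n (cpt n n gs as))"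
    unfolding Fmap_pt[OF bs] by (rule lin_push2[OF kmod_Cyl kmod_Cmod Gmap_lin Fl_in[OF bs] cpt_in])
  also have "\<dots> = psum (Cmod B n) (Fl bs) (\<lambda>gs as. psum (Cmod B n) (Gl as gs) (\<lambda>bs u. ptens (replicate (Suc n) B) bs))"
    by (rule psum_cong[OF Fl_in[OF bs] Gmap_pt])
  also have "\<dots> = ptens (replicate (Suc n) B) bs" by (rule Gl_Fl[OF kmod_Cmod Cpt_mlin bs])
  finally show "Gmap n (Fmap n (ptens (replicate (Suc n) B) bs)) = ptens (replicate (Suc n) B) bs" .
qed

lemma Fmap_Gmap: "x \<in> acar (Cyl H A n n) \<Longrightarrow> Fmap n (Gmap n x) = x"
proof (rule Cyl_ext[OF kmod_Cyl lin_comp[OF Fmap_lin Gmap_lin] lin_id])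
  fix gs as assume gs: "gs \<in> pw (Suc n) H" and as: "as \<in> pw (Suc n) A"
  note gi = Gl_in[OF as gs]
  have "Fmap n (Gmap n (cpt n n gs as)) = psum (Cyl H A n n) (Gl as gs) (\<lambda>bs u. Fmap n (ptens (replicate (Suc n) B) bs))"
    unfolding Gmap_pt[OF gs as] by (rule lin_push2[OF kmod_Cmod kmod_Cyl Fmap_lin gi]) (rule mlin_in[OF Cpt_mlin])
  also have "\<dots> = psum (Cyl H A n n) (Gl as gs) (\<lambda>bs u. psum (Cyl H A n n) (Fl bs) (cpt n n))"
    by (rule psum_cong[OF gi Fmap_pt])
  also have "\<dots> = cpt n n gs as" by (rule Fl_Gl[OF kmod_Cyl cpt_ml2 gs as])
  finally show "Fmap n (Gmap n (cpt n n gs as)) = cpt n n gs as" .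
qed

lemma Fmap_face_low:
  assumes i: "i < Suc n" and y: "y \<in> acar (Cmod B (Suc n))"
  shows "Fmap n (Cface B (Suc n) i y) = dface (Suc n) i (Fmap (Suc n) y)"
proof (rule Cmod_ext[OF algB kmod_Cyl _ lin_comp[OF dface_lin Fmap_lin] _ y])
  show "lin_map (Cmod B (Suc n)) (Cyl H A n n) (\<lambda>y. Fmap n (Cface B (Suc n) i y))"
    using lin_comp[OF Fmap_lin, of "Cmod B (Suc n)" n] Cface_lin[OF algB, of "Suc n" i] by simp
  fix bs assume bs: "bs \<in> pw (Suc (Suc n)) B"
  have fc: "fc B (Suc n) i bs = mrg B i bs" using i by (simp add: fc_def)
  have "Fmap n (Cface B (Suc n) i (ptens (replicate (Suc (Suc n)) B) bs)) = Fmap n (ptens (replicate (Suc n) B) (mrg B i bs))"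
    using Cface_pt[OF algB _ bs, of i] fc by (simp del: replicate_Suc)
  also have "\<dots> = psum (Cyl H A n n) (Fl (mrg B i bs)) (cpt n n)" by (rule Fmap_pt[OF mrg_in[OF algB bs i]])
  also have "\<dots> = psum (Cyl H A n n) (Fl bs) (\<lambda>gs as. cpt n n (mrg H i gs) (mrg A i as))"
    by (rule Fl_mrg[OF kmod_Cyl cpt_ml2 i bs])
  also have "\<dots> = psum (Cyl H A n n) (Fl bs) (\<lambda>gs as. dface (Suc n) i (cpt (Suc n) (Suc n) gs as))"
    by (rule psum_cong[OF Fl_in[OF bs] dface_pt[OF i, symmetric]])
  also have "\<dots> = dface (Suc n) i (psum (Cyl H A (Suc n) (Suc n)) (Fl bs) (cpt (Suc n) (Suc n)))"
    by (rule lin_push2[OF kmod_Cyl kmod_Cyl dface_lin Fl_in[OF bs] cpt_in, symmetric]) (use i in simp)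
  finally show "Fmap n (Cface B (Suc n) i (ptens (replicate (Suc (Suc n)) B) bs)) = dface (Suc n) i (Fmap (Suc n) (ptens (replicate (Suc (Suc n)) B) bs))"
    by (simp only: Fmap_pt[OF bs])
qed (use i in simp)

lemma Fmap_degen:
  assumes i: "i \<le> n" and y: "y \<in> acar (Cmod B n)"
  shows "Fmap (Suc n) (Cdegen B n i y) = diag_degen H A n i (Fmap n y)"
proof (rule Cmod_ext[OF algB kmod_Cyl lin_comp[OF Fmap_lin Cdegen_lin[OF algB i]] lin_comp[OF ddegen_lin[OF i] Fmap_lin] _ y])
  let ?T = "Cyl H A (Suc n) (Suc n)"
  fix bs assume bs: "bs \<in> pw (Suc n) B"
  have "Fmap (Suc n) (Cdegen B n i (ptens (replicate (Suc n) B) bs)) = psum ?T (Fl (ins B (Suc i) bs)) (cpt (Suc n) (Suc n))"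
    unfolding Cdegen_pt[OF algB i bs] by (rule Fmap_pt[OF ins_in[OF algB bs]])
  also have "\<dots> = psum ?T (Fl bs) (\<lambda>gs as. cpt (Suc n) (Suc n) (ins H (Suc i) gs) (ins A (Suc i) as))"
    by (rule Fl_ins[OF kmod_Cyl cpt_ml2 _ bs]) (use i in simp)
  also have "\<dots> = psum ?T (Fl bs) (\<lambda>gs as. diag_degen H A n i (cpt n n gs as))"
    by (rule psum_cong[OF Fl_in[OF bs] ddegen_pt[OF i, symmetric]])
  also have "\<dots> = diag_degen H A n i (psum (Cyl H A n n) (Fl bs) (cpt n n))"
    by (rule lin_push2[OF kmod_Cyl kmod_Cyl ddegen_lin[OF i] Fl_in[OF bs] cpt_in, symmetric])
  finally show "Fmap (Suc n) (Cdegen B n i (ptens (replicate (Suc n) B) bs)) = diag_degen H A n i (Fmap n (ptens (replicate (Suc n) B) bs))"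
    by (simp only: Fmap_pt[OF bs])
qed

lemma Fmap_tau:
  assumes y: "y \<in> acar (Cmod B n)"
  shows "Fmap n (Ctau B n y) = dtau n (Fmap n y)"
proof (rule Cmod_ext[OF algB kmod_Cyl lin_comp[OF Fmap_lin Ctau_lin[OF algB]] lin_comp[OF dtau_lin Fmap_lin] _ y])
  let ?T = "Cyl H A n n"
  fix bs assume bs: "bs \<in> pw (Suc n) B"
  have "Fmap n (Ctau B n (ptens (replicate (Suc n) B) bs)) = psum ?T (Fl (rot bs)) (cpt n n)"
    unfolding Ctau_pt[OF algB bs] by (rule Fmap_pt[OF rot_in[OF bs]])
  also have "\<dots> = psum ?T (Fl bs) (\<lambda>gs as. dtau n (cpt n n gs as))"
    unfolding Fl_rot[OF kmod_Cyl cpt_ml2 bs] by (rule psum_cong[OF Fl_in[OF bs] dtau_pt[symmetric]])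
  also have "\<dots> = dtau n (psum ?T (Fl bs) (cpt n n))"
    by (rule lin_push2[OF kmod_Cyl kmod_Cyl dtau_lin Fl_in[OF bs] cpt_in, symmetric])
  finally show "Fmap n (Ctau B n (ptens (replicate (Suc n) B) bs)) = dtau n (Fmap n (ptens (replicate (Suc n) B) bs))"
    by (simp only: Fmap_pt[OF bs])
qed

lemma Fmap_face:
  assumes i: "i \<le> Suc n" and y: "y \<in> acar (Cmod B (Suc n))"
  shows "Fmap n (Cface B (Suc n) i y) = dface (Suc n) i (Fmap (Suc n) y)"
proof (cases "i = Suc n")
  case True
  have ty: "Ctau B (Suc n) y \<in> acar (Cmod B (Suc n))" by (rule lin_in[OF Ctau_lin[OF algB] y])
  have "Cface B (Suc n) (Suc n) y = Cface B (Suc n) 0 (Ctau B (Suc n) y)"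
    using cyclic_Cmod[OF algB] y unfolding cyclic_module_def by (metis le_add1 plus_1_eq_Suc)
  then have "Fmap n (Cface B (Suc n) i y) = dface (Suc n) 0 (dtau (Suc n) (Fmap (Suc n) y))"
    using True by (simp add: Fmap_face_low[OF _ ty] Fmap_tau[OF y])
  also have "\<dots> = dface (Suc n) i (Fmap (Suc n) y)"
    using dface_last[OF lin_in[OF Fmap_lin y]] True by simp
  finally show ?thesis .
next
  case False
  then show ?thesis using i by (intro Fmap_face_low[OF _ y]) simp
qed

text \<open>The compatibilities are known for \<open>Fmap\<close>; applying \<open>Gmap\<close> to
  both sides and cancelling turns them into those of the inverse.\<close>

lemma diag_cyclic_iso:
  "cyclic_iso (diag_mod H A) (diag_face H A D S r) (diag_degen H A) (diag_tau H A D S r)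
     (Cmod B) (Cface B) (Cdegen B) (Ctau B) Gmap"
  unfolding cyclic_iso_def diag_mod_def
proof (intro conjI allI ballI impI; (elim conjE)?)
  fix n
  show "lin_map (Cyl H A n n) (Cmod B n) (Gmap n)" by (rule Gmap_lin)
  show "bij_betw (Gmap n) (acar (Cyl H A n n)) (acar (Cmod B n))"
    by (rule bij_betw_byWitness[where f' = "Fmap n"]) (auto simp: Fmap_Gmap Gmap_Fmap intro: lin_in[OF Gmap_lin] lin_in[OF Fmap_lin])
  fix x assume x: "x \<in> acar (Cyl H A n n)"
  have gx: "Gmap n x \<in> acar (Cmod B n)" by (rule lin_in[OF Gmap_lin x])
  show "Gmap n (dtau n x) = Ctau B n (Gmap n x)"
    using Gmap_Fmap[OF lin_in[OF Ctau_lin[OF algB] gx]] by (simp add: Fmap_tau[OF gx] Fmap_Gmap[OF x])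
  fix i
  show "Gmap (Suc n) (diag_degen H A n i x) = Cdegen B n i (Gmap n x)" if "i \<le> n"
    using Gmap_Fmap[OF lin_in[OF Cdegen_lin[OF algB that] gx]] by (simp add: Fmap_degen[OF that gx] Fmap_Gmap[OF x])
  show "Gmap (n - 1) (dface n i x) = Cface B n i (Gmap n x)" if "1 \<le> n" "i \<le> n"
  proof -
    obtain m where n: "n = Suc m" using \<open>1 \<le> n\<close> by (cases n) auto
    have "Cface B n i (Gmap n x) \<in> acar (Cmod B m)" using lin_in[OF Cface_lin[OF algB \<open>1 \<le> n\<close>] gx] n by simp
    then show ?thesis
      using Gmap_Fmap[of "Cface B n i (Gmap n x)" m] Fmap_face[of i m "Gmap n x"] gx Fmap_Gmap[OF x] \<open>i \<le> n\<close> n by simp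
  qed
qed

lemma diag_cyclic: "cyclic_module (diag_mod H A) (diag_face H A D S r) (diag_degen H A) (diag_tau H A D S r)"
proof (rule cyclic_module_transport[OF cyclic_Cmod[OF algB] diag_cyclic_iso])
  fix n i
  show "is_kmod (diag_mod H A n)" by (simp add: diag_mod_def kmod_Cyl)
  show "lin_map (diag_mod H A n) (diag_mod H A n) (diag_tau H A D S r n)" unfolding diag_mod_def by (rule dtau_lin)
  show "i \<le> n \<Longrightarrow> lin_map (diag_mod H A n) (diag_mod H A (Suc n)) (diag_degen H A n i)" unfolding diag_mod_def by (rule ddegen_lin)
  show "1 \<le> n \<Longrightarrow> i \<le> n \<Longrightarrow> lin_map (diag_mod H A n) (diag_mod H A (n - 1)) (diag_face H A D S r n i)"
    unfolding diag_mod_def using dface_lin[of i "n - 1"] by simp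
qed

end

theorem theorem2p3:
  fixes H A :: "('k::comm_ring_1, 'm) alg"
    and D :: "'m \<Rightarrow> ('m list \<Rightarrow> 'k) set" and e :: "'m \<Rightarrow> 'k" and S :: "'m \<Rightarrow> 'm"
    and r :: "'m \<Rightarrow> ('m list \<Rightarrow> 'k) set"
  assumes "is_hopf H D e S" and "bij_antipode H S" and "is_comod_alg H D e A r"
  shows "cyclic_module (diag_mod H A) (diag_face H A D S r) (diag_degen H A) (diag_tau H A D S r)
       \<and> (\<exists>\<phi>. cyclic_iso (diag_mod H A) (diag_face H A D S r) (diag_degen H A) (diag_tau H A D S r)
               (Cmod (crossed H A D S r)) (Cface (crossed H A D S r))
               (Cdegen (crossed H A D S r)) (Ctau (crossed H A D S r)) \<phi>)"
proof -
  interpret hopf_comodule_algebra H A D e S r using assms by unfold_locales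
  show ?thesis using diag_cyclic diag_cyclic_iso by blast
qed

end
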